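(* Let $B=2^{k_1}C_1\perp\cdots\perp2^{k_r}C_r\in\mathcal H_n(\mathfrak o)$ be a pre-optimal form, and write $\mathrm{GK}(B)=(\underbrace{m_1,\ldots,m_1}_{n_1},\ldots,\underbrace{m_s,\ldots,m_s}_{n_s})$ with $m_1<\cdots<m_s$ and $n=n_1+\cdots+n_s$; put $n_j^*=n_1+\cdots+n_j$. Then: (1) for every $1\le j\le s$ there is an integer $1\le l_j\le r$ such that $B^{(n_j^* )}=B^{[l_j]}$ (i.e. $n_j^*=\deg C_1+\cdots+\deg C_{l_j}$); (2) defining $\zeta_j=\eta_{B^{[l_j]}}$ if $n_j^*$ is odd and $\zeta_j=\xi_{B^{[l_j]}}$ if $n_j^*$ is even, we have $\mathrm{EGK}(B)=(n_1,\ldots,n_s;m_1,\ldots,m_s;\zeta_1,\ldots,\zeta_s)$.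
   Context: Let $F$ be a finite unramified extension of $\mathbb Q_2$ with ring of integers $\mathfrak o$, $\mathrm{ord}$ the valuation with $\mathrm{ord}(2)=1$, $\mathrm{ord}(0)=+\infty$. $\mathcal H_n(\mathfrak o)$ is the set of symmetric $B=(b_{ij})\in M_n(F)$ with $b_{ii}\in\mathfrak o$, $2b_{ij}\in\mathfrak o$; nondegenerate means $\det B\ne0$. $B^{(m)}$ is the upper-left $m\times m$ submatrix; $\perp$ is block-diagonal sum; $B\sim B'$ means $B'={}^tUBU$ with $U\in GL_n(\mathfrak o)$. For nondegenerate $B$ of degree $n$: $D_B=(-4)^{[n/2]}\det B$; $\xi_B=1,-1,0$ according as $D_B\in F^{\times2}$, $F(\sqrt{D_B})/F$ is unramified quadratic, or ramified; if $B$ is $GL_n(F)$-equivalent to $\mathrm{diag}(b_1',\dots,b_n')$, $\eta_B=\langle-1,-1\rangle^{[(n+1)/4]}\langle-1,\det B\rangle^{[(n-1)/2]}\prod_{i<j}\langle b_i',b_j'\rangle$ (Hilbert symbols; this is the Clifford invariant). $S_2(\mathfrak o)_e$: symmetric $2\times2$ matrices over $\mathfrak o$ with diagonal in $2\mathfrak o$; unimodular diagonal: diagonal with unit entries. GK invariant: $S(B)$ is the set of non-decreasing $(a_i)\in\mathbb Z_{\ge0}^n$ with $\mathrm{ord}(b_{ii})\ge a_i$ and $\mathrm{ord}(2b_{ij})\ge(a_i+a_j)/2$ ($i\le j$); $\mathbf S(\{B\})=\bigcup_{U\in GL_n(\mathfrak o)}S({}^tUBU)$; $\mathrm{GK}(B)$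 is its lexicographically greatest element; $B$ is optimal if $\mathrm{GK}(B)\in S(B)$. Extended GK datum: for nondegenerate $B$, choose optimal $B'\sim B$, write $\mathrm{GK}(B')=(m_1^{(n_1)},\dots,m_t^{(n_t)})$ ($m_1<\dots<m_t$, multiplicities $n_i$), $n_u^*=n_1+\dots+n_u$, $\zeta_u=\xi_{B'^{(n_u^* )}}$ if $n_u^*$ even and $\eta_{B'^{(n_u^* )}}$ if odd; $\mathrm{EGK}(B)=(n_1,\dots,n_t;m_1,\dots,m_t;\zeta_1,\dots,\zeta_t)$ (independent of the choice of $B'$). Pre-optimal forms: $B=2^{k_1}C_1\perp\cdots\perp2^{k_r}C_r$ with $k_i\ge0$, each $C_i$ unimodular diagonal or in $\frac12(S_2(\mathfrak o)_e\cap GL_2(\mathfrak o))$; $B^{[j]}=2^{k_1}C_1\perp\cdots\perp2^{k_j}C_j$; $\mathcal D_m=\{j:k_j=m, C_j\text{ diagonal}\}$, $\mathcal E_m=\{j:k_j=m, C_j\text{ not diagonal}\}$. Pre-optimal means: (PO1) $\sum_{j\in\mathcal D_m}\deg C_j\le2$ and $\mathcal E_m$ is a (possibly empty) set of consecutive integers, for each $m$; (PO2) for $i<j$: $\mathcal D_{m_1}\ni i$, $\mathcal D_{m_2}\ni j\Rightarrow m_1\le m_2$; $\mathcal E_{m_1}\ni i,\mathcal E_{m_2}\ni j\Rightarrow m_1\le m_2$; $\mathcal D_{m_1}\ni i,\mathcal E_{m_2}\ni j\Rightarrow m_1\le m_2-1$; $\mathcal E_{m_1}\ni i,\mathcal D_{m_2}\ni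 j\Rightarrow m_1\le m_2+1$; (PO3) if $C_i$ is unimodular diagonal of degree 2 then $i\ge2$ and either ($\deg B^{[i]}$ even and $\xi_{B^{[i-1]}}=\xi_{B^{[i]}}=0$) or ($\deg B^{[i-1]}$ odd and $\mathrm{ord}\det B^{[i-1]}+k_i$ even); (PO4) if $k_i=k_{i-1}-1$, $C_i$ diagonal, $C_{i-1}$ not diagonal, then $\deg C_i=2$, or $\deg C_i=1$ and either ($\deg B^{[i]}$ and $\mathrm{ord}\det B^{[i]}$ even) or ($\deg B^{[i]}$ odd and $\xi_{B^{[i-1]}}=0$); (PO5) if $C_i$ diagonal, $C_{i+1}$ not diagonal, $k_i=k_{i+1}-1$, then $\deg C_i=1$ and either ($\deg B^{[i]}$ even and $\mathrm{ord}\det B^{[i]}$ odd) or ($\deg B^{[i]}$ odd and $\xi_{B^{[i-1]}}\ne0$ if $i\ge2$); (PO6) if $\deg B^{[i]}$ even, $C_i,C_{i+1}$ unimodular diagonal and $k_{i+1}=k_i+1$, then $\xi_{B^{[i]}}=0$. *)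

theory Defs
  imports "Jordan_Normal_Form.Determinant"
begin

text \<open>F is modelled as a field type 'a with a discrete valuation
  v = ord : 'a \<Rightarrow> int (the value at 0 is irrelevant; ord 0 = +infinity is
  handled by the predicate vge below).  A complete discretely valued field with
  finite residue field and ord 2 = 1 is exactly a finite unramified extension
  of Q_2.\<close>

definition vge :: "('a::field \<Rightarrow> int) \<Rightarrow> 'a \<Rightarrow> int \<Rightarrow> bool" where
  "vge v x k \<longleftrightarrow> x = 0 \<or> v x \<ge> k"

definition valuation :: "('a::field \<Rightarrow> int) \<Rightarrow> bool" where
  "valuation v \<longleftrightarrow>
     (\<forall>x y. x \<noteq> 0 \<longrightarrow> y \<noteq> 0 \<longrightarrow> v (x * y) = v x + v y) \<and>
     (\<forall>x y. x \<noteq> 0 \<longrightarrow> y \<noteq> 0 \<longrightarrow> x + y \<noteq> 0 \<longrightarrow> v (x + y) \<ge> min (v x) (v y))"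

definition vcomplete :: "('a::field \<Rightarrow> int) \<Rightarrow> bool" where
  "vcomplete v \<longleftrightarrow>
     (\<forall>X :: nat \<Rightarrow> 'a.
        (\<forall>N. \<exists>M. \<forall>m\<ge>M. \<forall>n\<ge>M. vge v (X m - X n) N) \<longrightarrow>
        (\<exists>L. \<forall>N. \<exists>M. \<forall>n\<ge>M. vge v (X n - L) N))"

definition finite_residue_field :: "('a::field \<Rightarrow> int) \<Rightarrow> bool" where
  "finite_residue_field v \<longleftrightarrow>
     (\<exists>R. finite R \<and> (\<forall>x. vge v x 0 \<longrightarrow> (\<exists>r\<in>R. vge v r 0 \<and> vge v (x - r) 1)))"

definition unram_ext_Q2 :: "('a::field \<Rightarrow> int) \<Rightarrow> bool" where
  "unram_ext_Q2 v \<longleftrightarrow> valuation v \<and> (2::'a) \<noteq> 0 \<and> v 2 = 1 \<and> vcomplete v \<and>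
     finite_residue_field v"

definition intg :: "('a::field \<Rightarrow> int) \<Rightarrow> 'a \<Rightarrow> bool" where
  "intg v x \<longleftrightarrow> vge v x 0"

definition unit_o :: "('a::field \<Rightarrow> int) \<Rightarrow> 'a \<Rightarrow> bool" where
  "unit_o v x \<longleftrightarrow> x \<noteq> 0 \<and> v x = 0"

definition is_square :: "'a::field \<Rightarrow> bool" where
  "is_square x \<longleftrightarrow> (\<exists>y. x = y * y)"

text \<open>For D not a square, the valuation extends uniquely to F(sqrt D) by
  w(a + b sqrt D) = ord(a^2 - D b^2)/2; the extension is unramified (ramification
  index 1) iff w takes only integer values.\<close>
definition quad_unramified :: "('a::field \<Rightarrow> int) \<Rightarrow> 'a \<Rightarrow> bool" where
  "quad_unramified v D \<longleftrightarrow> \<not> is_square D \<and>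
     (\<forall>a b. a \<noteq> 0 \<or> b \<noteq> 0 \<longrightarrow> even (v (a * a - D * b * b)))"

definition hilbert :: "'a::field \<Rightarrow> 'a \<Rightarrow> int" where
  "hilbert a b = (if \<exists>x y z. (x \<noteq> 0 \<or> y \<noteq> 0 \<or> z \<noteq> 0) \<and> a * x * x + b * y * y = z * z
                  then 1 else -1)"

definition upleft :: "'a mat \<Rightarrow> nat \<Rightarrow> 'a mat" where
  "upleft B m = mat m m (\<lambda>(i, j). B $$ (i, j))"

definition perp :: "'a::zero mat \<Rightarrow> 'a mat \<Rightarrow> 'a mat" where
  "perp A B = four_block_mat A (0\<^sub>m (dim_row A) (dim_col B)) (0\<^sub>m (dim_row B) (dim_col A)) B"

definition diag_mat_of :: "'a::zero list \<Rightarrow> 'a mat" where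
  "diag_mat_of d = mat (length d) (length d) (\<lambda>(i, j). if i = j then d ! i else 0)"

definition symmetric_mat :: "'a mat \<Rightarrow> bool" where
  "symmetric_mat B \<longleftrightarrow> B \<in> carrier_mat (dim_row B) (dim_row B) \<and> transpose_mat B = B"

definition half_integral :: "('a::field \<Rightarrow> int) \<Rightarrow> nat \<Rightarrow> 'a mat \<Rightarrow> bool" where
  "half_integral v n B \<longleftrightarrow> B \<in> carrier_mat n n \<and> transpose_mat B = B \<and>
     (\<forall>i<n. intg v (B $$ (i, i))) \<and> (\<forall>i<n. \<forall>j<n. intg v (2 * B $$ (i, j)))"

definition GL_o :: "('a::field \<Rightarrow> int) \<Rightarrow> nat \<Rightarrow> 'a mat \<Rightarrow> bool" where
  "GL_o v n U \<longleftrightarrow> U \<in> carrier_mat n n \<and> (\<forall>i<n. \<forall>j<n. intg v (U $$ (i, j))) \<and>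
     unit_o v (det U)"

definition o_equiv :: "('a::field \<Rightarrow> int) \<Rightarrow> 'a mat \<Rightarrow> 'a mat \<Rightarrow> bool" where
  "o_equiv v B B' \<longleftrightarrow> (\<exists>U. GL_o v (dim_row B) U \<and> B' = transpose_mat U * B * U)"

definition D_inv :: "'a::field mat \<Rightarrow> 'a" where
  "D_inv B = (-4) ^ (dim_row B div 2) * det B"

definition xi :: "('a::field \<Rightarrow> int) \<Rightarrow> 'a mat \<Rightarrow> int" where
  "xi v B = (if is_square (D_inv B) then 1
             else if quad_unramified v (D_inv B) then -1 else 0)"

definition eta_of_diag :: "'a::field list \<Rightarrow> 'a \<Rightarrow> int" where
  "eta_of_diag d dt = (let n = length d in
      hilbert (-1::'a) (-1) ^ ((n + 1) div 4) * hilbert (-1) dt ^ ((n - 1) div 2) *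
      (\<Prod>i<n. \<Prod>j\<in>{i<..<n}. hilbert (d ! i) (d ! j)))"

definition eta :: "'a::field mat \<Rightarrow> int" where
  "eta B = eta_of_diag
     (SOME d. length d = dim_row B \<and>
        (\<exists>P. P \<in> carrier_mat (dim_row B) (dim_row B) \<and> det P \<noteq> 0 \<and>
             transpose_mat P * B * P = diag_mat_of d))
     (det B)"

definition S_set :: "('a::field \<Rightarrow> int) \<Rightarrow> 'a mat \<Rightarrow> nat list set" where
  "S_set v B = {a. length a = dim_row B \<and> sorted a \<and>
     (\<forall>i<dim_row B. vge v (B $$ (i, i)) (int (a ! i))) \<and>
     (\<forall>i<dim_row B. \<forall>j<dim_row B. i \<le> j \<longrightarrow>
        (B $$ (i, j) = 0 \<or> 2 * v (2 * B $$ (i, j)) \<ge> int (a ! i) + int (a ! j)))}"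

definition SS_set :: "('a::field \<Rightarrow> int) \<Rightarrow> 'a mat \<Rightarrow> nat list set" where
  "SS_set v B = (\<Union>U\<in>{U. GL_o v (dim_row B) U}. S_set v (transpose_mat U * B * U))"

definition GK :: "('a::field \<Rightarrow> int) \<Rightarrow> 'a mat \<Rightarrow> nat list" where
  "GK v B = (THE g. g \<in> SS_set v B \<and> (\<forall>a\<in>SS_set v B. lexordp_eq a g))"

definition optimal :: "('a::field \<Rightarrow> int) \<Rightarrow> 'a mat \<Rightarrow> bool" where
  "optimal v B \<longleftrightarrow> GK v B \<in> S_set v B"

definition zeta_inv :: "('a::field \<Rightarrow> int) \<Rightarrow> 'a mat \<Rightarrow> int" where
  "zeta_inv v C = (if even (dim_row C) then xi v C else eta C)"

definition gk_values :: "nat list \<Rightarrow> nat list" where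
  "gk_values g = remdups g"

definition gk_mults :: "nat list \<Rightarrow> nat list" where
  "gk_mults g = map (\<lambda>m. length (filter ((=) m) g)) (remdups g)"

definition gk_partial :: "nat list \<Rightarrow> nat \<Rightarrow> nat" where
  "gk_partial g u = sum_list (take u (gk_mults g))"

definition egk_data :: "('a::field \<Rightarrow> int) \<Rightarrow> 'a mat \<Rightarrow> nat list \<times> nat list \<times> int list" where
  "egk_data v B' = (let g = GK v B' in
     (gk_mults g, gk_values g,
      map (\<lambda>u. zeta_inv v (upleft B' (gk_partial g u))) [1..<Suc (length (gk_values g))]))"

definition EGK :: "('a::field \<Rightarrow> int) \<Rightarrow> 'a mat \<Rightarrow> nat list \<times> nat list \<times> int list" where
  "EGK v B = (SOME e. \<exists>B'. o_equiv v B B' \<and> optimal v B' \<and> e = egk_data v B')"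

text \<open>A form 2^k_1 C_1 \<perp> ... \<perp> 2^k_r C_r is given by the list
  bs = [(k_1, C_1), ..., (k_r, C_r)]; blocks are indexed 1..r as in the paper.\<close>

definition unimod_diag :: "('a::field \<Rightarrow> int) \<Rightarrow> 'a mat \<Rightarrow> bool" where
  "unimod_diag v C \<longleftrightarrow> dim_row C \<ge> 1 \<and> C \<in> carrier_mat (dim_row C) (dim_row C) \<and>
     (\<forall>i<dim_row C. \<forall>j<dim_row C. i \<noteq> j \<longrightarrow> C $$ (i, j) = 0) \<and>
     (\<forall>i<dim_row C. unit_o v (C $$ (i, i)))"

definition half_even_unimod :: "('a::field \<Rightarrow> int) \<Rightarrow> 'a mat \<Rightarrow> bool" where
  "half_even_unimod v C \<longleftrightarrow> (\<exists>M. M \<in> carrier_mat 2 2 \<and> transpose_mat M = M \<and>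
     (\<forall>i<2. \<forall>j<2. intg v (M $$ (i, j))) \<and> vge v (M $$ (0, 0)) 1 \<and> vge v (M $$ (1, 1)) 1 \<and>
     GL_o v 2 M \<and> C = (1 / 2) \<cdot>\<^sub>m M)"

definition valid_block :: "('a::field \<Rightarrow> int) \<Rightarrow> nat \<times> 'a mat \<Rightarrow> bool" where
  "valid_block v b \<longleftrightarrow> unimod_diag v (snd b) \<or> half_even_unimod v (snd b)"

definition blocks_mat :: "(nat \<times> 'a::field mat) list \<Rightarrow> 'a mat" where
  "blocks_mat bs = foldr (\<lambda>(k, C) A. perp ((2 ^ k) \<cdot>\<^sub>m C) A) bs (0\<^sub>m 0 0)"

definition kk :: "(nat \<times> 'a mat) list \<Rightarrow> nat \<Rightarrow> nat" where
  "kk bs i = fst (bs ! (i - 1))"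

definition CC :: "(nat \<times> 'a mat) list \<Rightarrow> nat \<Rightarrow> 'a mat" where
  "CC bs i = snd (bs ! (i - 1))"

definition Bpre :: "(nat \<times> 'a::field mat) list \<Rightarrow> nat \<Rightarrow> 'a mat" where
  "Bpre bs j = blocks_mat (take j bs)"

definition isD :: "('a::field \<Rightarrow> int) \<Rightarrow> (nat \<times> 'a mat) list \<Rightarrow> nat \<Rightarrow> nat \<Rightarrow> bool" where
  "isD v bs m j \<longleftrightarrow> 1 \<le> j \<and> j \<le> length bs \<and> kk bs j = m \<and> unimod_diag v (CC bs j)"

definition isE :: "('a::field \<Rightarrow> int) \<Rightarrow> (nat \<times> 'a mat) list \<Rightarrow> nat \<Rightarrow> nat \<Rightarrow> bool" where
  "isE v bs m j \<longleftrightarrow> 1 \<le> j \<and> j \<le> length bs \<and> kk bs j = m \<and> \<not> unimod_diag v (CC bs j)"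

definition PO1 where
  "PO1 v bs \<longleftrightarrow> (\<forall>m. (\<Sum>j\<in>{j. isD v bs m j}. dim_row (CC bs j)) \<le> 2 \<and>
      (\<forall>i j l. isE v bs m i \<and> isE v bs m j \<and> i \<le> l \<and> l \<le> j \<longrightarrow> isE v bs m l))"

definition PO2 where
  "PO2 v bs \<longleftrightarrow> (\<forall>i j m1 m2. i < j \<longrightarrow>
      (isD v bs m1 i \<and> isD v bs m2 j \<longrightarrow> m1 \<le> m2) \<and>
      (isE v bs m1 i \<and> isE v bs m2 j \<longrightarrow> m1 \<le> m2) \<and>
      (isD v bs m1 i \<and> isE v bs m2 j \<longrightarrow> int m1 \<le> int m2 - 1) \<and>
      (isE v bs m1 i \<and> isD v bs m2 j \<longrightarrow> m1 \<le> m2 + 1))"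

definition PO3 where
  "PO3 v bs \<longleftrightarrow> (\<forall>i. 1 \<le> i \<and> i \<le> length bs \<and> unimod_diag v (CC bs i) \<and> dim_row (CC bs i) = 2 \<longrightarrow>
      i \<ge> 2 \<and>
      ((even (dim_row (Bpre bs i)) \<and> xi v (Bpre bs (i - 1)) = 0 \<and> xi v (Bpre bs i) = 0) \<or>
       (odd (dim_row (Bpre bs (i - 1))) \<and> even (v (det (Bpre bs (i - 1))) + int (kk bs i)))))"

definition PO4 where
  "PO4 v bs \<longleftrightarrow> (\<forall>i. 2 \<le> i \<and> i \<le> length bs \<and> int (kk bs i) = int (kk bs (i - 1)) - 1 \<and>
      unimod_diag v (CC bs i) \<and> \<not> unimod_diag v (CC bs (i - 1)) \<longrightarrow>
      dim_row (CC bs i) = 2 \<or>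
      (dim_row (CC bs i) = 1 \<and>
        ((even (dim_row (Bpre bs i)) \<and> even (v (det (Bpre bs i)))) \<or>
         (odd (dim_row (Bpre bs i)) \<and> xi v (Bpre bs (i - 1)) = 0))))"

definition PO5 where
  "PO5 v bs \<longleftrightarrow> (\<forall>i. 1 \<le> i \<and> i < length bs \<and> unimod_diag v (CC bs i) \<and>
      \<not> unimod_diag v (CC bs (i + 1)) \<and> kk bs i + 1 = kk bs (i + 1) \<longrightarrow>
      dim_row (CC bs i) = 1 \<and>
      ((even (dim_row (Bpre bs i)) \<and> odd (v (det (Bpre bs i)))) \<or>
       (odd (dim_row (Bpre bs i)) \<and> (i \<ge> 2 \<longrightarrow> xi v (Bpre bs (i - 1)) \<noteq> 0))))"

definition PO6 where
  "PO6 v bs \<longleftrightarrow> (\<forall>i. 1 \<le> i \<and> i < length bs \<and> even (dim_row (Bpre bs i)) \<and>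
      unimod_diag v (CC bs i) \<and> unimod_diag v (CC bs (i + 1)) \<and> kk bs (i + 1) = kk bs i + 1 \<longrightarrow>
      xi v (Bpre bs i) = 0)"

definition pre_optimal :: "('a::field \<Rightarrow> int) \<Rightarrow> (nat \<times> 'a mat) list \<Rightarrow> bool" where
  "pre_optimal v bs \<longleftrightarrow> (\<forall>b\<in>set bs. valid_block v b) \<and>
     PO1 v bs \<and> PO2 v bs \<and> PO3 v bs \<and> PO4 v bs \<and> PO5 v bs \<and> PO6 v bs"

end

theory Submission
  imports Defs "HOL-Library.FuncSet" "HOL-Library.Function_Algebras"
begin

text \<open>
  Call a lattice basis with a non-decreasing sequence of levels admissible if it satisfies the inequalities defining
  \<open>S(B)\<close>. The levels filter the lattice, and the quadratic form induces a quadratic form over the residue field on every graded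
  piece. An admissible sequence is lexicographically maximal iff, for every \<open>t\<close>, the basis vectors of level at most \<open>t\<close> give
  a graded form that is anisotropic on its radical (semiregular), since an isotropic radical vector would permit raising a level.
  Two maximal admissible bases differ by a matrix that respects the filtration. Hence at a jump of the levels the Gram matrices of
  the initial segments are congruent up to terms of higher level, and such a perturbation of a semiregular family changes neither
  the class of an unramified discriminant nor, in odd rank, the Clifford invariant. So the invariants at the jumps do not depend
  on the chosen optimal form.

  For a pre-optimal form an admissible maximal basis is built block by block with a unitriangular base change. An even block of
  scale \<open>k\<close> contributes the levels \<open>k, k\<close>. A diagonal vector of scale \<open>k\<close> is corrected by a vector in the radical of the
  preceding piece; its level becomes \<open>k\<close>, \<open>k + 1\<close> or \<open>k + 2\<close> according to the nondegeneracy of the pieces before and after,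
  which is read off from \<open>\<xi>\<close> in even degree and from the parity of \<open>ord det\<close> in odd degree. Conditions (PO1)--(PO6) make
  the resulting levels non-decreasing and force every jump to occur at the end of a block.
\<close>

section \<open>Arithmetic of an unramified dyadic field\<close>

text \<open>In residue characteristic 2 a graded quadratic form is not determined by its polar form,
  and on the radical of the polar form it is additive and semilinear for squaring. The residue field
  is finite, hence perfect, so a semiregular piece has a radical of dimension at most one.
  Multiplication by 2 shifts levels by 2, so only two pieces matter, one for each parity. Splitting
  off planes with nondegenerate polar form therefore leaves at most two vectors, of levels of
  opposite parity. Such a plane has unramified discriminant D, and in odd rank it changes the
  Clifford invariant by a Hilbert symbol with D, which depends only on the square class of D and on
  the parity of an order. Both survive a perturbation of higher level. The obstacle for pre-optimal
  forms is a diagonal vector that alone would get level k + 2: if another one of scale k follows,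
  monotonicity fails, and the two are corrected together to level k + 1. Completeness enters only
  through roots of z^2 + z = t. Finiteness of the residue field gives perfectness and norm groups of
  index 2.\<close>

locale dyadic =
  fixes v :: "'a::field \<Rightarrow> int"
  assumes unram: "unram_ext_Q2 v"
begin

abbreviation ge :: "'a \<Rightarrow> int \<Rightarrow> bool" where "ge x k \<equiv> vge v x k"

definition ex :: "'a \<Rightarrow> int \<Rightarrow> bool" where "ex x k \<longleftrightarrow> x \<noteq> 0 \<and> v x = k"

lemma two_nz [simp]: "(2::'a) \<noteq> 0"
  and v_two [simp]: "v 2 = 1"
  and v_mult: "x \<noteq> 0 \<Longrightarrow> y \<noteq> 0 \<Longrightarrow> v (x * y) = v x + v y"
  and v_add: "x \<noteq> 0 \<Longrightarrow> y \<noteq> 0 \<Longrightarrow> x + y \<noteq> 0 \<Longrightarrow> v (x + y) \<ge> min (v x) (v y)"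
  using unram unfolding unram_ext_Q2_def valuation_def by auto

lemma v_one [simp]: "v 1 = 0"
  using v_mult[of 1 1] by simp

lemma v_uminus [simp]: "v (- x) = v x"
proof (cases "x = 0")
  case False
  have "v (-1) + v (-1) = 0" using v_mult[of "-1" "-1"] by simp
  then show ?thesis using v_mult[of "-1" x] False by simp
qed simp

lemma v_inverse: "x \<noteq> 0 \<Longrightarrow> v (inverse x) = - v x"
  using v_mult[of x "inverse x"] by simp

lemma v_divide: "x \<noteq> 0 \<Longrightarrow> y \<noteq> 0 \<Longrightarrow> v (x / y) = v x - v y"
  by (simp add: divide_inverse v_mult v_inverse)

lemma four_nz [simp]: "(4::'a) \<noteq> 0"
proof -
  have "(4::'a) = 2 * 2" by simp
  then show ?thesis by (metis mult_eq_0_iff two_nz)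
qed

lemma v_four [simp]: "v 4 = 2"
proof -
  have "(4::'a) = 2 * 2" by simp
  then show ?thesis using v_mult[of 2 2] by simp
qed

lemma ge_0 [simp]: "ge 0 k" by (simp add: vge_def)

lemma ge_mono: "ge x k \<Longrightarrow> l \<le> k \<Longrightarrow> ge x l" by (auto simp: vge_def)

lemma ge_add: "ge x k \<Longrightarrow> ge y k \<Longrightarrow> ge (x + y) k"
  using v_add[of x y] by (cases "x = 0"; cases "y = 0"; cases "x + y = 0") (auto simp: vge_def)

lemma ge_uminus [simp]: "ge (- x) k \<longleftrightarrow> ge x k" by (simp add: vge_def)

lemma ge_diff: "ge x k \<Longrightarrow> ge y k \<Longrightarrow> ge (x - y) k"
  using ge_add[of x k "-y"] by simp

lemma ge_diff_commute: "ge (x - y) k \<longleftrightarrow> ge (y - x) k"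
  using ge_uminus[of "x - y" k] by simp

lemma ge_mult: "ge x k \<Longrightarrow> ge y l \<Longrightarrow> ge (x * y) (k + l)"
  by (cases "x = 0"; cases "y = 0") (auto simp: vge_def v_mult)

lemma ge_mult': "ge x k \<Longrightarrow> ge y l \<Longrightarrow> m \<le> k + l \<Longrightarrow> ge (x * y) m"
  using ge_mult ge_mono by blast

lemma ge_sum: "(\<And>i. i \<in> I \<Longrightarrow> ge (f i) k) \<Longrightarrow> ge (sum f I) k"
  by (induction I rule: infinite_finite_induct) (auto intro: ge_add)

lemma ge_two [simp]: "ge 2 k \<longleftrightarrow> k \<le> 1" by (auto simp: vge_def)
lemma ge_one [simp]: "ge 1 k \<longleftrightarrow> k \<le> 0" by (auto simp: vge_def)
lemma ge_four [simp]: "ge 4 k \<longleftrightarrow> k \<le> 2" by (auto simp: vge_def)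

lemma ge_two_mult [simp]: "ge (2 * x) k \<longleftrightarrow> ge x (k - 1)"
  by (cases "x = 0") (auto simp: vge_def v_mult)

lemma ge_four_mult: "ge (4 * x) k \<longleftrightarrow> ge x (k - 2)"
  by (cases "x = 0") (auto simp: vge_def v_mult)

lemma ge_sq: "ge x 0 \<Longrightarrow> ge (x * x) 0" using ge_mult[of x 0 x 0] by simp

lemma ge_prod0: "ge x 0 \<Longrightarrow> ge y 0 \<Longrightarrow> ge (x * y) 0" using ge_mult[of x 0 y 0] by simp

lemma ge_prod: "(\<And>i. i \<in> I \<Longrightarrow> ge (f i) (g i)) \<Longrightarrow> finite I \<Longrightarrow> ge (prod f I) (sum g I)"
proof (induction I rule: infinite_finite_induct)
  case (insert x F) then show ?case by (auto intro: ge_mult)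
qed auto

lemma ex_ge: "ex x k \<Longrightarrow> ge x k" by (simp add: ex_def vge_def)
lemma ex_nz: "ex x k \<Longrightarrow> x \<noteq> 0" by (simp add: ex_def)
lemma ex_not_ge: "ex x k \<Longrightarrow> \<not> ge x (k + 1)" by (simp add: ex_def vge_def)
lemma exI': "ge x k \<Longrightarrow> \<not> ge x (k + 1) \<Longrightarrow> ex x k" by (auto simp: ex_def vge_def)
lemma ex_iff: "ex x k \<longleftrightarrow> ge x k \<and> \<not> ge x (k + 1)"
  using ex_ge ex_not_ge exI' by blast
lemma ex_mult: "ex x k \<Longrightarrow> ex y l \<Longrightarrow> ex (x * y) (k + l)" by (auto simp: ex_def v_mult)
lemma ex_uminus [simp]: "ex (- x) k \<longleftrightarrow> ex x k" by (simp add: ex_def)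
lemma ex_divide: "ex x k \<Longrightarrow> ex y l \<Longrightarrow> ex (x / y) (k - l)" by (auto simp: ex_def v_divide)
lemma ex_two [simp]: "ex 2 k \<longleftrightarrow> k = 1" by (auto simp: ex_def)
lemma ex_one [simp]: "ex 1 k \<longleftrightarrow> k = 0" by (auto simp: ex_def)
lemma ex_four [simp]: "ex 4 k \<longleftrightarrow> k = 2" by (auto simp: ex_def)
lemma ex_self: "x \<noteq> 0 \<Longrightarrow> ex x (v x)" by (simp add: ex_def)

lemma ex_add: assumes "ex x k" "ge y (k + 1)" shows "ex (x + y) k"
proof (rule exI')
  show "ge (x + y) k" using assms ex_ge ge_add ge_mono by (metis zle_add1_eq_le less_add_one order_less_imp_le)
  show "\<not> ge (x + y) (k + 1)"
  proof
    assume "ge (x + y) (k + 1)"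
    then have "ge (x + y - y) (k + 1)" using assms(2) ge_diff by blast
    then show False using ex_not_ge[OF assms(1)] by simp
  qed
qed

lemma ge_mult_ex: "ex y l \<Longrightarrow> ge (x * y) k \<longleftrightarrow> ge x (k - l)"
  by (cases "x = 0") (auto simp: vge_def ex_def v_mult)

lemma ge_divide: "ge x k \<Longrightarrow> ex y l \<Longrightarrow> ge (x / y) (k - l)"
  by (cases "x = 0") (auto simp: vge_def ex_def v_divide)

lemma ge_divide': "ge x k \<Longrightarrow> ex y l \<Longrightarrow> m \<le> k - l \<Longrightarrow> ge (x / y) m"
  using ge_divide ge_mono by blast

text \<open>The element 2 is a uniformizer. Negative exponents are allowed, so that multiplication
  by \<open>tw\<close> moves a vector between any two levels of the same parity.\<close>

definition tw :: "int \<Rightarrow> 'a" where "tw k = 2 powi k"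

lemma tw_add: "tw (k + l) = tw k * tw l" by (simp add: tw_def power_int_add)
lemma tw_nz [simp]: "tw k \<noteq> 0" by (simp add: tw_def)
lemma tw_0 [simp]: "tw 0 = 1" by (simp add: tw_def)
lemma tw_1 [simp]: "tw 1 = 2" by (simp add: tw_def)

lemma v_tw [simp]: "v (tw k) = k"
proof -
  have nat: "v (tw (int n)) = int n" for n
    by (induction n) (simp_all add: tw_add v_mult add.commute)
  show ?thesis
  proof (cases "k \<ge> 0")
    case True then show ?thesis using nat[of "nat k"] by simp
  next
    case False
    have "v (tw k) + v (tw (-k)) = 0" using v_mult[of "tw k" "tw (-k)"] tw_add[of k "-k"] by simp
    then show ?thesis using nat[of "nat (-k)"] False by simp
  qed
qed

lemma ex_tw: "ex (tw k) k" by (simp add: ex_def)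

lemma two_power_tw: "(2::'a) ^ n = tw (int n)" by (simp add: tw_def)



section \<open>Linear algebra over the residue field by representatives\<close>

definition repset :: "'a set" where
  "repset = (SOME R. finite R \<and> (\<forall>x. ge x 0 \<longrightarrow> (\<exists>r\<in>R. ge r 0 \<and> ge (x - r) 1)))"

definition rep :: "'a \<Rightarrow> 'a" where
  "rep x = (SOME r. r \<in> repset \<and> ge r 0 \<and> ge (x - r) 1)"

text \<open>A model of the residue field without a quotient: \<open>rep\<close> depends only on the
  residue class (\<open>rep_cong\<close>), so \<open>K\<close> meets each class exactly once even
  where \<open>repset\<close> contains several elements of a class.\<close>

definition K :: "'a set" where "K = rep ` {x. ge x 0}"

lemma repset: "finite repset" "ge x 0 \<Longrightarrow> \<exists>r\<in>repset. ge r 0 \<and> ge (x - r) 1"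
proof -
  have "\<exists>R. finite R \<and> (\<forall>x. ge x 0 \<longrightarrow> (\<exists>r\<in>R. ge r 0 \<and> ge (x - r) 1))"
    using unram unfolding unram_ext_Q2_def finite_residue_field_def by auto
  then have "finite repset \<and> (\<forall>x. ge x 0 \<longrightarrow> (\<exists>r\<in>repset. ge r 0 \<and> ge (x - r) 1))"
    unfolding repset_def by (rule someI_ex)
  then show "finite repset" "ge x 0 \<Longrightarrow> \<exists>r\<in>repset. ge r 0 \<and> ge (x - r) 1" by auto
qed

lemma rep: assumes "ge x 0" shows "rep x \<in> repset" "ge (rep x) 0" "ge (x - rep x) 1"
proof -
  have "rep x \<in> repset \<and> ge (rep x) 0 \<and> ge (x - rep x) 1"
    unfolding rep_def by (rule someI_ex) (use repset(2)[OF assms] in blast)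
  then show "rep x \<in> repset" "ge (rep x) 0" "ge (x - rep x) 1" by auto
qed

lemma rep_cong: assumes "ge (x - y) 1" shows "rep x = rep y"
proof -
  have "ge (x - r) 1 \<longleftrightarrow> ge (y - r) 1" for r
  proof
    assume "ge (x - r) 1" then show "ge (y - r) 1" using ge_diff[of "x - r" 1 "x - y"] assms by (simp add: algebra_simps)
  next
    assume "ge (y - r) 1" then show "ge (x - r) 1" using ge_add[of "y - r" 1 "x - y"] assms by (simp add: algebra_simps)
  qed
  then show ?thesis by (simp add: rep_def)
qed

lemma rep_eq_iff: assumes "ge x 0" "ge y 0" shows "rep x = rep y \<longleftrightarrow> ge (x - y) 1"
proof
  assume "rep x = rep y"
  then show "ge (x - y) 1" using ge_diff[OF rep(3)[OF assms(1)] rep(3)[OF assms(2)]] by simp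
qed (rule rep_cong)

lemma finite_K: "finite K"
  by (rule finite_subset[OF _ repset(1)]) (auto simp: K_def rep)

lemma rep_K: "ge x 0 \<Longrightarrow> rep x \<in> K" by (auto simp: K_def)
lemma K_ge: "x \<in> K \<Longrightarrow> ge x 0" by (auto simp: K_def rep)
lemma rep_id: assumes "x \<in> K" shows "rep x = x"
proof -
  obtain y where y: "ge y 0" "x = rep y" using assms by (auto simp: K_def)
  show ?thesis using rep_cong[OF rep(3)[OF y(1)]] y(2) by simp
qed

lemma K_eq: "x \<in> K \<Longrightarrow> y \<in> K \<Longrightarrow> ge (x - y) 1 \<Longrightarrow> x = y"
  using rep_cong rep_id by metis

lemma ge_sq_1: "ge (x * x) 1 \<Longrightarrow> ge x 1"
  by (cases "x = 0") (auto simp: vge_def v_mult)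

lemma ge_mult_1: "ge (x * y) 1 \<Longrightarrow> ge x 0 \<Longrightarrow> ge y 0 \<Longrightarrow> ge x 1 \<or> ge y 1"
  by (cases "x = 0"; cases "y = 0") (auto simp: vge_def v_mult)

text \<open>The residue field is perfect: squaring is injective on \<open>K\<close> in
  characteristic 2, hence surjective because \<open>K\<close> is finite.\<close>

lemma sqrt_mod: assumes "ge x 0" shows "\<exists>y. ge y 0 \<and> ge (x - y * y) 1"
proof -
  let ?f = "\<lambda>y. rep (y * y)"
  have "inj_on ?f K"
  proof (rule inj_onI)
    fix y z assume yz: "y \<in> K" "z \<in> K" "?f y = ?f z"
    then have "ge (y * y - z * z) 1" using rep_eq_iff[OF ge_sq ge_sq] K_ge by blast
    \<comment> \<open>Added to y^2 - z^2, this even term completes the square (y - z)^2.\<close>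
    moreover have "ge (2 * (z * (z - y))) 1"
      using yz by (auto intro!: ge_prod0 ge_diff dest: K_ge)
    ultimately have "ge (y * y - z * z + 2 * (z * (z - y))) 1" by (rule ge_add)
    then have "ge ((y - z) * (y - z)) 1" by (simp add: algebra_simps)
    then show "y = z" using yz K_eq ge_sq_1 by blast
  qed
  moreover have "?f ` K \<subseteq> K" by (auto intro!: rep_K ge_sq dest: K_ge)
  ultimately have "?f ` K = K" using finite_K endo_inj_surj by blast
  then have "rep x \<in> ?f ` K" using rep_K[OF assms] by simp
  then obtain y where y: "y \<in> K" "rep x = rep (y * y)" by auto
  then have "ge (x - y * y) 1" using rep_eq_iff[OF assms ge_sq[OF K_ge[OF y(1)]]] by simp
  then show ?thesis using K_ge[OF y(1)] by blast
qed

text \<open>Perfectness of the residue field: the leading coefficient of -x / q is a square. This is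
  how the value of a vector is pushed to the next order by adding a multiple of a radical
  vector.\<close>

lemma sq_approx: assumes "ex q t" "ge x t" shows "\<exists>c. ge c 0 \<and> ge (x + c * c * q) (t + 1)"
proof -
  have "ge (- x / q) 0" using ge_divide[of "-x" t q t] assms by simp
  then obtain c where c: "ge c 0" "ge (- x / q - c * c) 1" using sqrt_mod by blast
  have "ge ((- x / q - c * c) * q) (1 + t)" using c(2) assms(1) ex_ge ge_mult by blast
  moreover have "(- x / q - c * c) * q = - (x + c * c * q)" using ex_nz[OF assms(1)] by (simp add: field_simps)
  ultimately have "ge (- (x + c * c * q)) (1 + t)" by simp
  then show ?thesis using c(1) ge_uminus by (metis add.commute)
qed

text \<open>An injective self-map of the finite set of vectors over the residue field is surjective.
  Counting replaces determinants and dimension theory.\<close>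

lemma linear_surj:
  assumes T: "finite T" and N: "\<And>k i. k \<in> T \<Longrightarrow> i \<in> T \<Longrightarrow> ge (N k i) 0"
    and inj: "\<And>x. (\<And>i. i \<in> T \<Longrightarrow> ge (x i) 0) \<Longrightarrow> (\<And>k. k \<in> T \<Longrightarrow> ge (\<Sum>i\<in>T. N k i * x i) 1) \<Longrightarrow>
       (\<And>i. i \<in> T \<Longrightarrow> ge (x i) 1)"
    and t: "\<And>k. k \<in> T \<Longrightarrow> ge (t k) 0"
  shows "\<exists>x. (\<forall>i\<in>T. ge (x i) 0) \<and> (\<forall>k\<in>T. ge ((\<Sum>i\<in>T. N k i * x i) - t k) 1)"
proof -
  let ?X = "T \<rightarrow>\<^sub>E K"
  let ?f = "\<lambda>x. \<lambda>k\<in>T. rep (\<Sum>i\<in>T. N k i * x i)"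
  have fin: "finite ?X" using T finite_K by (simp add: finite_PiE)
  have ge0: "ge (\<Sum>i\<in>T. N k i * x i) 0" if "x \<in> ?X" "k \<in> T" for x k
    using that by (intro ge_sum ge_prod0 N) (auto simp: PiE_iff intro: K_ge)
  have "inj_on ?f ?X"
  proof (rule inj_onI)
    fix x y assume x: "x \<in> ?X" and y: "y \<in> ?X" and eq: "?f x = ?f y"
    have "ge (x i - y i) 1" if "i \<in> T" for i
    proof (rule inj[where x = "\<lambda>i. x i - y i", OF _ _ that])
      fix i assume "i \<in> T" then show "ge (x i - y i) 0"
        using x y by (intro ge_diff; intro K_ge) (auto simp: PiE_iff)
    next
      fix k assume k: "k \<in> T"
      have "rep (\<Sum>i\<in>T. N k i * x i) = rep (\<Sum>i\<in>T. N k i * y i)"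
        using fun_cong[OF eq, of k] k by simp
      then have "ge ((\<Sum>i\<in>T. N k i * x i) - (\<Sum>i\<in>T. N k i * y i)) 1"
        using rep_eq_iff ge0 x y k by blast
      then show "ge (\<Sum>i\<in>T. N k i * (x i - y i)) 1"
        by (simp add: sum_subtractf right_diff_distrib)
    qed
    then have "\<forall>i\<in>T. x i = y i" using K_eq x y by (meson PiE_mem)
    then show "x = y" using x y by (meson PiE_ext)
  qed
  moreover have "?f ` ?X \<subseteq> ?X" using ge0 by (auto intro!: rep_K)
  ultimately have "?f ` ?X = ?X" using fin endo_inj_surj by blast
  moreover have "(\<lambda>k\<in>T. rep (t k)) \<in> ?X" using t rep_K by auto
  ultimately have "(\<lambda>k\<in>T. rep (t k)) \<in> ?f ` ?X" by simp
  then obtain x where x: "x \<in> ?X" "?f x = (\<lambda>k\<in>T. rep (t k))" by auto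
  have "ge ((\<Sum>i\<in>T. N k i * x i) - t k) 1" if "k \<in> T" for k
    using fun_cong[OF x(2), of k] that rep_eq_iff ge0[OF x(1) that] t[OF that] by auto
  moreover have "\<forall>i\<in>T. ge (x i) 0" using x(1) by (auto simp: PiE_iff intro: K_ge)
  ultimately show ?thesis by blast
qed

end

lemma is_square_mult: "is_square x \<Longrightarrow> is_square y \<Longrightarrow> is_square (x * y :: 'a::field)"
  unfolding is_square_def by (metis mult.assoc mult.left_commute)

lemma is_square_sq [simp]: "is_square (x * x)" by (auto simp: is_square_def)

lemma is_square_mult_sq: assumes "s \<noteq> (0::'a::field)" shows "is_square (x * (s * s)) \<longleftrightarrow> is_square x"
proof
  assume "is_square (x * (s * s))"
  then obtain y where "x * (s * s) = y * y" by (auto simp: is_square_def)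
  then have "x = (y / s) * (y / s)" using assms by (simp add: field_simps)
  then show "is_square x" unfolding is_square_def by blast
qed (simp add: is_square_mult)

lemma is_square_cancel: assumes "is_square (x * y)" "is_square x" "x \<noteq> (0::'a::field)" shows "is_square y"
proof -
  obtain s where s: "x = s * s" using assms(2) by (auto simp: is_square_def)
  then have "s \<noteq> 0" using assms(3) by auto
  then show ?thesis using is_square_mult_sq[of s y] assms(1) s by (simp add: mult.commute)
qed

section \<open>Artin-Schreier classes and unramified square classes\<close>

context dyadic
begin

lemma ge_eq: "ge x k \<Longrightarrow> x = y \<Longrightarrow> ge y k" by simp

lemma ge_all_zero: assumes "\<And>N. ge x N" shows "x = 0"
  using assms[of "v x + 1"] by (auto simp: vge_def)

text \<open>The map z to t - z^2 contracts the elements of order at least 1, because a difference of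
  squares gains the order of the sum; its fixed point is the root. Completeness of the field enters
  here.\<close>

lemma as_root: assumes t: "ge t 1" shows "\<exists>z. z * z + z = t"
proof -
  define z where "z = rec_nat (0::'a) (\<lambda>_ y. t - y * y)"
  have z0: "z 0 = 0" and zS: "z (Suc n) = t - z n * z n" for n by (simp_all add: z_def)
  have z1: "ge (z n) 1" for n
  proof (induction n)
    case (Suc n)
    then have "ge (z n * z n) 1" using ge_mult' by fastforce
    then show ?case using t by (simp add: zS ge_diff)
  qed (simp add: z0)
  have d: "ge (z (Suc n) - z n) (int n + 1)" for n
  proof (induction n)
    case (Suc n)
    have "z (Suc (Suc n)) - z (Suc n) = - ((z (Suc n) - z n) * (z (Suc n) + z n))"
      by (simp add: zS[of "Suc n"] zS[of n] algebra_simps)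
    moreover have "ge ((z (Suc n) - z n) * (z (Suc n) + z n)) (int n + 1 + 1)"
      using Suc z1 by (intro ge_mult ge_add)
    ultimately show ?case by (simp add: add.commute del: of_nat_Suc) (simp add: add.commute)
  qed (simp add: z0 zS t)
  have dk: "ge (z (n + k) - z n) (int n + 1)" for n k
  proof (induction k)
    case (Suc k)
    have "ge ((z (Suc (n + k)) - z (n + k)) + (z (n + k) - z n)) (int n + 1)"
      using d[of "n + k"] Suc by (intro ge_add) (auto elim: ge_mono)
    then show ?case by simp
  qed simp
  have cauchy: "\<exists>M. \<forall>m\<ge>M. \<forall>n\<ge>M. ge (z m - z n) N" for N
  proof (intro exI allI impI)
    fix m n assume mn: "nat N \<le> m" "nat N \<le> n"
    obtain i j where ij: "m = nat N + i" "n = nat N + j" using mn le_Suc_ex by blast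
    have "ge ((z m - z (nat N)) - (z n - z (nat N))) (int (nat N) + 1)"
      unfolding ij by (intro ge_diff dk)
    then show "ge (z m - z n) N" by (auto elim!: ge_mono)
  qed
  have "vcomplete v" using unram by (simp add: unram_ext_Q2_def)
  from this[unfolded vcomplete_def, rule_format, OF cauchy]
  obtain L where L: "\<And>N. \<exists>M. \<forall>n\<ge>M. ge (z n - L) N" by blast
  have "L * L + L - t = 0"
  proof (rule ge_all_zero)
    fix N
    obtain M where M: "\<And>n. n \<ge> M \<Longrightarrow> ge (z n - L) (max N 1)" using L by blast
    have a: "ge (z M - L) N" "ge (z (Suc M) - L) N" "ge (z M - L) 1"
      using M[of M] M[of "Suc M"] by (auto elim: ge_mono)
    have "ge (z M - (z M - L)) 1" using a(3) z1 ge_diff by blast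
    then have "ge L 1" by simp
    then have "ge ((z M - L) * (z M + L)) N"
      using ge_mult'[OF a(1) ge_add[OF z1[of M]], of L N] by simp
    then have "ge ((z (Suc M) - L) + (z M - L) * (z M + L)) N" using a(2) ge_add by blast
    then have "ge (- (L * L + L - t)) N" by (rule ge_eq) (simp add: zS algebra_simps)
    then show "ge (L * L + L - t) N" by (simp only: ge_uminus)
  qed
  then show ?thesis by (auto intro!: exI[of _ L])
qed

text \<open>Modulo \<open>2\<close>, \<open>t\<close> is a value of the Artin--Schreier map; equivalently \<open>1 + 4 t\<close> is a square.\<close>
definition artin_schreier :: "'a \<Rightarrow> bool" where "artin_schreier t \<longleftrightarrow> (\<exists>s. ge s 0 \<and> ge (t - (s * s + s)) 1)"

lemma artin_schreier_cong: assumes "artin_schreier t" "ge (t - t') 1" shows "artin_schreier t'"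
proof -
  obtain s where s: "ge s 0" "ge (t - (s * s + s)) 1" using assms(1) by (auto simp: artin_schreier_def)
  have "ge ((t - (s * s + s)) - (t - t')) 1" using s(2) assms(2) ge_diff by blast
  then have "ge (t' - (s * s + s)) 1" by (rule ge_eq) simp
  then show ?thesis using s(1) unfolding artin_schreier_def by blast
qed

lemma artin_schreier_add: assumes "artin_schreier t" "artin_schreier t'" shows "artin_schreier (t + t')"
proof -
  obtain s where s: "ge s 0" "ge (t - (s * s + s)) 1" using assms(1) by (auto simp: artin_schreier_def)
  obtain s' where s': "ge s' 0" "ge (t' - (s' * s' + s')) 1" using assms(2) by (auto simp: artin_schreier_def)
  have "ge (2 * (s * s')) 1" using s s' ge_prod0 by simp
  then have "ge ((t - (s * s + s)) + (t' - (s' * s' + s')) - 2 * (s * s')) 1"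
    using ge_diff[OF ge_add[OF s(2) s'(2)]] by blast
  then have "ge (t + t' - ((s + s') * (s + s') + (s + s'))) 1" by (simp add: algebra_simps)
  then show ?thesis unfolding artin_schreier_def using s s' ge_add by blast
qed

lemma artin_schreier_0: "ge t 1 \<Longrightarrow> artin_schreier t" unfolding artin_schreier_def by (rule exI[of _ 0]) simp

lemma ex_1_plus: "ge s 1 \<Longrightarrow> ex (1 + s) 0"
  using ex_add[of 1 0 s] by simp

lemma ex_1_plus2: "ge s 0 \<Longrightarrow> ex (1 + 2 * s) 0"
  using ex_1_plus[of "2 * s"] by simp

lemma ex_1_plus4: "ge s 0 \<Longrightarrow> ex (1 + 4 * s) 0"
  using ex_1_plus[of "4 * s"] ge_mono[of s 0 "-1"] by (simp add: ge_four_mult)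

text \<open>After division by (1 + 2 s)^2 what remains is 1 + 4 r with r of order at least 1, and (1
  + 2 z)^2 = 1 + 4 (z^2 + z) reduces this to \<open>as_root\<close>.\<close>

lemma artin_schreier_square: assumes t: "ge t 0" and "artin_schreier t" shows "is_square (1 + 4 * t)"
proof -
  obtain s where s: "ge s 0" "ge (t - (s * s + s)) 1" using assms(2) by (auto simp: artin_schreier_def)
  have u: "ex (1 + 2 * s) 0" using s ex_1_plus2 by blast
  let ?r = "(t - (s * s + s)) / ((1 + 2 * s) * (1 + 2 * s))"
  have "ge ?r 1" using ge_divide[OF s(2) ex_mult[OF u u]] by simp
  then obtain z where z: "z * z + z = ?r" using as_root by blast
  have nz: "1 + 2 * s \<noteq> 0" using u ex_nz by blast
  have "((1 + 2 * s) * (1 + 2 * z)) * ((1 + 2 * s) * (1 + 2 * z))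
      = ((1 + 2 * s) * (1 + 2 * s)) * (1 + 4 * (z * z + z))" by (simp add: algebra_simps)
  also have "\<dots> = (1 + 2 * s) * (1 + 2 * s) + 4 * (((1 + 2 * s) * (1 + 2 * s)) * ?r)"
    unfolding z by (simp add: algebra_simps)
  also have "((1 + 2 * s) * (1 + 2 * s)) * ?r = t - (s * s + s)" using nz by simp
  also have "(1 + 2 * s) * (1 + 2 * s) + 4 * (t - (s * s + s)) = 1 + 4 * t" by (simp add: algebra_simps)
  finally show ?thesis unfolding is_square_def by metis
qed

text \<open>The image of s to s^2 + s has index 2 in the residue field. Its fibres have at most two
  elements, so \<open>K\<close> has at most twice the size of the image \<open>I\<close>; the
  translate \<open>J\<close> by a class outside the image is disjoint from \<open>I\<close>, hence
  the two cover \<open>K\<close>.\<close>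

lemma artin_schreier_add_not:
  assumes t1: "ge t1 0" and t2: "ge t2 0" and n1: "\<not> artin_schreier t1" and n2: "\<not> artin_schreier t2"
  shows "artin_schreier (t1 + t2)"
proof -
  let ?f = "\<lambda>s. rep (s * s + s)"
  have f0: "ge (s * s + s) 0" if "s \<in> K" for s using K_ge[OF that] by (intro ge_add ge_sq)
  define I where "I = ?f ` K"
  define J where "J = (\<lambda>y. rep (y + t1)) ` I"
  have IK: "I \<subseteq> K" unfolding I_def using f0 rep_K by auto
  have JK: "J \<subseteq> K" unfolding J_def using IK K_ge t1 by (auto intro!: rep_K ge_add)
  have fI: "finite I" "finite J" using IK JK finite_K finite_subset by auto
  have aspI: "artin_schreier y" if yI: "y \<in> I" for y
  proof -
    obtain s where s: "s \<in> K" "y = rep (s * s + s)" using yI by (auto simp: I_def)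
    show ?thesis unfolding artin_schreier_def using s rep(3)[OF f0[OF s(1)]] K_ge ge_diff_commute by blast
  qed
  have Iasp: "rep y \<in> I" if y: "artin_schreier y" for y
  proof -
    obtain s where s: "ge s 0" "ge (y - (s * s + s)) 1" using y by (auto simp: artin_schreier_def)
    have r: "ge (s - rep s) 1" using rep(3) s by blast
    have "ge ((s - rep s) * (s + rep s) + (s - rep s)) 1"
      using ge_mult'[OF r ge_add[OF s(1) rep(2)[OF s(1)]]] r by (intro ge_add) auto
    then have "ge ((y - (s * s + s)) + ((s - rep s) * (s + rep s) + (s - rep s))) 1" using s(2) ge_add by blast
    then have "ge (y - (rep s * rep s + rep s)) 1" by (simp add: algebra_simps)
    then have "rep y = ?f (rep s)" by (rule rep_cong)
    then show ?thesis unfolding I_def using rep_K[OF s(1)] by blast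
  qed
  have fib: "card {s \<in> K. ?f s = y} \<le> 2" for y
  proof (cases "\<exists>s0\<in>K. ?f s0 = y")
    case True
    then obtain s0 where s0: "s0 \<in> K" "?f s0 = y" by blast
    \<comment> \<open>The difference of the values at s and s0 factors as (s - s0) (s + s0 +
      1).\<close>
    have "{s \<in> K. ?f s = y} \<subseteq> {s0, rep (- s0 - 1)}"
    proof
      fix s assume "s \<in> {s \<in> K. ?f s = y}"
      then have s: "s \<in> K" "?f s = ?f s0" using s0 by auto
      then have "ge ((s * s + s) - (s0 * s0 + s0)) 1" using rep_eq_iff[OF f0 f0] s0(1) by blast
      then have "ge ((s - s0) * (s - (- s0 - 1))) 1" by (simp add: algebra_simps)
      moreover have g: "ge (s - s0) 0" "ge (- s0 - 1) 0" "ge (s - (- s0 - 1)) 0"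
        using K_ge[OF s(1)] K_ge[OF s0(1)] by (auto intro!: ge_diff)
      ultimately have "ge (s - s0) 1 \<or> ge (s - (- s0 - 1)) 1" using ge_mult_1 by blast
      then show "s \<in> {s0, rep (- s0 - 1)}"
        using K_eq[OF s(1) s0(1)] rep_cong[of s "- s0 - 1"] rep_id[OF s(1)] by auto
    qed
    then have "card {s \<in> K. ?f s = y} \<le> card {s0, rep (- s0 - 1)}" by (intro card_mono) auto
    also have "\<dots> \<le> 2" by (simp add: card_insert_if)
    finally show ?thesis .
  next
    case False
    then have "{s \<in> K. ?f s = y} = {}" by blast
    then show ?thesis by (metis card.empty zero_le)
  qed
  have KU: "K = (\<Union>y\<in>I. {s \<in> K. ?f s = y})" by (auto simp: I_def)
  have "card K \<le> (\<Sum>y\<in>I. card {s \<in> K. ?f s = y})" by (subst KU) (rule card_UN_le[OF fI(1)])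
  also have "\<dots> \<le> (\<Sum>y\<in>I. 2)" using fib by (intro sum_mono)
  finally have cK: "card K \<le> 2 * card I" by simp
  have "inj_on (\<lambda>y. rep (y + t1)) I"
  proof (rule inj_onI)
    fix y z assume yz: "y \<in> I" "z \<in> I" "rep (y + t1) = rep (z + t1)"
    then have k: "y \<in> K" "z \<in> K" using IK by auto
    then have "ge ((y + t1) - (z + t1)) 1" using rep_eq_iff[of "y + t1" "z + t1"] yz K_ge t1 ge_add by blast
    then show "y = z" using K_eq k by simp
  qed
  then have cJ: "card J = card I" unfolding J_def by (rule card_image)
  have "I \<inter> J = {}"
  proof (rule ccontr)
    assume "I \<inter> J \<noteq> {}"
    then obtain y where y: "y \<in> I" "rep (y + t1) \<in> I" by (auto simp: J_def)
    have "artin_schreier (rep (y + t1))" "artin_schreier y" using aspI y by auto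
    moreover have "ge (y + t1) 0" using y IK K_ge t1 ge_add by blast
    ultimately have "artin_schreier (y + t1)" "artin_schreier y" using artin_schreier_cong rep(3) ge_diff_commute by blast+
    then have "artin_schreier (y + t1 + y)" using artin_schreier_add by blast
    moreover have "ge ((y + t1 + y) - t1) 1"
    proof -
      have "ge (2 * y) 1" using y IK K_ge by auto
      then show ?thesis by (simp add: algebra_simps)
    qed
    ultimately show False using artin_schreier_cong n1 by blast
  qed
  then have "card (I \<union> J) = 2 * card I" using fI cJ by (simp add: card_Un_disjoint)
  then have "I \<union> J = K" using cK IK JK finite_K by (intro card_seteq) auto
  moreover have "rep t2 \<in> K" using t2 rep_K by blast
  moreover have "rep t2 \<notin> I"
  proof
    assume "rep t2 \<in> I"
    then have "artin_schreier (rep t2)" using aspI by blast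
    then show False using n2 artin_schreier_cong rep(3)[OF t2] ge_diff_commute by blast
  qed
  ultimately obtain y where y: "y \<in> I" "rep t2 = rep (y + t1)" by (auto simp: J_def)
  then have y0: "ge y 0" using IK K_ge by blast
  have "ge (t2 - (y + t1)) 1" using rep_eq_iff[OF t2 ge_add[OF y0 t1]] y(2) by simp
  moreover have "ge (2 * t1) 1" using t1 by simp
  ultimately have "ge ((t2 - (y + t1)) + 2 * t1) 1" by (rule ge_add)
  then have "ge (y - (t1 + t2)) 1" using ge_diff_commute[of y "t1 + t2"] by (simp add: algebra_simps)
  then show ?thesis using aspI[OF y(1)] artin_schreier_cong by blast
qed

text \<open>\<open>F(\<surd>x)\<close> is unramified over \<open>F\<close>, possibly trivial.\<close>
definition unr :: "'a \<Rightarrow> bool" where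
  "unr x \<longleftrightarrow> (\<exists>s t. s \<noteq> 0 \<and> ge t 0 \<and> x = s * s * (1 + 4 * t))"

lemma unr_nz: "unr x \<Longrightarrow> x \<noteq> 0"
  using ex_1_plus4 ex_nz by (fastforce simp: unr_def)

lemma unr_mult: assumes "unr x" "unr y" shows "unr (x * y)"
proof -
  obtain s t where x: "s \<noteq> 0" "ge t 0" "x = s * s * (1 + 4 * t)" using assms(1) by (auto simp: unr_def)
  obtain s' t' where y: "s' \<noteq> 0" "ge t' 0" "y = s' * s' * (1 + 4 * t')" using assms(2) by (auto simp: unr_def)
  have "x * y = (s * s') * (s * s') * (1 + 4 * (t + t' + 4 * (t * t')))"
    unfolding x y by (simp add: algebra_simps)
  moreover have "ge (t + t' + 4 * (t * t')) 0"
    using x y ge_mult'[of 4 0 "t * t'" 0 0] ge_prod0 by (intro ge_add) auto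
  ultimately show ?thesis unfolding unr_def using x y by (metis mult_eq_0_iff)
qed

lemma unr_sq: "s \<noteq> 0 \<Longrightarrow> unr (s * s)"
  unfolding unr_def by (rule exI[of _ s], rule exI[of _ 0]) simp

lemma unr_square: "is_square x \<Longrightarrow> x \<noteq> 0 \<Longrightarrow> unr x"
  using unr_sq by (auto simp: is_square_def)

lemma unr_cancel: assumes "unr (x * y)" "unr x" shows "unr y"
proof -
  have nz: "x \<noteq> 0" using assms unr_nz by blast
  have "unr (x * y * x)" using assms unr_mult by blast
  moreover have "unr ((1 / x) * (1 / x))" using nz by (intro unr_sq) simp
  ultimately have "unr ((x * y * x) * ((1 / x) * (1 / x)))" using unr_mult by blast
  then show ?thesis using nz by simp
qed

lemma unr_v_even: assumes "unr x" shows "even (v x)"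
proof -
  obtain s t where x: "s \<noteq> 0" "ge t 0" "x = s * s * (1 + 4 * t)" using assms(1) by (auto simp: unr_def)
  have "ex x (v s + v s + 0)" unfolding x using x by (intro ex_mult ex_self ex_1_plus4)
  then show ?thesis by (simp add: ex_def)
qed

text \<open>By perfectness the unit is congruent to a square z^2 modulo 2, and z is again a unit, so
  the quotient by z^2 is 1 modulo 2.\<close>

lemma unit_normal: assumes "ex u 0" shows "\<exists>z s. ex z 0 \<and> ge s 0 \<and> u = z * z * (1 + 2 * s)"
proof -
  obtain z where z: "ge z 0" "ge (u - z * z) 1" using sqrt_mod assms ex_ge by blast
  have "\<not> ge z 1"
  proof
    assume "ge z 1"
    then have "ge (z * z) 1" using ge_mult'[of z 1 z 1 1] by simp
    then have "ge (u - z * z + z * z) 1" using z(2) ge_add by blast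
    then show False using ex_not_ge[OF assms] by simp
  qed
  then have ez: "ex z 0" using z exI' by simp
  define s where "s = (u - z * z) / (2 * (z * z))"
  have "ex (2 * (z * z)) (1 + (0 + 0))" using ez by (intro ex_mult) auto
  then have "ge s (1 - 1)" unfolding s_def using z(2) by (intro ge_divide) auto
  moreover have "u = z * z * (1 + 2 * s)" using ex_nz[OF ez] by (simp add: s_def field_simps)
  ultimately show ?thesis using ez by auto
qed

lemma even_normal: assumes "x \<noteq> 0" "even (v x)"
  shows "\<exists>z s. z \<noteq> 0 \<and> ge s 0 \<and> x = z * z * (1 + 2 * s)"
proof -
  define c where "c = tw (v x div 2)"
  have c: "c \<noteq> 0" "ex (c * c) (v x)" using ex_mult[OF ex_tw ex_tw, of "v x div 2" "v x div 2"] assms by (auto simp: c_def)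
  then have "ex (x / (c * c)) 0" using ex_divide[OF ex_self[OF assms(1)] c(2)] by simp
  then obtain z s where z: "ex z 0" "ge s 0" "x / (c * c) = z * z * (1 + 2 * s)" using unit_normal by blast
  have "x = (c * c) * (x / (c * c))" using c(1) by simp
  also have "\<dots> = (c * z) * (c * z) * (1 + 2 * s)" unfolding z(3) by (simp only: ac_simps)
  finally have "x = (c * z) * (c * z) * (1 + 2 * s)" .
  then show ?thesis using c(1) z ex_nz by (metis mult_eq_0_iff)
qed

lemma unr_1_plus2: assumes "ge s 1" shows "unr (1 + 2 * s)"
  unfolding unr_def by (rule exI[of _ 1], rule exI[of _ "s / 2"]) (use ge_divide[OF assms, of 2 1] in auto)

text \<open>The product is 1 + 4 r where r is congruent to s' - s modulo 2, so its Artin-Schreier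
  class is trivial. It shows that discriminants of close planes lie in one square class.\<close>

lemma square_close:
  assumes "ge s 0" "ge s' 0" "ge (s - s') 1"
  shows "is_square ((1 + 4 * s) * (1 + 4 * s'))"
proof -
  have "(1 + 4 * s) * (1 + 4 * s') = 1 + 4 * ((s' - s) + 2 * s + 4 * (s * s'))" by (simp add: algebra_simps)
  moreover have g: "ge ((s' - s) + 2 * s + 4 * (s * s')) 1"
    using assms ge_mult'[of 4 2 "s * s'" 0 1] ge_prod0 ge_diff_commute[of s s'] by (intro ge_add) auto
  ultimately show ?thesis using artin_schreier_square[OF ge_mono[OF g] artin_schreier_0[OF g]] by simp
qed


section \<open>Hilbert symbols\<close>


definition is_norm :: "'a \<Rightarrow> 'a \<Rightarrow> bool" where
  "is_norm a b \<longleftrightarrow> (\<exists>x y. b = x * x - a * (y * y))"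

lemma is_normI: "b = x * x - a * (y * y) \<Longrightarrow> is_norm a b" unfolding is_norm_def by blast

lemma is_norm_mult: assumes "is_norm a b" "is_norm a c" shows "is_norm a (b * c)"
proof -
  obtain x y where 1: "b = x * x - a * (y * y)" using assms(1) by (auto simp: is_norm_def)
  obtain x' y' where 2: "c = x' * x' - a * (y' * y')" using assms(2) by (auto simp: is_norm_def)
  show ?thesis unfolding 1 2
    by (rule is_normI[of _ "x * x' + a * (y * y')" _ "x * y' + x' * y"]) (simp add: algebra_simps)
qed

lemma is_norm_sq: "is_norm a (s * s)" by (rule is_normI[of _ s _ 0]) simp

lemma is_norm_cancel: assumes "is_norm a (b * c)" "is_norm a b" "b \<noteq> 0" shows "is_norm a c"
proof -
  have "is_norm a ((b * c) * b * ((1 / b) * (1 / b)))" using is_norm_mult[OF is_norm_mult[OF assms(1,2)] is_norm_sq] .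
  then show ?thesis using assms(3) by simp
qed

lemma is_norm_square: "is_square b \<Longrightarrow> is_norm a b" using is_norm_sq by (auto simp: is_square_def)

lemma hilbertI: fixes a b :: 'a shows "x \<noteq> 0 \<or> y \<noteq> 0 \<or> z \<noteq> 0 \<Longrightarrow> a * x * x + b * y * y = z * z \<Longrightarrow> hilbert a b = 1"
  unfolding hilbert_def by auto

lemma hilbert_square: fixes a b :: 'a assumes "is_square a" shows "hilbert a b = 1"
proof -
  obtain y where "a = y * y" using assms by (auto simp: is_square_def)
  then show ?thesis by (intro hilbertI[of 1 0 y]) auto
qed

lemma hilbert_is_norm: fixes a b :: 'a assumes "\<not> is_square a" shows "hilbert a b = 1 \<longleftrightarrow> is_norm a b"
proof
  assume "hilbert a b = 1"
  then obtain x y z where h: "x \<noteq> 0 \<or> y \<noteq> 0 \<or> z \<noteq> 0" "a * x * x + b * y * y = z * z"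
    unfolding hilbert_def by (auto split: if_splits)
  have y: "y \<noteq> 0"
  proof
    assume y: "y = 0"
    then have e: "a * x * x = z * z" using h by simp
    show False
    proof (cases "x = 0")
      case True then show False using e y h by simp
    next
      case False
      then have "a = (z / x) * (z / x)" using e by (simp add: field_simps)
      then show False using assms unfolding is_square_def by blast
    qed
  qed
  have "b * y * y = z * z - a * x * x" using h(2) by (simp add: algebra_simps)
  then have "b = (z / y) * (z / y) - a * ((x / y) * (x / y))" using y by (simp add: field_simps)
  then show "is_norm a b" by (rule is_normI)
next
  assume "is_norm a b"
  then obtain x y where "b = x * x - a * (y * y)" by (auto simp: is_norm_def)
  then have "a * y * y + b * 1 * 1 = x * x" by (simp add: algebra_simps)
  then show "hilbert a b = 1" unfolding hilbert_def by (metis zero_neq_one)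
qed

lemma hilbert_pm: fixes a b :: 'a shows "hilbert a b = 1 \<or> hilbert a b = -1" by (simp add: hilbert_def)

lemma hilbert_sq_self [simp]: fixes a b :: 'a shows "hilbert a b * hilbert a b = 1" by (simp add: hilbert_def)

lemma hilbert_sym: fixes a b :: 'a shows "hilbert a b = hilbert b a"
proof -
  have "hilbert b a = 1" if h: "hilbert a b = 1" for a b :: 'a
  proof -
    obtain x y z where xyz: "x \<noteq> 0 \<or> y \<noteq> 0 \<or> z \<noteq> 0" "a * x * x + b * y * y = z * z"
      using h unfolding hilbert_def by (auto split: if_splits)
    have "(y \<noteq> 0 \<or> x \<noteq> 0 \<or> z \<noteq> 0) \<and> b * y * y + a * x * x = z * z"
      using xyz by (auto simp: add.commute)
    then show ?thesis unfolding hilbert_def by auto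
  qed
  then show ?thesis using hilbert_pm[of a b] hilbert_pm[of b a] by metis
qed

lemma is_norm_scale: assumes "s \<noteq> 0" shows "is_norm (s * s * a) b \<longleftrightarrow> is_norm a b"
proof
  assume "is_norm (s * s * a) b"
  then obtain x y where "b = x * x - (s * s * a) * (y * y)" by (auto simp: is_norm_def)
  then show "is_norm a b" by (intro is_normI[of _ x _ "s * y"]) (simp add: algebra_simps)
next
  assume "is_norm a b"
  then obtain x y where "b = x * x - a * (y * y)" by (auto simp: is_norm_def)
  then show "is_norm (s * s * a) b" using assms by (intro is_normI[of _ x _ "y / s"]) (simp add: field_simps)
qed

text \<open>With (1 + sqrt(1 + 4 t)) / 2 as second basis element the norm form is x^2 + x y - t y^2.
  Its values at (1, 2 s) and (1, 4 r) approximate the unit modulo 4 and then modulo 8; the remaining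
  factor is a square.\<close>

lemma unit_is_norm_unr: assumes t: "ge t 0" and u: "ex u 0" shows "is_norm (1 + 4 * t) u"
proof -
  have N: "is_norm (1 + 4 * t) (x * x + x * y - t * (y * y))" for x y
  proof (rule is_normI)
    have h: "y = y / 2 + y / 2" by (metis mult_2 nonzero_mult_div_cancel_left times_divide_eq_right two_nz)
    define h where "h = y / 2"
    have y: "y = h + h" unfolding h_def using h by simp
    have "x * x + x * y - t * (y * y) = (x + h) * (x + h) - (1 + 4 * t) * (h * h)"
      unfolding y by (simp add: algebra_simps)
    then show "x * x + x * y - t * (y * y) = (x + y / 2) * (x + y / 2) - (1 + 4 * t) * (y / 2 * (y / 2))"
      by (simp add: h_def)
  qed
  obtain z s where z: "ex z 0" "ge s 0" "u = z * z * (1 + 2 * s)" using unit_normal[OF u] by blast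
  define n1 where "n1 = 1 + 2 * s - 4 * (t * (s * s))"
  have g1: "ge (4 * (t * (s * s))) 1" using t z(2) ge_mult'[of 4 2 "t * (s * s)" 0 1] by (simp add: ge_prod0)
  have n1: "ex n1 0"
  proof -
    have "ex (1 + (2 * s - 4 * (t * (s * s)))) 0" using z(2) g1 by (intro ex_1_plus ge_diff) auto
    then show ?thesis by (simp add: n1_def algebra_simps)
  qed
  \<comment> \<open>This norm agrees with 1 + 2 s modulo 4; the quotient 1 + 4 r is treated in the
    same way with second coordinate 4 r.\<close>
  have nn1: "is_norm (1 + 4 * t) n1" using N[of 1 "2 * s"] by (simp add: n1_def algebra_simps)
  define r where "r = t * (s * s) / n1"
  have r: "ge r 0" unfolding r_def using ge_divide[OF _ n1, of "t * (s * s)" 0] t z(2) by (simp add: ge_prod0)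
  have e1: "1 + 2 * s = n1 * (1 + 4 * r)" using ex_nz[OF n1] by (simp add: r_def n1_def field_simps)
  define n2 where "n2 = 1 + 4 * r - 4 * (4 * (t * (r * r)))"
  have g2: "ge (4 * (t * (r * r))) 1" using t r ge_mult'[of 4 2 "t * (r * r)" 0 1] by (simp add: ge_prod0)
  have n2: "ex n2 0"
  proof -
    have "ge (r - 4 * (t * (r * r))) 0" using r ge_mono[OF g2, of 0] by (intro ge_diff) auto
    then have "ex (1 + 4 * (r - 4 * (t * (r * r)))) 0" by (rule ex_1_plus4)
    then show ?thesis by (simp add: n2_def algebra_simps)
  qed
  have nn2: "is_norm (1 + 4 * t) n2" using N[of 1 "4 * r"] by (simp add: n2_def algebra_simps)
  define w where "w = 4 * (t * (r * r)) / n2"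
  have w: "ge w 1" unfolding w_def using ge_divide[OF g2 n2] by simp
  have e2: "1 + 4 * r = n2 * (1 + 4 * w)" using ex_nz[OF n2] by (simp add: w_def n2_def field_simps)
  have "is_square (1 + 4 * w)" using artin_schreier_square[OF ge_mono[OF w] artin_schreier_0[OF w]] by simp
  then have "is_norm (1 + 4 * t) (1 + 4 * w)" by (rule is_norm_square)
  then have "is_norm (1 + 4 * t) (z * z * (n1 * (n2 * (1 + 4 * w))))" by (intro is_norm_mult nn1 nn2 is_norm_sq)
  then show ?thesis using z(3) e1 e2 by simp
qed

text \<open>If x and y have different orders, one square dominates. If the orders agree,
  cancellation is limited: a cancellation beyond order 2 would exhibit t as an Artin-Schreier value
  modulo 2 and make 1 + 4 t a square.\<close>

lemma is_norm_unr_parity: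
  assumes t: "ge t 0" and ns: "\<not> is_square (1 + 4 * t)" and xy: "x \<noteq> 0 \<or> y \<noteq> 0"
  shows "x * x - (1 + 4 * t) * (y * y) \<noteq> 0 \<and> even (v (x * x - (1 + 4 * t) * (y * y)))"
proof -
  have a: "ex (1 + 4 * t) 0" using t ex_1_plus4 by blast
  have par: "b \<noteq> 0 \<and> even (v b)" if "ex b k" "even k" for b k using that by (auto simp: ex_def)
  show ?thesis
  proof (cases "y = 0")
    case True
    then show ?thesis using xy by (simp add: v_mult)
  next
    case y: False
    have ey: "ex (- ((1 + 4 * t) * (y * y))) (0 + (v y + v y))"
      unfolding ex_uminus using y a by (intro ex_mult ex_self)
    show ?thesis
    proof (cases "x = 0")
      case True
      then show ?thesis using par[OF ey] by simp
    next
      case x: False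
      have ex': "ex (x * x) (v x + v x)" using x by (intro ex_mult ex_self)
      consider "v x < v y" | "v y < v x" | "v x = v y" by linarith
      then show ?thesis
      proof cases
        case 1
        then have "ex (x * x + (- ((1 + 4 * t) * (y * y)))) (v x + v x)"
          using ex' ey by (intro ex_add) (auto intro: ge_mono[OF ex_ge])
        from par[OF this] show ?thesis by simp
      next
        case 2
        then have "ex (- ((1 + 4 * t) * (y * y)) + x * x) (v y + v y)"
          using ex' ey by (intro ex_add) (auto intro: ge_mono[OF ex_ge])
        from par[OF this] show ?thesis by simp
      next
        case 3
        \<comment> \<open>In terms of w the value is y^2 (w^2 + 2 w - 4 t). A unit w makes w^2
          dominate; otherwise w = 2 s and the second factor is -4 (t - (s^2 + s)), four times a
          unit.\<close>
        define w where "w = x / y - 1"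
        have r: "ex (x / y) 0" using ex_divide[OF ex_self[OF x] ex_self[OF y]] 3 by simp
        have w0: "ge w 0" unfolding w_def using r ex_ge by (intro ge_diff) auto
        have xw: "x = y * (1 + w)" using y by (simp add: w_def)
        have e: "x * x - (1 + 4 * t) * (y * y) = (y * y) * (w * w + 2 * w - 4 * t)"
          unfolding xw by (simp add: algebra_simps)
        have eyy: "ex (y * y) (v y + v y)" using y by (intro ex_mult ex_self)
        show ?thesis
        proof (cases "ge w 1")
          case False
          then have "ex (w * w) (0 + 0)" using w0 by (intro ex_mult exI') auto
          moreover have "ge (2 * w - 4 * t) 1" using w0 t by (intro ge_diff) (auto simp: ge_four_mult elim: ge_mono)
          ultimately have "ex (w * w + (2 * w - 4 * t)) 0" using ex_add by fastforce
          then have "ex ((y * y) * (w * w + (2 * w - 4 * t))) (v y + v y + 0)" using eyy ex_mult by blast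
          from par[OF this] show ?thesis unfolding e by (simp add: add_diff_eq)
        next
          case True
          define s where "s = w / 2"
          have s: "ge s 0" "w = 2 * s" using ge_divide[OF True, of 2 1] by (auto simp: s_def)
          have "\<not> ge (t - (s * s + s)) 1" using ns artin_schreier_square[OF t] s(1) by (auto simp: artin_schreier_def)
          moreover have "ge (t - (s * s + s)) 0" using t s by (intro ge_diff ge_add ge_sq)
          ultimately have "ex (t - (s * s + s)) 0" by (intro exI') auto
          then have "ex (4 * (- (t - (s * s + s)))) (2 + 0)" by (intro ex_mult) (auto simp del: minus_diff_eq)
          then have "ex ((y * y) * (4 * (- (t - (s * s + s))))) (v y + v y + (2 + 0))" by (rule ex_mult[OF eyy])
          moreover have "w * w + 2 * w - 4 * t = 4 * (- (t - (s * s + s)))" unfolding s by (simp add: algebra_simps)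
          ultimately show ?thesis unfolding e using par by fastforce
        qed
      qed
    qed
  qed
qed

lemma hilbert_unr:
  assumes a: "unr a" "\<not> is_square a" and b: "b \<noteq> 0"
  shows "hilbert a b = 1 \<longleftrightarrow> even (v b)"
proof -
  obtain s t where st: "s \<noteq> 0" "ge t 0" "a = s * s * (1 + 4 * t)" using a(1) by (auto simp: unr_def)
  have ns: "\<not> is_square (1 + 4 * t)" using a(2) st is_square_mult_sq[of s "1 + 4 * t"] by (simp add: mult.commute)
  have "hilbert a b = 1 \<longleftrightarrow> is_norm (1 + 4 * t) b" using hilbert_is_norm[OF a(2)] is_norm_scale st by simp
  also have "\<dots> \<longleftrightarrow> even (v b)"
  proof
    assume "is_norm (1 + 4 * t) b"
    then obtain x y where xy: "b = x * x - (1 + 4 * t) * (y * y)" by (auto simp: is_norm_def)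
    then have "x \<noteq> 0 \<or> y \<noteq> 0" using b by auto
    then show "even (v b)" using is_norm_unr_parity[OF st(2) ns] xy by simp
  next
    assume "even (v b)"
    then obtain z s where z: "z \<noteq> 0" "ge s 0" "b = z * z * (1 + 2 * s)" using even_normal[OF b] by blast
    have "is_norm (1 + 4 * t) (1 + 2 * s)" using unit_is_norm_unr[OF st(2)] ex_1_plus2 z(2) by blast
    then show "is_norm (1 + 4 * t) b" unfolding z by (intro is_norm_mult is_norm_sq)
  qed
  finally show ?thesis .
qed

lemma hilbert_1_plus4:
  assumes "a \<noteq> 0" "even (v a)" "ge r 0" shows "hilbert a (1 + 4 * r) = 1"
proof -
  have u: "unr (1 + 4 * r)" unfolding unr_def by (rule exI[of _ 1], rule exI[of _ r]) (use assms in auto)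
  show ?thesis
    using hilbert_unr[OF u _ assms(1)] hilbert_square[of "1 + 4 * r" a] assms hilbert_sym[of a "1 + 4 * r"]
    by (cases "is_square (1 + 4 * r)") auto
qed

text \<open>The norm group of a quadratic extension has index at most 2, which is what
  bimultiplicativity of the symbol rests on. In the ramified case a norm of odd order and squares
  reduce every element to some 1 + 2 r; explicit norms then reduce the question to one
  Artin-Schreier class, where \<open>artin_schreier_add_not\<close> applies.\<close>

lemma hilbert_nonnorm:
  fixes a b c :: 'a
  assumes a: "a \<noteq> 0" and b: "b \<noteq> 0" and c: "c \<noteq> 0"
    and hb: "hilbert a b \<noteq> 1" and hc: "hilbert a c \<noteq> 1"
  shows "hilbert a (b * c) = 1"
proof -
  have ns: "\<not> is_square a" using hilbert_square a hb by blast
  have nb: "\<not> is_norm a b" and nc: "\<not> is_norm a c" using hilbert_is_norm[OF ns] hb hc by auto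
  have "is_norm a (b * c)"
  proof (cases "unr a")
    case True
    then show ?thesis using hilbert_unr[OF True ns] hilbert_is_norm[OF ns] b c nb nc by (auto simp: v_mult)
  next
    case nu: False
    \<comment> \<open>Two ingredients: a norm \<open>g\<close> of odd order, and the index bound for
      elements 1 + 2 r.\<close>
    have key: "\<exists>g. g \<noteq> 0 \<and> odd (v g) \<and> is_norm a g \<and>
       (\<forall>r1 r2. ge r1 0 \<longrightarrow> ge r2 0 \<longrightarrow> is_norm a (1 + 2 * r1) \<or> is_norm a (1 + 2 * r2) \<or> is_norm a ((1 + 2 * r1) * (1 + 2 * r2)))"
    proof (cases "odd (v a)")
      case odd: True
      have g: "is_norm a (- a)" by (rule is_normI[of _ 0 _ 1]) simp
      define k where "k = (v a - 1) div 2"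
      have k: "v a = 2 * k + 1" using odd by (auto simp: k_def elim!: oddE)
      define w where "w = a / (tw k * tw k)"
      have ew: "ex w 1" using ex_divide[OF ex_self[OF a] ex_mult[OF ex_tw[of k] ex_tw[of k]]] k by (simp add: w_def)
      have wa: "a = tw k * tw k * w" by (simp add: w_def)
      \<comment> \<open>The element w is a uniformizer in the square class of a. A norm 1 - w y^2
        with suitable y agrees with 1 + 2 r modulo 4.\<close>
      have step: "\<exists>n r'. n \<noteq> 0 \<and> is_norm a n \<and> ge r' 0 \<and> 1 + 2 * r = n * (1 + 4 * r')" if r: "ge r 0" for r
      proof -
        obtain y where y: "ge y 0" "ge (2 * r + y * y * w) (1 + 1)" using sq_approx[OF ew, of "2 * r"] r by auto
        define n where "n = 1 - w * (y * y)"
        have n: "ex n 0"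
        proof -
          have "ge (w * (y * y)) 1" using ew y(1) ex_ge ge_mult'[of w 1 "y * y" 0 1] ge_sq by auto
          then show ?thesis using ex_1_plus[of "- (w * (y * y))"] by (simp add: n_def)
        qed
        have nn: "is_norm a n" unfolding wa using is_norm_scale[of "tw k" w] by (auto intro!: is_normI[of _ 1 _ y] simp: n_def)
        define r' where "r' = (2 * r + y * y * w) / (4 * n)"
        have "ge r' 0" unfolding r'_def using ge_divide[OF y(2) ex_mult[OF _ n, of 4 2]] by simp
        moreover have "1 + 2 * r = n * (1 + 4 * r')"
        proof -
          have "n * (4 * r') = 2 * r + y * y * w" using ex_nz[OF n] by (simp add: r'_def)
          then have "n * (1 + 4 * r') = n + (2 * r + y * y * w)" by (simp only: distrib_left mult_1_right)
          also have "\<dots> = 1 + 2 * r" by (simp add: n_def algebra_simps)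
          finally show ?thesis by simp
        qed
        ultimately show ?thesis using nn ex_nz[OF n] by blast
      qed
      have "is_norm a ((1 + 2 * r1) * (1 + 2 * r2))"
        if r: "ge r1 0" "ge r2 0" "\<not> is_norm a (1 + 2 * r1)" "\<not> is_norm a (1 + 2 * r2)" for r1 r2
      proof -
        obtain n1 s1 where 1: "is_norm a n1" "ge s1 0" "1 + 2 * r1 = n1 * (1 + 4 * s1)" using step[OF r(1)] by blast
        obtain n2 s2 where 2: "is_norm a n2" "ge s2 0" "1 + 2 * r2 = n2 * (1 + 4 * s2)" using step[OF r(2)] by blast
        \<comment> \<open>Otherwise 1 + 4 s1 would be a square and the first factor 1 + 2 r1 a
          norm.\<close>
        have "\<not> artin_schreier s1" using r(3) is_norm_mult[OF 1(1) is_norm_square[OF artin_schreier_square[OF 1(2)]]] unfolding 1(3) by blast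
        moreover have "\<not> artin_schreier s2" using r(4) is_norm_mult[OF 2(1) is_norm_square[OF artin_schreier_square[OF 2(2)]]] unfolding 2(3) by blast
        ultimately have "artin_schreier (s1 + s2)" using artin_schreier_add_not 1 2 by blast
        moreover have g4: "ge (4 * (s1 * s2)) 1" using ge_mult'[of 4 2 "s1 * s2" 0 1] 1 2 ge_prod0 by simp
        moreover have "ge ((s1 + s2) - (s1 + s2 + 4 * (s1 * s2))) 1" using g4 by (simp add: algebra_simps)
        ultimately have "artin_schreier (s1 + s2 + 4 * (s1 * s2))" using artin_schreier_cong by blast
        moreover have "ge (s1 + s2 + 4 * (s1 * s2)) 0" using 1 2 ge_mono[OF g4, of 0] by (intro ge_add) auto
        ultimately have "is_square (1 + 4 * (s1 + s2 + 4 * (s1 * s2)))" using artin_schreier_square by blast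
        then have "is_norm a (n1 * n2 * (1 + 4 * (s1 + s2 + 4 * (s1 * s2))))" using is_norm_mult[OF is_norm_mult[OF 1(1) 2(1)] is_norm_square] by blast
        then show ?thesis unfolding 1(3) 2(3) by (simp add: algebra_simps)
      qed
      then show ?thesis using g odd a by (intro exI[of _ "- a"]) auto
    next
      case even: False
      then obtain s t where st: "s \<noteq> 0" "ge t 0" "a = s * s * (1 + 2 * t)" using even_normal[OF a] by auto
      have t0: "\<not> ge t 1"
      proof
        assume "ge t 1"
        then have "unr (1 + 2 * t)" by (rule unr_1_plus2)
        then have "unr a" unfolding st using unr_mult unr_sq st by blast
        then show False using nu by simp
      qed
      then have et: "ex t 0" using st exI' by simp
      have na: "is_norm a n \<longleftrightarrow> is_norm (1 + 2 * t) n" for n unfolding st(3) using is_norm_scale st by blast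
      \<comment> \<open>Here a is a square times 1 + 2 t with t a unit, and 1 - (1 + 2 t) is a norm
        of order 1.\<close>
      have g: "is_norm a (- 2 * t)" unfolding na by (rule is_normI[of _ 1 _ 1]) simp
      have eg: "ex (- 2 * t) 1" using ex_mult[of "-2" 1 t 0] et by simp
      have step: "is_norm a (1 + 2 * r)" if r: "ge r 0" and as: "artin_schreier (r * t)" for r
      proof -
        obtain s where s: "ge s 0" "ge (r * t - (s * s + s)) 1" using as by (auto simp: artin_schreier_def)
        \<comment> \<open>With this choice y - t y^2 = -(s^2 + s) / t, which is congruent to r
          modulo 2. Hence the norm (1 + y)^2 - (1 + 2 t) y^2 = 1 + 2 (y - t y^2) agrees with 1 + 2 r
          modulo 4.\<close>
        define y where "y = - (s / t)"
        have y: "ge y 0" unfolding y_def using ge_divide[OF s(1) et] by simp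
        define n where "n = 1 + 2 * (y - t * (y * y))"
        have n0: "ge (y - t * (y * y)) 0" using y st by (intro ge_diff ge_prod0 ge_sq)
        have n: "ex n 0" unfolding n_def using ex_1_plus2[OF n0] .
        have nn: "is_norm a n" unfolding na n_def by (rule is_normI[of _ "1 + y" _ y]) (simp add: algebra_simps)
        define r' where "r' = (r - (y - t * (y * y))) / (2 * n)"
        have "ge (r - (y - t * (y * y))) 1"
        proof -
          have "ge (r * t - (s * s + s) + 2 * (s * s + s)) 1" using s by (intro ge_add) (auto intro!: ge_add ge_sq)
          then have "ge ((r * t + (s * s + s)) / t) (1 - 0)" using et by (intro ge_divide) (auto simp: algebra_simps)
          moreover have "(r * t + (s * s + s)) / t = r - (y - t * (y * y))"
            using ex_nz[OF et] by (simp add: y_def field_simps)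
          ultimately show ?thesis by simp
        qed
        then have r': "ge r' 0" unfolding r'_def using ge_divide[OF _ ex_mult[OF _ n, of 2 1]] by fastforce
        have "1 + 2 * r = n * (1 + 4 * r')"
        proof -
          have "n * (4 * r') = 2 * (r - (y - t * (y * y)))"
            using ex_nz[OF n] by (simp add: r'_def field_simps)
          then have "n * (1 + 4 * r') = n + 2 * (r - (y - t * (y * y)))" by (simp only: distrib_left mult_1_right)
          also have "\<dots> = 1 + 2 * r" by (simp add: n_def algebra_simps)
          finally show ?thesis by simp
        qed
        moreover have "is_norm a (1 + 4 * r')" using hilbert_1_plus4[OF a _ r'] even hilbert_is_norm[OF ns] by blast
        ultimately show ?thesis using nn is_norm_mult by simp
      qed
      have "is_norm a ((1 + 2 * r1) * (1 + 2 * r2))"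
        if r: "ge r1 0" "ge r2 0" "\<not> is_norm a (1 + 2 * r1)" "\<not> is_norm a (1 + 2 * r2)" for r1 r2
      proof -
        have "artin_schreier (r1 * t + r2 * t)" using r step st by (intro artin_schreier_add_not ge_prod0) auto
        moreover have "ge (2 * (r1 * r2 * t)) 1" using r st ge_prod0 by simp
        then have "ge ((r1 * t + r2 * t) - (r1 + r2 + 2 * (r1 * r2)) * t) 1"
          using ge_uminus[of "2 * (r1 * r2 * t)" 1] by (simp add: algebra_simps)
        ultimately have "artin_schreier ((r1 + r2 + 2 * (r1 * r2)) * t)" using artin_schreier_cong by blast
        moreover have "ge (r1 + r2 + 2 * (r1 * r2)) 0" using r ge_prod0[of r1 r2] by (intro ge_add) (auto elim: ge_mono)
        ultimately have "is_norm a (1 + 2 * (r1 + r2 + 2 * (r1 * r2)))" using step by blast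
        then show ?thesis by (simp add: algebra_simps)
      qed
      then show ?thesis using g eg by (intro exI[of _ "- 2 * t"]) (auto simp: ex_def)
    qed
    then obtain g where g: "g \<noteq> 0" "odd (v g)" "is_norm a g"
      and two: "\<And>r1 r2. ge r1 0 \<Longrightarrow> ge r2 0 \<Longrightarrow> is_norm a (1 + 2 * r1) \<or> is_norm a (1 + 2 * r2) \<or> is_norm a ((1 + 2 * r1) * (1 + 2 * r2))"
      by blast
    \<comment> \<open>Division by the norm \<open>g\<close> repairs an odd order, and squares are
      norms, so every nonzero element is a norm times some 1 + 2 r.\<close>
    have norm: "\<exists>n r. n \<noteq> 0 \<and> is_norm a n \<and> ge r 0 \<and> x = n * (1 + 2 * r)" if x: "x \<noteq> 0" for x
    proof (cases "even (v x)")
      case True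
      then obtain z s where "z \<noteq> 0" "ge s 0" "x = z * z * (1 + 2 * s)" using even_normal[OF x] by blast
      then show ?thesis using is_norm_sq[of a z] by (metis mult_eq_0_iff)
    next
      case False
      then have "even (v (x / g))" "x / g \<noteq> 0" using g x by (auto simp: v_divide)
      then obtain z s where z: "z \<noteq> 0" "ge s 0" "x / g = z * z * (1 + 2 * s)" using even_normal by blast
      then have "x = (g * (z * z)) * (1 + 2 * s)" using g by (simp add: field_simps)
      then show ?thesis using is_norm_mult[OF g(3) is_norm_sq[of a z]] z g by (metis mult_eq_0_iff)
    qed
    obtain n1 r1 where 1: "n1 \<noteq> 0" "is_norm a n1" "ge r1 0" "b = n1 * (1 + 2 * r1)" using norm[OF b] by blast
    obtain n2 r2 where 2: "n2 \<noteq> 0" "is_norm a n2" "ge r2 0" "c = n2 * (1 + 2 * r2)" using norm[OF c] by blast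
    have "\<not> is_norm a (1 + 2 * r1)" "\<not> is_norm a (1 + 2 * r2)" using nb nc 1 2 is_norm_mult by auto
    then have "is_norm a ((1 + 2 * r1) * (1 + 2 * r2))" using two 1 2 by blast
    then have "is_norm a (n1 * n2 * ((1 + 2 * r1) * (1 + 2 * r2)))" using is_norm_mult[OF is_norm_mult[OF 1(2) 2(2)]] by blast
    then show ?thesis unfolding 1(4) 2(4) by (simp only: ac_simps)
  qed
  then show ?thesis using hilbert_is_norm[OF ns] by blast
qed

lemma hilbert_mult:
  fixes a b c :: 'a
  assumes a: "a \<noteq> 0" and b: "b \<noteq> 0" and c: "c \<noteq> 0"
  shows "hilbert a (b * c) = hilbert a b * hilbert a c"
proof (cases "is_square a")
  case True then show ?thesis using hilbert_square a by simp
next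
  case False
  have N: "hilbert a x = 1 \<longleftrightarrow> is_norm a x" for x using hilbert_is_norm[OF False] .
  have "hilbert a (b * c) = 1" if "hilbert a b = 1" "hilbert a c = 1" using that N is_norm_mult by blast
  moreover have "hilbert a (b * c) \<noteq> 1" if "hilbert a b = 1" "hilbert a c \<noteq> 1" using that N is_norm_cancel b by blast
  moreover have "hilbert a (b * c) \<noteq> 1" if "hilbert a b \<noteq> 1" "hilbert a c = 1"
    using that N is_norm_cancel[of a c b] c by (auto simp: mult.commute)
  moreover have "hilbert a (b * c) = 1" if "hilbert a b \<noteq> 1" "hilbert a c \<noteq> 1" using hilbert_nonnorm a b c that by blast
  ultimately show ?thesis
    using hilbert_pm[of a b] hilbert_pm[of a c] hilbert_pm[of a "b * c"] by auto
qed

lemma hilbert_mult_left: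
  fixes a b c :: 'a shows "a \<noteq> 0 \<Longrightarrow> b \<noteq> 0 \<Longrightarrow> c \<noteq> 0 \<Longrightarrow> hilbert (a * b) c = hilbert a c * hilbert b c"
  using hilbert_mult[of c a b] by (simp add: hilbert_sym[of _ c])

lemma hilbert_square_right: fixes a b :: 'a shows "is_square b \<Longrightarrow> hilbert a b = 1"
  using hilbert_square[of b a] hilbert_sym[of a b] by simp

lemma hilbert_neg: fixes a :: 'a shows "hilbert a (- a) = 1"
  by (rule hilbertI[of 1 1 0]) auto

lemma hilbert_cong:
  fixes a b b' :: 'a
  assumes "a \<noteq> 0" "b \<noteq> 0" "b' \<noteq> 0" "is_square (b * b')"
  shows "hilbert a b = hilbert a b'"
proof -
  have "hilbert a b * hilbert a b' = 1" using hilbert_mult[of a b b'] hilbert_square_right[of "b * b'" a] assms by simp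
  then show ?thesis using hilbert_pm[of a b] hilbert_pm[of a b'] by auto
qed

end

section \<open>Isometries and invariants of diagonal forms\<close>

text \<open>The columns of \<open>P\<close> carry the diagonal form \<open>d\<close> into the diagonal form \<open>e\<close>.\<close>
definition disom :: "'a::field list \<Rightarrow> 'a list \<Rightarrow> bool" where
  "disom d e \<longleftrightarrow> length d = length e \<and> (\<exists>P. \<forall>j<length e. \<forall>k<length e.
     (\<Sum>i<length d. d ! i * (P i j * P i k)) = (if j = k then e ! j else 0))"

lemma disomD:
  assumes "disom d e"
  shows "length e = length d" "\<exists>P. \<forall>j k. j < length d \<longrightarrow> k < length d \<longrightarrow>
    (\<Sum>i<length d. d ! i * (P i j * P i k)) = (if j = k then e ! j else 0)"
proof -
  obtain P where P: "length d = length e" "\<forall>j<length e. \<forall>k<length e.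
     (\<Sum>i<length d. d ! i * (P i j * P i k)) = (if j = k then e ! j else 0)"
    using assms unfolding disom_def by blast
  then show "length e = length d" by simp
  show "\<exists>P. \<forall>j k. j < length d \<longrightarrow> k < length d \<longrightarrow>
    (\<Sum>i<length d. d ! i * (P i j * P i k)) = (if j = k then e ! j else 0)"
    using P by (intro exI[of _ P]) auto
qed

lemma disom_trans: assumes "disom d e" "disom e f" shows "disom d f"
proof -
  let ?n = "length d"
  have n1: "length e = ?n" and n2: "length f = ?n" using disomD(1) assms by metis+
  obtain P where P: "\<And>j k. j < ?n \<Longrightarrow> k < ?n \<Longrightarrow> (\<Sum>i<?n. d ! i * (P i j * P i k)) = (if j = k then e ! j else 0)"
    using disomD(2)[OF assms(1)] by blast
  obtain R where R: "\<And>j k. j < ?n \<Longrightarrow> k < ?n \<Longrightarrow> (\<Sum>i<?n. e ! i * (R i j * R i k)) = (if j = k then f ! j else 0)"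
    using disomD(2)[OF assms(2)] unfolding n1 by blast
  have "(\<Sum>i<?n. d ! i * ((\<Sum>a<?n. P i a * R a j) * (\<Sum>c<?n. P i c * R c k))) = (if j = k then f ! j else 0)"
    if jk: "j < ?n" "k < ?n" for j k
  proof -
    have "(\<Sum>i<?n. d ! i * ((\<Sum>a<?n. P i a * R a j) * (\<Sum>c<?n. P i c * R c k)))
        = (\<Sum>i<?n. \<Sum>a<?n. \<Sum>c<?n. (d ! i * (P i a * P i c)) * (R a j * R c k))"
      by (intro sum.cong[OF refl], subst sum_product, unfold sum_distrib_left, intro sum.cong refl)
         (simp only: ac_simps)
    also have "\<dots> = (\<Sum>a<?n. \<Sum>i<?n. \<Sum>c<?n. (d ! i * (P i a * P i c)) * (R a j * R c k))"
      by (rule sum.swap)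
    also have "\<dots> = (\<Sum>a<?n. \<Sum>c<?n. \<Sum>i<?n. (d ! i * (P i a * P i c)) * (R a j * R c k))"
      by (rule sum.cong[OF refl]) (rule sum.swap)
    also have "\<dots> = (\<Sum>a<?n. \<Sum>c<?n. (if a = c then e ! a else 0) * (R a j * R c k))"
      by (intro sum.cong[OF refl]) (simp add: P[symmetric] sum_distrib_right)
    also have "\<dots> = (\<Sum>a<?n. e ! a * (R a j * R a k))"
    proof (intro sum.cong[OF refl])
      fix a assume a: "a \<in> {..<?n}"
      have "(\<Sum>c<?n. (if a = c then e ! a else 0) * (R a j * R c k))
          = (\<Sum>c<?n. if c = a then e ! a * (R a j * R a k) else 0)" by (intro sum.cong) auto
      then show "(\<Sum>c<?n. (if a = c then e ! a else 0) * (R a j * R c k)) = e ! a * (R a j * R a k)"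
        using a by simp
    qed
    finally show ?thesis using R jk by simp
  qed
  then show ?thesis unfolding disom_def using n2
    by (intro conjI exI[of _ "\<lambda>i j. \<Sum>a<?n. P i a * R a j"]) auto
qed

lemma sum_lessThan_Suc2: "(\<Sum>i<Suc (Suc n). f i) = f 0 + f 1 + (\<Sum>i<n. f (Suc (Suc i)))"
  for f :: "nat \<Rightarrow> 'a::comm_monoid_add"
  by (simp add: sum.lessThan_Suc_shift add.assoc del: sum.lessThan_Suc)

lemma disom_Cons: assumes "disom d e" shows "disom (x # d) (x # e)"
proof -
  have n: "length e = length d" using disomD(1)[OF assms] .
  obtain P where P: "\<And>j k. j < length d \<Longrightarrow> k < length d \<Longrightarrow>
      (\<Sum>i<length d. d ! i * (P i j * P i k)) = (if j = k then e ! j else 0)"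
    using disomD(2)[OF assms] by blast
  let ?P = "\<lambda>i j. case i of 0 \<Rightarrow> (if j = 0 then 1 else 0) | Suc i' \<Rightarrow> (case j of 0 \<Rightarrow> 0 | Suc j' \<Rightarrow> P i' j')"
  show ?thesis unfolding disom_def
    by (intro conjI exI[of _ ?P])
       (auto simp: n sum.lessThan_Suc_shift P less_Suc_eq_0_disj simp del: sum.lessThan_Suc split: if_splits)
qed

text \<open>The vector (-d2 y, d1 x) is orthogonal to (x, y) and has value e d1 d2.\<close>

lemma disom_binary:
  assumes e: "e = d1 * (x * x) + d2 * (y * y)" and nz: "e \<noteq> 0"
  shows "disom (d1 # d2 # ds) (e # (e * d1 * d2) # ds)"
proof -
  let ?P = "\<lambda>i j. if i = 0 \<and> j = 0 then x else if i = 1 \<and> j = 0 then y else if i = 0 \<and> j = 1 then - d2 * y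
      else if i = 1 \<and> j = 1 then d1 * x else if i = j then 1 else (0::'a)"
  show ?thesis unfolding disom_def
  proof (intro conjI exI[of _ ?P] allI impI)
    fix j k assume jk: "j < length (e # (e * d1 * d2) # ds)" "k < length (e # (e * d1 * d2) # ds)"
    let ?S = "\<lambda>j k. \<Sum>i<length ds. ds ! i * (?P (Suc (Suc i)) j * ?P (Suc (Suc i)) k)"
    have S1: "?S j k = 0" if "j < 2 \<or> k < 2" using that by (intro sum.neutral) auto
    have S2: "?S (Suc (Suc j')) (Suc (Suc k')) = (if j' = k' then ds ! j' else 0)"
      if "j' < length ds" for j' k'
    proof -
      have "?S (Suc (Suc j')) (Suc (Suc k')) = (\<Sum>i<length ds. if i = j' then (if j' = k' then ds ! j' else 0) else 0)"
        by (intro sum.cong) auto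
      then show ?thesis using that by simp
    qed
    have "(\<Sum>i<length (d1 # d2 # ds). (d1 # d2 # ds) ! i * (?P i j * ?P i k))
       = d1 * (?P 0 j * ?P 0 k) + d2 * (?P 1 j * ?P 1 k) + ?S j k"
      by (simp only: length_Cons sum_lessThan_Suc2 nth_Cons_0 One_nat_def nth_Cons_Suc)
    also have "\<dots> = (if j = k then (e # (e * d1 * d2) # ds) ! j else 0)"
    proof (cases "j < 2 \<or> k < 2")
      case True
      then consider "j = 0" "k = 0" | "j = 0" "k = 1" | "j = 1" "k = 0" | "j = 1" "k = 1" | "j < 2" "k \<ge> 2" | "k < 2" "j \<ge> 2"
        by linarith
      then show ?thesis
        by cases (use S1 True in \<open>auto simp: e algebra_simps\<close>)
    next
      case False
      define j' k' where "j' = j - 2" and "k' = k - 2"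
      then have j': "j = Suc (Suc j')" and k': "k = Suc (Suc k')" using False by auto
      have "j' < length ds" using jk j' by simp
      from S2[OF this, of k'] show ?thesis unfolding j' k' by simp
    qed
    finally show "(\<Sum>i<length (d1 # d2 # ds). (d1 # d2 # ds) ! i * (?P i j * ?P i k))
       = (if j = k then (e # (e * d1 * d2) # ds) ! j else 0)" .
  qed simp
qed

lemma disom_scale_head:
  assumes "x \<noteq> 0" shows "disom (c # ds) (c * (x * x) # ds)"
proof -
  let ?P = "\<lambda>i j. if i = j then (if i = 0 then x else 1) else (0::'a)"
  show ?thesis unfolding disom_def
  proof (intro conjI exI[of _ ?P] allI impI)
    fix j k assume jk: "j < length (c * (x * x) # ds)" "k < length (c * (x * x) # ds)"
    have "(\<Sum>i<length (c # ds). (c # ds) ! i * (?P i j * ?P i k))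
       = (\<Sum>i<length (c # ds). if i = j then (if j = k then (c * (x * x) # ds) ! j else 0) else 0)"
      by (intro sum.cong refl) (auto simp: nth_Cons')
    then show "(\<Sum>i<length (c # ds). (c # ds) ! i * (?P i j * ?P i k)) = (if j = k then (c * (x * x) # ds) ! j else 0)"
      using jk by simp
  qed simp
qed

lemma witt_cancel:
  assumes "disom (c # d) (c # e)" "c \<noteq> 0" "(2::'a::field) \<noteq> 0"
  shows "disom (d :: 'a list) e"
proof -
  let ?n = "length d"
  have n: "length e = ?n" using disomD(1)[OF assms(1)] by simp
  obtain P where P: "\<And>j k. j < Suc ?n \<Longrightarrow> k < Suc ?n \<Longrightarrow>
      (\<Sum>i<Suc ?n. (c # d) ! i * (P i j * P i k)) = (if j = k then (c # e) ! j else 0)"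
    using disomD(2)[OF assms(1)] unfolding length_Cons by blast
  define s where "s = (\<lambda>j k. \<Sum>i<?n. d ! i * (P (Suc i) j * P (Suc i) k))"
  have S: "s j k = (if j = k then (c # e) ! j else 0) - c * (P 0 j * P 0 k)" if "j < Suc ?n" "k < Suc ?n" for j k
    using P[OF that] by (simp add: sum.lessThan_Suc_shift s_def algebra_simps del: sum.lessThan_Suc)
  \<comment> \<open>Adding \<open>g * P 0 (Suc j)\<close> times column 0 to column
    \<open>Suc j\<close> adds c g^2 P_0j P_0k to the Gram entry and turns the first coordinate into
    \<epsilon> g P_0j, whose contribution is the same. The equation for g needs P_00 different from
    the sign \<epsilon>, which one of the two signs satisfies because 2 is nonzero.\<close>
  have main: "disom d e" if h: "g * (1 - \<epsilon> * P 0 0) = \<epsilon>" "\<epsilon> * \<epsilon> = 1" for g \<epsilon>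
  proof -
    let ?P = "\<lambda>i j. P (Suc i) (Suc j) + g * (P 0 (Suc j) * P (Suc i) 0)"
    have "(\<Sum>i<?n. d ! i * (?P i j * ?P i k)) = (if j = k then e ! j else 0)" if jk: "j < ?n" "k < ?n" for j k
    proof -
      have "(\<Sum>i<?n. d ! i * (?P i j * ?P i k))
         = s (Suc j) (Suc k) + g * P 0 (Suc k) * s (Suc j) 0 + g * P 0 (Suc j) * s 0 (Suc k)
           + g * g * P 0 (Suc j) * P 0 (Suc k) * s 0 0"
        unfolding s_def sum_distrib_left sum.distrib[symmetric] by (intro sum.cong refl) (simp add: algebra_simps)
      also have "\<dots> = (if j = k then e ! j else 0)
         + c * (P 0 (Suc j) * P 0 (Suc k)) * (g * g - (1 + g * P 0 0) * (1 + g * P 0 0))"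
        using jk by (simp add: S algebra_simps)
      also have "g * g - (1 + g * P 0 0) * (1 + g * P 0 0) = 0"
      proof -
        have "1 + g * P 0 0 = \<epsilon> * g"
        proof -
          have "\<epsilon> * (g * (1 - \<epsilon> * P 0 0)) = 1" using h by simp
          then have "\<epsilon> * g - (\<epsilon> * \<epsilon>) * (g * P 0 0) = 1" by (simp add: algebra_simps)
          then show ?thesis using h(2) by (simp add: algebra_simps)
        qed
        then have "(1 + g * P 0 0) * (1 + g * P 0 0) = (\<epsilon> * \<epsilon>) * (g * g)" by (simp only: ac_simps)
        then show ?thesis using h(2) by simp
      qed
      finally show ?thesis by simp
    qed
    then show ?thesis unfolding disom_def using n by (intro conjI exI[of _ ?P]) auto
  qed
  show ?thesis
  proof (cases "P 0 0 = 1")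
    case False
    then show ?thesis by (intro main[of "1 / (1 - P 0 0)" 1]) auto
  next
    case True
    then show ?thesis using assms(3) by (intro main[of "- (1 / 2)" "-1"]) auto
  qed
qed

lemma prod_list_nz: "prod_list d \<noteq> 0 \<longleftrightarrow> (\<forall>x\<in>set d. x \<noteq> (0::'a::field))"
  by (induction d) auto

section \<open>Hasse and Clifford invariants of diagonal forms\<close>

context dyadic
begin

text \<open>The Hasse invariant of a diagonal form.\<close>
fun hs :: "'a list \<Rightarrow> int" where
  "hs [] = 1" | "hs (x # d) = hilbert x (prod_list d) * hs d"

text \<open>Merging the entries into e one at a time uses only \<open>disom_binary\<close> and
  scaling by squares, and these steps visibly preserve the discriminant class and \<open>hs\<close>.
  The lemma is the inductive step of the invariance theorem.\<close>

lemma represent: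
  fixes d :: "'a list"
  assumes "\<forall>x\<in>set d. x \<noteq> 0" "e = (\<Sum>i<length d. d ! i * (x i * x i))" "e \<noteq> 0"
  shows "\<exists>d'. disom d (e # d') \<and> (\<forall>y\<in>set d'. y \<noteq> 0) \<and> is_square (prod_list d * prod_list (e # d'))
     \<and> hs d = hs (e # d')"
  using assms
proof (induction d arbitrary: x e)
  case (Cons c d)
  define t where "t = (\<Sum>i<length d. d ! i * (x (Suc i) * x (Suc i)))"
  have e: "e = c * (x 0 * x 0) + t" using Cons.prems(2) by (simp add: t_def sum.lessThan_Suc_shift del: sum.lessThan_Suc)
  have c: "c \<noteq> 0" and d: "\<forall>y\<in>set d. y \<noteq> 0" using Cons.prems by auto
  have pd: "prod_list d \<noteq> 0" using d prod_list_nz by blast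
  show ?case
  proof (cases "t = 0")
    case True
    then have x0: "x 0 \<noteq> 0" using e Cons.prems(3) by auto
    have et: "e = c * (x 0 * x 0)" using e True by simp
    have "hilbert c (prod_list d) = hilbert e (prod_list d)"
      using hilbert_cong[of "prod_list d" c e] pd c Cons.prems(3) et is_square_mult[of "c * c" "x 0 * x 0"]
      by (simp add: hilbert_sym[of _ "prod_list d"] ac_simps)
    moreover have "is_square (prod_list (c # d) * prod_list (e # d))"
      using is_square_sq[of "c * x 0 * prod_list d"] by (simp add: et ac_simps)
    ultimately show ?thesis using disom_scale_head[OF x0, of c d] d et by (intro exI[of _ d]) auto
  next
    case False
    obtain d' where d': "disom d (t # d')" "\<forall>y\<in>set d'. y \<noteq> 0" "is_square (prod_list d * prod_list (t # d'))" "hs d = hs (t # d')"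
      using Cons.IH[OF d, of t "\<lambda>i. x (Suc i)"] t_def False by auto
    have p': "prod_list d' \<noteq> 0" using d'(2) prod_list_nz by blast
    let ?f = "e * c * t"
    have "disom (c # d) (c # t # d')" using d'(1) by (rule disom_Cons)
    moreover have "disom (c # t # d') (e # ?f # d')" using e Cons.prems(3) by (intro disom_binary[of e c "x 0" t 1]) auto
    ultimately have 1: "disom (c # d) (e # ?f # d')" by (rule disom_trans)
    have 2: "\<forall>y\<in>set (?f # d'). y \<noteq> 0" using d'(2) Cons.prems(3) c False by auto
    have 3: "is_square (prod_list (c # d) * prod_list (e # ?f # d'))"
    proof -
      have "prod_list (c # d) * prod_list (e # ?f # d') = (prod_list d * prod_list (t # d')) * ((c * e) * (c * e))"
        by (simp add: ac_simps)
      then show ?thesis using d'(3) is_square_mult is_square_sq by metis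
    qed
    have 4: "hs (c # d) = hs (e # ?f # d')"
    proof -
      have b: "hilbert c t = hilbert e ?f"
      proof -
        \<comment> \<open>Multiply e = c x^2 + t by e. Expanding this symbol gives equality of the
          symbols of the old and the new binary form.\<close>
        have "hilbert (c * e) (t * e) = 1"
          by (rule hilbertI[of "x 0" 1 e]) (use Cons.prems(3) in \<open>auto simp: e algebra_simps\<close>)
        then have "hilbert c t * hilbert c e * (hilbert e t * hilbert e e) = 1"
          using c False Cons.prems(3) by (simp add: hilbert_mult hilbert_mult_left ac_simps)
        moreover have "hilbert e ?f = hilbert e e * hilbert c e * hilbert e t"
          using c False Cons.prems(3) by (simp add: hilbert_mult hilbert_sym[of c e])
        ultimately have "hilbert c t * hilbert e ?f = 1" by (simp add: ac_simps)
        then show ?thesis using hilbert_pm[of c t] hilbert_pm[of e ?f] by auto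
      qed
      have "hilbert c (prod_list d) = hilbert c (t * prod_list d')"
        using hilbert_cong[OF c pd _ ] d'(3) False p' by simp
      then have "hs (c # d) = hilbert c t * hilbert c (prod_list d') * (hilbert t (prod_list d') * hs d')"
        using d'(4) c False p' by (simp add: hilbert_mult)
      moreover have "hs (e # ?f # d') = hilbert c t * hilbert c (prod_list d') * (hilbert t (prod_list d') * hs d')"
      proof -
        have "hilbert e (prod_list (?f # d')) = hilbert e ?f * hilbert e (prod_list d')"
          using c False p' Cons.prems(3) hilbert_mult[of e ?f "prod_list d'"] by simp
        moreover have "hilbert ?f (prod_list d') = hilbert e (prod_list d') * hilbert c (prod_list d') * hilbert t (prod_list d')"
          using c False p' Cons.prems(3) by (simp add: hilbert_mult_left)
        ultimately have "hs (e # ?f # d') = (hilbert e ?f * hilbert e (prod_list d'))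
            * ((hilbert e (prod_list d') * hilbert c (prod_list d') * hilbert t (prod_list d')) * hs d')"
          by (simp only: hs.simps)
        also have "\<dots> = hilbert e ?f * hilbert c (prod_list d') * (hilbert t (prod_list d') * hs d')
            * (hilbert e (prod_list d') * hilbert e (prod_list d'))" by (simp only: ac_simps)
        finally show ?thesis using b by simp
      qed
      ultimately show ?thesis by (simp only:)
    qed
    show ?thesis using 1 2 3 4 by blast
  qed
qed auto

text \<open>The head of e is a value of d, so \<open>represent\<close> moves it to the front of d
  without changing the invariants; Witt cancellation then leaves the tails to the induction.\<close>

theorem hasse_invariant:
  fixes d :: "'a list"
  assumes "disom d e" "\<forall>x\<in>set d. x \<noteq> 0" "\<forall>x\<in>set e. x \<noteq> 0"
  shows "hs d = hs e \<and> is_square (prod_list d * prod_list e)"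
  using assms
proof (induction e arbitrary: d)
  case Nil
  then show ?case using is_square_sq[of 1] by (auto simp: disom_def)
next
  case (Cons c e)
  have n: "length d = Suc (length e)" using disomD(1)[OF Cons.prems(1)] by simp
  obtain P where P: "\<And>j k. j < length d \<Longrightarrow> k < length d \<Longrightarrow>
      (\<Sum>i<length d. d ! i * (P i j * P i k)) = (if j = k then (c # e) ! j else 0)"
    using disomD(2)[OF Cons.prems(1)] by blast
  have c: "c \<noteq> 0" "c = (\<Sum>i<length d. d ! i * (P i 0 * P i 0))" using Cons.prems(3) P[of 0 0] n by auto
  obtain d' where d': "disom d (c # d')" "\<forall>y\<in>set d'. y \<noteq> 0" "is_square (prod_list d * prod_list (c # d'))" "hs d = hs (c # d')"
    using represent[OF Cons.prems(2) c(2,1)] by blast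
  have n2: "length d' = length e" using disomD(1)[OF d'(1)] n by simp
  obtain R where R: "\<And>j k. j < length d \<Longrightarrow> k < length d \<Longrightarrow>
      (\<Sum>i<length d. d ! i * (R i j * R i k)) = (if j = k then (c # d') ! j else 0)"
    using disomD(2)[OF d'(1)] by blast
  \<comment> \<open>Isometries are given one way only, so this one has to be inverted: from R^T d R
    = d' the inverse of R is (d')^-1 R^T d.\<close>
  have "disom (c # d') d"
    unfolding disom_def
  proof (intro conjI)
    show "length (c # d') = length d" using n n2 by simp
    let ?P = "\<lambda>i j. d ! j * R j i / (c # d') ! i"
    let ?m = "length d"
    have nz: "(c # d') ! i \<noteq> 0" if "i < ?m" for i using that n n2 c(1) d'(2)
      by (cases i) auto
    have dnz: "d ! i \<noteq> 0" if "i < ?m" for i using that Cons.prems(2) by auto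
    define M where "M = mat ?m ?m (\<lambda>(i, j). R i j)"
    define M' where "M' = mat ?m ?m (\<lambda>(j, i). R i j * d ! i / (c # d') ! j)"
    have car: "M \<in> carrier_mat ?m ?m" "M' \<in> carrier_mat ?m ?m" by (auto simp: M_def M'_def)
    have "M' * M = 1\<^sub>m ?m"
    proof (rule eq_matI)
      fix i j assume ij: "i < dim_row (1\<^sub>m ?m :: 'a mat)" "j < dim_col (1\<^sub>m ?m :: 'a mat)"
      then have "(M' * M) $$ (i, j) = (\<Sum>k<?m. R k i * d ! k / (c # d') ! i * R k j)"
        by (simp add: M_def M'_def scalar_prod_def lessThan_atLeast0)
      also have "\<dots> = (\<Sum>k<?m. d ! k * (R k i * R k j)) / (c # d') ! i"
        by (simp add: sum_divide_distrib ac_simps)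
      also have "\<dots> = (if i = j then 1 else 0)" using R[of i j] ij n nz by simp
      finally show "(M' * M) $$ (i, j) = 1\<^sub>m ?m $$ (i, j)" using ij by simp
    qed (auto simp: car M_def M'_def)
    then have MM: "M * M' = 1\<^sub>m ?m" using mat_mult_left_right_inverse[OF car(2,1)] by blast
    have "(\<Sum>i<length (c # d'). (c # d') ! i * (?P i j * ?P i k)) = (if j = k then d ! j else 0)"
      if jk: "j < ?m" "k < ?m" for j k
    proof -
      have "(\<Sum>i<length (c # d'). (c # d') ! i * (?P i j * ?P i k)) = (\<Sum>i<?m. (c # d') ! i * (?P i j * ?P i k))"
        using n n2 by simp
      also have "\<dots> = d ! j * (\<Sum>i<?m. R j i * (R k i * d ! k / (c # d') ! i))"
        unfolding sum_distrib_left by (intro sum.cong refl) (use nz in \<open>simp add: field_simps\<close>)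
      also have "(\<Sum>i<?m. R j i * (R k i * d ! k / (c # d') ! i)) = (M * M') $$ (j, k)"
        using jk by (simp add: M_def M'_def scalar_prod_def lessThan_atLeast0)
      finally show ?thesis using jk by (simp add: MM)
    qed
    then show "\<exists>P. \<forall>j<length d. \<forall>k<length d. (\<Sum>i<length (c # d'). (c # d') ! i * (P i j * P i k)) = (if j = k then d ! j else 0)"
      by (intro exI[of _ ?P]) blast
  qed
  then have "disom (c # d') (c # e)" by (rule disom_trans[OF _ Cons.prems(1)])
  then have "disom d' e" by (rule witt_cancel[OF _ c(1) two_nz])
  then have IH: "hs d' = hs e \<and> is_square (prod_list d' * prod_list e)" using Cons d'(2) by auto
  have nz: "prod_list d' \<noteq> 0" "prod_list e \<noteq> 0" "prod_list d \<noteq> 0" using d'(2) Cons.prems prod_list_nz by auto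
  have "hs d = hs (c # e)" using d'(4) IH hilbert_cong[OF c(1) nz(1,2)] by simp
  moreover have "is_square (prod_list d * prod_list (c # e))"
  proof -
    have "is_square (prod_list d * prod_list (c # d') * (prod_list d' * prod_list e))" using is_square_mult[OF d'(3)] IH by blast
    then have "is_square ((prod_list d * prod_list (c # e)) * (prod_list d' * prod_list d'))" by (simp add: ac_simps)
    then show ?thesis using is_square_mult_sq nz(1) by blast
  qed
  ultimately show ?case by blast
qed

lemma hs_prod: assumes "\<forall>x\<in>set d. x \<noteq> 0"
  shows "(\<Prod>i<length d. \<Prod>j\<in>{i<..<length d}. hilbert (d ! i) (d ! j)) = hs d"
  using assms
proof (induction d)
  case (Cons x d)
  have x: "x \<noteq> 0" using Cons.prems by simp
  have h: "(\<Prod>j<length d. hilbert x (d ! j)) = hilbert x (prod_list d)" if "\<forall>x\<in>set d. x \<noteq> 0" for d :: "'a list"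
    using that
  proof (induction d)
    case Nil
    then show ?case using hilbert_square_right[of 1 x] is_square_sq[of "1::'a"] by simp
  next
    case (Cons y d)
    then have "prod_list d \<noteq> 0" using prod_list_nz by auto
    then show ?case using Cons x by (simp add: prod.lessThan_Suc_shift hilbert_mult del: prod.lessThan_Suc)
  qed
  have "(\<Prod>j\<in>{0<..<Suc (length d)}. hilbert x ((x # d) ! j)) = (\<Prod>j<length d. hilbert x (d ! j))"
    by (rule prod.reindex_bij_witness[of _ Suc "\<lambda>j. j - 1"]) (auto simp: nth_Cons')
  moreover have "(\<Prod>j\<in>{Suc i<..<Suc (length d)}. hilbert (d ! i) ((x # d) ! j)) = (\<Prod>j\<in>{i<..<length d}. hilbert (d ! i) (d ! j))" for i
    by (rule prod.reindex_bij_witness[of _ Suc "\<lambda>j. j - 1"]) (auto simp: nth_Cons')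
  ultimately show ?case using Cons h[of d] by (simp add: prod.lessThan_Suc_shift del: prod.lessThan_Suc)
qed simp

definition etad :: "'a list \<Rightarrow> int" where "etad d = eta_of_diag d (prod_list d)"

lemma eta_of_diag_hs:
  assumes "\<forall>x\<in>set d. x \<noteq> 0"
  shows "eta_of_diag d dt = hilbert (-1::'a) (-1) ^ ((length d + 1) div 4) * hilbert (-1) dt ^ ((length d - 1) div 2) * hs d"
  using hs_prod[OF assms] by (simp add: eta_of_diag_def Let_def)

lemma etad_step:
  assumes d: "\<forall>x\<in>set d. x \<noteq> 0" and odd: "odd (length d)" and t: "t \<noteq> 0" and D: "unr D"
  shows "etad (t # (- t * D) # d) = etad d * hilbert D (t * prod_list d)"
proof -
  have Dnz: "D \<noteq> 0" using D unr_nz by blast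
  have pd: "prod_list d \<noteq> 0" using d prod_list_nz by blast
  obtain m where m: "length d = 2 * m + 1" using odd by (auto elim: oddE)
  have D1: "hilbert (-1) D = 1"
    using hilbert_unr[OF D, of "-1"] hilbert_square[of D "-1"] hilbert_sym[of D "-1"] by (cases "is_square D") auto
  let ?p = "prod_list d" let ?h = "hilbert (-1::'a)"
  have h1: "hilbert t (- t * D * ?p) = hilbert t D * hilbert t ?p"
  proof -
    have "hilbert t (- t * (D * ?p)) = hilbert t (- t) * hilbert t (D * ?p)" using t Dnz pd by (intro hilbert_mult) auto
    then show ?thesis using t Dnz pd hilbert_neg[of t] by (simp add: hilbert_mult mult.assoc)
  qed
  have h2: "hilbert (- t * D) ?p = ?h ?p * hilbert t ?p * hilbert D ?p"
    using t Dnz pd hilbert_mult_left[of "-1" "t * D" ?p] by (simp add: hilbert_mult_left ac_simps)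
  have h3: "?h (t * (- t * D) * ?p) = ?h (-1) * ?h ?p"
  proof -
    have "?h (t * (- t * D) * ?p) = ?h ((-1) * (D * ?p))"
    proof (rule hilbert_cong)
      have "t * (- t * D) * ?p * (- 1 * (D * ?p)) = (t * D * ?p) * (t * D * ?p)" by (simp add: ac_simps)
      then show "is_square (t * (- t * D) * ?p * (- 1 * (D * ?p)))" using is_square_sq by metis
    qed (use t Dnz pd in auto)
    also have "\<dots> = ?h (-1) * (?h D * ?h ?p)" using Dnz pd by (simp only: hilbert_mult mult_eq_0_iff neg_equal_0_iff_equal one_neq_zero simp_thms)
    finally show ?thesis using D1 by simp
  qed
  have h4: "hilbert D (t * ?p) = hilbert t D * hilbert D ?p" using Dnz t pd by (simp add: hilbert_mult hilbert_sym)
  have sq: "hilbert x y * (hilbert x y * z) = z" for x y :: 'a and z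
    using hilbert_sq_self[of x y] by (metis mult.assoc mult_1)
  let ?a = "(2 * m + 2) div 4" and ?b = "(2 * m + 4) div 4"
  \<comment> \<open>The exponent [(n + 1) / 4] grows with n = 2 m + 1 according to the parity of m,
    and this parity matches the sign produced by the other exponent.\<close>
  have par: "?h (-1) ^ ?b * ?h (-1) ^ Suc m = ?h (-1) ^ ?a"
  proof (cases "even m")
    case True then obtain q where q: "m = 2 * q" by (auto elim: evenE)
    have "?b = Suc q" "?a = q" using q by auto
    then show ?thesis using hilbert_pm[of "-1" "-1"] q by (auto simp: power_mult)
  next
    case False then obtain q where q: "m = 2 * q + 1" by (auto elim: oddE)
    have "?b = Suc q" "?a = Suc q" using q by auto
    then show ?thesis using hilbert_pm[of "-1" "-1"] q by (auto simp: power_mult)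
  qed
  have "etad (t # (- t * D) # d) = ?h (-1) ^ ?b * (?h (-1) * ?h ?p) ^ Suc m
      * ((hilbert t D * hilbert t ?p) * ((?h ?p * hilbert t ?p * hilbert D ?p) * hs d))"
    unfolding etad_def using t Dnz d m h1 h2 h3
    by (subst eta_of_diag_hs) (auto simp: mult.assoc)
  also have "\<dots> = (?h (-1) ^ ?b * ?h (-1) ^ Suc m) * (?h ?p ^ m * hs d) * (hilbert t D * hilbert D ?p)"
    by (simp add: power_mult_distrib ac_simps sq)
  also have "\<dots> = etad d * hilbert D (t * ?p)"
    unfolding etad_def par h4 using d m by (subst eta_of_diag_hs) (auto simp: ac_simps)
  finally show ?thesis .
qed

end

section \<open>Families of vectors with levels\<close>

text \<open>The ceiling of \<open>t / 2\<close>.\<close>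
definition hc :: "int \<Rightarrow> int" where "hc t = (t + 1) div 2"

lemma hc_bounds: "t \<le> 2 * hc t" "2 * hc t \<le> t + 1" by (auto simp: hc_def)
lemma hc_le_iff: "hc t \<le> k \<longleftrightarrow> t \<le> 2 * k" by (auto simp: hc_def)
lemma hc_double [simp]: "hc (2 * t) = t" "hc (t + t) = t" by (auto simp: hc_def)
lemma hc_add_double: "hc (t + 2 * k) = hc t + k" by (auto simp: hc_def)
lemma hc_odd: "odd t \<Longrightarrow> hc (t + 1) = hc t" by (auto simp: hc_def elim!: oddE)
lemma hc_mono: "s \<le> t \<Longrightarrow> hc s \<le> hc t" by (auto simp: hc_def)

text \<open>The vectors form a space over F, not a lattice: integrality is carried by orders of
  coefficients. The same lemmas then serve families that do not span a fixed lattice, such as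
  truncations and projections.\<close>

locale qspace = dyadic v for v :: "'a::field \<Rightarrow> int" +
  fixes b :: "'b::ab_group_add \<Rightarrow> 'b \<Rightarrow> 'a" and sc :: "'a \<Rightarrow> 'b \<Rightarrow> 'b"
  assumes b_sym: "b x y = b y x"
    and b_add: "b (x + y) z = b x z + b y z"
    and b_sc: "b (sc c x) z = c * b x z"
    and sc_add: "sc (c + d) x = sc c x + sc d x"
    and sc_add_right: "sc c (x + y) = sc c x + sc c y"
    and sc_sc: "sc c (sc d x) = sc (c * d) x"
    and sc_one: "sc 1 x = x"
begin

text \<open>The polar form of \<open>q\<close>. A half-integral matrix bounds twice its off-diagonal
  entries, so orders are always imposed on \<open>bb\<close> and not on \<open>b\<close>.\<close>

definition bb :: "'b \<Rightarrow> 'b \<Rightarrow> 'a" where "bb x y = 2 * b x y"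
definition q :: "'b \<Rightarrow> 'a" where "q x = b x x"

lemma sc_zero [simp]: "sc 0 x = 0" using sc_add[of 0 0 x] by simp
lemma sc_zero_right [simp]: "sc c 0 = 0" using sc_add_right[of c 0 0] by simp
lemma sc_minus: "sc (- c) x = - sc c x" using sc_add[of c "- c" x] by (simp add: eq_neg_iff_add_eq_0 add.commute)

lemma b_add2: "b z (x + y) = b z x + b z y" using b_add[of x y z] b_sym by simp
lemma b_sc2: "b z (sc c x) = c * b z x" using b_sc b_sym by metis
lemma b_zero [simp]: "b 0 z = 0" "b z 0 = 0" using b_sc[of 0 0 z] b_sc2[of z 0 0] by auto
lemma b_minus: "b (- x) z = - b x z" using b_add[of x "- x" z] by (simp add: eq_neg_iff_add_eq_0 add.commute)
lemma b_diff: "b (x - y) z = b x z - b y z" using b_add[of x "- y" z] b_minus by simp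
lemma b_diff2: "b z (x - y) = b z x - b z y" using b_diff b_sym by metis

lemma bb_sym: "bb x y = bb y x" using b_sym by (simp add: bb_def)
lemma bb_add: "bb (x + y) z = bb x z + bb y z" by (simp add: bb_def b_add distrib_left)
lemma bb_add2: "bb z (x + y) = bb z x + bb z y" by (simp add: bb_def b_add2 distrib_left)
lemma bb_diff: "bb (x - y) z = bb x z - bb y z" by (simp add: bb_def b_diff right_diff_distrib)
lemma bb_diff2: "bb z (x - y) = bb z x - bb z y" by (simp add: bb_def b_diff2 right_diff_distrib)
lemma bb_sc: "bb (sc c x) z = c * bb x z" by (simp add: bb_def b_sc)
lemma bb_sc2: "bb z (sc c x) = c * bb z x" by (simp add: bb_def b_sc2)
lemma bb_zero [simp]: "bb 0 z = 0" "bb z 0 = 0" by (auto simp: bb_def)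
lemma bb_self: "bb x x = 2 * q x" by (simp add: bb_def q_def)
lemma q_add: "q (x + y) = q x + q y + bb x y"
  by (simp add: q_def bb_def b_add b_add2 b_sym[of y x])
lemma q_sc: "q (sc c x) = c * c * q x" by (simp add: q_def b_sc b_sc2 ac_simps)
lemma q_diff: "q (x - y) = q x + q y - bb x y"
  by (simp add: q_def bb_def b_diff b_diff2 b_sym[of y x])
lemma q_zero [simp]: "q 0 = 0" by (simp add: q_def)

definition lc :: "nat set \<Rightarrow> (nat \<Rightarrow> 'a) \<Rightarrow> (nat \<Rightarrow> 'b) \<Rightarrow> 'b" where
  "lc S x e = (\<Sum>k\<in>S. sc (x k) (e k))"

lemma b_sum: "b (sum f I) z = (\<Sum>i\<in>I. b (f i) z)"
  by (induction I rule: infinite_finite_induct) (auto simp: b_add)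
lemma b_lc: "b (lc S x e) z = (\<Sum>k\<in>S. x k * b (e k) z)" by (simp add: lc_def b_sum b_sc)
lemma bb_lc: "bb (lc S x e) z = (\<Sum>k\<in>S. x k * bb (e k) z)"
  unfolding bb_def b_lc sum_distrib_left by (intro sum.cong) auto
lemma bb_lc2: "bb z (lc S x e) = (\<Sum>k\<in>S. x k * bb z (e k))"
  using bb_lc[of S x e z] by (simp add: bb_sym[of z])

lemma lc_add: "lc S (\<lambda>k. x k + y k) e = lc S x e + lc S y e"
  by (simp add: lc_def sc_add sum.distrib)
lemma sc_sum: "sc c (sum f I) = (\<Sum>i\<in>I. sc c (f i))"
  by (induction I rule: infinite_finite_induct) (auto simp: sc_add_right)
lemma lc_scale: "lc S (\<lambda>k. c * x k) e = sc c (lc S x e)"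
  by (simp add: lc_def sc_sc sc_sum)
lemma lc_diff: "lc S (\<lambda>k. x k - y k) e = lc S x e - lc S y e"
proof -
  have "lc S x e = lc S (\<lambda>k. x k - y k) e + lc S y e" by (simp add: lc_add[symmetric])
  then show ?thesis by simp
qed
lemma lc_cong: "(\<And>k. k \<in> S \<Longrightarrow> x k = x' k) \<Longrightarrow> (\<And>k. k \<in> S \<Longrightarrow> e k = e' k) \<Longrightarrow> lc S x e = lc S x' e'"
  by (auto simp: lc_def intro!: sum.cong)
lemma lc_insert: "finite S \<Longrightarrow> m \<notin> S \<Longrightarrow> lc (insert m S) x e = sc (x m) (e m) + lc S x e"
  by (simp add: lc_def)
lemma lc_upd: "m \<notin> S \<Longrightarrow> lc S x (e(m := n)) = lc S x e" "m \<notin> S \<Longrightarrow> lc S (x(m := c)) e = lc S x e"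
  by (auto intro: lc_cong)
lemma lc_zero: "lc S (\<lambda>k. 0) e = 0" by (simp add: lc_def)

text \<open>Let \<open>e\<close> be a family of vectors with levels \<open>a\<close> satisfying the inequalities that define \<open>S(B)\<close>. The coefficient vectors
  with \<open>cA S a t\<close> form a decreasing filtration in \<open>t\<close> on which \<open>q\<close> takes values of order at least \<open>t\<close>, so each
  graded piece carries a quadratic form over the residue field. Its polar form is nondegenerate iff \<open>nondeg\<close> holds, and
  \<open>semireg\<close> says that the quadratic form does not vanish on a nonzero vector of the radical.\<close>
definition aint :: "nat set \<Rightarrow> (nat \<Rightarrow> 'b) \<Rightarrow> (nat \<Rightarrow> int) \<Rightarrow> bool" where
  "aint S e a \<longleftrightarrow> (\<forall>k\<in>S. ge (q (e k)) (a k)) \<and> (\<forall>j\<in>S. \<forall>k\<in>S. ge (bb (e j) (e k)) (hc (a j + a k)))"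

definition cA :: "nat set \<Rightarrow> (nat \<Rightarrow> int) \<Rightarrow> int \<Rightarrow> (nat \<Rightarrow> 'a) \<Rightarrow> bool" where
  "cA S a t x \<longleftrightarrow> (\<forall>k\<in>S. ge (x k) (hc (t - a k)))"

text \<open>The bound on pairings that every combination in filtration step s satisfies
  (\<open>aint_lev\<close>). A vector of step t that satisfies it already at t + 1 represents a
  radical vector of the graded polar form.\<close>

definition lev :: "nat set \<Rightarrow> (nat \<Rightarrow> 'b) \<Rightarrow> (nat \<Rightarrow> int) \<Rightarrow> int \<Rightarrow> 'b \<Rightarrow> bool" where
  "lev S e a s u \<longleftrightarrow> (\<forall>k\<in>S. ge (bb u (e k)) (hc (s + a k)))"

definition semireg :: "nat set \<Rightarrow> (nat \<Rightarrow> 'b) \<Rightarrow> (nat \<Rightarrow> int) \<Rightarrow> int \<Rightarrow> bool" where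
  "semireg S e a t \<longleftrightarrow> (\<forall>x. cA S a t x \<longrightarrow> lev S e a (t + 1) (lc S x e) \<longrightarrow>
     ge (q (lc S x e)) (t + 1) \<longrightarrow> cA S a (t + 1) x)"

definition nondeg :: "nat set \<Rightarrow> (nat \<Rightarrow> 'b) \<Rightarrow> (nat \<Rightarrow> int) \<Rightarrow> int \<Rightarrow> bool" where
  "nondeg S e a t \<longleftrightarrow> (\<forall>x. cA S a t x \<longrightarrow> lev S e a (t + 1) (lc S x e) \<longrightarrow> cA S a (t + 1) x)"

lemma nondeg_semireg: "nondeg S e a t \<Longrightarrow> semireg S e a t" by (auto simp: nondeg_def semireg_def)

lemma ge_mult_hc: "ge x (hc s) \<Longrightarrow> ge y (hc t) \<Longrightarrow> r \<le> s + t \<Longrightarrow> ge (x * y) (hc r)"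
  by (rule ge_mult', assumption, assumption) (use hc_bounds[of s] hc_bounds[of t] in \<open>auto simp: hc_le_iff\<close>)

lemma cA_mono: "cA S a t x \<Longrightarrow> s \<le> t \<Longrightarrow> cA S a s x"
  unfolding cA_def by (meson ge_mono hc_mono diff_right_mono)
lemma cA_add: "cA S a t x \<Longrightarrow> cA S a t y \<Longrightarrow> cA S a t (\<lambda>k. x k + y k)" by (auto simp: cA_def intro: ge_add)
lemma cA_diff: "cA S a t x \<Longrightarrow> cA S a t y \<Longrightarrow> cA S a t (\<lambda>k. x k - y k)" by (auto simp: cA_def intro: ge_diff)
lemma cA_scale: "cA S a t x \<Longrightarrow> ge c k \<Longrightarrow> cA S a (t + 2 * k) (\<lambda>i. c * x i)"
  unfolding cA_def by (auto intro!: ge_mult' simp: hc_add_double[symmetric] hc_le_iff diff_add_eq[symmetric])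
     (metis add.commute add_diff_eq hc_add_double hc_bounds(1) diff_add_eq)
lemma cA_scale0: "cA S a t x \<Longrightarrow> ge c 0 \<Longrightarrow> cA S a t (\<lambda>i. c * x i)" using cA_scale[of S a t x c 0] by simp
lemma cA_zero: "cA S a t (\<lambda>k. 0)" by (simp add: cA_def)
lemma cA_subset: "cA S a t x \<Longrightarrow> T \<subseteq> S \<Longrightarrow> cA T a t x" by (auto simp: cA_def)
lemma lev_mono: "lev S e a t u \<Longrightarrow> s \<le> t \<Longrightarrow> lev S e a s u"
  unfolding lev_def by (meson ge_mono hc_mono add_right_mono)
lemma lev_add: "lev S e a t u \<Longrightarrow> lev S e a t w \<Longrightarrow> lev S e a t (u + w)" by (auto simp: lev_def bb_add intro: ge_add)
lemma lev_diff: "lev S e a t u \<Longrightarrow> lev S e a t w \<Longrightarrow> lev S e a t (u - w)" by (auto simp: lev_def bb_diff intro: ge_diff)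
lemma lev_sc: "lev S e a t u \<Longrightarrow> ge c k \<Longrightarrow> lev S e a (t + 2 * k) (sc c u)"
proof -
  assume l: "lev S e a t u" and c: "ge c k"
  have "hc (t + 2 * k + a j) = k + hc (t + a j)" for j using hc_add_double[of "t + a j" k] by (simp add: ac_simps)
  then show ?thesis using l c unfolding lev_def bb_sc by (auto intro: ge_mult)
qed
lemma lev_sc0: "lev S e a t u \<Longrightarrow> ge c 0 \<Longrightarrow> lev S e a t (sc c u)" using lev_sc[of S e a t u c 0] by simp

lemma lev_lc: assumes "lev S e a s u" "cA S a t x" shows "ge (bb u (lc S x e)) (hc (s + t))"
  unfolding bb_lc2
proof (rule ge_sum)
  fix k assume "k \<in> S"
  then show "ge (x k * bb u (e k)) (hc (s + t))"
    using assms by (intro ge_mult_hc[of _ "t - a k" _ "s + a k"]) (auto simp: lev_def cA_def)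
qed

lemma lev_lc': assumes "lev S e a s u" "cA S a t x" shows "ge (bb (lc S x e) u) (hc (s + t))"
  using lev_lc[OF assms] bb_sym by simp

lemma aint_lev: assumes "aint S e a" "cA S a t x" shows "lev S e a t (lc S x e)"
  unfolding lev_def
proof
  fix k assume k: "k \<in> S"
  have "lev S e a (a k) (e k)" using assms(1) k by (auto simp: aint_def lev_def)
  then show "ge (bb (lc S x e) (e k)) (hc (t + a k))" using lev_lc' assms(2) by (metis add.commute)
qed

lemma aint_lc2: "aint S e a \<Longrightarrow> cA S a s x \<Longrightarrow> cA S a t y \<Longrightarrow> ge (bb (lc S x e) (lc S y e)) (hc (s + t))"
  using aint_lev lev_lc by blast

lemma aint_subset: "aint S e a \<Longrightarrow> T \<subseteq> S \<Longrightarrow> aint T e a" by (auto simp: aint_def)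

lemma ge_sq_hc: "ge x (hc (t - r)) \<Longrightarrow> ge y r \<Longrightarrow> ge (x * x * y) t"
  by (rule ge_mult'[OF ge_mult[of x "hc (t - r)" x "hc (t - r)"]]) (use hc_bounds[of "t - r"] in auto)

lemma aint_q: assumes "finite S" "aint S e a" "cA S a t x" shows "ge (q (lc S x e)) t"
  using assms
proof (induction S rule: finite_induct)
  case empty then show ?case by (simp add: lc_def)
next
  case (insert m S)
  have i: "aint S e a" "cA S a t x" using insert.prems aint_subset cA_subset by (meson subset_insertI)+
  have "lev S e a (a m) (e m)" using insert.prems(1) by (auto simp: aint_def lev_def)
  then have "ge (bb (e m) (lc S x e)) (hc (a m + t))" using lev_lc i by blast
  then have "ge (x m * bb (e m) (lc S x e)) (hc (2 * t))"
    using insert.prems(2) by (intro ge_mult_hc[of _ "t - a m" _ "a m + t"]) (auto simp: cA_def)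
  moreover have "ge (x m * x m * q (e m)) t" using insert.prems by (intro ge_sq_hc[of _ _ "a m"]) (auto simp: cA_def aint_def)
  moreover have "ge (q (lc S x e)) t" using insert.IH i by blast
  ultimately show ?case
    unfolding lc_insert[OF insert.hyps] q_add q_sc bb_sc by (intro ge_add) auto
qed

text \<open>Multiplication by 2^j identifies the graded pieces at t and t + 2 j, so semiregularity
  has to be checked for one level of each parity only.\<close>

lemma semireg_shift: assumes "semireg S e a t" shows "semireg S e a (t + 2 * j)"
  unfolding semireg_def
proof (intro allI impI)
  fix x assume x: "cA S a (t + 2 * j) x" "lev S e a (t + 2 * j + 1) (lc S x e)" "ge (q (lc S x e)) (t + 2 * j + 1)"
  let ?c = "tw (- j)" let ?y = "\<lambda>k. tw (- j) * x k"
  have c: "ge ?c (- j)" using ex_tw ex_ge by blast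
  have "cA S a t ?y" using cA_scale[OF x(1) c] by simp
  moreover have "lev S e a (t + 1) (lc S ?y e)" unfolding lc_scale using lev_sc[OF x(2) c] by (simp add: algebra_simps)
  moreover have "ge (q (lc S ?y e)) (t + 1)" unfolding lc_scale q_sc using ge_mult'[OF ge_mult[OF c c] x(3), of "t + 1"] by simp
  ultimately have "cA S a (t + 1) ?y" using assms by (auto simp: semireg_def)
  then have "cA S a (t + 1 + 2 * j) (\<lambda>k. tw j * ?y k)" using cA_scale ex_tw ex_ge by blast
  moreover have "(\<lambda>k. tw j * ?y k) = x" by (simp add: mult.assoc[symmetric] tw_add[symmetric])
  moreover have "t + 1 + 2 * j = t + 2 * j + 1" by simp
  ultimately show "cA S a (t + 2 * j + 1) x" by (simp only:)
qed

lemma semireg_par: "semireg S e a t \<Longrightarrow> even (s - t) \<Longrightarrow> semireg S e a s"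
  using semireg_shift[of S e a t "(s - t) div 2"] by simp
lemma semireg_all: "semireg S e a t \<Longrightarrow> semireg S e a (t + 1) \<Longrightarrow> semireg S e a s"
  using semireg_par[of S e a t s] semireg_par[of S e a "t + 1" s] by (cases "even (s - t)") auto

lemma rad_q: assumes "semireg S e a t" "finite S" "aint S e a" "cA S a t y" "lev S e a (t + 1) (lc S y e)" "\<not> cA S a (t + 1) y"
  shows "ex (q (lc S y e)) t"
  using assms aint_q[OF assms(2-4)] by (intro exI') (auto simp: semireg_def)

text \<open>On the radical the graded form is additive and semilinear for squaring. Perfectness
  gives c for which the value of x + c y vanishes, and semiregularity puts this vector into the next
  step: the radical is spanned by y.\<close>

lemma rad_unique:
  assumes "semireg S e a t" "finite S" "aint S e a"
    and y: "cA S a t y" "lev S e a (t + 1) (lc S y e)" "\<not> cA S a (t + 1) y"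
    and x: "cA S a t x" "lev S e a (t + 1) (lc S x e)"
  shows "\<exists>c. ge c 0 \<and> cA S a (t + 1) (\<lambda>k. x k + c * y k)"
proof -
  have "ge (q (lc S x e)) t" using aint_q assms by blast
  then obtain c where c: "ge c 0" "ge (q (lc S x e) + c * c * q (lc S y e)) (t + 1)"
    using sq_approx[OF rad_q[OF assms(1-6)]] by blast
  have "ge (bb (lc S x e) (lc S y e)) (t + 1)" using lev_lc[OF x(2) y(1)] hc_double(1)[of "t + 1"]
    by (simp add: algebra_simps hc_def)
  then have "ge (c * bb (lc S x e) (lc S y e)) (t + 1)" using ge_mult[OF c(1)] by fastforce
  then have "ge (q (lc S (\<lambda>k. x k + c * y k) e)) (t + 1)"
    unfolding lc_add lc_scale q_add q_sc bb_sc2 using c(2) ge_add by blast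
  moreover have "cA S a t (\<lambda>k. x k + c * y k)" using cA_add[OF x(1) cA_scale0[OF y(1) c(1)]] .
  moreover have "lev S e a (t + 1) (lc S (\<lambda>k. x k + c * y k) e)"
    unfolding lc_add lc_scale using lev_add[OF x(2) lev_sc0[OF y(2) c(1)]] .
  ultimately show ?thesis using assms(1) c(1) by (auto simp: semireg_def)
qed



lemma cAD: "cA S a t x \<Longrightarrow> k \<in> S \<Longrightarrow> ge (x k) (hc (t - a k))" by (simp add: cA_def)
lemma levD: "lev S e a t u \<Longrightarrow> k \<in> S \<Longrightarrow> ge (bb u (e k)) (hc (t + a k))" by (simp add: lev_def)

text \<open>Over the residue field, a functional that vanishes on the radical is induced by a
  vector. Injectivity implies surjectivity by \<open>linear_surj\<close>, directly if the polar form
  is nondegenerate and after a modification in one coordinate if the radical is a line.\<close>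

lemma lin_solve:
  assumes fin: "finite S" and ai: "aint S e a" and sr: "semireg S e a t" and u: "lev S e a t u"
    and rad: "\<And>z. cA S a t z \<Longrightarrow> lev S e a (t + 1) (lc S z e) \<Longrightarrow> ge (bb u (lc S z e)) (t + 1)"
  shows "\<exists>w. cA S a t w \<and> lev S e a (t + 1) (u - lc S w e)"
proof -
  \<comment> \<open>Only coordinates whose level has the parity of t occur in the graded piece; for
    the others the coefficient bounds at t and t + 1 coincide.\<close>
  define T where "T = {k \<in> S. even (t - a k)}"
  have finT: "finite T" and TS: "T \<subseteq> S" using fin by (auto simp: T_def)
  define p where "p k = (t - a k) div 2" for k
  define r where "r k = (t + a k) div 2" for k
  have p: "2 * p k = t - a k" "2 * r k = t + a k" "r k = p k + a k" if "k \<in> T" for k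
    using that by (auto simp: T_def p_def r_def)
  have hcT: "hc (t - a k) = p k" "hc (t + 1 - a k) = p k + 1" "hc (t + a k) = r k" "hc (t + 1 + a k) = r k + 1" if "k \<in> T" for k
  proof -
    have "t - a k = 2 * p k" "t + 1 - a k = 2 * p k + 1" "t + a k = 2 * r k" "t + 1 + a k = 2 * r k + 1" using p[OF that] by auto
    then show "hc (t - a k) = p k" "hc (t + 1 - a k) = p k + 1" "hc (t + a k) = r k" "hc (t + 1 + a k) = r k + 1"
      by (auto simp: hc_def)
  qed
  have hcN: "hc (t + 1 - a k) = hc (t - a k)" "hc (t + 1 + a k) = hc (t + a k)" if "k \<in> S - T" for k
    using that hc_odd[of "t - a k"] hc_odd[of "t + a k"] by (auto simp: T_def algebra_simps)
  \<comment> \<open>\<open>W\<close> and \<open>N\<close> are the normalized coordinates and the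
    normalized Gram matrix of the graded piece, with integral entries.\<close>
  define W where "W x k = (if k \<in> T then tw (p k) * x k else 0)" for x :: "nat \<Rightarrow> 'a" and k
  have Wt: "cA S a t (W x)" if "\<And>i. i \<in> T \<Longrightarrow> ge (x i) 0" for x
    unfolding cA_def
  proof
    fix k assume "k \<in> S"
    show "ge (W x k) (hc (t - a k))"
      using ge_mult'[OF ex_ge[OF ex_tw] that[of k], of "p k" "p k"] hcT[of k] by (auto simp: W_def)
  qed
  have Wt1: "ge (x k) 1" if "cA S a (t + 1) (W x)" "k \<in> T" for x k
  proof -
    have "ge (W x k) (p k + 1)" using cAD[OF that(1) subsetD[OF TS that(2)]] hcT(2)[OF that(2)] by simp
    then have "ge (x k * tw (p k)) (p k + 1)" using that(2) by (simp add: W_def mult.commute)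
    then show ?thesis using ge_mult_ex[OF ex_tw] by simp
  qed
  define N where "N k i = bb (e i) (e k) * tw (p i) / tw (r k)" for k i
  have N0: "ge (N k i) 0" if "k \<in> T" "i \<in> T" for k i
  proof -
    have "ge (bb (e i) (e k)) (hc (a i + a k))" using ai that TS by (auto simp: aint_def)
    moreover have "hc (a i + a k) + p i - r k \<ge> 0"
      using p[OF that(1)] p[OF that(2)] hc_bounds[of "a i + a k"] by linarith
    ultimately show ?thesis unfolding N_def
      using ge_divide'[OF ge_mult[OF _ ex_ge[OF ex_tw]] ex_tw] by fastforce
  qed
  have bbW: "bb (lc S (W x) e) (e k) = tw (r k) * (\<Sum>i\<in>T. N k i * x i)" for x k
  proof -
    have "bb (lc S (W x) e) (e k) = (\<Sum>i\<in>T. W x i * bb (e i) (e k))"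
      unfolding bb_lc by (rule sum.mono_neutral_right[OF fin TS]) (auto simp: W_def)
    also have "\<dots> = tw (r k) * (\<Sum>i\<in>T. N k i * x i)"
      unfolding sum_distrib_left by (intro sum.cong refl) (simp add: W_def N_def)
    finally show ?thesis .
  qed
  have levW: "lev S e a (t + 1) (y - lc S (W x) e)"
    if "lev S e a t y" "\<And>i. i \<in> T \<Longrightarrow> ge (x i) 0"
       "\<And>k. k \<in> T \<Longrightarrow> ge (bb y (e k) / tw (r k) - (\<Sum>i\<in>T. N k i * x i)) 1" for x y
    unfolding lev_def
  proof
    fix k assume k: "k \<in> S"
    show "ge (bb (y - lc S (W x) e) (e k)) (hc (t + 1 + a k))"
    proof (cases "k \<in> T")
      case True
      have "ge (tw (r k) * (bb y (e k) / tw (r k) - (\<Sum>i\<in>T. N k i * x i))) (r k + 1)"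
        using ge_mult[OF ex_ge[OF ex_tw] that(3)[OF True]] by blast
      moreover have "tw (r k) * (bb y (e k) / tw (r k) - (\<Sum>i\<in>T. N k i * x i)) = bb (y - lc S (W x) e) (e k)"
        unfolding bb_diff bbW right_diff_distrib by simp
      ultimately show ?thesis using hcT[OF True] by simp
    next
      case False
      then show ?thesis using levD[OF lev_diff[OF that(1) aint_lev[OF ai Wt[of x, OF that(2)]]] k] k hcN[of k] by simp
    qed
  qed
  have levW0: "lev S e a (t + 1) (lc S (W x) e)"
    if x: "\<And>i. i \<in> T \<Longrightarrow> ge (x i) 0" "\<And>k. k \<in> T \<Longrightarrow> ge (\<Sum>i\<in>T. N k i * x i) 1" for x
  proof -
    have "lev S e a (t + 1) (0 - lc S (W x) e)" by (rule levW) (use x in \<open>auto simp: lev_def\<close>)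
    then show ?thesis by (simp add: lev_def bb_def b_minus)
  qed
  define g where "g k = bb u (e k) / tw (r k)" for k
  have g0: "ge (g k) 0" if "k \<in> T" for k
    using levD[OF u subsetD[OF TS that]] hcT(3)[OF that] ge_divide[OF _ ex_tw, of "bb u (e k)" "r k" "r k"] by (simp add: g_def)
  show ?thesis
  proof (cases "nondeg S e a t")
    case True
    have "\<exists>x. (\<forall>i\<in>T. ge (x i) 0) \<and> (\<forall>k\<in>T. ge ((\<Sum>i\<in>T. N k i * x i) - g k) 1)"
    proof (rule linear_surj[OF finT N0 _ g0])
      fix x k assume x: "\<And>i. i \<in> T \<Longrightarrow> ge (x i) 0" "\<And>k. k \<in> T \<Longrightarrow> ge (\<Sum>i\<in>T. N k i * x i) 1" and k: "k \<in> T"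
      have "cA S a (t + 1) (W x)" using True Wt[of x, OF x(1)] levW0[of x, OF x] by (auto simp: nondeg_def)
      then show "ge (x k) 1" using Wt1 k by blast
    qed auto
    then obtain x where x: "\<And>i. i \<in> T \<Longrightarrow> ge (x i) 0" "\<And>k. k \<in> T \<Longrightarrow> ge (g k - (\<Sum>i\<in>T. N k i * x i)) 1"
      using ge_diff_commute by blast
    have "lev S e a (t + 1) (u - lc S (W x) e)" by (rule levW[OF u]) (use x in \<open>auto simp: g_def\<close>)
    then show ?thesis using Wt[of x, OF x(1)] by blast
  next
    case False
    then obtain y where y: "cA S a t y" "lev S e a (t + 1) (lc S y e)" "\<not> cA S a (t + 1) y" by (auto simp: nondeg_def)
    obtain m where m: "m \<in> S" "\<not> ge (y m) (hc (t + 1 - a m))" using y(3) by (auto simp: cA_def)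
    have mT: "m \<in> T" using m hcN(1)[of m] cAD[OF y(1) m(1)] by force
    have ym: "ex (y m) (p m)" using m(2) cAD[OF y(1) m(1)] hcT[OF mT] by (intro exI') auto
    define N' where "N' k i = N k i + (if k = m \<and> i = m then 1 else 0)" for k i
    have N'sum: "(\<Sum>i\<in>T. N' k i * x i) = (\<Sum>i\<in>T. N k i * x i) + (if k = m then x m else 0)" for k x
    proof -
      have "(\<Sum>i\<in>T. N' k i * x i) = (\<Sum>i\<in>T. N k i * x i) + (\<Sum>i\<in>T. if i = m then (if k = m then x m else 0) else 0)"
        unfolding sum.distrib[symmetric] by (intro sum.cong refl) (auto simp: N'_def algebra_simps)
      then show ?thesis using finT mT by simp
    qed
    \<comment> \<open>Adding a square in the coordinate \<open>m\<close> kills the radical; pairing with the radical vector \<open>y\<close> shows that a solution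
       for the modified form has vanishing coordinate \<open>m\<close>.\<close>
    have key: "ge (x m) 1" if x: "\<And>i. i \<in> T \<Longrightarrow> ge (x i) 0" and h: "lev S e a t u'" "ge (bb u' (lc S y e)) (t + 1)"
      "\<And>k. k \<in> T \<Longrightarrow> ge ((\<Sum>i\<in>T. N' k i * x i) - bb u' (e k) / tw (r k)) 1" for x u'
    proof -
      have t1: "hc (t + 1 + t) = t + 1" by (auto simp: hc_def)
      let ?u = "u' - lc S (W x) e"
      have a1: "ge (bb ?u (lc S y e)) (t + 1)"
        using h(2) lev_lc'[OF y(2) Wt[of x, OF x]] t1 unfolding bb_diff by (intro ge_diff) auto
      have "ge (y k * bb ?u (e k) - (if k = m then y m * tw (r m) * x m else 0)) (t + 1)" if k: "k \<in> S" for k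
      proof (cases "k \<in> T")
        case True
        have "ge (tw (r k) * ((\<Sum>i\<in>T. N' k i * x i) - bb u' (e k) / tw (r k))) (r k + 1)"
          using ge_mult[OF ex_ge[OF ex_tw] h(3)[OF True]] by blast
        moreover have "tw (r k) * ((\<Sum>i\<in>T. N' k i * x i) - bb u' (e k) / tw (r k))
            = - (bb ?u (e k) - (if k = m then tw (r m) * x m else 0))"
          unfolding bb_diff bbW N'sum by (auto simp: algebra_simps)
        ultimately have "ge (bb ?u (e k) - (if k = m then tw (r m) * x m else 0)) (r k + 1)" by (simp only: ge_uminus)
        moreover have "ge (y k) (p k)" using cAD[OF y(1) k] hcT[OF True] by simp
        ultimately have "ge (y k * (bb ?u (e k) - (if k = m then tw (r m) * x m else 0))) (t + 1)"
          using ge_mult'[of "y k" "p k" _ "r k + 1" "t + 1"] p[OF True] by auto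
        then show ?thesis by (rule ge_eq) (auto simp: algebra_simps)
      next
        case False
        then have "k \<noteq> m" using mT by auto
        have "ge (bb ?u (e k)) (hc (t + a k))" using lev_diff[OF h(1) aint_lev[OF ai Wt[of x, OF x]]] k by (auto simp: lev_def)
        then have "ge (y k * bb ?u (e k)) (hc (t + 1 + t))"
          using cAD[OF y(1) k] hcN[of k] False k by (intro ge_mult_hc[of _ "t + 1 - a k" _ "t + a k"]) auto
        then show ?thesis using \<open>k \<noteq> m\<close> t1 by simp
      qed
      then have "ge (\<Sum>k\<in>S. y k * bb ?u (e k) - (if k = m then y m * tw (r m) * x m else 0)) (t + 1)" by (rule ge_sum)
      moreover have "(\<Sum>k\<in>S. y k * bb ?u (e k) - (if k = m then y m * tw (r m) * x m else 0))
          = bb ?u (lc S y e) - y m * tw (r m) * x m"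
        unfolding bb_lc2 sum_subtractf using fin m by simp
      ultimately have "ge (bb ?u (lc S y e) - (bb ?u (lc S y e) - y m * tw (r m) * x m)) (t + 1)" using a1 ge_diff by metis
      then have "ge (x m * (y m * tw (r m))) (t + 1)" by (rule ge_eq) (simp add: algebra_simps)
      then have "ge (x m) (t + 1 - (p m + r m))" using ge_mult_ex[OF ex_mult[OF ym ex_tw]] by simp
      moreover have "t + 1 - (p m + r m) = 1" using p[OF mT] by linarith
      ultimately show ?thesis by simp
    qed
    have "\<exists>x. (\<forall>i\<in>T. ge (x i) 0) \<and> (\<forall>k\<in>T. ge ((\<Sum>i\<in>T. N' k i * x i) - g k) 1)"
    proof (rule linear_surj[OF finT _ _ g0])
      fix k i assume "k \<in> T" "i \<in> T" then show "ge (N' k i) 0" using N0 by (auto simp: N'_def intro!: ge_add)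
    next
      fix x k assume x: "\<And>i. i \<in> T \<Longrightarrow> ge (x i) 0" "\<And>k. k \<in> T \<Longrightarrow> ge (\<Sum>i\<in>T. N' k i * x i) 1" and k: "k \<in> T"
      have xm: "ge (x m) 1" by (rule key[of x 0]) (use x in \<open>auto simp: lev_def\<close>)
      have "ge (\<Sum>i\<in>T. N k i * x i) 1" if "k \<in> T" for k
      proof -
        have "ge ((\<Sum>i\<in>T. N' k i * x i) - (if k = m then x m else 0)) 1" using x(2)[OF that] xm by (intro ge_diff) auto
        then show ?thesis unfolding N'sum by simp
      qed
      then have "lev S e a (t + 1) (lc S (W x) e)" using levW0 x(1) by blast
      then obtain c where c: "ge c 0" "cA S a (t + 1) (\<lambda>k. W x k + c * y k)"
        using rad_unique[OF sr fin ai y Wt[of x, OF x(1)]] by blast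
      have "ge (W x m + c * y m) (p m + 1)" using cAD[OF c(2) m(1)] hcT[OF mT] by simp
      moreover have "ge (W x m) (p m + 1)" unfolding W_def using mT ge_mult[OF ex_ge[OF ex_tw] xm] by simp
      ultimately have "ge (W x m + c * y m - W x m) (p m + 1)" by (rule ge_diff)
      then have "ge c 1" using ge_mult_ex[OF ym, of c "p m + 1"] by simp
      then have "cA S a (t + 1) (\<lambda>k. c * y k)" using cA_mono[OF cA_scale[OF y(1), of c 1], of "t + 1"] by simp
      then have "cA S a (t + 1) (\<lambda>k. (W x k + c * y k) - c * y k)" using c(2) cA_diff by blast
      then have "cA S a (t + 1) (W x)" by simp
      then show "ge (x k) 1" using Wt1 k by blast
    qed auto
    then obtain x where x: "\<And>i. i \<in> T \<Longrightarrow> ge (x i) 0" "\<And>k. k \<in> T \<Longrightarrow> ge ((\<Sum>i\<in>T. N' k i * x i) - g k) 1" by blast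
    have xm: "ge (x m) 1" by (rule key[OF x(1) u rad[OF y(1,2)]]) (use x in \<open>auto simp: g_def\<close>)
    have "ge (bb u (e k) / tw (r k) - (\<Sum>i\<in>T. N k i * x i)) 1" if k: "k \<in> T" for k
    proof -
      have "ge ((if k = m then x m else 0) - ((\<Sum>i\<in>T. N' k i * x i) - g k)) 1" by (rule ge_diff[OF _ x(2)[OF k]]) (use xm in simp)
      then show ?thesis unfolding N'sum g_def by (rule ge_eq) simp
    qed
    then have "lev S e a (t + 1) (u - lc S (W x) e)" using levW[OF u] x(1) by blast
    then show ?thesis using Wt[of x, OF x(1)] by blast
  qed
qed

lemma hc_2t1: "hc (t + 1 + t) = t + 1" "hc (t + (t + 1)) = t + 1" by (auto simp: hc_def)

lemma add_aint:
  assumes "aint S e a" "m \<notin> S" "lev S e a r n" "ge (q n) r"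
  shows "aint (insert m S) (e(m := n)) (a(m := r))"
proof -
  have "ge (bb n (e k)) (hc (r + a k))" "ge (bb (e k) n) (hc (a k + r))" if "k \<in> S" for k
    using assms(3) that by (auto simp: lev_def bb_sym[of "e k"] add.commute)
  moreover have "ge (bb n n) (hc (r + r))" using assms(4) unfolding bb_self by (auto elim: ge_mono)
  moreover have "\<And>k. k \<in> S \<Longrightarrow> k \<noteq> m" using assms(2) by auto
  ultimately show ?thesis using assms(1,4) unfolding aint_def by auto
qed

text \<open>For a level of the opposite parity the new coefficient has the same bound at t and t +
  1. It therefore contributes nothing to the graded piece at t.\<close>

lemma add_other:
  assumes fin: "finite S" and m: "m \<notin> S" and ai: "aint (insert m S) (e(m := n)) (a(m := r))" and odd: "odd (r - t)"
  shows "semireg S e a t \<Longrightarrow> semireg (insert m S) (e(m := n)) (a(m := r)) t"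
    and "nondeg (insert m S) (e(m := n)) (a(m := r)) t \<longleftrightarrow> nondeg S e a t"
proof -
  let ?S = "insert m S" and ?e = "e(m := n)" and ?a = "a(m := r)"
  have ne: "k \<noteq> m" if "k \<in> S" for k using that m by auto
  have ai0: "aint S e a" using ai ne unfolding aint_def by auto
  have ln: "lev S e a r n" using ai ne by (auto simp: aint_def lev_def)
  have qn: "ge (q n) r" using ai by (auto simp: aint_def)
  have ho: "hc (t + 1 - r) = hc (t - r)" "hc (t + 1 + r) = hc (t + r)" using odd hc_odd[of "t - r"] hc_odd[of "t + r"]
    by (auto simp: algebra_simps)
  have down: "cA S a t x \<and> ge (x m) (hc (t + 1 - r)) \<and> lev S e a (t + 1) (lc S x e) \<and>
      (ge (q (lc ?S x ?e)) (t + 1) \<longrightarrow> ge (q (lc S x e)) (t + 1))"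
    if x: "cA ?S ?a t x" "lev ?S ?e ?a (t + 1) (lc ?S x ?e)" for x
  proof -
    have x0: "cA S a t x" using x(1) ne by (auto simp: cA_def)
    have xm: "ge (x m) (hc (t + 1 - r))" using x(1) ho by (auto simp: cA_def)
    have u: "lc ?S x ?e = sc (x m) n + lc S x e" using fin m by (simp add: lc_insert lc_upd)
    have "lev S e a (t + 1) (lc S x e)" unfolding lev_def
    proof
      fix k assume k: "k \<in> S"
      have "ge (bb (lc ?S x ?e) (e k)) (hc (t + 1 + a k))" using x(2) k ne[OF k] by (auto simp: lev_def)
      moreover have "ge (x m * bb n (e k)) (hc (t + 1 + a k))"
        using xm ln k by (intro ge_mult_hc[of _ "t + 1 - r" _ "r + a k"]) (auto simp: lev_def)
      ultimately have "ge (bb (lc ?S x ?e) (e k) - x m * bb n (e k)) (hc (t + 1 + a k))" by (rule ge_diff)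
      then show "ge (bb (lc S x e) (e k)) (hc (t + 1 + a k))" unfolding u bb_add bb_sc by simp
    qed
    moreover have "ge (q (lc S x e)) (t + 1)" if "ge (q (lc ?S x ?e)) (t + 1)"
    proof -
      have "ge (x m * x m * q n) (t + 1)" using xm qn by (rule ge_sq_hc)
      moreover have "ge (x m * bb n (lc S x e)) (t + 1)"
        using ge_mult_hc[OF xm lev_lc[OF ln x0], of "t + 1 + t"] hc_2t1 by simp
      ultimately have "ge (q (lc ?S x ?e) - (x m * x m * q n + x m * bb n (lc S x e))) (t + 1)"
        using that by (intro ge_diff ge_add)
      then show ?thesis unfolding u q_add q_sc bb_sc by (rule ge_eq) simp
    qed
    ultimately show ?thesis using x0 xm by blast
  qed
  have up: "cA ?S ?a (t + 1) x" if "cA S a (t + 1) x" "ge (x m) (hc (t + 1 - r))" for x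
    using that by (auto simp: cA_def)
  show "semireg ?S ?e ?a t" if "semireg S e a t" using that down up unfolding semireg_def by meson
  show "nondeg ?S ?e ?a t \<longleftrightarrow> nondeg S e a t"
  proof
    assume "nondeg S e a t"
    then show "nondeg ?S ?e ?a t" using down up unfolding nondeg_def by meson
  next
    assume R: "nondeg ?S ?e ?a t"
    show "nondeg S e a t" unfolding nondeg_def
    proof (intro allI impI)
      fix x assume x: "cA S a t x" "lev S e a (t + 1) (lc S x e)"
      let ?x = "x(m := 0)"
      have u: "lc ?S ?x ?e = lc S x e" using fin m by (simp add: lc_insert lc_upd)
      have "cA ?S ?a t ?x" using x(1) by (auto simp: cA_def)
      moreover have "lev ?S ?e ?a (t + 1) (lc ?S ?x ?e)"
        unfolding u using x(2) lev_lc'[OF ln x(1)] ho by (auto simp: lev_def add.commute)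
      ultimately have "cA ?S ?a (t + 1) ?x" using R by (auto simp: nondeg_def)
      then show "cA S a (t + 1) x" using ne by (auto simp: cA_def)
    qed
  qed
qed

text \<open>Next to a nondegenerate piece, the new vector spans an anisotropic radical line: its
  pairings are of higher level but its value is not.\<close>

lemma add_line:
  assumes fin: "finite S" and m: "m \<notin> S" and ai: "aint S e a" and ln: "lev S e a (r + 1) n"
    and qn: "ex (q n) r" and R: "nondeg S e a r"
  shows "aint (insert m S) (e(m := n)) (a(m := r))" "semireg (insert m S) (e(m := n)) (a(m := r)) r"
    "\<not> nondeg (insert m S) (e(m := n)) (a(m := r)) r"
proof -
  let ?S = "insert m S" and ?e = "e(m := n)" and ?a = "a(m := r)"
  have ne: "k \<noteq> m" if "k \<in> S" for k using that m by auto
  show "aint ?S ?e ?a" by (rule add_aint[OF ai m lev_mono[OF ln] ex_ge[OF qn]]) simp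
  show "semireg ?S ?e ?a r" unfolding semireg_def
  proof (intro allI impI)
    fix x assume x: "cA ?S ?a r x" "lev ?S ?e ?a (r + 1) (lc ?S x ?e)" "ge (q (lc ?S x ?e)) (r + 1)"
    have x0: "cA S a r x" using x(1) ne by (auto simp: cA_def)
    have xm: "ge (x m) 0" using x(1) by (auto simp: cA_def hc_def)
    have u: "lc ?S x ?e = sc (x m) n + lc S x e" using fin m by (simp add: lc_insert lc_upd)
    have "lev S e a (r + 1) (lc ?S x ?e)" using x(2) ne by (auto simp: lev_def)
    then have "lev S e a (r + 1) (lc ?S x ?e - sc (x m) n)" using lev_sc0[OF ln xm] lev_diff by blast
    then have l: "lev S e a (r + 1) (lc S x e)" unfolding u by simp
    then have c: "cA S a (r + 1) x" using R x0 by (auto simp: nondeg_def)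
    then have "ge (q (lc S x e)) (r + 1)" using aint_q fin ai by blast
    moreover have "ge (x m * bb n (lc S x e)) (r + 1)"
      using ge_mult'[OF xm lev_lc[OF ln x0], of "r + 1"] by (simp add: hc_def)
    ultimately have "ge (q (lc ?S x ?e) - (q (lc S x e) + x m * bb n (lc S x e))) (r + 1)"
      using x(3) by (intro ge_diff ge_add)
    then have "ge ((x m * x m) * q n) (r + 1)" unfolding u q_add q_sc bb_sc by (rule ge_eq) simp
    then have "ge (x m * x m) 1" using ge_mult_ex[OF qn] by simp
    then have "ge (x m) 1" by (rule ge_sq_1)
    then show "cA ?S ?a (r + 1) x" using c by (auto simp: cA_def hc_def)
  qed
  show "\<not> nondeg ?S ?e ?a r"
  proof
    assume R: "nondeg ?S ?e ?a r"
    let ?x = "\<lambda>k. if k = m then 1 else (0::'a)"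
    have "lc S ?x e = lc S (\<lambda>k. 0) e" by (rule lc_cong) (use m in auto)
    then have u: "lc ?S ?x ?e = n" using fin m by (simp add: lc_insert lc_upd sc_one lc_zero)
    have "cA ?S ?a r ?x" by (auto simp: cA_def hc_def)
    moreover have "lev ?S ?e ?a (r + 1) (lc ?S ?x ?e)" unfolding u
      using ln ex_ge[OF qn] by (auto simp: lev_def bb_self hc_def)
    ultimately have "cA ?S ?a (r + 1) ?x" using R by (auto simp: nondeg_def)
    then show False by (auto simp: cA_def hc_def)
  qed
qed

text \<open>The radical vector y and the new vector pair with the smallest order that their levels
  allow, so together they span a nondegenerate plane and the radical at t disappears. The levels r
  and t need only have equal parity.\<close>

lemma add_pair:
  assumes fin: "finite S" and m: "m \<notin> S" and ai: "aint S e a" and ai': "aint (insert m S) (e(m := n)) (a(m := r))"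
    and sr: "semireg S e a t" and y: "cA S a t y" "lev S e a (t + 1) (lc S y e)" "\<not> cA S a (t + 1) y"
    and h: "r + t = 2 * h" and ny: "ex (bb n (lc S y e)) h"
  shows "nondeg (insert m S) (e(m := n)) (a(m := r)) t"
  unfolding nondeg_def
proof (intro allI impI)
  let ?S = "insert m S" and ?e = "e(m := n)" and ?a = "a(m := r)"
  have ne: "k \<noteq> m" if "k \<in> S" for k using that m by auto
  have ln: "lev S e a r n" using ai' ne by (auto simp: aint_def lev_def)
  have qn: "ge (q n) r" using ai' by (auto simp: aint_def)
  fix x assume x: "cA ?S ?a t x" "lev ?S ?e ?a (t + 1) (lc ?S x ?e)"
  let ?u = "lc ?S x ?e"
  have x0: "cA S a t x" using x(1) ne by (auto simp: cA_def)
  have u: "?u = sc (x m) n + lc S x e" using fin m by (simp add: lc_insert lc_upd)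
  have lu: "lev S e a (t + 1) ?u" using x(2) ne by (auto simp: lev_def)
  have "ge (bb ?u (lc S y e) - bb (lc S x e) (lc S y e)) (t + 1)"
    using lev_lc[OF lu y(1)] lev_lc'[OF y(2) x0] hc_2t1 by (intro ge_diff) auto
  then have "ge (x m * bb n (lc S y e)) (t + 1)" unfolding u bb_add bb_sc by simp
  then have xm: "ge (x m) (t + 1 - h)" using ge_mult_ex[OF ny] by simp
  have hr: "hc (t + 1 - r) = t + 1 - h" "hc (t + 1 + r) = h + 1" using h by (auto simp: hc_def)
  have "lev S e a (t + 1) (lc S x e)" unfolding lev_def
  proof
    fix k assume k: "k \<in> S"
    have "ge (x m * bb n (e k)) (hc (t + 1 + a k))"
      using xm ln k hr by (intro ge_mult_hc[of _ "t + 1 - r" _ "r + a k"]) (auto simp: lev_def)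
    then have "ge (bb ?u (e k) - x m * bb n (e k)) (hc (t + 1 + a k))" using lu k by (intro ge_diff) (auto simp: lev_def)
    then show "ge (bb (lc S x e) (e k)) (hc (t + 1 + a k))" unfolding u bb_add bb_sc by simp
  qed
  then obtain c where c: "ge c 0" "cA S a (t + 1) (\<lambda>k. x k + c * y k)"
    using rad_unique[OF sr fin ai y x0] by blast
  have "cA S a (t + 1) x"
  proof (cases "ge c 1")
    case True
    then have "cA S a (t + 1) (\<lambda>k. c * y k)" using cA_mono[OF cA_scale[OF y(1), of c 1], of "t + 1"] by simp
    then have "cA S a (t + 1) (\<lambda>k. (x k + c * y k) - c * y k)" using c(2) cA_diff by blast
    then show ?thesis by simp
  next
    case False
    then have ec: "ex c 0" using c(1) by (intro exI') auto
    have "ge (bb n (lc S (\<lambda>k. x k + c * y k) e)) (h + 1)" using lev_lc[OF ln c(2)] hr by (simp add: algebra_simps)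
    then have 1: "ge (bb n (lc S x e) + c * bb n (lc S y e)) (h + 1)" by (simp add: lc_add lc_scale bb_add2 bb_sc2)
    have "ge (bb ?u n) (h + 1)" using x(2) hr by (auto simp: lev_def)
    moreover have "ge (x m * bb n n) (h + 1)" using ge_mult'[OF xm, of "2 * q n" "r + 1" "h + 1"] qn h by (simp add: bb_self)
    ultimately have "ge (bb ?u n - x m * bb n n) (h + 1)" by (rule ge_diff)
    then have "ge (bb n (lc S x e)) (h + 1)" unfolding u bb_add bb_sc by (simp add: bb_sym)
    then have "ge (bb n (lc S x e) + c * bb n (lc S y e) - bb n (lc S x e)) (h + 1)" using 1 ge_diff by blast
    then have "ge (c * bb n (lc S y e)) (h + 1)" by simp
    then show ?thesis using ex_not_ge[OF ex_mult[OF ec ny]] by simp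
  qed
  then show "cA ?S ?a (t + 1) x" using xm hr by (auto simp: cA_def)
qed

end

lemma hc_simps [simp]: "hc (2 * t + 2) = t + 1" "hc (2 * t + 1) = t + 1" by (auto simp: hc_def)

section \<open>Adjoining diagonal vectors to a semiregular family\<close>

context qspace
begin

text \<open>The radical at level \<open>l\<close> contains a vector that stays orthogonal to the radical at level \<open>l + 1\<close>.\<close>
definition free_rad :: "nat set \<Rightarrow> (nat \<Rightarrow> 'b) \<Rightarrow> (nat \<Rightarrow> int) \<Rightarrow> int \<Rightarrow> bool" where
  "free_rad S e a l \<longleftrightarrow> (\<exists>y. cA S a l y \<and> lev S e a (l + 1) (lc S y e) \<and> \<not> cA S a (l + 1) y \<and>
     (\<forall>z. cA S a (l + 1) z \<longrightarrow> lev S e a (l + 2) (lc S z e) \<longrightarrow> ge (bb (lc S y e) (lc S z e)) (l + 2)))"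

lemma orth_lc: "(\<And>k. k \<in> S \<Longrightarrow> bb n (e k) = 0) \<Longrightarrow> bb n (lc S x e) = 0"
  by (simp add: bb_lc2)

text \<open>In a nondegenerate piece the vector n keeps level l. Otherwise a radical vector y has
  exact order l and, rescaled, cancels q(n) modulo order l + 1. If y pairs exactly with the radical
  at l + 1, the level is l + 1 and this radical disappears. If not, a further correction makes the
  pairings those of level l + 2, and the value decides between l + 1 and l + 2. Recording
  nondegeneracy before and after makes the level readable from the form alone.\<close>

lemma add_unary:
  assumes fin: "finite S" and m: "m \<notin> S" and ai: "aint S e a" and sr: "\<And>t. semireg S e a t"
    and orth: "\<And>k. k \<in> S \<Longrightarrow> bb n (e k) = 0" and qn: "ex (q n) l"
  shows "\<exists>x r. cA S a l x \<and> aint (insert m S) (e(m := n + lc S x e)) (a(m := r)) \<and>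
     (\<forall>t. semireg (insert m S) (e(m := n + lc S x e)) (a(m := r)) t) \<and>
     (r = l \<and> nondeg S e a l \<or>
      r = l + 1 \<and> \<not> nondeg S e a l \<and> \<not> nondeg (insert m S) (e(m := n + lc S x e)) (a(m := r)) l \<or>
      r = l + 2 \<and> \<not> nondeg S e a l \<and> nondeg (insert m S) (e(m := n + lc S x e)) (a(m := r)) l \<and> free_rad S e a l)"
proof -
  have ln: "lev S e a t n" for t using orth by (auto simp: lev_def)
  have nz: "bb n (lc S x e) = 0" for x using orth orth_lc by blast
  let ?P = "\<lambda>x r. cA S a l x \<and> aint (insert m S) (e(m := n + lc S x e)) (a(m := r)) \<and>
     (\<forall>t. semireg (insert m S) (e(m := n + lc S x e)) (a(m := r)) t) \<and>
     (r = l \<and> nondeg S e a l \<or>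
      r = l + 1 \<and> \<not> nondeg S e a l \<and> \<not> nondeg (insert m S) (e(m := n + lc S x e)) (a(m := r)) l \<or>
      r = l + 2 \<and> \<not> nondeg S e a l \<and> nondeg (insert m S) (e(m := n + lc S x e)) (a(m := r)) l \<and> free_rad S e a l)"
  show ?thesis
  proof (cases "nondeg S e a l")
    case True
    have u: "n + lc S (\<lambda>k. 0) e = n" by (simp add: lc_zero)
    note L = add_line[OF fin m ai ln qn True]
    have "semireg (insert m S) (e(m := n)) (a(m := l)) (l + 1)" using add_other(1)[OF fin m L(1)] sr by simp
    then have "?P (\<lambda>k. 0) l" unfolding u using L semireg_all True cA_zero by blast
    then show ?thesis by blast
  next
    case nR: False
    then obtain y0 where y0: "cA S a l y0" "lev S e a (l + 1) (lc S y0 e)" "\<not> cA S a (l + 1) y0" by (auto simp: nondeg_def)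
    have qy0: "ex (q (lc S y0 e)) l" using rad_q[OF sr fin ai y0] .
    obtain c where c: "ge c 0" "ge (q n + c * c * q (lc S y0 e)) (l + 1)" using sq_approx[OF qy0 ex_ge[OF qn]] by blast
    \<comment> \<open>The value q(n) has exact order l, so the square that cancels it must be a
      unit.\<close>
    have ec: "ex c 0"
    proof (rule exI')
      show "\<not> ge c (0 + 1)"
      proof
        assume "ge c (0 + 1)"
        then have "ge (c * c * q (lc S y0 e)) (l + 1)" using ge_mult'[OF ge_mult[of c 1 c 1] ex_ge[OF qy0], of "l + 1"] by simp
        then have "ge (q n + c * c * q (lc S y0 e) - c * c * q (lc S y0 e)) (l + 1)" using c(2) ge_diff by blast
        then show False using ex_not_ge[OF qn] by simp
      qed
    qed (use c in simp)
    define y where "y = (\<lambda>k. c * y0 k)"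
    have yv: "lc S y e = sc c (lc S y0 e)" unfolding y_def by (rule lc_scale)
    have y: "cA S a l y" "lev S e a (l + 1) (lc S y e)"
      unfolding yv unfolding y_def using cA_scale0[OF y0(1) c(1)] lev_sc0[OF y0(2) c(1)] by auto
    have y3: "\<not> cA S a (l + 1) y"
    proof
      assume "cA S a (l + 1) y"
      then have "cA S a (l + 1) (\<lambda>k. (1 / c) * y k)" using ge_divide[of 1 0 c 0] ec by (intro cA_scale0) auto
      then show False using y0(3) ex_nz[OF ec] by (simp add: y_def)
    qed
    have qy: "ex (q (lc S y e)) l" using rad_q[OF sr fin ai y y3] .
    have q1: "ge (q n + q (lc S y e)) (l + 1)" unfolding yv q_sc using c(2) by simp
    show ?thesis
    proof (cases "\<exists>z. cA S a (l + 1) z \<and> lev S e a (l + 2) (lc S z e) \<and> \<not> ge (bb (lc S y e) (lc S z e)) (l + 2)")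
      case True
      \<comment> \<open>First obstruction: z is radical at l + 1 but pairs exactly with y, hence
        with n + y, so level l + 1 is final and \<open>add_pair\<close> removes the radical line of
        z.\<close>
      then obtain z where z: "cA S a (l + 1) z" "lev S e a (l + 2) (lc S z e)" "\<not> ge (bb (lc S y e) (lc S z e)) (l + 2)" by blast
      let ?n = "n + lc S y e"
      have qn1: "ge (q ?n) (l + 1)" using q1 nz by (simp add: q_add)
      have ai': "aint (insert m S) (e(m := ?n)) (a(m := l + 1))"
        using add_aint[OF ai m lev_add[OF ln y(2)] qn1] .
      have z3: "\<not> cA S a (l + 1 + 1) z"
      proof
        assume "cA S a (l + 1 + 1) z"
        then have "ge (bb (lc S y e) (lc S z e)) (hc (l + 1 + (l + 1 + 1)))" using lev_lc[OF y(2)] by blast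
        then show False using z(3) by (simp add: hc_def algebra_simps)
      qed
      have "ge (bb (lc S y e) (lc S z e)) (l + 1)" using lev_lc[OF y(2) z(1)] by simp
      then have "ex (bb ?n (lc S z e)) (l + 1)" using z(3) nz by (intro exI') (simp_all add: bb_add algebra_simps)
      then have R: "nondeg (insert m S) (e(m := ?n)) (a(m := l + 1)) (l + 1)"
        using z(2) by (intro add_pair[OF fin m ai ai' sr z(1) _ z3, where h = "l + 1"]) (simp_all add: add.assoc)
      have "semireg (insert m S) (e(m := ?n)) (a(m := l + 1)) l" using add_other(1)[OF fin m ai' _ sr] by simp
      then have "\<forall>t. semireg (insert m S) (e(m := ?n)) (a(m := l + 1)) t" using semireg_all nondeg_semireg[OF R] by blast
      moreover have "\<not> nondeg (insert m S) (e(m := ?n)) (a(m := l + 1)) l" using add_other(2)[OF fin m ai', of l] nR by simp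
      ultimately have "?P y (l + 1)" using nR y(1) ai' by blast
      then show ?thesis by blast
    next
      case False
      then have H: "\<And>z. cA S a (l + 1) z \<Longrightarrow> lev S e a (l + 2) (lc S z e) \<Longrightarrow> ge (bb (lc S y e) (lc S z e)) (l + 2)" by blast
      then have free_rad: "free_rad S e a l" unfolding free_rad_def using y y3 by blast
      \<comment> \<open>Without such an obstruction the pairings of y at level l + 1 are those of a
        vector w, and y - w has the pairings of level l + 2.\<close>
      obtain w where w: "cA S a (l + 1) w" "lev S e a (l + 2) (lc S y e - lc S w e)"
        using lin_solve[OF fin ai sr y(2)] H by (auto simp: add.assoc)
      have yw: "ge (bb (lc S y e) (lc S w e)) (l + 2)"
      proof -
        have "ge (bb (lc S y e - lc S w e) (lc S w e)) (l + 2)" using lev_lc[OF w(2,1)] by (simp add: hc_def algebra_simps)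
        moreover have "ge (bb (lc S w e) (lc S w e)) (l + 2)" unfolding bb_self using aint_q[OF fin ai w(1)] by (auto elim!: ge_mono)
        ultimately have "ge (bb (lc S y e - lc S w e) (lc S w e) + bb (lc S w e) (lc S w e)) (l + 2)" by (rule ge_add)
        then show ?thesis by (simp add: bb_diff)
      qed
      have x2: "cA S a l (\<lambda>k. y k - w k)" using cA_diff[OF y(1) cA_mono[OF w(1)]] by simp
      let ?n2 = "n + lc S (\<lambda>k. y k - w k) e"
      have ln2: "lev S e a (l + 2) ?n2" unfolding lc_diff using lev_add[OF ln w(2)] .
      have q2: "ge (q ?n2) (l + 1)"
      proof -
        have "q ?n2 = (q n + q (lc S y e)) + q (lc S w e) - bb (lc S y e) (lc S w e)"
          unfolding lc_diff by (simp add: q_add q_diff bb_diff2 nz)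
        then show ?thesis using q1 aint_q[OF fin ai w(1)] ge_mono[OF yw, of "l + 1"] by (auto intro!: ge_add ge_diff)
      qed
      show ?thesis
      \<comment> \<open>A radical vector at l + 1 can cancel a remaining value of order l + 1; then
        level l + 2 is reached.\<close>
      proof (cases "\<not> nondeg S e a (l + 1) \<or> ge (q ?n2) (l + 2)")
        case True
        have "\<exists>z. cA S a (l + 1) z \<and> lev S e a (l + 2) (lc S z e) \<and> ge (q (?n2 + lc S z e)) (l + 2)"
        proof (cases "ge (q ?n2) (l + 2)")
          case True
          then show ?thesis by (intro exI[of _ "\<lambda>k. 0"]) (simp add: cA_zero lc_zero lev_def)
        next
          case False
          then obtain z where z: "cA S a (l + 1) z" "lev S e a (l + 1 + 1) (lc S z e)" "\<not> cA S a (l + 1 + 1) z"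
            using True by (auto simp: nondeg_def)
          obtain c where c: "ge c 0" "ge (q ?n2 + c * c * q (lc S z e)) (l + 1 + 1)"
            using sq_approx[OF rad_q[OF sr fin ai z] q2] by blast
          have "ge (bb ?n2 (lc S z e)) (l + 2)" using lev_lc[OF ln2 z(1)] by (simp add: hc_def algebra_simps)
          then have "ge (c * bb ?n2 (lc S z e)) (l + 2)" using ge_mult[OF c(1)] by fastforce
          moreover have "ge (q ?n2 + c * c * q (lc S z e)) (l + 2)" using c(2) by (simp add: add.assoc)
          ultimately have "ge (q ?n2 + c * c * q (lc S z e) + c * bb ?n2 (lc S z e)) (l + 2)" using ge_add by blast
          then have "ge (q (?n2 + lc S (\<lambda>k. c * z k) e)) (l + 2)" unfolding lc_scale q_add[of ?n2] q_sc bb_sc2 .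
          moreover have "lev S e a (l + 2) (lc S (\<lambda>k. c * z k) e)" unfolding lc_scale using lev_sc0[OF z(2) c(1)] by (simp add: add.assoc)
          ultimately show ?thesis using cA_scale0[OF z(1) c(1)] by blast
        qed
        then obtain z where z: "cA S a (l + 1) z" "lev S e a (l + 2) (lc S z e)" "ge (q (?n2 + lc S z e)) (l + 2)" by blast
        define x where "x = (\<lambda>k. y k - w k + z k)"
        have x: "cA S a l x" unfolding x_def using cA_add[OF x2 cA_mono[OF z(1)]] by simp
        let ?n = "n + lc S x e"
        have nn: "?n = ?n2 + lc S z e" unfolding x_def lc_add by (simp add: add.assoc)
        have ai': "aint (insert m S) (e(m := ?n)) (a(m := l + 2))"
          unfolding nn by (rule add_aint[OF ai m lev_add[OF ln2 z(2)] z(3)])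
        \<comment> \<open>The exact order comes from the polar value of y with itself, which is 2
          q(y); all other pairings are smaller.\<close>
        have "ex (bb ?n (lc S y e)) (l + 1)"
        proof -
          have "bb ?n (lc S y e) = 2 * q (lc S y e) + (bb (lc S y e) (lc S z e) - bb (lc S y e) (lc S w e))"
            unfolding nn lc_diff by (simp add: bb_add bb_diff nz bb_self bb_sym[of "lc S w e" "lc S y e"] bb_sym[of "lc S z e" "lc S y e"])
          moreover have "ex (2 * q (lc S y e)) (1 + l)" using qy by (intro ex_mult) auto
          moreover have "ge (bb (lc S y e) (lc S z e) - bb (lc S y e) (lc S w e)) (1 + l + 1)"
            using H[OF z(1,2)] yw by (intro ge_diff) (auto simp: add.commute)
          ultimately show ?thesis using ex_add by (metis add.commute)
        qed
        then have R: "nondeg (insert m S) (e(m := ?n)) (a(m := l + 2)) l"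
          by (intro add_pair[OF fin m ai ai' sr y y3]) auto
        have "semireg (insert m S) (e(m := ?n)) (a(m := l + 2)) (l + 1)" using add_other(1)[OF fin m ai' _ sr] by simp
        then have "\<forall>t. semireg (insert m S) (e(m := ?n)) (a(m := l + 2)) t" using semireg_all nondeg_semireg[OF R] by blast
        then have "?P x (l + 2)" using nR x ai' R free_rad by blast
        then show ?thesis by blast
      next
        case False
        \<comment> \<open>Second obstruction: the value has exact order l + 1 and no radical vector
          is available, so the new vector is itself an anisotropic radical line at l + 1.\<close>
        then have R1: "nondeg S e a (l + 1)" and "ex (q ?n2) (l + 1)" using q2 by (auto intro!: exI' simp: add.assoc)
        note L = add_line[OF fin m ai _ this(2,1)]
        have ln2': "lev S e a (l + 1 + 1) ?n2" using ln2 by (simp add: add.assoc)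
        have "semireg (insert m S) (e(m := ?n2)) (a(m := l + 1)) l" using add_other(1)[OF fin m L(1)[OF ln2'] _ sr] by simp
        then have "\<forall>t. semireg (insert m S) (e(m := ?n2)) (a(m := l + 1)) t" using semireg_all L(2)[OF ln2'] by blast
        moreover have "\<not> nondeg (insert m S) (e(m := ?n2)) (a(m := l + 1)) l" using add_other(2)[OF fin m L(1)[OF ln2'], of l] nR by simp
        ultimately have "?P (\<lambda>k. y k - w k) (l + 1)" using nR x2 L(1)[OF ln2'] by blast
        then show ?thesis by blast
      qed
    qed
  qed
qed

text \<open>Both vectors are corrected by unit multiples of the same radical vector y. The corrected
  vectors pair with value 2 c1 c2 q(y), of exact order l + 1, so they form a plane that is
  nondegenerate at level l + 1. Adding the vectors singly could raise the first one to l + 2, above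
  its partner.\<close>

lemma add_unary_pair:
  assumes fin: "finite S" and m1: "m1 \<notin> S" and m2: "m2 \<notin> S" and m12: "m1 \<noteq> m2" and ai: "aint S e a"
    and sr: "\<And>t. semireg S e a t" and free_rad: "free_rad S e a l"
    and orth: "\<And>k. k \<in> S \<Longrightarrow> bb n1 (e k) = 0" "\<And>k. k \<in> S \<Longrightarrow> bb n2 (e k) = 0" "bb n1 n2 = 0"
    and qn: "ex (q n1) l" "ex (q n2) l"
  shows "\<exists>x1 x2. cA S a l x1 \<and> cA S a l x2 \<and>
     aint (insert m2 (insert m1 S)) (e(m1 := n1 + lc S x1 e, m2 := n2 + lc S x2 e)) (a(m1 := l + 1, m2 := l + 1)) \<and>
     (\<forall>t. semireg (insert m2 (insert m1 S)) (e(m1 := n1 + lc S x1 e, m2 := n2 + lc S x2 e)) (a(m1 := l + 1, m2 := l + 1)) t)"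
proof -
  obtain y where y: "cA S a l y" "lev S e a (l + 1) (lc S y e)" "\<not> cA S a (l + 1) y"
    and H: "\<And>z. cA S a (l + 1) z \<Longrightarrow> lev S e a (l + 2) (lc S z e) \<Longrightarrow> ge (bb (lc S y e) (lc S z e)) (l + 2)"
    using free_rad by (auto simp: free_rad_def)
  have qy: "ex (q (lc S y e)) l" using rad_q[OF sr fin ai y] .
  have "\<exists>c. ex c 0 \<and> ge (q n + c * c * q (lc S y e)) (l + 1)" if qn: "ex (q n) l" for n
  proof -
    obtain c where c: "ge c 0" "ge (q n + c * c * q (lc S y e)) (l + 1)" using sq_approx[OF qy ex_ge[OF qn]] by blast
    have "\<not> ge c (0 + 1)"
    proof
      assume "ge c (0 + 1)"
      then have "ge (c * c * q (lc S y e)) (l + 1)" using ge_mult'[OF ge_mult[of c 1 c 1] ex_ge[OF qy], of "l + 1"] by simp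
      then have "ge (q n + c * c * q (lc S y e) - c * c * q (lc S y e)) (l + 1)" using c(2) ge_diff by blast
      then show False using ex_not_ge[OF qn] by simp
    qed
    then show ?thesis using c exI' by blast
  qed
  then obtain c1 c2 where c: "ex c1 0" "ge (q n1 + c1 * c1 * q (lc S y e)) (l + 1)" "ex c2 0" "ge (q n2 + c2 * c2 * q (lc S y e)) (l + 1)"
    using qn by blast
  have nz: "bb n1 (lc S x e) = 0" "bb n2 (lc S x e) = 0" for x using orth orth_lc by blast+
  have ln: "lev S e a t n1" "lev S e a t n2" for t using orth by (auto simp: lev_def)
  define x1 where "x1 = (\<lambda>k. c1 * y k)"
  define x2 where "x2 = (\<lambda>k. c2 * y k)"
  have v1: "lc S x1 e = sc c1 (lc S y e)" and v2: "lc S x2 e = sc c2 (lc S y e)" unfolding x1_def x2_def by (rule lc_scale)+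
  have cx: "cA S a l x1" "cA S a l x2" unfolding x1_def x2_def using cA_scale0[OF y(1)] c ex_ge by blast+
  define N1 where "N1 = n1 + lc S x1 e"
  define N2 where "N2 = n2 + lc S x2 e"
  have l1: "lev S e a (l + 1) N1" unfolding N1_def v1 using lev_add[OF ln(1) lev_sc0[OF y(2) ex_ge[OF c(1)]]] .
  have l2: "lev S e a (l + 1) N2" unfolding N2_def v2 using lev_add[OF ln(2) lev_sc0[OF y(2) ex_ge[OF c(3)]]] .
  have q1: "ge (q N1) (l + 1)" "ge (q N2) (l + 1)"
    unfolding N1_def N2_def v1 v2 q_add q_sc bb_sc2 using nz c by auto
  let ?S1 = "insert m1 S" and ?e1 = "e(m1 := N1)" and ?a1 = "a(m1 := l + 1)"
  let ?S2 = "insert m2 ?S1" and ?e2 = "e(m1 := N1, m2 := N2)" and ?a2 = "a(m1 := l + 1, m2 := l + 1)"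
  have ne: "k \<noteq> m1" "k \<noteq> m2" if "k \<in> S" for k using that m1 m2 by auto
  have ai1: "aint ?S1 ?e1 ?a1" using add_aint[OF ai m1 l1 q1(1)] .
  have e12: "bb N2 N1 = c1 * c2 * (2 * q (lc S y e))"
    unfolding N1_def N2_def v1 v2 using nz orth(3) bb_sym[of n2 n1] bb_sym[of "lc S y e" n1]
    by (simp add: bb_add bb_add2 bb_sc bb_sc2 bb_self)
  have "ge (bb N2 N1) (l + 1)"
    unfolding e12 using ge_mult'[OF ge_mult[OF ex_ge[OF c(1)] ex_ge[OF c(3)]], of "2 * q (lc S y e)" "l + 1"] ex_ge[OF qy] by simp
  then have "lev ?S1 ?e1 ?a1 (l + 1) N2" using l2 ne by (auto simp: lev_def)
  then have ai2: "aint ?S2 ?e2 ?a2" using m12 m2 q1(2) by (intro add_aint[OF ai1]) auto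
  have "semireg ?S1 ?e1 ?a1 l" using add_other(1)[OF fin m1 ai1 _ sr] by simp
  then have srl: "semireg ?S2 ?e2 ?a2 l" using add_other(1)[OF _ _ ai2] fin m2 m12 by simp
  \<comment> \<open>The difference d = y - w is almost orthogonal to the old family at level l + 1
    and has the same leading value as y; it replaces y in the computation of the radical.\<close>
  obtain w where w: "cA S a (l + 1) w" "lev S e a (l + 2) (lc S y e - lc S w e)"
    using lin_solve[OF fin ai sr y(2)] H by (auto simp: add.assoc)
  define d where "d = lc S y e - lc S w e"
  have yw: "ge (bb (lc S y e) (lc S w e)) (l + 2)"
  proof -
    have "ge (bb (lc S y e - lc S w e) (lc S w e)) (l + 2)" using lev_lc[OF w(2,1)] by (simp add: hc_def algebra_simps)
    moreover have "ge (bb (lc S w e) (lc S w e)) (l + 2)" unfolding bb_self using aint_q[OF fin ai w(1)] by (auto elim!: ge_mono)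
    ultimately have "ge (bb (lc S y e - lc S w e) (lc S w e) + bb (lc S w e) (lc S w e)) (l + 2)" by (rule ge_add)
    then show ?thesis by (simp add: bb_diff)
  qed
  have qdy: "ge (q d - q (lc S y e)) (l + 1)"
  proof -
    have "ge (q (lc S w e) - bb (lc S y e) (lc S w e)) (l + 1)"
      using aint_q[OF fin ai w(1)] ge_mono[OF yw] by (intro ge_diff) auto
    then show ?thesis unfolding d_def q_diff by (rule ge_eq) simp
  qed
  have qd: "ex (q d) l" using ex_add[OF qy qdy] by simp
  have nd: "bb n1 d = 0" "bb n2 d = 0" unfolding d_def bb_diff2 using nz by auto
  have "semireg ?S2 ?e2 ?a2 (l + 1)" unfolding semireg_def
  proof (intro allI impI)
    fix x assume x: "cA ?S2 ?a2 (l + 1) x" "lev ?S2 ?e2 ?a2 (l + 1 + 1) (lc ?S2 x ?e2)" "ge (q (lc ?S2 x ?e2)) (l + 1 + 1)"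
    define u where "u = lc ?S2 x ?e2"
    have xm: "ge (x m1) 0" "ge (x m2) 0" using x(1) m12 by (auto simp: cA_def hc_def)
    have x0: "cA S a (l + 1) x" using x(1) ne by (auto simp: cA_def)
    \<comment> \<open>The total coefficient of y in the combination. Writing u through n1, n2, d and
      the old family makes n1, n2 and d mutually orthogonal.\<close>
    define g where "g = x m1 * c1 + x m2 * c2"
    have g0: "ge g 0" unfolding g_def using xm c ex_ge by (intro ge_add ge_prod0) auto
    define x' where "x' = (\<lambda>k. x k + g * w k)"
    have x': "cA S a (l + 1) x'" unfolding x'_def using cA_add[OF x0 cA_scale0[OF w(1) g0]] .
    have u1: "u = sc (x m2) N2 + (sc (x m1) N1 + lc S x e)"
      unfolding u_def using fin m1 m2 m12 by (simp add: lc_insert lc_upd)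
    have u2: "u = sc (x m1) n1 + sc (x m2) n2 + sc g d + lc S x' e"
    proof -
      have "sc g d = sc g (lc S y e) - sc g (lc S w e)"
        unfolding d_def using sc_add_right[of g "lc S y e - lc S w e" "lc S w e"] by simp
      then show ?thesis unfolding u1 N1_def N2_def v1 v2 x'_def lc_add lc_scale
        by (simp add: sc_add_right sc_sc g_def sc_add algebra_simps)
    qed
    have lu: "lev S e a (l + 2) u" unfolding u_def using x(2) ne by (auto simp: lev_def add.assoc)
    have "lev S e a (l + 2) (u - (sc (x m1) n1 + sc (x m2) n2 + sc g d))"
      using xm g0 w(2) unfolding d_def[symmetric] by (intro lev_diff[OF lu] lev_add lev_sc0 ln)
    then have lx': "lev S e a (l + 2) (lc S x' e)" unfolding u2 by simp
    have xd: "ge (bb (lc S x' e) d) (l + 2)" using lev_lc'[OF w(2) x'] by (simp add: d_def hc_def algebra_simps)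
    \<comment> \<open>Pairing with one corrected vector detects the coefficient of the other: its
      own contribution is small because c was chosen to cancel the value.\<close>
    have small: "ge xb 1" if h: "ge xa 0" "ex ca 0" "ex cb 0" "g = xa * ca + xb * cb" "ge (q na + ca * ca * q (lc S y e)) (l + 1)"
        "ge (bb u (na + sc ca (lc S y e))) (l + 2)" "bb u na = xa * (2 * q na)" for xa xb ca cb na
    proof -
      have "bb u d = g * bb d d + bb (lc S x' e) d" unfolding u2 using nd by (simp add: bb_add bb_sc)
      then have e: "bb u (na + sc ca d) = xa * (2 * (q na + ca * ca * q d)) + xb * (cb * ca * (2 * q d)) + ca * bb (lc S x' e) d"
        unfolding bb_add2 bb_sc2 h(7) bb_self unfolding h(4) by (simp add: algebra_simps)
      have "ge (bb u (lc S w e)) (l + 2)" using lev_lc[OF lu w(1)] by (simp add: hc_def algebra_simps)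
      then have "ge (ca * bb u (lc S w e)) (l + 2)" using ge_mult[OF ex_ge[OF h(2)]] by fastforce
      then have "ge (bb u (na + sc ca (lc S y e)) - ca * bb u (lc S w e)) (l + 2)" using h(6) ge_diff by blast
      then have 1: "ge (bb u (na + sc ca d)) (l + 2)" unfolding d_def by (rule ge_eq) (simp add: bb_add2 bb_sc2 bb_diff2 algebra_simps)
      have "ge (ca * ca * (q d - q (lc S y e))) (l + 1)"
        using ge_mult[OF ge_mult[OF ex_ge[OF h(2)] ex_ge[OF h(2)]] qdy] by simp
      then have "ge ((q na + ca * ca * q (lc S y e)) + ca * ca * (q d - q (lc S y e))) (l + 1)" using h(5) ge_add by blast
      then have "ge (q na + ca * ca * q d) (l + 1)" by (rule ge_eq) (simp add: algebra_simps)
      then have "ge (2 * (q na + ca * ca * q d)) (1 + (l + 1))" by (intro ge_mult) auto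
      then have 2: "ge (xa * (2 * (q na + ca * ca * q d))) (l + 2)" by (rule ge_mult'[OF h(1)]) simp
      have 3: "ge (ca * bb (lc S x' e) d) (l + 2)" using ge_mult[OF ex_ge[OF h(2)] xd] by simp
      have "ge (bb u (na + sc ca d) - xa * (2 * (q na + ca * ca * q d)) - ca * bb (lc S x' e) d) (l + 2)"
        using 1 2 3 by (intro ge_diff)
      then have "ge (xb * (cb * ca * (2 * q d))) (l + 2)" unfolding e by (rule ge_eq) simp
      moreover have "ex (cb * ca * (2 * q d)) (0 + 0 + (1 + l))" using h qd by (intro ex_mult) auto
      ultimately have "ge xb (l + 2 - (0 + 0 + (1 + l)))" using ge_mult_ex by blast
      then show ?thesis by simp
    qed
    have b1: "bb u n1 = x m1 * (2 * q n1)" "bb u n2 = x m2 * (2 * q n2)"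
      unfolding u2 using nd nz orth(3) bb_sym[of d] bb_sym[of "lc S x' e"] bb_sym[of n2 n1]
      by (simp_all add: bb_add bb_sc bb_self)
    have lm: "ge (bb u (n1 + sc c1 (lc S y e))) (l + 2)" "ge (bb u (n2 + sc c2 (lc S y e))) (l + 2)"
    proof -
      have lx: "lev ?S2 ?e2 ?a2 (l + 1 + 1) u" using x(2) by (simp only: u_def)
      have "hc (l + 1 + 1 + (l + 1)) = l + 2" by (simp add: hc_def)
      then have "ge (bb u N1) (l + 2)" "ge (bb u N2) (l + 2)"
        using levD[OF lx, of m1] levD[OF lx, of m2] m12 by simp_all
      then show "ge (bb u (n1 + sc c1 (lc S y e))) (l + 2)" "ge (bb u (n2 + sc c2 (lc S y e))) (l + 2)"
        by (simp_all only: N1_def N2_def v1 v2)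
    qed
    have xm2: "ge (x m2) 1" by (rule small[OF xm(1) c(1) c(3) g_def c(2) lm(1) b1(1)])
    have xm1: "ge (x m1) 1" by (rule small[OF xm(2) c(3) c(1) _ c(4) lm(2) b1(2)]) (simp add: g_def)
    have g1: "ge g 1" unfolding g_def using ge_mult[OF xm1 ex_ge[OF c(1)]] ge_mult[OF xm2 ex_ge[OF c(3)]] by (intro ge_add) auto
    have sq: "ge (z * z * q n) (l + 2)" if "ge z 1" "ex (q n) l" for z n
      using ge_mult'[OF ge_mult[OF that(1) that(1)] ex_ge[OF that(2)]] by simp
    have "q u = x m1 * x m1 * q n1 + x m2 * x m2 * q n2 + g * g * q d + q (lc S x' e) + g * bb (lc S x' e) d"
      unfolding u2 using nd nz orth(3) bb_sym[of d]
      by (simp add: q_add q_sc bb_add bb_add2 bb_sc bb_sc2)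
    then have "q (lc S x' e) = q u - (x m1 * x m1 * q n1 + x m2 * x m2 * q n2 + g * g * q d + g * bb (lc S x' e) d)" by simp
    moreover have "ge (q u - (x m1 * x m1 * q n1 + x m2 * x m2 * q n2 + g * g * q d + g * bb (lc S x' e) d)) (l + 2)"
      using x(3) sq[OF xm1 qn(1)] sq[OF xm2 qn(2)] sq[OF g1 qd] ge_mult'[OF g0 xd, of "l + 2"]
      unfolding u_def[symmetric] by (intro ge_diff ge_add) (auto simp: add.assoc)
    ultimately have "ge (q (lc S x' e)) (l + 2)" by simp
    then have "cA S a (l + 1 + 1) x'" using sr[of "l + 1"] x' lx' unfolding semireg_def by (auto simp: add.assoc)
    moreover have "cA S a (l + 1 + 1) (\<lambda>k. g * w k)" using cA_mono[OF cA_scale[OF w(1) g1]] by simp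
    ultimately have "cA S a (l + 1 + 1) (\<lambda>k. x' k - g * w k)" by (rule cA_diff)
    then have "cA S a (l + 1 + 1) x" by (simp add: x'_def)
    then show "cA ?S2 ?a2 (l + 1 + 1) x" using xm1 xm2 ne by (auto simp: cA_def hc_def)
  qed
  then have "\<forall>t. semireg ?S2 ?e2 ?a2 t" using semireg_all srl by blast
  then show ?thesis using cx ai2 unfolding N1_def N2_def by blast
qed

section \<open>Splitting off nondegenerate binary planes\<close>

text \<open>Modulo the next level the Gram matrix of the plane is antidiagonal with exact entry,
  since 2 q always lies one order higher. Pairing with one basis vector therefore reads off the
  other coefficient; \<open>gen\<close> is used twice by symmetry.\<close>

lemma plane_coeff:
  assumes qi: "ge (q ei) ai" "ge (q ej) aj" and h: "ai + aj = 2 * h" and hh: "ex (bb ei ej) h"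
    and xi: "ge x (hc (t - ai))" "ge y (hc (t - aj))"
    and l: "ge (bb (sc x ei + sc y ej) ei) (hc (t + 1 + ai))" "ge (bb (sc x ei + sc y ej) ej) (hc (t + 1 + aj))"
  shows "ge x (hc (t + 1 - ai))" "ge y (hc (t + 1 - aj))"
proof -
  have gen: "ge y (hc (t + 1 - aj))"
    if qi: "ge (q ei) ai" and h: "ai + aj = 2 * h" and hh: "ex (bb ei ej) h"
      and xi: "ge x (hc (t - ai))" "ge y (hc (t - aj))" and l: "ge (bb (sc x ei + sc y ej) ei) (hc (t + 1 + ai))"
    for ei ej ai aj x y
  proof (cases "odd (t - aj)")
    case True
    then show ?thesis using xi(2) hc_odd[of "t - aj"] by (simp add: algebra_simps)
  next
    case False
    then have "even (t - ai)" using h by presburger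
    then have s: "t = ai + 2 * s" if "s = (t - ai) div 2" for s using that by simp
    define s where "s = (t - ai) div 2"
    note s = s[OF s_def]
    have "ge (x * (2 * q ei)) (s + (ai + 1))" using ge_mult[of x s "2 * q ei" "ai + 1"] xi(1) qi s by simp
    moreover have "hc (t + 1 + ai) = s + (ai + 1)" using s by (auto simp: hc_def)
    ultimately have "ge (bb (sc x ei + sc y ej) ei - x * (2 * q ei)) (s + ai + 1)" using l by (intro ge_diff) (auto simp: algebra_simps)
    then have "ge (y * bb ei ej) (s + ai + 1)" by (simp add: bb_add bb_sc bb_self bb_sym[of ej])
    then have "ge y (s + ai + 1 - h)" using ge_mult_ex[OF hh] by simp
    moreover have "hc (t + 1 - aj) = s + ai + 1 - h" using s h by (auto simp: hc_def)
    ultimately show ?thesis by simp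
  qed
  show "ge y (hc (t + 1 - aj))" by (rule gen[OF qi(1) h hh xi l(1)])
  show "ge x (hc (t + 1 - ai))"
    by (rule gen[of ej aj ai ei y x]) (use qi h hh xi l in \<open>auto simp: bb_sym[of ej] add.commute\<close>)
qed

text \<open>Cramer's rule: the determinant of the polar Gram matrix has exact order 2 h because the
  product of its diagonal entries has higher order. The bounds say that the orthogonal projection to
  the plane respects the filtration.\<close>

lemma plane_proj:
  assumes qi: "ge (q ei) ai" "ge (q ej) aj" and h: "ai + aj = 2 * h" and hh: "ex (bb ei ej) h"
    and u: "ge (bb u ei) (hc (s + ai))" "ge (bb u ej) (hc (s + aj))"
  shows "\<exists>x y. ge x (hc (s - ai)) \<and> ge y (hc (s - aj)) \<and>
     bb (u - sc x ei - sc y ej) ei = 0 \<and> bb (u - sc x ei - sc y ej) ej = 0"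
proof -
  let ?A = "2 * q ei" and ?C = "2 * q ej" and ?H = "bb ei ej"
  define D where "D = ?A * ?C - ?H * ?H"
  have D: "ex D (2 * h)"
  proof -
    have "ex (- (?H * ?H)) (2 * h)" using ex_mult[OF hh hh] by simp
    moreover have "ge (?A * ?C) (2 * h + 1)" using ge_mult'[of ?A "ai + 1" ?C "aj + 1" "2 * h + 1"] qi h by simp
    ultimately have "ex (- (?H * ?H) + ?A * ?C) (2 * h)" by (rule ex_add)
    then show ?thesis by (simp add: D_def)
  qed
  define x where "x = (bb u ei * ?C - bb u ej * ?H) / D"
  define y where "y = (?A * bb u ej - ?H * bb u ei) / D"
  have hh': "hc (s + ai) = hc (s - ai) + ai" "hc (s + aj) = hc (s - aj) + aj"
    using hc_add_double[of "s - ai" ai] hc_add_double[of "s - aj" aj] by (auto simp: algebra_simps)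
  have b: "hc (s - ai) \<le> hc (s + aj) - h" "hc (s - aj) \<le> hc (s + ai) - h"
    using h hc_bounds[of "s + aj"] hc_bounds[of "s + ai"] by (auto simp: hc_le_iff)
  have "ge (bb u ei * ?C - bb u ej * ?H) (hc (s - ai) + 2 * h)"
  proof (rule ge_diff)
    show "ge (bb u ei * ?C) (hc (s - ai) + 2 * h)"
      using ge_mult'[OF u(1), of ?C "aj + 1" "hc (s - ai) + 2 * h"] qi(2) hh' h by simp
    show "ge (bb u ej * ?H) (hc (s - ai) + 2 * h)"
      using ge_mult'[OF u(2) ex_ge[OF hh], of "hc (s - ai) + 2 * h"] b by simp
  qed
  then have x: "ge x (hc (s - ai))" unfolding x_def using ge_divide[OF _ D] by fastforce
  have "ge (?A * bb u ej - ?H * bb u ei) (hc (s - aj) + 2 * h)"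
  proof (rule ge_diff)
    show "ge (?A * bb u ej) (hc (s - aj) + 2 * h)"
      using ge_mult'[OF _ u(2), of ?A "ai + 1" "hc (s - aj) + 2 * h"] qi(1) hh' h by simp
    show "ge (?H * bb u ei) (hc (s - aj) + 2 * h)"
      using ge_mult'[OF ex_ge[OF hh] u(1), of "hc (s - aj) + 2 * h"] b by simp
  qed
  then have y: "ge y (hc (s - aj))" unfolding y_def using ge_divide[OF _ D] by fastforce
  have Dnz: "D \<noteq> 0" using D ex_nz by blast
  have e1: "x * ?A + y * ?H = bb u ei"
  proof -
    have "x * ?A + y * ?H = ((bb u ei * ?C - bb u ej * ?H) * ?A + (?A * bb u ej - ?H * bb u ei) * ?H) / D"
      by (simp add: x_def y_def add_divide_distrib)
    also have "(bb u ei * ?C - bb u ej * ?H) * ?A + (?A * bb u ej - ?H * bb u ei) * ?H = bb u ei * D"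
      by (simp add: D_def algebra_simps)
    finally show ?thesis using Dnz by simp
  qed
  have e2: "x * ?H + y * ?C = bb u ej"
  proof -
    have "x * ?H + y * ?C = ((bb u ei * ?C - bb u ej * ?H) * ?H + (?A * bb u ej - ?H * bb u ei) * ?C) / D"
      by (simp add: x_def y_def add_divide_distrib)
    also have "(bb u ei * ?C - bb u ej * ?H) * ?H + (?A * bb u ej - ?H * bb u ei) * ?C = bb u ej * D"
      by (simp add: D_def algebra_simps)
    finally show ?thesis using Dnz by simp
  qed
  have "bb (u - sc x ei - sc y ej) ei = bb u ei - (x * ?A + y * ?H)"
    by (simp add: bb_diff bb_sc bb_self bb_sym[of ej])
  moreover have "bb (u - sc x ei - sc y ej) ej = bb u ej - (x * ?H + y * ?C)"
    by (simp add: bb_diff bb_sc bb_self)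
  ultimately show ?thesis using x y e1 e2 by (intro exI[of _ x] exI[of _ y]) simp
qed



lemma sc_diff_right: "sc c (x - y) = sc c x - sc c y"
  using sc_add_right[of c "x - y" y] by simp

lemma sc_sum_left: "sc (sum f I) u = (\<Sum>i\<in>I. sc (f i) u)"
  by (induction I rule: infinite_finite_induct) (auto simp: sc_add)

lemma lc_sub: "lc S x (\<lambda>k. e k - sc (g k) u) = lc S x e - sc (\<Sum>k\<in>S. x k * g k) u"
  by (simp add: lc_def sc_diff_right sum_subtractf sc_sum_left sc_sc)

lemma lc_delta: "finite S \<Longrightarrow> i \<in> S \<Longrightarrow> lc S (\<lambda>k. if k = i then c else 0) e = sc c (e i)"
proof -
  assume "finite S" "i \<in> S"
  moreover have "sc (if k = i then c else 0) (e k) = (if k = i then sc c (e i) else 0)" for k by simp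
  ultimately show ?thesis by (simp add: lc_def)
qed

text \<open>The plane is nondegenerate at every level, so radical vectors have trivial plane
  component and the whole question passes to the orthogonal complement \<open>e'\<close>.\<close>

lemma plane_split:
  assumes fin: "finite S" and i: "i \<notin> S" and j: "j \<notin> S" and ij: "i \<noteq> j"
    and ai: "aint (insert i (insert j S)) e a" and h: "a i + a j = 2 * h" and hh: "ex (bb (e i) (e j)) h"
    and lam: "\<And>k. k \<in> S \<Longrightarrow> ge (lam k) (hc (a k - a i))" and mu: "\<And>k. k \<in> S \<Longrightarrow> ge (mu k) (hc (a k - a j))"
    and e': "\<And>k. k \<in> S \<Longrightarrow> e' k = e k - sc (lam k) (e i) - sc (mu k) (e j)"
    and o: "\<And>k. k \<in> S \<Longrightarrow> bb (e' k) (e i) = 0" "\<And>k. k \<in> S \<Longrightarrow> bb (e' k) (e j) = 0"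
  shows "aint S e' a" "semireg (insert i (insert j S)) e a t \<longleftrightarrow> semireg S e' a t"
    "nondeg (insert i (insert j S)) e a t \<longleftrightarrow> nondeg S e' a t"
proof -
  let ?S = "insert i (insert j S)"
  have ne: "k \<noteq> i" "k \<noteq> j" if "k \<in> S" for k using that i j by auto
  have finS: "finite ?S" using fin by simp
  have qij: "ge (q (e i)) (a i)" "ge (q (e j)) (a j)" using ai by (auto simp: aint_def)
  let ?sl = "\<lambda>x. \<Sum>k\<in>S. x k * lam k" and ?sm = "\<lambda>x. \<Sum>k\<in>S. x k * mu k"
  have lce': "lc S x e' = lc S x e - sc (?sl x) (e i) - sc (?sm x) (e j)" for x
  proof -
    have "lc S x e' = lc S x (\<lambda>k. (e k - sc (lam k) (e i)) - sc (mu k) (e j))" by (rule lc_cong) (auto simp: e')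
    then show ?thesis by (simp add: lc_sub)
  qed
  have lcS: "lc ?S x e = sc (x i) (e i) + (sc (x j) (e j) + lc S x e)" for x
    using fin i j ij by (simp add: lc_insert)
  have lcS2: "lc ?S x e = lc S x e' + (sc (x i + ?sl x) (e i) + sc (x j + ?sm x) (e j))" for x
    unfolding lcS lce' sc_add by (simp add: algebra_simps)
  have sl: "ge (?sl x) (hc (t - a i))" "ge (?sm x) (hc (t - a j))" if "cA S a t x" for x t
  proof -
    have "ge (x k * lam k) (hc (t - a i))" "ge (x k * mu k) (hc (t - a j))" if k: "k \<in> S" for k
      using ge_mult_hc[OF cAD[OF \<open>cA S a t x\<close> k] lam[OF k]] ge_mult_hc[OF cAD[OF \<open>cA S a t x\<close> k] mu[OF k]] by auto
    then show "ge (?sl x) (hc (t - a i))" "ge (?sm x) (hc (t - a j))" by (auto intro: ge_sum)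
  qed
  \<comment> \<open>Coordinates in the full family of a combination of the projected vectors
    \<open>e'\<close>.\<close>
  define hat where "hat x = x(i := - ?sl x, j := - ?sm x)" for x
  have hat: "lc ?S (hat x) e = lc S x e'" for x
  proof -
    have s: "?sl (hat x) = ?sl x" "?sm (hat x) = ?sm x" using ne by (auto simp: hat_def intro!: sum.cong)
    have l: "lc S (hat x) e' = lc S x e'" using ne by (intro lc_cong) (auto simp: hat_def)
    show ?thesis unfolding lcS2[of "hat x"] s l using ij by (simp add: hat_def)
  qed
  have cAhat: "cA ?S a t (hat x) \<longleftrightarrow> cA S a t x" for x t
    using sl[of t x] ne ij by (auto simp: cA_def hat_def)
  have u0: "bb (lc S x e') (e i) = 0" "bb (lc S x e') (e j) = 0" for x
    unfolding bb_lc using o by simp_all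
  have bbe': "bb u (e' k) = bb u (e k)" if "bb u (e i) = 0" "bb u (e j) = 0" "k \<in> S" for u k
    using that by (simp add: e' bb_diff2 bb_sc2)
  have levhat: "lev ?S e a s (lc S x e') \<longleftrightarrow> lev S e' a s (lc S x e')" for x s
    unfolding lev_def using u0 bbe' by auto
  have coef: "\<exists>c. cA ?S a (a k) c \<and> e' k = lc ?S c e" if k: "k \<in> S" for k
  proof -
    let ?x = "\<lambda>l. if l = k then 1 else (0::'a)"
    have "cA S a (a k) ?x" by (auto simp: cA_def hc_def)
    then have "cA ?S a (a k) (hat ?x)" using cAhat by blast
    moreover have "lc ?S (hat ?x) e = e' k" unfolding hat using lc_delta[OF fin k, of 1 e'] by (simp add: sc_one)
    ultimately show ?thesis by metis
  qed
  show "aint S e' a" unfolding aint_def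
  proof (intro conjI ballI)
    fix k assume "k \<in> S"
    then obtain c where "cA ?S a (a k) c" "e' k = lc ?S c e" using coef by blast
    then show "ge (q (e' k)) (a k)" using aint_q[OF finS ai] by simp
  next
    fix k l assume "k \<in> S" "l \<in> S"
    then obtain c c' where "cA ?S a (a k) c" "e' k = lc ?S c e" "cA ?S a (a l) c'" "e' l = lc ?S c' e" using coef by meson
    then show "ge (bb (e' k) (e' l)) (hc (a k + a l))" using aint_lc2[OF ai] by simp
  qed
  have up: "ge (x i + ?sl x) (hc (t + 1 - a i)) \<and> ge (x j + ?sm x) (hc (t + 1 - a j)) \<and> lev S e' a (t + 1) (lc S x e') \<and>
     (ge (q (lc ?S x e)) (t + 1) \<longrightarrow> ge (q (lc S x e')) (t + 1)) \<and> cA S a t x"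
    if x: "cA ?S a t x" "lev ?S e a (t + 1) (lc ?S x e)" for x t
  proof -
    let ?u = "lc ?S x e" and ?p = "sc (x i + ?sl x) (e i) + sc (x j + ?sm x) (e j)"
    have x0: "cA S a t x" using x(1) by (auto simp: cA_def)
    have c0: "ge (x i + ?sl x) (hc (t - a i))" "ge (x j + ?sm x) (hc (t - a j))"
      using sl[OF x0] x(1) by (auto intro!: ge_add simp: cA_def)
    have "bb ?p (e i) = bb ?u (e i)" "bb ?p (e j) = bb ?u (e j)" unfolding lcS2[of x] bb_add u0 by simp_all
    then have "ge (bb ?p (e i)) (hc (t + 1 + a i))" "ge (bb ?p (e j)) (hc (t + 1 + a j))" using x(2) by (auto simp: lev_def)
    note c1 = plane_coeff[OF qij h hh c0 this]
    have lx: "lev S e' a (t + 1) (lc S x e')" unfolding lev_def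
    proof
      fix k assume k: "k \<in> S"
      have "bb ?p (e' k) = 0" using o[OF k] by (simp add: bb_add bb_sc bb_sym[of "e i" "e' k"] bb_sym[of "e j" "e' k"])
      then have "bb (lc S x e') (e' k) = bb ?u (e' k)" unfolding lcS2[of x] bb_add by simp
      also have "\<dots> = bb ?u (e k) - lam k * bb ?u (e i) - mu k * bb ?u (e j)" by (simp add: e'[OF k] bb_diff2 bb_sc2)
      finally have eq: "bb (lc S x e') (e' k) = \<dots>" .
      have "ge (bb ?u (e k)) (hc (t + 1 + a k))" using x(2) k by (auto simp: lev_def)
      moreover have "ge (lam k * bb ?u (e i)) (hc (t + 1 + a k))"
        using lam[OF k] x(2) by (intro ge_mult_hc[of _ "a k - a i" _ "t + 1 + a i"]) (auto simp: lev_def)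
      moreover have "ge (mu k * bb ?u (e j)) (hc (t + 1 + a k))"
        using mu[OF k] x(2) by (intro ge_mult_hc[of _ "a k - a j" _ "t + 1 + a j"]) (auto simp: lev_def)
      ultimately show "ge (bb (lc S x e') (e' k)) (hc (t + 1 + a k))" unfolding eq by (intro ge_diff)
    qed
    have "q ?u = q (lc S x e') + q ?p"
      unfolding lcS2[of x] q_add[of "lc S x e'"] bb_add2 bb_sc2 u0 by simp
    moreover have "ge (q ?p) (t + 1)"
    proof -
      have "ge ((x i + ?sl x) * (x i + ?sl x) * q (e i)) (t + 1)" using c1(1) qij(1) by (rule ge_sq_hc)
      moreover have "ge ((x j + ?sm x) * (x j + ?sm x) * q (e j)) (t + 1)" using c1(2) qij(2) by (rule ge_sq_hc)
      moreover have "ge ((x j + ?sm x) * ((x i + ?sl x) * bb (e i) (e j))) (t + 1)"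
        using ge_mult'[OF c1(2) ge_mult[OF c1(1) ex_ge[OF hh]], of "t + 1"] hc_bounds[of "t + 1 - a i"] hc_bounds[of "t + 1 - a j"] h
        by simp
      ultimately show ?thesis unfolding q_add q_sc bb_sc bb_sc2 by (intro ge_add)
    qed
    ultimately have "ge (q (lc S x e')) (t + 1)" if "ge (q ?u) (t + 1)" using ge_diff[OF that] by fastforce
    then show ?thesis using c1 lx x0 by blast
  qed
  have down: "cA ?S a (t + 1) x" if "cA S a (t + 1) x" "ge (x i + ?sl x) (hc (t + 1 - a i))" "ge (x j + ?sm x) (hc (t + 1 - a j))" for x
  proof -
    have "ge (x i + ?sl x - ?sl x) (hc (t + 1 - a i))" "ge (x j + ?sm x - ?sm x) (hc (t + 1 - a j))"
      using ge_diff[OF that(2) sl(1)[OF that(1)]] ge_diff[OF that(3) sl(2)[OF that(1)]] .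
    then show ?thesis using that(1) by (auto simp: cA_def)
  qed
  show "semireg ?S e a t \<longleftrightarrow> semireg S e' a t"
  proof
    assume R: "semireg ?S e a t"
    show "semireg S e' a t" unfolding semireg_def
    proof (intro allI impI)
      fix x assume "cA S a t x" "lev S e' a (t + 1) (lc S x e')" "ge (q (lc S x e')) (t + 1)"
      then have "cA ?S a (t + 1) (hat x)" using R cAhat levhat hat unfolding semireg_def by metis
      then show "cA S a (t + 1) x" using cAhat by blast
    qed
  next
    assume R: "semireg S e' a t"
    show "semireg ?S e a t" unfolding semireg_def
    proof (intro allI impI)
      fix x assume x: "cA ?S a t x" "lev ?S e a (t + 1) (lc ?S x e)" "ge (q (lc ?S x e)) (t + 1)"
      note u = up[OF x(1,2)]
      have "cA S a (t + 1) x" using R u x(3) unfolding semireg_def by blast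
      then show "cA ?S a (t + 1) x" using down u by blast
    qed
  qed
  show "nondeg ?S e a t \<longleftrightarrow> nondeg S e' a t"
  proof
    assume R: "nondeg ?S e a t"
    show "nondeg S e' a t" unfolding nondeg_def
    proof (intro allI impI)
      fix x assume "cA S a t x" "lev S e' a (t + 1) (lc S x e')"
      then have "cA ?S a (t + 1) (hat x)" using R cAhat levhat hat unfolding nondeg_def by metis
      then show "cA S a (t + 1) x" using cAhat by blast
    qed
  next
    assume R: "nondeg S e' a t"
    show "nondeg ?S e a t" unfolding nondeg_def
    proof (intro allI impI)
      fix x assume x: "cA ?S a t x" "lev ?S e a (t + 1) (lc ?S x e)"
      note u = up[OF x(1,2)]
      have "cA S a (t + 1) x" using R u unfolding nondeg_def by blast
      then show "cA ?S a (t + 1) x" using down u by blast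
    qed
  qed
qed

section \<open>Perturbation of a family by terms of higher level\<close>

text \<open>Every bound is one level stronger than the one in \<open>aint\<close>: the two families
  have the same graded quadratic forms. Only Gram entries are compared, not the vectors
  themselves.\<close>

definition close :: "nat set \<Rightarrow> (nat \<Rightarrow> 'b) \<Rightarrow> (nat \<Rightarrow> 'b) \<Rightarrow> (nat \<Rightarrow> int) \<Rightarrow> bool" where
  "close S e f a \<longleftrightarrow> (\<forall>k\<in>S. ge (q (f k) - q (e k)) (a k + 1)) \<and>
     (\<forall>j\<in>S. \<forall>k\<in>S. ge (bb (f j) (f k) - bb (e j) (e k)) (hc (a j + a k + 1)))"

lemma close_refl: "close S e e a" by (simp add: close_def)

lemma close_subset: "close S e f a \<Longrightarrow> T \<subseteq> S \<Longrightarrow> close T e f a" by (auto simp: close_def)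

lemma close_aint: assumes "aint S e a" "close S e f a" shows "aint S f a"
  unfolding aint_def
proof (intro conjI ballI)
  fix k assume k: "k \<in> S"
  have "ge (q (f k) - q (e k)) (a k + 1)" using assms k by (auto simp: close_def)
  then have "ge (q (f k) - q (e k)) (a k)" by (rule ge_mono) simp
  then have "ge (q (e k) + (q (f k) - q (e k))) (a k)" using assms k by (intro ge_add) (auto simp: aint_def)
  then show "ge (q (f k)) (a k)" by simp
next
  fix j k assume jk: "j \<in> S" "k \<in> S"
  have "ge (bb (e j) (e k) + (bb (f j) (f k) - bb (e j) (e k))) (hc (a j + a k))"
  proof (rule ge_add)
    show "ge (bb (f j) (f k) - bb (e j) (e k)) (hc (a j + a k))"
      using assms(2) jk by (intro ge_mono[OF _ hc_mono[of "a j + a k" "a j + a k + 1"]]) (auto simp: close_def)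
  qed (use assms jk in \<open>auto simp: aint_def\<close>)
  then show "ge (bb (f j) (f k)) (hc (a j + a k))" by simp
qed

lemma close_bb1:
  assumes "close S e f a" "cA S a s x" "k \<in> S"
  shows "ge (bb (f k) (lc S x f) - bb (e k) (lc S x e)) (hc (a k + s + 1))"
  unfolding bb_lc2 sum_subtractf[symmetric] right_diff_distrib[symmetric]
proof (rule ge_sum)
  fix j assume "j \<in> S"
  then show "ge (x j * (bb (f k) (f j) - bb (e k) (e j))) (hc (a k + s + 1))"
    using assms by (intro ge_mult_hc[of _ "s - a j" _ "a k + a j + 1"]) (auto simp: close_def cA_def)
qed

lemma close_bb:
  assumes "close S e f a" "cA S a s x" "cA S a t y"
  shows "ge (bb (lc S x f) (lc S y f) - bb (lc S x e) (lc S y e)) (hc (s + t + 1))"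
  unfolding bb_lc[of S x f] bb_lc[of S x e] sum_subtractf[symmetric] right_diff_distrib[symmetric]
proof (rule ge_sum)
  fix j assume j: "j \<in> S"
  then show "ge (x j * (bb (f j) (lc S y f) - bb (e j) (lc S y e))) (hc (s + t + 1))"
    using assms close_bb1[OF assms(1,3) j] by (intro ge_mult_hc[of _ "s - a j" _ "a j + t + 1"]) (auto simp: cA_def)
qed

lemma close_q:
  assumes "finite S" "close S e f a" "cA S a t x" shows "ge (q (lc S x f) - q (lc S x e)) (t + 1)"
  using assms
proof (induction S rule: finite_induct)
  case empty then show ?case by (simp add: lc_def)
next
  case (insert m S)
  have i: "close S e f a" "cA S a t x" using insert.prems close_subset cA_subset by (meson subset_insertI)+
  have xm: "ge (x m) (hc (t - a m))" using insert.prems(2) by (auto simp: cA_def)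
  have "ge (bb (f m) (lc S x f) - bb (e m) (lc S x e)) (hc (a m + t + 1))"
    unfolding bb_lc2 sum_subtractf[symmetric] right_diff_distrib[symmetric]
  proof (rule ge_sum)
    fix j assume "j \<in> S"
    then show "ge (x j * (bb (f m) (f j) - bb (e m) (e j))) (hc (a m + t + 1))"
      using insert.prems by (intro ge_mult_hc[of _ "t - a j" _ "a m + a j + 1"]) (auto simp: close_def cA_def)
  qed
  then have "ge (x m * (bb (f m) (lc S x f) - bb (e m) (lc S x e))) (hc (2 * t + 1))"
    using xm by (intro ge_mult_hc[of _ "t - a m" _ "a m + t + 1"]) auto
  moreover have "ge (x m * x m * (q (f m) - q (e m))) (t + 1)"
  proof (rule ge_sq_hc[of _ _ "a m + 1"])
    show "ge (x m) (hc (t + 1 - (a m + 1)))" using xm by (simp add: algebra_simps)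
  qed (use insert.prems in \<open>auto simp: close_def\<close>)
  moreover have "ge (q (lc S x f) - q (lc S x e)) (t + 1)" using insert.IH i by blast
  ultimately have "ge (x m * x m * (q (f m) - q (e m)) + (q (lc S x f) - q (lc S x e)) + x m * (bb (f m) (lc S x f) - bb (e m) (lc S x e))) (t + 1)"
    by (intro ge_add) auto
  then show ?case unfolding lc_insert[OF insert.hyps] q_add q_sc bb_sc by (rule ge_eq) (simp add: algebra_simps)
qed

text \<open>The vector p2 spans the orthogonal complement of p1 inside the plane; its value is that
  of p1 times the Gram determinant of the plane.\<close>

lemma plane_diag:
  fixes x y u w
  defines "p1 \<equiv> sc x u + sc y w"
  defines "p2 \<equiv> sc (b p1 w) u - sc (b p1 u) w"
  shows "b p1 p2 = 0" "q p2 = - q p1 * (b u w * b u w - q u * q w)"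
proof -
  show "b p1 p2 = 0" unfolding p2_def by (simp add: b_diff2 b_sc2)
  have 1: "b p1 w = x * b u w + y * q w" "b p1 u = x * q u + y * b u w" unfolding p1_def q_def by (simp_all add: b_add b_sc b_sym[of w u])
  have 2: "q p2 = b p1 w * b p1 w * q u + b p1 u * b p1 u * q w - 2 * (b p1 w * b p1 u) * b u w"
    unfolding p2_def q_diff q_sc bb_sc bb_sc2 by (simp add: bb_def algebra_simps)
  have 3: "q p1 = x * x * q u + y * y * q w + 2 * (x * y * b u w)"
    unfolding p1_def q_add q_sc bb_sc bb_sc2 by (simp add: bb_def algebra_simps)
  show "q p2 = - q p1 * (b u w * b u w - q u * q w)"
    unfolding 2 1 3 by (simp add: algebra_simps)
qed

definition diagz :: "nat set \<Rightarrow> (nat \<Rightarrow> 'b) \<Rightarrow> 'a list \<Rightarrow> bool" where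
  "diagz S e d \<longleftrightarrow> length d = card S \<and> (\<forall>x\<in>set d. x \<noteq> 0) \<and>
    (\<exists>P. \<forall>j<length d. \<forall>k<length d. b (lc S (P j) e) (lc S (P k) e) = (if j = k then d ! j else 0))"

lemma bb_eq_0: "bb x y = 0 \<longleftrightarrow> b x y = 0" by (simp add: bb_def)

lemma diagz_plane:
  assumes fin: "finite S" and i: "i \<notin> S" and j: "j \<notin> S" and ij: "i \<noteq> j"
    and e': "\<And>k. k \<in> S \<Longrightarrow> e' k = e k - sc (lam k) (e i) - sc (mu k) (e j)"
    and o: "\<And>k. k \<in> S \<Longrightarrow> bb (e' k) (e i) = 0" "\<And>k. k \<in> S \<Longrightarrow> bb (e' k) (e j) = 0"
    and d: "diagz S e' d"
    and t: "t = q (sc x (e i) + sc y (e j))" "t \<noteq> 0"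
    and D: "D = b (e i) (e j) * b (e i) (e j) - q (e i) * q (e j)" "D \<noteq> 0"
  shows "diagz (insert i (insert j S)) e (t # (- t * D) # d)"
proof -
  let ?S = "insert i (insert j S)"
  have ne: "k \<noteq> i" "k \<noteq> j" if "k \<in> S" for k using that i j by auto
  let ?sl = "\<lambda>x. \<Sum>k\<in>S. x k * lam k" and ?sm = "\<lambda>x. \<Sum>k\<in>S. x k * mu k"
  have lce': "lc S x e' = lc S x e - sc (?sl x) (e i) - sc (?sm x) (e j)" for x
  proof -
    have "lc S x e' = lc S x (\<lambda>k. (e k - sc (lam k) (e i)) - sc (mu k) (e j))" by (rule lc_cong) (auto simp: e')
    then show ?thesis by (simp add: lc_sub)
  qed
  have lcS: "lc ?S x e = sc (x i) (e i) + (sc (x j) (e j) + lc S x e)" for x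
    using fin i j ij by (simp add: lc_insert)
  define hat where "hat x = x(i := - ?sl x, j := - ?sm x)" for x
  have hat: "lc ?S (hat x) e = lc S x e'" for x
  proof -
    have l: "lc S (hat x) e = lc S x e" using ne by (intro lc_cong) (auto simp: hat_def)
    show ?thesis unfolding lcS[of "hat x"] lce' l using ij by (simp add: hat_def sc_minus algebra_simps)
  qed
  define pl where "pl x y = (\<lambda>k. if k = i then x else if k = j then y else (0::'a))" for x y
  have pl: "lc ?S (pl x y) e = sc x (e i) + sc y (e j)" for x y
  proof -
    have "lc S (pl x y) e = lc S (\<lambda>k. 0) e" using ne by (intro lc_cong) (auto simp: pl_def)
    then show ?thesis unfolding lcS[of "pl x y"] using ij by (simp add: pl_def lc_zero)
  qed
  obtain P where P: "\<And>j k. j < length d \<Longrightarrow> k < length d \<Longrightarrow> b (lc S (P j) e') (lc S (P k) e') = (if j = k then d ! j else 0)"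
    and len: "length d = card S" and dnz: "\<forall>x\<in>set d. x \<noteq> 0" using d unfolding diagz_def by blast
  define p1 where "p1 = sc x (e i) + sc y (e j)"
  define p2 where "p2 = sc (b p1 (e j)) (e i) - sc (b p1 (e i)) (e j)"
  have pd: "b p1 p2 = 0" "q p2 = - q p1 * D"
    unfolding D using plane_diag[where x = x and y = y and u = "e i" and w = "e j"] unfolding p1_def p2_def by blast+
  have o': "b (lc S z e') (e i) = 0" "b (lc S z e') (e j) = 0" for z unfolding b_lc using o by (simp_all add: bb_eq_0)
  have op: "b p1 (lc S z e') = 0" "b p2 (lc S z e') = 0" "b (lc S z e') p1 = 0" "b (lc S z e') p2 = 0" for z
    unfolding p1_def p2_def using o'[of z] b_sym[of "lc S z e'"] by (simp_all add: b_add b_add2 b_diff b_diff2 b_sc b_sc2)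
  let ?P = "\<lambda>k. case k of 0 \<Rightarrow> pl x y | Suc k' \<Rightarrow> (case k' of 0 \<Rightarrow> pl (b p1 (e j)) (- b p1 (e i)) | Suc k'' \<Rightarrow> hat (P k''))"
  define pv where "pv k = (case k of 0 \<Rightarrow> p1 | Suc k' \<Rightarrow> (case k' of 0 \<Rightarrow> p2 | Suc k'' \<Rightarrow> lc S (P k'') e'))" for k
  have v: "lc ?S (?P k) e = pv k" for k
    unfolding pv_def using pl[of x y] pl[of "b p1 (e j)" "- b p1 (e i)"] hat
    by (auto simp: p1_def[symmetric] p2_def sc_minus split: nat.split)
  have b11: "b p1 p1 = t" "b p2 p2 = - t * D" "b p2 p1 = 0" using t pd b_sym[of p2 p1] by (simp_all add: p1_def q_def)
  have "b (lc ?S (?P l) e) (lc ?S (?P k) e) = (if l = k then (t # (- t * D) # d) ! l else 0)"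
    if lk: "l < Suc (Suc (length d))" "k < Suc (Suc (length d))" for l k
    unfolding v using lk pd(1) op P b11 unfolding pv_def by (auto simp: nth_Cons split: nat.split)
  then show ?thesis unfolding diagz_def using fin i j ij len dnz t D by (intro conjI exI[of _ ?P]) auto
qed

end

section \<open>Invariants of close families\<close>

context dyadic
begin

text \<open>The signed discriminant. It differs from the discriminant D_B of the form by the square
  4^[n/2].\<close>

definition Dd :: "'a list \<Rightarrow> 'a" where "Dd d = (-1) ^ (length d div 2) * prod_list d"

text \<open>If 1 + 2 w were s^2 (1 + 4 t), then s = 1 + r with r of order at least 1, so s^2 and
  hence 1 + 2 w would be 1 modulo 4, against w being a unit.\<close>

lemma not_unr_1_plus2: assumes w: "ex w 0" shows "\<not> unr (1 + 2 * w)"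
proof
  assume "unr (1 + 2 * w)"
  then obtain s t where st: "s \<noteq> 0" "ge t 0" "1 + 2 * w = s * s * (1 + 4 * t)" by (auto simp: unr_def)
  have "ex (s * s * (1 + 4 * t)) (v s + v s + 0)" using st ex_self by (intro ex_mult ex_1_plus4)
  moreover have "ex (1 + 2 * w) 0" using ex_1_plus2 w ex_ge by blast
  ultimately have es: "ex s 0" using st by (simp add: ex_def)
  define r where "r = s - 1"
  have r0: "ge r 0" unfolding r_def using es ex_ge by (intro ge_diff) auto
  have sr: "s = 1 + r" by (simp add: r_def)
  have "ge (4 * (s * s * t)) 2" using ge_mult'[of 4 2 "s * s * t" 0 2] st es ex_ge by (auto intro!: ge_prod0)
  then have 1: "ge (s * s - (1 + 2 * w)) 2" unfolding st(3) using ge_uminus[of "4 * (s * s * t)" 2] by (simp add: algebra_simps)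
  have "ge ((s * s - (1 + 2 * w)) + 2 * (w - r)) 1" using ge_mono[OF 1] r0 ex_ge[OF w] by (intro ge_add) (auto intro: ge_diff)
  then have "ge (r * r) 1" by (rule ge_eq) (simp add: sr algebra_simps)
  then have r1: "ge r 1" by (rule ge_sq_1)
  have "ge (r * (r + 2)) 2" using ge_mult'[OF r1 ge_add[OF r1, of 2], of 2] by simp
  then have "ge (r * (r + 2) - (s * s - (1 + 2 * w))) 2" using 1 ge_diff by blast
  then have "ge (2 * w) 2" by (rule ge_eq) (simp add: sr algebra_simps)
  then show False using ex_not_ge[OF w] by simp
qed

end

context qspace
begin

lemma aintD: "aint S e a \<Longrightarrow> j \<in> S \<Longrightarrow> k \<in> S \<Longrightarrow> ge (bb (e j) (e k)) (hc (a j + a k))" by (simp add: aint_def)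
lemma closeD: "close S e f a \<Longrightarrow> k \<in> S \<Longrightarrow> ge (q (f k) - q (e k)) (a k + 1)"
  "close S e f a \<Longrightarrow> j \<in> S \<Longrightarrow> k \<in> S \<Longrightarrow> ge (bb (f j) (f k) - bb (e j) (e k)) (hc (a j + a k + 1))" by (simp_all add: close_def)

text \<open>\<open>R t\<close> stands for nondegeneracy at level \<open>t\<close>. In even rank it detects whether the discriminant is unramified; in odd
  rank it holds for one parity of \<open>t\<close>, the one determined by the discriminant.\<close>
definition inv_agree :: "nat \<Rightarrow> (int \<Rightarrow> bool) \<Rightarrow> 'a list \<Rightarrow> 'a list \<Rightarrow> bool" where
  "inv_agree n R d d' \<longleftrightarrow> (if even n then
      (\<forall>t. R t) \<and> unr (Dd d) \<and> unr (Dd d') \<and> is_square (Dd d * Dd d') \<or> (\<forall>t. \<not> R t) \<and> \<not> unr (Dd d) \<and> \<not> unr (Dd d')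
    else (\<exists>p. (\<forall>t. R t \<longleftrightarrow> odd (t - p)) \<and> even (v (prod_list d) - p) \<and> even (v (prod_list d') - p)) \<and> etad d = etad d')"

text \<open>The polar value dominates the diagonal, so the discriminant is a square times 1 + 4 s.
  The explicit s allows discriminants of close planes to be compared modulo 2.\<close>

lemma plane_disc:
  assumes qi: "ge (q u) ai" "ge (q w) aj" and h: "ai + aj = 2 * h" and hh: "ex (bb u w) h"
  shows "\<exists>s. ge s 0 \<and> b u w * b u w - q u * q w = b u w * b u w * (1 + 4 * s) \<and> s = - (q u * q w / (bb u w * bb u w))"
proof -
  define s where "s = - (q u * q w / (bb u w * bb u w))"
  have "ge (q u * q w) (ai + aj)" using qi by (rule ge_mult)
  then have "ge s 0" unfolding s_def using ge_divide[OF _ ex_mult[OF hh hh], of "q u * q w" "ai + aj"] h by simp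
  moreover have "b u w * b u w - q u * q w = b u w * b u w * (1 + 4 * s)"
    using ex_nz[OF hh] by (simp add: s_def bb_def field_simps)
  ultimately show ?thesis using s_def by blast
qed

text \<open>After rescaling w, both basis vectors have level ai and their polar value has exact
  order ai. One of u, w, u + w then has a value of exact order ai.\<close>

lemma plane_vector:
  assumes qi: "ge (q u) ai" "ge (q w) aj" and h: "ai + aj = 2 * h" and hh: "ex (bb u w) h"
  shows "\<exists>x y. ex (q (sc x u + sc y w)) ai"
proof -
  let ?w = "sc (tw (ai - h)) w"
  have qw: "ge (q ?w) ai" unfolding q_sc using ge_mult'[OF ge_mult[OF ex_ge[OF ex_tw] ex_ge[OF ex_tw]] qi(2), of ai "ai - h" "ai - h"] h by simp
  have huw: "ex (bb u ?w) ai" unfolding bb_sc2 using ex_mult[OF ex_tw hh, of "ai - h"] by simp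
  show ?thesis
  proof (cases "ge (q u) (ai + 1)")
    case False
    then have "ex (q (sc 1 u + sc 0 w)) ai" using qi exI' by (simp add: sc_one)
    then show ?thesis by blast
  next
    case u: True
    show ?thesis
    proof (cases "ge (q ?w) (ai + 1)")
      case False
      then have "ex (q (sc 0 u + sc (tw (ai - h)) w)) ai" using qw exI' by simp
      then show ?thesis by blast
    next
      case True
      then have "ex (bb u ?w + (q u + q ?w)) ai" using u huw ge_add ex_add by blast
      then have "ex (q (sc 1 u + sc (tw (ai - h)) w)) ai" by (simp add: sc_one q_add add.commute)
      then show ?thesis by blast
    qed
  qed
qed

lemma etad_1: "c \<noteq> 0 \<Longrightarrow> etad [c] = 1"
  unfolding etad_def using eta_of_diag_hs[of "[c]" "prod_list [c]"] hilbert_square_right[of 1 c] is_square_sq[of "1::'a"] by simp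

lemma diagz_empty: "diagz {} e []" by (simp add: diagz_def)

lemma diagz_single: "q (e i) \<noteq> 0 \<Longrightarrow> diagz {i} e [q (e i)]"
  unfolding diagz_def by (auto intro!: exI[of _ "\<lambda>_ _. 1"] simp: lc_def sc_one q_def)

text \<open>By \<open>etad_step\<close> the plane multiplies the Clifford invariant by a Hilbert
  symbol with an unramified D. This symbol depends only on whether D is a square and on the parity
  of the order of t times the old determinant, and these data agree on both sides.\<close>

lemma inv_agree_plane:
  assumes D: "unr D" "unr D'" "is_square (D * D')" and t: "t \<noteq> 0" "t' \<noteq> 0" "even (v t - v t')"
    and d: "\<forall>x\<in>set d. x \<noteq> 0" "\<forall>x\<in>set d'. x \<noteq> 0" "length d = n" "length d' = n"
    and out: "inv_agree n R d d'"
  shows "inv_agree (Suc (Suc n)) R (t # (- t * D) # d) (t' # (- t' * D') # d')"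
proof -
  have Dnz: "D \<noteq> 0" "D' \<noteq> 0" using D unr_nz by auto
  have pd: "prod_list d \<noteq> 0" "prod_list d' \<noteq> 0" using d prod_list_nz by blast+
  have Dd: "Dd (t # (- t * D) # d) = Dd d * D * (t * t)" for t D d by (simp add: Dd_def ac_simps)
  show ?thesis
  proof (cases "even n")
    case True
    have sq: "is_square (Dd d * D * (t * t) * (Dd d' * D' * (t' * t')))" if "is_square (Dd d * Dd d')"
    proof -
      have "is_square ((Dd d * Dd d') * (D * D') * ((t * t') * (t * t')))" using is_square_mult[OF is_square_mult[OF that D(3)] is_square_sq] .
      then show ?thesis by (simp only: ac_simps)
    qed
    have un: "unr (Dd d * D * (t * t)) \<longleftrightarrow> unr (Dd d)" if "unr D" "t \<noteq> 0" for d D t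
    proof
      assume "unr (Dd d * D * (t * t))"
      then have "unr ((D * (t * t)) * Dd d)" by (simp only: ac_simps)
      then show "unr (Dd d)" using unr_cancel unr_mult[OF that(1) unr_sq[OF that(2)]] by blast
    next
      assume "unr (Dd d)" then show "unr (Dd d * D * (t * t))" using that by (intro unr_mult unr_sq)
    qed
    show ?thesis using True out un[OF D(1) t(1), of d] un[OF D(2) t(2), of d'] sq unfolding inv_agree_def Dd by auto
  next
    case False
    then obtain p where p: "\<And>t. R t \<longleftrightarrow> odd (t - p)" "even (v (prod_list d) - p)" "even (v (prod_list d') - p)" "etad d = etad d'"
      using out unfolding inv_agree_def by auto
    have ev: "even (v (prod_list (t # (- t * D) # d)) - p)" if "even (v (prod_list d) - p)" "t \<noteq> 0" "unr D" "prod_list d \<noteq> 0" for t D d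
    proof -
      have "v (prod_list (t # (- t * D) # d)) = v t + (v t + v D) + v (prod_list d)"
        using that unr_nz[OF that(3)] by (simp add: v_mult)
      then show ?thesis using that(1) unr_v_even[OF that(3)] by simp
    qed
    have hD: "hilbert D (t * prod_list d) = hilbert D' (t' * prod_list d')"
    proof (cases "is_square D")
      case True
      then have "is_square D'" using is_square_cancel D(3) Dnz by blast
      then show ?thesis using True hilbert_square by metis
    next
      case nD: False
      then have nD': "\<not> is_square D'" using is_square_cancel[of D' D] D(3) Dnz by (auto simp: mult.commute)
      have "even (v (t * prod_list d)) \<longleftrightarrow> even (v (t' * prod_list d'))"
        using t pd p(2,3) by (auto simp: v_mult)
      then have "hilbert D (t * prod_list d) = 1 \<longleftrightarrow> hilbert D' (t' * prod_list d') = 1"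
        using hilbert_unr[OF D(1) nD, of "t * prod_list d"] hilbert_unr[OF D(2) nD', of "t' * prod_list d'"] t pd by simp
      then show ?thesis using hilbert_pm by metis
    qed
    have "etad (t # (- t * D) # d) = etad (t' # (- t' * D') # d')"
      using etad_step[OF d(1) _ t(1) D(1)] etad_step[OF d(2) _ t(2) D(2)] False d hD p(4) by simp
    then show ?thesis unfolding inv_agree_def using False p ev[OF p(2) t(1) D(1) pd(1)] ev[OF p(3) t(2) D(2) pd(2)] by auto
  qed
qed

text \<open>When no two vectors pair with the minimal order, every polar Gram entry lies one level
  higher, so all graded polar forms vanish and each piece is its own radical.\<close>

lemma unlinked_lev:
  assumes ai: "aint S e a"
    and no: "\<And>i j h. i \<in> S \<Longrightarrow> j \<in> S \<Longrightarrow> i \<noteq> j \<Longrightarrow> a i + a j = 2 * h \<Longrightarrow> \<not> ex (bb (e i) (e j)) h"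
    and x: "cA S a t x"
  shows "lev S e a (t + 1) (lc S x e)"
proof -
  have s: "ge (bb (e j) (e k)) (hc (a j + a k + 1))" if jk: "j \<in> S" "k \<in> S" for j k
  proof (cases "odd (a j + a k)")
    case True
    then show ?thesis using ai jk hc_odd[OF True] by (auto simp: aint_def)
  next
    case ev: False
    define h where "h = (a j + a k) div 2"
    have h: "a j + a k = 2 * h" using ev by (simp add: h_def)
    show ?thesis
    proof (cases "j = k")
      case True
      have "ge (q (e k)) (a k)" using ai jk by (auto simp: aint_def)
      then show ?thesis using True h by (simp add: bb_self)
    next
      case False
      have "ge (bb (e j) (e k)) h" using aintD[OF ai jk] h by simp
      then have "ge (bb (e j) (e k)) (h + 1)" using no[OF jk False h] exI' by blast
      then show ?thesis using h by simp
    qed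
  qed
  show ?thesis unfolding lev_def bb_lc
  proof (intro ballI ge_sum)
    fix k j assume "k \<in> S" "j \<in> S"
    then show "ge (x j * bb (e j) (e k)) (hc (t + 1 + a k))"
      using cAD[OF x, of j] s[of j k] by (intro ge_mult_hc[of _ "t - a j" _ "a j + a k + 1"]) auto
  qed
qed

lemma ex_close: "ex x k \<Longrightarrow> ge (y - x) (k + 1) \<Longrightarrow> ex y k"
  using ex_add[of x k "y - x"] by simp

text \<open>Either the polar value is minimal, and the discriminant is a square times 1 + 2 g with a
  unit g, or the product of the two values dominates and the discriminant has odd order.\<close>

lemma half_plane_not_unr:
  assumes qi: "ex (q u) ai" "ex (q w) aj" and odd: "odd (ai + aj)" and hh: "ge (bb u w) (hc (ai + aj))"
  shows "\<not> unr (b u w * b u w - q u * q w)" "b u w * b u w - q u * q w \<noteq> 0"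
proof -
  let ?A = "q u * q w"
  have A: "ex (- ?A) (ai + aj)" using ex_mult[OF qi] by simp
  have "\<not> unr (b u w * b u w - ?A) \<and> b u w * b u w - ?A \<noteq> 0"
  proof (cases "ex (bb u w) (hc (ai + aj))")
    case True
    define m where "m = (ai + aj) div 2"
    have m: "ai + aj = 2 * m + 1" using odd unfolding m_def by presburger
    have hm: "hc (ai + aj) = m + 1" using m by simp
    have eb: "ex (b u w) m"
    proof -
      have "ex (bb u w / 2) (m + 1 - 1)" using True hm by (intro ex_divide) auto
      then show ?thesis by (simp add: bb_def)
    qed
    define g where "g = - ?A / (2 * (b u w * b u w))"
    have "ex (2 * (b u w * b u w)) (1 + (m + m))" using eb by (intro ex_mult) auto
    then have "ex g 0" unfolding g_def using ex_divide[OF A] m by fastforce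
    then have nu: "\<not> unr (1 + 2 * g)" by (rule not_unr_1_plus2)
    have eq: "b u w * b u w - ?A = (b u w * b u w) * (1 + 2 * g)" using ex_nz[OF eb] by (simp add: g_def field_simps)
    have "1 + 2 * g \<noteq> 0" using ex_1_plus2[OF ex_ge[OF \<open>ex g 0\<close>]] ex_nz by blast
    then show ?thesis unfolding eq using nu unr_cancel unr_sq ex_nz[OF eb] by (metis mult_eq_0_iff)
  next
    case False
    then have "ge (bb u w) (hc (ai + aj) + 1)" using hh exI' by blast
    then have g: "ge (b u w) (hc (ai + aj))" by (simp add: bb_def)
    have "ai + aj + 1 \<le> hc (ai + aj) + hc (ai + aj)" using odd hc_bounds[of "ai + aj"] by presburger
    then have "ge (b u w * b u w) (ai + aj + 1)" using ge_mult'[OF g g] by blast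
    then have "ex (- ?A + b u w * b u w) (ai + aj)" by (rule ex_add[OF A])
    then have "ex (b u w * b u w - ?A) (ai + aj)" by simp
    then show ?thesis using unr_v_even[of "b u w * b u w - ?A"] odd by (metis ex_def)
  qed
  then show "\<not> unr (b u w * b u w - ?A)" "b u w * b u w - ?A \<noteq> 0" by auto
qed

text \<open>Induction on the rank: a pair with minimal polar value spans a plane, which is split off
  from both families. If no such pair exists, semiregularity leaves at most two vectors, whose
  invariants are explicit.\<close>

lemma close_invariants:
  assumes "finite S" "aint S e a" "\<And>t. semireg S e a t" "close S e f a"
  shows "\<exists>d d'. diagz S e d \<and> diagz S f d' \<and> inv_agree (card S) (nondeg S e a) d d'"
  using assms
proof (induction "card S" arbitrary: S e f rule: less_induct)
  case less
  note fin = less.prems(1) and ai = less.prems(2) and sr = less.prems(3) and cl = less.prems(4)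
  have aif: "aint S f a" using close_aint[OF ai cl] .
  show ?case
  proof (cases "\<exists>i\<in>S. \<exists>j\<in>S. \<exists>h. i \<noteq> j \<and> a i + a j = 2 * h \<and> ex (bb (e i) (e j)) h")
    case True
    then obtain i j h where ij: "i \<in> S" "j \<in> S" "i \<noteq> j" and h: "a i + a j = 2 * h" and hh: "ex (bb (e i) (e j)) h" by blast
    define T where "T = S - {i, j}"
    have ST: "S = insert i (insert j T)" and T: "finite T" "i \<notin> T" "j \<notin> T" using ij fin by (auto simp: T_def)
    have cS: "card S = Suc (Suc (card T))" using T ij unfolding ST by simp
    have q1: "ge (q (e i)) (a i)" "ge (q (e j)) (a j)" "ge (q (f i)) (a i)" "ge (q (f j)) (a j)" using ai aif ij by (auto simp: aint_def)
    have hf: "ex (bb (f i) (f j)) h"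
    proof (rule ex_close[OF hh])
      have "ge (bb (f i) (f j) - bb (e i) (e j)) (hc (a i + a j + 1))" using cl ij by (auto simp: close_def)
      then show "ge (bb (f i) (f j) - bb (e i) (e j)) (h + 1)" using h by simp
    qed
    have "\<exists>x y. ge x (hc (a k - a i)) \<and> ge y (hc (a k - a j)) \<and>
       bb (e k - sc x (e i) - sc y (e j)) (e i) = 0 \<and> bb (e k - sc x (e i) - sc y (e j)) (e j) = 0" if "k \<in> T" for k
      using ai ij that by (intro plane_proj[OF q1(1,2) h hh]) (auto simp: aint_def T_def)
    then obtain lam mu where lm: "\<And>k. k \<in> T \<Longrightarrow> ge (lam k) (hc (a k - a i))" "\<And>k. k \<in> T \<Longrightarrow> ge (mu k) (hc (a k - a j))"
      "\<And>k. k \<in> T \<Longrightarrow> bb (e k - sc (lam k) (e i) - sc (mu k) (e j)) (e i) = 0"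
      "\<And>k. k \<in> T \<Longrightarrow> bb (e k - sc (lam k) (e i) - sc (mu k) (e j)) (e j) = 0" by metis
    define e' where "e' k = e k - sc (lam k) (e i) - sc (mu k) (e j)" for k
    \<comment> \<open>The projection coefficients found for e are applied to f first. By closeness
      the result is orthogonal to the plane of f up to one higher level.\<close>
    define f1 where "f1 k = f k - sc (lam k) (f i) - sc (mu k) (f j)" for k
    define cc where "cc k = (\<lambda>l. if l = i then - lam k else if l = j then - mu k else if l = k then 1 else (0::'a))" for k
    have cce: "lc S (cc k) g = g k - sc (lam k) (g i) - sc (mu k) (g j)" if k: "k \<in> T" for k and g :: "nat \<Rightarrow> 'b"
    proof -
      have "lc T (cc k) g = lc T (\<lambda>l. if l = k then 1 else 0) g" using T k by (intro lc_cong) (auto simp: cc_def)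
      then have "lc T (cc k) g = g k" using lc_delta[OF T(1) k, of 1 g] by (simp add: sc_one)
      then show ?thesis unfolding ST using T ij by (simp add: lc_insert cc_def sc_minus)
    qed
    have ccA: "cA S a (a k) (cc k)" if k: "k \<in> T" for k
      using lm(1,2)[OF k] by (auto simp: cA_def cc_def hc_def)
    have delta: "cA S a (a l) (\<lambda>m. if m = l then 1 else 0)" "lc S (\<lambda>m. if m = l then 1 else 0) g = g l" if "l \<in> S" for l and g :: "nat \<Rightarrow> 'b"
      using lc_delta[OF fin that, of 1 g] by (auto simp: cA_def hc_def sc_one)
    have f1i: "ge (bb (f1 k) (f l)) (hc (a k + 1 + a l))" if k: "k \<in> T" and l: "l \<in> {i, j}" for k l
    proof -
      have lS: "l \<in> S" using l ij by auto
      have "ge (bb (lc S (cc k) f) (f l) - bb (lc S (cc k) e) (e l)) (hc (a k + a l + 1))"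
        using close_bb[OF cl ccA[OF k] delta(1)[OF lS]] unfolding delta(2)[OF lS] .
      moreover have "bb (lc S (cc k) e) (e l) = 0" using lm(3,4)[OF k] l cce[OF k] by auto
      ultimately show ?thesis using cce[OF k, of f] by (simp add: f1_def algebra_simps)
    qed
    have "\<exists>x y. ge x (hc (a k + 1 - a i)) \<and> ge y (hc (a k + 1 - a j)) \<and>
       bb (f1 k - sc x (f i) - sc y (f j)) (f i) = 0 \<and> bb (f1 k - sc x (f i) - sc y (f j)) (f j) = 0" if "k \<in> T" for k
      using f1i[OF that] by (intro plane_proj[OF q1(3,4) h hf]) auto
    then obtain lam' mu' where lm': "\<And>k. k \<in> T \<Longrightarrow> ge (lam' k) (hc (a k + 1 - a i))" "\<And>k. k \<in> T \<Longrightarrow> ge (mu' k) (hc (a k + 1 - a j))"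
      "\<And>k. k \<in> T \<Longrightarrow> bb (f1 k - sc (lam' k) (f i) - sc (mu' k) (f j)) (f i) = 0"
      "\<And>k. k \<in> T \<Longrightarrow> bb (f1 k - sc (lam' k) (f i) - sc (mu' k) (f j)) (f j) = 0" by metis
    \<comment> \<open>The second projection makes \<open>f'\<close> exactly orthogonal and changes
      \<open>f1\<close> only by the vectors with coefficients \<open>gg\<close>, which lie one level
      higher; so \<open>f'\<close> stays close to \<open>e'\<close>.\<close>
    define f' where "f' k = f1 k - sc (lam' k) (f i) - sc (mu' k) (f j)" for k
    have f'2: "f' k = f k - sc (lam k + lam' k) (f i) - sc (mu k + mu' k) (f j)" for k
      unfolding f'_def f1_def sc_add by (simp add: algebra_simps)
    have fT: "f1 k = lc S (cc k) f" "e' k = lc S (cc k) e" if "k \<in> T" for k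
      using cce[OF that] by (simp_all add: f1_def e'_def)
    define gg where "gg k = (\<lambda>l. if l = i then lam' k else if l = j then mu' k else (0::'a))" for k
    have ggA: "cA S a (a k + 1) (gg k)" if k: "k \<in> T" for k
      using lm'(1,2)[OF k] by (auto simp: cA_def gg_def)
    have ggf: "f' k = f1 k - lc S (gg k) f" for k
    proof -
      have "lc T (gg k) f = lc T (\<lambda>l. 0) f" using T by (intro lc_cong) (auto simp: gg_def)
      then show ?thesis unfolding ST f'_def using T ij by (simp add: lc_insert gg_def lc_zero)
    qed
    have cl': "close T e' f' a" unfolding close_def
    proof (intro conjI ballI)
      fix k assume k: "k \<in> T"
      have "ge (bb (f1 k) (lc S (gg k) f)) (a k + 1)"
        using aint_lc2[OF aif ccA[OF k] ggA[OF k]] unfolding fT(1)[OF k] by (simp add: hc_2t1)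
      then have "ge ((q (f1 k) - q (e' k)) + (q (lc S (gg k) f) - bb (f1 k) (lc S (gg k) f))) (a k + 1)"
        using close_q[OF fin cl ccA[OF k]] aint_q[OF fin aif ggA[OF k]] unfolding fT[OF k] by (intro ge_add ge_diff[of "q (lc S (gg k) f)"])
      then show "ge (q (f' k) - q (e' k)) (a k + 1)" unfolding ggf q_diff by (rule ge_eq) simp
    next
      fix k l assume k: "k \<in> T" and l: "l \<in> T"
      have 1: "ge (bb (f1 k) (f1 l) - bb (e' k) (e' l)) (hc (a k + a l + 1))"
        using close_bb[OF cl ccA[OF k] ccA[OF l]] unfolding fT[OF k] fT[OF l] .
      have 2: "ge (bb (f1 k) (lc S (gg l) f)) (hc (a k + a l + 1))"
        using aint_lc2[OF aif ccA[OF k] ggA[OF l]] unfolding fT(1)[OF k] by (simp add: add.assoc)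
      have 3: "ge (bb (lc S (gg k) f) (f1 l)) (hc (a k + a l + 1))"
        using aint_lc2[OF aif ggA[OF k] ccA[OF l]] unfolding fT(1)[OF l] by (simp add: ac_simps)
      have 4: "ge (bb (lc S (gg k) f) (lc S (gg l) f)) (hc (a k + a l + 1))"
        using aint_lc2[OF aif ggA[OF k] cA_mono[OF ggA[OF l], of "a l"]] by (simp add: ac_simps)
      have "ge ((bb (f1 k) (f1 l) - bb (e' k) (e' l)) - bb (f1 k) (lc S (gg l) f) - bb (lc S (gg k) f) (f1 l)
          + bb (lc S (gg k) f) (lc S (gg l) f)) (hc (a k + a l + 1))"
        by (rule ge_add[OF ge_diff[OF ge_diff[OF 1 2] 3] 4])
      then show "ge (bb (f' k) (f' l) - bb (e' k) (e' l)) (hc (a k + a l + 1))"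
        unfolding ggf bb_diff bb_diff2 by (rule ge_eq) simp
    qed
    have oe: "bb (e' k) (e i) = 0" "bb (e' k) (e j) = 0" if "k \<in> T" for k using lm(3,4)[OF that] by (simp_all add: e'_def)
    have of: "bb (f' k) (f i) = 0" "bb (f' k) (f j) = 0" if "k \<in> T" for k using lm'(3,4)[OF that] by (simp_all add: f'_def)
    have ai2: "aint (insert i (insert j T)) e a" using ai ST by simp
    note PS = plane_split[OF T(1) T(2) T(3) ij(3) ai2 h hh lm(1) lm(2) e'_def oe, unfolded ST[symmetric]]
    have srT: "semireg T e' a t" for t using PS(2) sr by blast
    have RR: "nondeg S e a = nondeg T e' a" using PS(3) by blast
    obtain d d' where d: "diagz T e' d" "diagz T f' d'" "inv_agree (card T) (nondeg T e' a) d d'"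
      using less.hyps[of T e' f', OF _ T(1) PS(1) srT cl'] cS by auto
    obtain x y where xy: "ex (q (sc x (e i) + sc y (e j))) (a i)" using plane_vector[OF q1(1,2) h hh] by blast
    obtain x' y' where xy': "ex (q (sc x' (f i) + sc y' (f j))) (a i)" using plane_vector[OF q1(3,4) h hf] by blast
    define t where "t = q (sc x (e i) + sc y (e j))"
    define t' where "t' = q (sc x' (f i) + sc y' (f j))"
    define D where "D = b (e i) (e j) * b (e i) (e j) - q (e i) * q (e j)"
    define D' where "D' = b (f i) (f j) * b (f i) (f j) - q (f i) * q (f j)"
    obtain s where s: "ge s 0" "D = b (e i) (e j) * b (e i) (e j) * (1 + 4 * s)" "s = - (q (e i) * q (e j) / (bb (e i) (e j) * bb (e i) (e j)))"
      using plane_disc[OF q1(1,2) h hh] unfolding D_def by blast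
    obtain s' where s': "ge s' 0" "D' = b (f i) (f j) * b (f i) (f j) * (1 + 4 * s')" "s' = - (q (f i) * q (f j) / (bb (f i) (f j) * bb (f i) (f j)))"
      using plane_disc[OF q1(3,4) h hf] unfolding D'_def by blast
    have bnz: "b (e i) (e j) \<noteq> 0" "b (f i) (f j) \<noteq> 0" using ex_nz[OF hh] ex_nz[OF hf] by (auto simp: bb_def)
    have uD: "unr D" "unr D'" unfolding unr_def using s s' bnz by blast+
    \<comment> \<open>The Artin-Schreier parameters of the two discriminants agree modulo 2, so the
      discriminants agree up to squares.\<close>
    have ss: "ge (s - s') 1"
    proof -
      let ?X = "q (e i) * q (e j)" and ?X' = "q (f i) * q (f j)" and ?H = "bb (e i) (e j)" and ?H' = "bb (f i) (f j)"
      have cq: "ge (q (f i) - q (e i)) (a i + 1)" "ge (q (f j) - q (e j)) (a j + 1)" "ge (?H' - ?H) (h + 1)"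
        using closeD(1)[OF cl ij(1)] closeD(1)[OF cl ij(2)] closeD(2)[OF cl ij(1,2)] h by simp_all
      have "ge ((q (f i) - q (e i)) * q (f j) + q (e i) * (q (f j) - q (e j))) (2 * h + 1)"
        using ge_mult'[OF cq(1) q1(4), of "2 * h + 1"] ge_mult'[OF q1(1) cq(2), of "2 * h + 1"] h by (intro ge_add) auto
      then have X: "ge (?X' - ?X) (2 * h + 1)" by (rule ge_eq) (simp add: algebra_simps)
      have "ge ((?H' - ?H) * (?H' + ?H)) (h + 1 + h)" using cq(3) ex_ge[OF hh] ex_ge[OF hf] by (intro ge_mult ge_add)
      then have Y: "ge (?H' * ?H' - ?H * ?H) (2 * h + 1)" by (rule ge_mono[OF ge_eq]) (simp_all add: algebra_simps)
      have "ge ((?X' - ?X) * (?H * ?H) - ?X * (?H' * ?H' - ?H * ?H)) (2 * h + 1 + 2 * h)"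
      proof (rule ge_diff)
        show "ge ((?X' - ?X) * (?H * ?H)) (2 * h + 1 + 2 * h)" using ge_mult[OF X ge_mult[OF ex_ge[OF hh] ex_ge[OF hh]]] by simp
        show "ge (?X * (?H' * ?H' - ?H * ?H)) (2 * h + 1 + 2 * h)" using ge_mult'[OF ge_mult[OF q1(1,2)] Y] h by simp
      qed
      then have "ge (((?X' - ?X) * (?H * ?H) - ?X * (?H' * ?H' - ?H * ?H)) / ((?H * ?H) * (?H' * ?H'))) (2 * h + 1 + 2 * h - (h + h + (h + h)))"
        by (rule ge_divide) (intro ex_mult hh hf)
      moreover have "((?X' - ?X) * (?H * ?H) - ?X * (?H' * ?H' - ?H * ?H)) / ((?H * ?H) * (?H' * ?H')) = s - s'"
        unfolding s s' using ex_nz[OF hh] ex_nz[OF hf] by (simp add: field_simps)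
      ultimately show ?thesis by simp
    qed
    have sqD: "is_square (D * D')"
    proof -
      have "is_square ((b (e i) (e j) * b (f i) (f j)) * (b (e i) (e j) * b (f i) (f j)) * ((1 + 4 * s) * (1 + 4 * s')))"
        using square_close[OF s(1) s'(1) ss] by (rule is_square_mult[OF is_square_sq])
      moreover have "(b (e i) (e j) * b (f i) (f j)) * (b (e i) (e j) * b (f i) (f j)) * ((1 + 4 * s) * (1 + 4 * s')) = D * D'"
        unfolding s(2) s'(2) by (simp only: ac_simps)
      ultimately show ?thesis by simp
    qed
    have tt: "t \<noteq> 0" "t' \<noteq> 0" "even (v t - v t')" using xy xy' by (auto simp: t_def t'_def ex_def)
    have DP: "diagz S e (t # (- t * D) # d)" unfolding ST
      by (rule diagz_plane[OF T(1) T(2) T(3) ij(3) e'_def oe d(1) t_def tt(1) D_def unr_nz[OF uD(1)]])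
    have DP': "diagz S f (t' # (- t' * D') # d')" unfolding ST
      by (rule diagz_plane[OF T(1) T(2) T(3) ij(3) f'2 of d(2) t'_def tt(2) D'_def unr_nz[OF uD(2)]])
    have "inv_agree (Suc (Suc (card T))) (nondeg S e a) (t # (- t * D) # d) (t' # (- t' * D') # d')"
      unfolding RR using d by (intro inv_agree_plane[OF uD sqD tt]) (auto simp: diagz_def)
    then show ?thesis using DP DP' cS by metis
  next
    case False
    then have no: "\<And>i j h. i \<in> S \<Longrightarrow> j \<in> S \<Longrightarrow> i \<noteq> j \<Longrightarrow> a i + a j = 2 * h \<Longrightarrow> \<not> ex (bb (e i) (e j)) h" by blast
    have L: "lev S e a (t + 1) (lc S x e)" if "cA S a t x" for t x by (rule unlinked_lev[OF ai _ that]) (use no in blast)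
    have delta: "cA S a t (\<lambda>m. if m = l then c else 0)" "lc S (\<lambda>m. if m = l then c else 0) e = sc c (e l)"
      if "l \<in> S" "ge c (hc (t - a l))" for l c t
      using lc_delta[OF fin that(1), of c e] that(2) by (auto simp: cA_def)
    \<comment> \<open>All vectors are radical here, so a larger order of the value would contradict
      semiregularity at the level of the vector.\<close>
    have exq: "ex (q (e i)) (a i)" if i: "i \<in> S" for i
    proof (rule exI')
      show "ge (q (e i)) (a i)" using ai i by (auto simp: aint_def)
      show "\<not> ge (q (e i)) (a i + 1)"
      proof
        assume g: "ge (q (e i)) (a i + 1)"
        let ?x = "\<lambda>m. if m = i then 1 else (0::'a)"
        have x: "cA S a (a i) ?x" "lc S ?x e = e i" using delta[OF i, of 1 "a i"] by (simp_all add: hc_def sc_one)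
        have "cA S a (a i + 1) ?x" using sr[of "a i"] x L[OF x(1)] g by (auto simp: semireg_def)
        then show False using i by (auto simp: cA_def hc_def)
      qed
    qed
    \<comment> \<open>Two vectors with levels of equal parity could be brought to the same level and
      combined, by perfectness, into a radical vector of higher order. Hence three vectors are
      impossible.\<close>
    have par: "odd (a i + a j)" if i: "i \<in> S" and j: "j \<in> S" and ij: "i \<noteq> j" for i j
    proof
      assume ev: "even (a i + a j)"
      define s where "s = (a i - a j) div 2"
      have s: "2 * s = a i - a j" unfolding s_def using ev by simp
      have hs: "hc (a i - a j) = s" using s by (metis hc_double(1))
      let ?w = "sc (tw s) (e j)"
      have qw: "ex (q ?w) (a i)" unfolding q_sc using ex_mult[OF ex_mult[OF ex_tw ex_tw] exq[OF j], of s s] s by simp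
      obtain c where c: "ge c 0" "ge (q (e i) + c * c * q ?w) (a i + 1)" using sq_approx[OF qw ex_ge[OF exq[OF i]]] by blast
      let ?x = "\<lambda>m. (if m = i then 1 else (0::'a)) + (if m = j then c * tw s else 0)"
      have gc: "ge (c * tw s) s" using ge_mult[OF c(1) ex_ge[OF ex_tw]] by simp
      have cx: "cA S a (a i) ?x" using delta(1)[OF i, of 1 "a i"] delta(1)[OF j, of "c * tw s" "a i"] gc hs by (intro cA_add) (simp_all add: hc_def)
      have lx: "lc S ?x e = e i + sc (c * tw s) (e j)"
        using delta(2)[OF i, of 1 "a i"] delta(2)[OF j, of "c * tw s" "a i"] gc hs by (simp add: lc_add sc_one hc_def)
      define h where "h = (a i + a j) div 2"
      have h: "a i + a j = 2 * h" using ev by (simp add: h_def)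
      have "ge (bb (e i) (e j)) h" using aintD[OF ai i j] h by simp
      then have "ge (bb (e i) (e j)) (h + 1)" using no[OF i j ij h] exI' by blast
      then have "ge (c * tw s * bb (e i) (e j)) (a i + 1)" using ge_mult'[OF gc] s h by simp
      then have "ge (q (e i) + c * c * q ?w + c * tw s * bb (e i) (e j)) (a i + 1)" using c(2) ge_add by blast
      then have "ge (q (lc S ?x e)) (a i + 1)" unfolding lx by (rule ge_eq) (simp add: q_add q_sc bb_sc2)
      then have "cA S a (a i + 1) ?x" using sr[of "a i"] cx L[OF cx] by (auto simp: semireg_def)
      then have "ge (?x i) (hc (a i + 1 - a i))" using i by (rule cAD)
      then show False using ij by (simp add: hc_def)
    qed
    have nR: "\<not> nondeg S e a t" if i: "i \<in> S" and ev: "even (t - a i)" for i t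
    proof
      assume R: "nondeg S e a t"
      define s where "s = (t - a i) div 2"
      have s: "t - a i = 2 * s" "t + 1 - a i = 2 * s + 1" using ev by (auto simp: s_def)
      let ?x = "\<lambda>m. if m = i then tw s else 0"
      have "ge (tw s) (hc (t - a i))" using s ex_ge[OF ex_tw] by simp
      then have x: "cA S a t ?x" using delta[OF i] by blast
      then have "cA S a (t + 1) ?x" using R L[OF x] by (auto simp: nondeg_def)
      then have "ge (?x i) (hc (t + 1 - a i))" using i by (rule cAD)
      then show False using s ex_not_ge[OF ex_tw] by simp
    qed
    have exf: "ex (q (f i)) (a i)" if i: "i \<in> S" for i using ex_close[OF exq[OF i]] cl i by (auto simp: close_def)
    show ?thesis
    proof (cases "S = {}")
      case True
      have "unr (Dd [])" using unr_sq[of 1] by (simp add: Dd_def)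
      moreover have "nondeg {} e a t" for t by (simp add: nondeg_def cA_def)
      ultimately have "inv_agree 0 (nondeg {} e a) [] []" using is_square_sq[of "Dd []"] unfolding inv_agree_def by auto
      then show ?thesis unfolding True using diagz_empty by (intro exI[of _ "[]"]) simp
    next
      case False
      then obtain i where i: "i \<in> S" by blast
      show ?thesis
      proof (cases "S = {i}")
        case True
        have R: "nondeg S e a t \<longleftrightarrow> odd (t - a i)" for t
        proof
          show "odd (t - a i)" if "nondeg S e a t" using nR[OF i] that by blast
          show "nondeg S e a t" if o: "odd (t - a i)"
          proof -
            have "hc (t + 1 - a i) = hc (t - a i)" using hc_odd[OF o] by (simp add: algebra_simps)
            then show ?thesis unfolding nondeg_def True by (simp add: cA_def)
          qed
        qed
        have "etad [q (e i)] = etad [q (f i)]" using etad_1 exq[OF i] exf[OF i] by (simp add: ex_def)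
        then have "inv_agree 1 (nondeg S e a) [q (e i)] [q (f i)]" unfolding inv_agree_def
          using R exq[OF i] exf[OF i] by (auto intro!: exI[of _ "a i"] simp: ex_def)
        moreover have "diagz S e [q (e i)]" "diagz S f [q (f i)]" using diagz_single exq[OF i] exf[OF i] ex_nz unfolding True by blast+
        moreover have "card S = 1" using True by simp
        ultimately show ?thesis by metis
      next
        case False
        then obtain j where j: "j \<in> S" "i \<noteq> j" using i by blast
        have S: "S = {i, j}"
        proof (rule ccontr)
          assume "S \<noteq> {i, j}"
          then obtain k where "k \<in> S" "k \<noteq> i" "k \<noteq> j" using i j by blast
          then have "odd (a i + a j)" "odd (a i + a k)" "odd (a j + a k)" using par i j by metis+
          then show False by presburger
        qed
        have odd: "odd (a i + a j)" using par i j by blast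
        have nRt: "\<not> nondeg S e a t" for t
        proof (cases "even (t - a i)")
          case True then show ?thesis using nR i by blast
        next
          case False
          then have "even (t - a j)" using odd by presburger
          then show ?thesis using nR j by blast
        qed
        have hb: "ge (bb (e i) (e j)) (hc (a i + a j))" "ge (bb (f i) (f j)) (hc (a i + a j))"
          using ai aif i j by (auto simp: aint_def)
        have DD: "Dd [t, - t * D] = (t * t) * D" for t D by (simp add: Dd_def)
        have one: "diagz S g [q (g i), - q (g i) * D] \<and> \<not> unr (Dd [q (g i), - q (g i) * D])"
          if g: "ex (q (g i)) (a i)" "ex (q (g j)) (a j)" "ge (bb (g i) (g j)) (hc (a i + a j))"
            and D: "D = b (g i) (g j) * b (g i) (g j) - q (g i) * q (g j)" for g D
        proof -
          note N = half_plane_not_unr[OF g(1,2) odd g(3)]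
          have "diagz (insert i (insert j {})) g [q (g i), - q (g i) * D]"
            by (rule diagz_plane[where x = 1 and y = 0 and e' = g and lam = "\<lambda>_. 0" and mu = "\<lambda>_. 0"])
               (use j ex_nz[OF g(1)] N(2) D in \<open>auto simp: diagz_empty sc_one\<close>)
          moreover have "\<not> unr (Dd [q (g i), - q (g i) * D])"
            unfolding DD using N(1) unr_cancel[OF _ unr_sq[OF ex_nz[OF g(1)]]] D by blast
          ultimately show ?thesis using S by simp
        qed
        have cS: "card S = 2" using S j by simp
        show ?thesis using one[of e, OF exq[OF i] exq[OF j(1)] hb(1) refl] one[of f, OF exf[OF i] exf[OF j(1)] hb(2) refl] nRt
          unfolding cS inv_agree_def by (intro exI conjI) (simp_all, auto)
      qed
    qed
  qed
qed

end

section \<open>The Gross--Keating invariant\<close>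

context dyadic
begin

text \<open>Leibniz expansion with an arbitrary matrix of lower bounds. It is used with bounds
  coming from levels and with the indicator of a block.\<close>

lemma det_ge:
  assumes A: "A \<in> carrier_mat n n"
    and g: "\<And>i j. i < n \<Longrightarrow> j < n \<Longrightarrow> ge (A $$ (i, j)) (g i j)"
    and N: "\<And>p. p permutes {0..<n} \<Longrightarrow> N \<le> (\<Sum>i\<in>{0..<n}. g i (p i))"
  shows "ge (det A) N"
  unfolding det_def'[OF A]
proof (rule ge_sum)
  fix p assume "p \<in> {p. p permutes {0..<n}}"
  then have p: "p permutes {0..<n}" by simp
  have "ge (\<Prod>i\<in>{0..<n}. A $$ (i, p i)) (\<Sum>i\<in>{0..<n}. g i (p i))"
    using permutes_in_image[OF p] by (intro ge_prod g) auto
  then have "ge (\<Prod>i\<in>{0..<n}. A $$ (i, p i)) N" using N[OF p] ge_mono by blast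
  moreover have "signof p = (1::'a) \<or> signof p = (-1::'a)" by (simp add: sign_def)
  ultimately show "ge (signof p * (\<Prod>i = 0..<n. A $$ (i, p i))) N" by auto
qed

lemma det_ge0:
  assumes A: "A \<in> carrier_mat n n" and g: "\<And>i j. i < n \<Longrightarrow> j < n \<Longrightarrow> ge (A $$ (i, j)) 0"
  shows "ge (det A) 0"
  using det_ge[OF A g, of 0] by simp

lemma GL_oD: assumes "GL_o v n U"
  shows "U \<in> carrier_mat n n" "\<And>i j. i < n \<Longrightarrow> j < n \<Longrightarrow> ge (U $$ (i, j)) 0" "ex (det U) 0" "det U \<noteq> 0"
  using assms by (auto simp: GL_o_def intg_def unit_o_def ex_def)

lemma GL_oI: assumes "U \<in> carrier_mat n n" "\<And>i j. i < n \<Longrightarrow> j < n \<Longrightarrow> ge (U $$ (i, j)) 0" "ex (det U) 0"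
  shows "GL_o v n U"
  using assms by (auto simp: GL_o_def intg_def unit_o_def ex_def)

lemma mult_ge0:
  assumes "A \<in> carrier_mat n n" "B \<in> carrier_mat n n" "i < n" "j < n"
    "\<And>i j. i < n \<Longrightarrow> j < n \<Longrightarrow> ge (A $$ (i, j)) 0" "\<And>i j. i < n \<Longrightarrow> j < n \<Longrightarrow> ge (B $$ (i, j)) 0"
  shows "ge ((A * B) $$ (i, j)) 0"
  using assms by (auto simp: scalar_prod_def intro!: ge_sum ge_prod0)

lemma GL_o_mult: assumes "GL_o v n U" "GL_o v n W" shows "GL_o v n (U * W)"
proof (rule GL_oI)
  note U = GL_oD[OF assms(1)] and W = GL_oD[OF assms(2)]
  show "U * W \<in> carrier_mat n n" using U W by simp
  show "ge ((U * W) $$ (i, j)) 0" if "i < n" "j < n" for i j using mult_ge0[OF U(1) W(1) that U(2) W(2)] by simp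
  show "ex (det (U * W)) 0" using det_mult[OF U(1) W(1)] ex_mult[OF U(3) W(3)] by simp
qed

lemma GL_o_inverse: assumes "GL_o v n U"
  shows "\<exists>W. GL_o v n W \<and> U * W = 1\<^sub>m n \<and> W * U = 1\<^sub>m n"
proof -
  note U = GL_oD[OF assms]
  define W where "W = (1 / det U) \<cdot>\<^sub>m adj_mat U"
  note adj = adj_mat[OF U(1)]
  have W: "W \<in> carrier_mat n n" using adj by (simp add: W_def)
  have "U * W = (1 / det U) \<cdot>\<^sub>m (U * adj_mat U)" unfolding W_def using mult_smult_distrib[OF U(1) adj(1)] by simp
  also have "\<dots> = 1\<^sub>m n" unfolding adj(2) using U(4) by (intro eq_matI) auto
  finally have UW: "U * W = 1\<^sub>m n" .
  have WU: "W * U = 1\<^sub>m n" using mat_mult_left_right_inverse[OF U(1) W UW] .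
  have "ge (W $$ (i, j)) 0" if ij: "i < n" "j < n" for i j
  proof -
    have "ge (det (mat_delete U j i)) 0"
    proof (rule det_ge0)
      show "mat_delete U j i \<in> carrier_mat (n - 1) (n - 1)" using U(1) by (auto simp: mat_delete_def)
      fix k l assume "k < n - 1" "l < n - 1"
      then show "ge (mat_delete U j i $$ (k, l)) 0" using U(1,2) by (auto simp: mat_delete_def)
    qed
    then have "ge (cofactor U j i) 0"
      by (cases "even (j + i)") (simp_all add: cofactor_def)
    then have "ge (adj_mat U $$ (i, j)) 0" using ij U(1) by (simp add: adj_mat_def)
    then have "ge (adj_mat U $$ (i, j) / det U) 0" using ge_divide[OF _ U(3)] by fastforce
    then show ?thesis using ij adj(1) U(1) by (simp add: W_def)
  qed
  moreover have "ex (det W) 0"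
  proof -
    have "det U * det W = 1" using det_mult[OF U(1) W] UW by simp
    then have "det W = 1 / det U" using U(4) by (simp add: field_simps)
    then show ?thesis using ex_divide[of 1 0 "det U" 0] U(3) by simp
  qed
  ultimately have "GL_o v n W" using W by (intro GL_oI)
  then show ?thesis using UW WU by blast
qed

lemma finite_lex_max: "finite A \<Longrightarrow> A \<noteq> {} \<Longrightarrow> \<exists>g\<in>A. \<forall>a\<in>A. lexordp_eq a (g :: nat list)"
proof (induction A rule: finite_ne_induct)
  case (singleton x) then show ?case by (simp add: lexordp_eq_refl)
next
  case (insert x F)
  then obtain g where g: "g \<in> F" "\<And>a. a \<in> F \<Longrightarrow> lexordp_eq a g" by blast
  show ?case
  proof (cases "lexordp_eq x g")
    case True then show ?thesis using g by blast
  next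
    case False
    then have "lexordp_eq g x" using lexordp_eq_linear by blast
    then show ?thesis using g lexordp_eq_trans lexordp_eq_refl by blast
  qed
qed

end

section \<open>Uniqueness of the filtration of a maximal basis\<close>

context qspace
begin

text \<open>This condition characterizes the maximal levels: an isotropic vector in the radical of a graded piece allows one level to be raised.\<close>
definition level_max :: "nat \<Rightarrow> (nat \<Rightarrow> 'b) \<Rightarrow> (nat \<Rightarrow> int) \<Rightarrow> bool" where
  "level_max n e a \<longleftrightarrow> (\<forall>t. semireg {k. k < n \<and> a k \<le> t} e a t)"

text \<open>Coordinates of level above t are integral and satisfy the bound at t + 1 anyway;
  subtracting them (\<open>z\<close>) leaves a combination of vectors of level at most t. The second
  family shows that its pairings and its value are those of step t + 1, and semiregularity of that
  initial segment turns this into bounds on the coefficients.\<close>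

lemma norm_step:
  assumes ae: "aint {..<n} e a" and af: "aint {..<n} f c" and level_max: "level_max n e a"
    and M: "\<And>x. lc {..<n} x e = lc {..<n} (M x) f"
    and IH: "\<And>s' x. s' < s \<Longrightarrow> (\<forall>k<n. ge (x k) 0) \<Longrightarrow> cA {..<n} a s' x \<longleftrightarrow> cA {..<n} c s' (M x)"
    and x: "\<forall>k<n. ge (x k) 0" "cA {..<n} c s (M x)"
  shows "cA {..<n} a s x"
proof -
  let ?S = "{..<n}"
  define t where "t = s - 1"
  have st: "s = t + 1" by (simp add: t_def)
  let ?T = "{k. k < n \<and> a k \<le> t}"
  have fin: "finite ?S" "finite ?T" by auto
  have TS: "?T \<subseteq> ?S" by auto
  have "cA ?S c t (M x)" using x(2) st cA_mono by fastforce
  then have xt: "cA ?S a t x" using IH[of t x] x(1) st by simp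
  define z where "z k = (if k \<in> ?T then 0 else x k)" for k
  have z0: "\<forall>k<n. ge (z k) 0" using x(1) by (auto simp: z_def)
  have zs: "cA ?S a s z" unfolding cA_def
  proof
    fix k assume k: "k \<in> ?S"
    show "ge (z k) (hc (s - a k))"
    proof (cases "k \<in> ?T")
      case False
      then have "hc (s - a k) \<le> 0" using k st by (auto simp: hc_le_iff)
      then show ?thesis using z0 k ge_mono by blast
    qed (simp add: z_def)
  qed
  have "cA ?S a t z" using zs st cA_mono by fastforce
  then have zf: "cA ?S c t (M z)" using IH[of t z] z0 st by simp
  let ?u = "lc ?S x e" and ?z = "lc ?S z e"
  have y: "lc ?T x e = ?u - ?z"
  proof -
    have "lc ?T x e = lc ?S (\<lambda>k. x k - z k) e"
      unfolding lc_def by (rule sum.mono_neutral_cong_left) (auto simp: z_def)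
    then show ?thesis by (simp add: lc_diff)
  qed
  have "cA ?T a t x" using xt TS cA_subset by blast
  moreover have "lev ?T e a (t + 1) (lc ?T x e)" unfolding lev_def y bb_diff
  proof (intro ballI ge_diff)
    fix k assume k: "k \<in> ?T"
    let ?d = "\<lambda>m. if m = k then 1 else (0::'a)"
    have d: "lc ?S ?d e = e k" using lc_delta[OF fin(1), of k 1 e] k by (simp add: sc_one)
    have "cA ?S a (a k) ?d" by (auto simp: cA_def hc_def)
    then have "cA ?S c (a k) (M ?d)" using IH[of "a k" ?d] k st by auto
    then have "ge (bb (lc ?S (M x) f) (lc ?S (M ?d) f)) (hc (s + a k))" using aint_lc2[OF af x(2)] by blast
    then show "ge (bb ?u (e k)) (hc (t + 1 + a k))" unfolding M[symmetric] d st .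
    show "ge (bb ?z (e k)) (hc (t + 1 + a k))" using levD[OF aint_lev[OF ae zs], of k] k st by simp
  qed
  moreover have "ge (q (lc ?T x e)) (t + 1)"
  proof -
    have 1: "ge (q ?u) (t + 1)" unfolding M[of x] using aint_q[OF fin(1) af x(2)] st by simp
    have 2: "ge (q ?z) (t + 1)" using aint_q[OF fin(1) ae zs] st by simp
    have "ge (bb (lc ?S (M x) f) (lc ?S (M z) f)) (hc (s + t))" using aint_lc2[OF af x(2) zf] .
    then have 3: "ge (bb ?u ?z) (t + 1)" unfolding M[symmetric] st by (simp add: hc_2t1)
    show ?thesis unfolding y q_diff using 1 2 3 by (intro ge_diff ge_add)
  qed
  ultimately have "cA ?T a (t + 1) x" using level_max unfolding level_max_def semireg_def by blast
  then have "cA ?T a s x" using st by simp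
  moreover have "ge (x k) (hc (s - a k))" if "k < n" "k \<notin> ?T" for k using cAD[OF zs, of k] that by (simp add: z_def)
  ultimately show ?thesis unfolding cA_def by auto
qed

text \<open>Induction on s, with \<open>norm_step\<close> in both directions. At s at most 0 both
  conditions hold for integral coordinates, since the levels are nonnegative. The filtration thus
  depends only on the lattice and the form.\<close>

lemma norm_unique:
  assumes ae: "aint {..<n} e a" and af: "aint {..<n} f c" and level_max: "level_max n e a" "level_max n f c"
    and M: "\<And>x. lc {..<n} x e = lc {..<n} (M x) f" "\<And>x. lc {..<n} x f = lc {..<n} (N x) e"
    and MN: "\<And>x k. k < n \<Longrightarrow> M (N x) k = x k" "\<And>x k. k < n \<Longrightarrow> N (M x) k = x k"
    and I: "\<And>x. \<forall>k<n. ge (x k) 0 \<Longrightarrow> \<forall>k<n. ge (M x k) 0" "\<And>x. \<forall>k<n. ge (x k) 0 \<Longrightarrow> \<forall>k<n. ge (N x k) 0"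
    and pos: "\<And>k. k < n \<Longrightarrow> a k \<ge> 0" "\<And>k. k < n \<Longrightarrow> c k \<ge> 0"
    and x: "\<forall>k<n. ge (x k) 0"
  shows "cA {..<n} a s x \<longleftrightarrow> cA {..<n} c s (M x)"
  using x
proof (induction "nat s" arbitrary: s x rule: less_induct)
  case less
  have cong: "cA {..<n} d s y \<longleftrightarrow> cA {..<n} d s y'" if "\<And>k. k < n \<Longrightarrow> y k = y' k" for d s y y'
    using that by (auto simp: cA_def)
  show ?case
  proof (cases "s \<le> 0")
    case True
    have "ge (y k) (hc (s - d k))" if "d k \<ge> 0" "ge (y k) 0" for d :: "nat \<Rightarrow> int" and y k
      using that True by (intro ge_mono[OF that(2)]) (auto simp: hc_le_iff)
    then show ?thesis using less.prems I(1)[OF less.prems] pos unfolding cA_def by auto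
  next
    case False
    have IH: "cA {..<n} a s' y \<longleftrightarrow> cA {..<n} c s' (M y)" if "s' < s" "\<forall>k<n. ge (y k) 0" for s' y
    proof -
      have "nat s' < nat s" using that(1) False by simp
      then show ?thesis using less.hyps that(2) by blast
    qed
    have IH': "cA {..<n} c s' y \<longleftrightarrow> cA {..<n} a s' (N y)" if "s' < s" "\<forall>k<n. ge (y k) 0" for s' y
    proof -
      have "cA {..<n} c s' (M (N y)) \<longleftrightarrow> cA {..<n} c s' y" by (rule cong) (rule MN(1))
      then show ?thesis using IH[OF that(1) I(2)[OF that(2)]] by blast
    qed
    show ?thesis
    proof
      assume h: "cA {..<n} c s (M x)"
      show "cA {..<n} a s x" by (rule norm_step[OF ae af level_max(1) M(1) IH less.prems h])
    next
      assume h: "cA {..<n} a s x"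
      have "cA {..<n} a s (N (M x)) \<longleftrightarrow> cA {..<n} a s x" by (rule cong) (rule MN(2))
      then have "cA {..<n} a s (N (M x))" using h by blast
      then show "cA {..<n} c s (M x)"
        by (intro norm_step[OF af ae level_max(2) M(2) IH' I(1)[OF less.prems]])
    qed
  qed
qed

end

locale mspace = dyadic v for v :: "'a::field \<Rightarrow> int" +
  fixes n :: nat and B :: "'a mat"
  assumes Bc: "B \<in> carrier_mat n n" and Bs: "transpose_mat B = B"
begin

text \<open>Vectors are functions on all naturals, which form an additive group in every dimension;
  only coordinates below n enter the form.\<close>

definition bf :: "(nat \<Rightarrow> 'a) \<Rightarrow> (nat \<Rightarrow> 'a) \<Rightarrow> 'a" where
  "bf x y = (\<Sum>i<n. \<Sum>j<n. x i * B $$ (i, j) * y j)"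

definition fsc :: "'a \<Rightarrow> (nat \<Rightarrow> 'a) \<Rightarrow> (nat \<Rightarrow> 'a)" where "fsc c x = (\<lambda>i. c * x i)"

lemma B_sym: "i < n \<Longrightarrow> j < n \<Longrightarrow> B $$ (i, j) = B $$ (j, i)"
  using Bs Bc by (metis carrier_matD index_transpose_mat(1))

sublocale qspace v bf fsc
proof
  fix x y z :: "nat \<Rightarrow> 'a" and c d :: 'a
  have "bf x y = (\<Sum>j<n. \<Sum>i<n. x i * B $$ (i, j) * y j)" unfolding bf_def by (rule sum.swap)
  also have "\<dots> = bf y x" unfolding bf_def by (intro sum.cong refl) (simp add: B_sym)
  finally show "bf x y = bf y x" .
  show "bf (x + y) z = bf x z + bf y z" by (simp add: bf_def plus_fun_def distrib_right sum.distrib)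
  show "bf (fsc c x) z = c * bf x z" by (simp add: bf_def fsc_def sum_distrib_left mult.assoc)
qed (auto simp: fsc_def plus_fun_def algebra_simps)

definition fU :: "'a mat \<Rightarrow> nat \<Rightarrow> nat \<Rightarrow> 'a" where
  "fU U j = (\<lambda>i. if i < n then U $$ (i, j) else 0)"

lemma bf_fU: assumes "U \<in> carrier_mat n m" "W \<in> carrier_mat n m'" "j < m" "k < m'"
  shows "bf (fU U j) (fU W k) = (transpose_mat U * B * W) $$ (j, k)"
proof -
  have "(transpose_mat U * B * W) $$ (j, k) = (\<Sum>i<n. U $$ (i, j) * (\<Sum>l<n. B $$ (i, l) * W $$ (l, k)))"
    using assms Bc by (simp add: scalar_prod_def lessThan_atLeast0)
  also have "\<dots> = bf (fU U j) (fU W k)" unfolding bf_def by (simp add: fU_def sum_distrib_left mult.assoc)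
  finally show ?thesis by simp
qed

lemma sum_fun_apply: "(\<Sum>k\<in>S. g k) i = (\<Sum>k\<in>S. (g k :: nat \<Rightarrow> 'a) i)"
  by (induction S rule: infinite_finite_induct) auto

lemma lc_fU: assumes "U \<in> carrier_mat n m" "P \<in> carrier_mat m m'" "j < m'"
  shows "lc {..<m} (\<lambda>k. P $$ (k, j)) (fU U) = fU (U * P) j"
proof
  fix i
  show "lc {..<m} (\<lambda>k. P $$ (k, j)) (fU U) i = fU (U * P) j i"
    using assms unfolding lc_def sum_fun_apply
    by (auto simp: fsc_def fU_def scalar_prod_def lessThan_atLeast0 mult.commute)
qed

lemma S_set_iff:
  assumes "U \<in> carrier_mat n n"
  shows "c \<in> S_set v (transpose_mat U * B * U) \<longleftrightarrow> length c = n \<and> sorted c \<and> aint {..<n} (fU U) (\<lambda>k. int (c ! k))"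
proof -
  let ?B = "transpose_mat U * B * U"
  have dim: "dim_row ?B = n" using assms by simp
  have E: "?B $$ (i, j) = bf (fU U i) (fU U j)" if "i < n" "j < n" for i j using bf_fU[OF assms assms that] by simp
  \<comment> \<open>The half-integral inequality in the definition of S(B) is an integral one with
    the ceiling \<open>hc\<close>.\<close>
  have h: "(x = 0 \<or> int a + int b \<le> 2 * v (2 * x)) \<longleftrightarrow> ge (2 * x) (hc (int a + int b))" for x a b
    by (auto simp: vge_def hc_le_iff)
  have "(\<forall>i<n. vge v (?B $$ (i, i)) (int (c ! i))) \<longleftrightarrow> (\<forall>k\<in>{..<n}. ge (q (fU U k)) (int (c ! k)))"
    by (auto simp: E q_def)
  moreover have "(\<forall>i<n. \<forall>j<n. i \<le> j \<longrightarrow> (?B $$ (i, j) = 0 \<or> 2 * v (2 * ?B $$ (i, j)) \<ge> int (c ! i) + int (c ! j))) \<longleftrightarrow>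
     (\<forall>j\<in>{..<n}. \<forall>k\<in>{..<n}. ge (bb (fU U j) (fU U k)) (hc (int (c ! j) + int (c ! k))))"
  proof -
    have "(\<forall>i<n. \<forall>j<n. i \<le> j \<longrightarrow> (?B $$ (i, j) = 0 \<or> 2 * v (2 * ?B $$ (i, j)) \<ge> int (c ! i) + int (c ! j))) \<longleftrightarrow>
      (\<forall>i<n. \<forall>j<n. i \<le> j \<longrightarrow> ge (bb (fU U i) (fU U j)) (hc (int (c ! i) + int (c ! j))))"
      unfolding bb_def by (auto simp: E h simp del: ge_two_mult)
    also have "\<dots> \<longleftrightarrow> (\<forall>j\<in>{..<n}. \<forall>k\<in>{..<n}. ge (bb (fU U j) (fU U k)) (hc (int (c ! j) + int (c ! k))))"
      by (auto, metis add.commute bb_sym nle_le)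
    finally show ?thesis .
  qed
  ultimately show ?thesis unfolding S_set_def dim aint_def by auto
qed

end

lemma lexordp_nth:
  assumes "length a = length c" "m < length a" "\<And>k. k < m \<Longrightarrow> a ! k = c ! k" "a ! m < (c ! m :: nat)"
  shows "ord_class.lexordp a c"
  using assms
proof (induction a arbitrary: c m)
  case (Cons x a)
  then obtain y c' where c: "c = y # c'" by (cases c) auto
  show ?case
  proof (cases m)
    case 0 then show ?thesis using Cons.prems c by simp
  next
    case (Suc m')
    have "ord_class.lexordp a c'"
    proof (rule Cons.IH)
      show "a ! k = c' ! k" if "k < m'" for k using Cons.prems(3)[of "Suc k"] c Suc that by simp
    qed (use Cons.prems c Suc in auto)
    moreover have "x = y" using Cons.prems(3)[of 0] c Suc by simp
    ultimately show ?thesis using c by simp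
  qed
qed simp

section \<open>Maximal admissible sequences\<close>

context mspace
begin

text \<open>A failure of semiregularity is an isotropic radical vector. Rescaled to have a unit
  coefficient at a suitable index i and stripped of coordinates of higher level, it replaces the
  i-th basis vector, moves to the last place m with the same level r, and receives level r + 1
  there.\<close>

lemma improve_levels:
  assumes U: "GL_o v n U" and c: "c \<in> S_set v (transpose_mat U * B * U)" and nLM: "\<not> level_max n (fU U) (\<lambda>k. int (c ! k))"
  shows "\<exists>U' c'. GL_o v n U' \<and> c' \<in> S_set v (transpose_mat U' * B * U') \<and> ord_class.lexordp c c'"
proof -
  define f where "f = fU U"
  define a where "a k = int (c ! k)" for k
  note U' = GL_oD[OF U]
  have len: "length c = n" and sc: "sorted c" and ai: "aint {..<n} f a"
    using c[unfolded S_set_iff[OF U'(1)]] unfolding f_def a_def by auto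
  obtain t x where viol: "cA {k. k < n \<and> a k \<le> t} a t x" "lev {k. k < n \<and> a k \<le> t} f a (t + 1) (lc {k. k < n \<and> a k \<le> t} x f)"
     "ge (q (lc {k. k < n \<and> a k \<le> t} x f)) (t + 1)" "\<not> cA {k. k < n \<and> a k \<le> t} a (t + 1) x"
    using nLM unfolding level_max_def semireg_def f_def[symmetric] a_def[symmetric] by blast
  define T where "T = {k. k < n \<and> a k \<le> t}"
  note viol = viol[folded T_def]
  have finT: "finite T" and TS: "T \<subseteq> {..<n}" by (auto simp: T_def)
  have aiT: "aint T f a" using ai TS aint_subset by blast
  define Tt where "Tt = {k \<in> T. \<not> ge (x k) (hc (t + 1 - a k))}"
  have Tt: "finite Tt" "Tt \<noteq> {}" using viol(4) finT by (auto simp: Tt_def cA_def)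
  then have "Max (a ` Tt) \<in> a ` Tt" by (intro Max_in) auto
  then obtain i where i: "i \<in> Tt" "a i = Max (a ` Tt)" by auto
  have imax: "a k \<le> a i" if "k \<in> Tt" for k using that Tt(1) i(2) by simp
  define r where "r = a i"
  have iT: "i \<in> T" "\<not> ge (x i) (hc (t + 1 - r))" "i < n" using i(1) by (auto simp: Tt_def r_def T_def)
  have ev: "even (t - r)"
  proof (rule ccontr)
    assume "odd (t - r)"
    then have "hc (t + 1 - r) = hc (t - r)" using hc_odd[of "t - r"] by (simp add: algebra_simps)
    then show False using iT cAD[OF viol(1) iT(1)] by (simp add: r_def)
  qed
  define d where "d = (t - r) div 2"
  have td: "t = r + 2 * d" using ev by (simp add: d_def)
  have "hc (t - r) = d" "hc (t + 1 - r) = d + 1" using td by (simp_all add: hc_def)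
  then have exi: "ex (x i) d" using cAD[OF viol(1) iT(1)] iT(2) by (intro exI') (simp_all add: r_def[symmetric])
  define w where "w = tw (- d)"
  have ew: "ex w (- d)" unfolding w_def by (rule ex_tw)
  \<comment> \<open>The scaled coefficients are divided between y, on levels at most r, and z, on
    levels above r, which lies one step higher. So \<open>Y\<close> is still radical and isotropic,
    and its coefficients are integral.\<close>
  define y where "y k = (if k < n \<and> a k \<le> r then w * x k else 0)" for k
  define z where "z k = (if k \<in> T \<and> \<not> a k \<le> r then w * x k else 0)" for k
  have rt: "k \<in> T" if "k < n" "a k \<le> r" for k using that iT(1) by (auto simp: T_def r_def)
  have hcd: "hc (t - s) = hc (r - s) + d" "hc (t + 1 - s) = hc (r + 1 - s) + d" for s
    using hc_add_double[of "r - s" d] hc_add_double[of "r + 1 - s" d] td by (auto simp: algebra_simps)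
  have zA: "cA T a (r + 1) z" unfolding cA_def
  proof
    fix k assume k: "k \<in> T"
    show "ge (z k) (hc (r + 1 - a k))"
    proof (cases "a k \<le> r")
      case False
      then have "k \<notin> Tt" using imax r_def by force
      then have "ge (x k) (hc (r + 1 - a k) + d)" using k hcd by (simp add: Tt_def)
      then have "ge (w * x k) (hc (r + 1 - a k))" using ge_mult'[OF ex_ge[OF ew]] by fastforce
      then show ?thesis by (simp add: z_def)
    qed (simp add: z_def)
  qed
  have yA: "cA {..<n} a r y" unfolding cA_def
  proof
    fix k assume k: "k \<in> {..<n}"
    show "ge (y k) (hc (r - a k))"
    proof (cases "a k \<le> r")
      case True
      then have "ge (x k) (hc (r - a k) + d)" using cAD[OF viol(1) rt] k hcd by simp
      then have "ge (w * x k) (hc (r - a k))" using ge_mult'[OF ex_ge[OF ew]] by fastforce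
      then show ?thesis by (simp add: y_def)
    qed (simp add: y_def)
  qed
  have y0: "ge (y k) 0" for k
  proof (cases "k < n \<and> a k \<le> r")
    case True
    then have "0 \<le> hc (r - a k)" by (simp add: hc_def)
    then show ?thesis using cAD[OF yA, of k] True ge_mono by blast
  next
    case False then show ?thesis unfolding y_def by (simp only: if_False ge_0)
  qed
  have yi: "ex (y i) 0" using ex_mult[OF ew exi] iT by (simp add: y_def r_def)
  define Y where "Y = lc T y f"
  have Yz: "Y = fsc w (lc T x f) - lc T z f"
  proof -
    have "lc T (\<lambda>k. w * x k) f = lc T (\<lambda>k. y k + z k) f" using TS by (intro lc_cong) (auto simp: y_def z_def)
    then show ?thesis unfolding Y_def lc_scale lc_add by simp
  qed
  have lu: "lev T f a (r + 1) (fsc w (lc T x f))" using lev_sc[OF viol(2) ex_ge[OF ew]] td by (simp add: algebra_simps)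
  have lY: "lev T f a (r + 1) Y" unfolding Yz using lev_diff[OF lu aint_lev[OF aiT zA]] .
  have qY: "ge (q Y) (r + 1)"
  proof -
    have "ge (q (fsc w (lc T x f))) (r + 1)" unfolding q_sc using ge_mult'[OF ge_mult[OF ex_ge[OF ew] ex_ge[OF ew]] viol(3)] td by simp
    moreover have "ge (q (lc T z f)) (r + 1)" using aint_q[OF finT aiT zA] .
    moreover have "ge (bb (fsc w (lc T x f)) (lc T z f)) (r + 1)" using lev_lc[OF lu zA] by simp
    ultimately show ?thesis unfolding Yz q_diff by (intro ge_diff ge_add)
  qed
  have Yn: "Y = lc {..<n} y f"
    unfolding Y_def lc_def by (rule sum.mono_neutral_left) (use TS rt in \<open>auto simp: y_def\<close>)
  define yv where "yv = vec n y"
  define U1 where "U1 = replace_col U (U *\<^sub>v yv) i"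
  have U1c: "U1 \<in> carrier_mat n n" using U'(1) by (simp add: U1_def replace_col_def)
  have U1i: "U1 $$ (k, l) = (if l = i then (\<Sum>j<n. U $$ (k, j) * y j) else U $$ (k, l))" if "k < n" "l < n" for k l
    using that U'(1) by (auto simp: U1_def replace_col_def yv_def scalar_prod_def lessThan_atLeast0)
  have dU1: "ex (det U1) 0"
    using cramer_lemma_mat[OF U'(1), of yv i] iT ex_mult[OF yi U'(3)] by (simp add: U1_def yv_def)
  have U1ge: "ge (U1 $$ (k, l)) 0" if "k < n" "l < n" for k l
    unfolding U1i[OF that] using that U'(2) y0 by (auto intro!: ge_sum ge_prod0)
  have f1: "fU U1 k = (if k = i then Y else f k)" if "k < n" for k
  proof
    fix l
    show "fU U1 k l = (if k = i then Y else f k) l"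
      using that U1i[of l k] unfolding Yn lc_def by (auto simp: sum_fun_apply fU_def f_def fsc_def mult.commute)
  qed
  define Im where "Im = {k. k < n \<and> a k = r}"
  have Im: "finite Im" "i \<in> Im" using iT by (auto simp: Im_def r_def)
  define m where "m = Max Im"
  have mI: "m \<in> Im" unfolding m_def using Im by (intro Max_in) auto
  have m: "m < n" "a m = r" "i \<le> m" using mI Im unfolding m_def by (auto simp: Im_def)
  have amono: "a k \<le> a l" if "k \<le> l" "l < n" for k l using that sc len by (auto simp: a_def sorted_iff_nth_mono)
  have agt: "r + 1 \<le> a k" if "m < k" "k < n" for k
  proof -
    have "k \<notin> Im" using that(1) Im(1) unfolding m_def by (meson Max_ge not_less)
    then have "a k \<noteq> r" using that by (auto simp: Im_def)
    then show ?thesis using amono[of m k] that m by simp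
  qed
  define U2 where "U2 = (if i = m then U1 else swapcols i m U1)"
  have U2c: "U2 \<in> carrier_mat n n" using U1c by (simp add: U2_def)
  have U2G: "GL_o v n U2"
  proof (rule GL_oI[OF U2c])
    show "ge (U2 $$ (k, l)) 0" if "k < n" "l < n" for k l
      using that U1ge U1c iT m by (auto simp: U2_def)
    show "ex (det U2) 0" using dU1 det_swapcols[OF iT(3) m(1) _ U1c] by (auto simp: U2_def)
  qed
  define sr where "sr k = (if k = i then m else k)" for k
  define g where "g = fU U2"
  have gm: "g m = Y"
  proof (cases "i = m")
    case True then show ?thesis using f1[of m] m by (simp add: g_def U2_def)
  next
    case False
    have "fU U2 m = fU U1 i" unfolding fU_def using U1c iT m False by (auto simp: U2_def)
    then show ?thesis using f1[OF iT(3)] by (simp add: g_def)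
  qed
  have gk: "g k = f (sr k)" if "k < n" "k \<noteq> m" for k
  proof (cases "i = m")
    case True then show ?thesis using f1[OF that(1)] that by (simp add: g_def U2_def sr_def)
  next
    case False
    have "fU U2 k = fU U1 (sr k)" unfolding fU_def using U1c iT m False that by (auto simp: U2_def sr_def)
    then show ?thesis using f1[of "sr k"] that m False by (auto simp: g_def sr_def)
  qed
  \<comment> \<open>Every level behind position m is lowered to r + 1. This is harmless for the
    lexicographic order once position m has grown, and it is all that the pairings of
    \<open>Y\<close> with later vectors allow.\<close>
  define c' where "c' = take m c @ replicate (n - m) (Suc (c ! i))"
  have len': "length c' = n" using len m by (simp add: c'_def)
  have c'n: "c' ! k = (if k < m then c ! k else Suc (c ! i))" if "k < n" for k
    using that len m by (simp add: c'_def nth_append)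
  define a' where "a' k = int (c' ! k)" for k
  have a': "a' k = (if k < m then a k else r + 1)" if "k < n" for k using c'n[OF that] by (simp add: a'_def a_def r_def)
  have srn: "sr k < n" if "k < n" for k using that m by (simp add: sr_def)
  have a's: "a' k \<le> a (sr k)" if "k < n" "k \<noteq> m" for k
    using that a'[OF that(1)] agt[of k] m by (auto simp: sr_def r_def)
  have Ysr: "ge (bb Y (g k)) (hc (a' m + a' k))" if k: "k < n" "k \<noteq> m" for k
  proof (cases "k < m")
    case True
    then have "a (sr k) \<le> r" using amono[of k m] m k by (auto simp: sr_def)
    then have "sr k \<in> T" using rt srn k by blast
    then have "ge (bb Y (f (sr k))) (hc (r + 1 + a (sr k)))" using levD[OF lY] by blast
    then show ?thesis unfolding gk[OF k] using a's[OF k] a'[OF m(1)] by (auto elim!: ge_mono intro!: hc_mono)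
  next
    case False
    then have "r + 1 \<le> a (sr k)" using agt[of k] k m by (auto simp: sr_def)
    moreover have "ge (bb Y (f (sr k))) (hc (r + a (sr k)))" unfolding Yn using levD[OF aint_lev[OF ai yA]] srn k by blast
    ultimately have "ge (bb Y (f (sr k))) (r + 1)" by (elim ge_mono) (smt (verit) hc_mono hc_2t1(2))
    moreover have "hc (a' m + a' k) = r + 1" using a' k m False by simp
    ultimately show ?thesis unfolding gk[OF k] by simp
  qed
  have "aint {..<n} g a'" unfolding aint_def
  proof (intro conjI ballI)
    fix k assume "k \<in> {..<n}"
    then have k: "k < n" by simp
    show "ge (q (g k)) (a' k)"
    proof (cases "k = m")
      case True then show ?thesis using qY gm a'[OF k] by simp
    next
      case False
      have "ge (q (f (sr k))) (a (sr k))" using ai srn[OF k] by (simp add: aint_def)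
      then show ?thesis unfolding gk[OF k False] using a's[OF k False] ge_mono by blast
    qed
  next
    fix j k assume "j \<in> {..<n}" "k \<in> {..<n}"
    then have j: "j < n" and k: "k < n" by auto
    show "ge (bb (g j) (g k)) (hc (a' j + a' k))"
    proof (cases "j = m")
      case jm: True
      show ?thesis
      proof (cases "k = m")
        case True
        then show ?thesis using jm gm qY a'[OF m(1)] by (auto simp: bb_self elim!: ge_mono)
      next
        case False then show ?thesis using Ysr[OF k] jm gm by simp
      qed
    next
      case jm: False
      show ?thesis
      proof (cases "k = m")
        case True then show ?thesis using Ysr[OF j jm] gm bb_sym[of "g j" Y] by (simp add: add.commute)
      next
        case False
        have "ge (bb (f (sr j)) (f (sr k))) (hc (a (sr j) + a (sr k)))" using ai srn[OF k] srn[OF j] by (simp add: aint_def)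
        then show ?thesis unfolding gk[OF k False] gk[OF j jm]
          using a's[OF k False] a's[OF j jm] by (elim ge_mono) (auto intro!: hc_mono)
      qed
    qed
  qed
  moreover have "sorted c'"
  proof -
    have "x \<le> Suc (c ! i)" if x: "x \<in> set (take m c)" for x
    proof -
      obtain k where k: "k < m" "x = c ! k" using x len m by (auto simp: in_set_conv_nth)
      then have "a k \<le> r" using amono[of k m] m by simp
      then show ?thesis using k by (simp add: a_def r_def)
    qed
    then show ?thesis using sc by (auto simp: c'_def sorted_append sorted_wrt_take)
  qed
  ultimately have "c' \<in> S_set v (transpose_mat U2 * B * U2)"
    unfolding S_set_iff[OF U2c] g_def a'_def using len' by auto
  moreover have "ord_class.lexordp c c'"
  proof (rule lexordp_nth[of _ _ m])
    have "c ! m = c ! i" using m(2) by (simp add: a_def r_def)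
    then show "c ! m < c' ! m" using c'n[OF m(1)] by simp
  qed (use len len' m c'n in auto)
  ultimately show ?thesis using U2G by blast
qed

lemma SS_iff: "c \<in> SS_set v B \<longleftrightarrow> (\<exists>U. GL_o v n U \<and> c \<in> S_set v (transpose_mat U * B * U))"
  using Bc by (auto simp: SS_set_def)

text \<open>The determinant of 2 B bounds the sum of an admissible sequence: along any permutation p
  the bounds for the entries add up to at least half the sum of c_i + c_p(i). Finiteness makes the
  greatest element exist.\<close>

lemma SS_finite: assumes nd: "det B \<noteq> 0" shows "finite (SS_set v B)"
proof -
  define N where "N = nat (int n + v (det B))"
  have "set c \<subseteq> {..N} \<and> length c = n" if cS: "c \<in> SS_set v B" for c
  proof -
    obtain U where U: "GL_o v n U" and c: "c \<in> S_set v (transpose_mat U * B * U)" using cS unfolding SS_iff by blast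
    note U' = GL_oD[OF U]
    let ?B = "transpose_mat U * B * U"
    have Bc': "?B \<in> carrier_mat n n" using U'(1) Bc by simp
    have len: "length c = n" and ai: "aint {..<n} (fU U) (\<lambda>k. int (c ! k))" using c S_set_iff[OF U'(1)] by auto
    have "ge (det (2 \<cdot>\<^sub>m ?B)) (\<Sum>i\<in>{0..<n}. int (c ! i))"
    proof (rule det_ge[where g = "\<lambda>i j. hc (int (c ! i) + int (c ! j))"])
      show "2 \<cdot>\<^sub>m ?B \<in> carrier_mat n n" using Bc' by simp
      fix i j assume ij: "i < n" "j < n"
      have "ge (2 * ?B $$ (i, j)) (hc (int (c ! i) + int (c ! j)))"
        using aintD[OF ai, of i j] ij bf_fU[OF U'(1) U'(1) ij] by (simp add: bb_def)
      then show "ge ((2 \<cdot>\<^sub>m ?B) $$ (i, j)) (hc (int (c ! i) + int (c ! j)))"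
        using ij U'(1) by (simp del: ge_two_mult index_mult_mat(1))
    next
      fix p assume p: "p permutes {0..<n}"
      have "2 * (\<Sum>i\<in>{0..<n}. int (c ! i)) = (\<Sum>i\<in>{0..<n}. int (c ! i)) + (\<Sum>i\<in>{0..<n}. int (c ! (p i)))"
        using sum.permute[OF p, of "\<lambda>i. int (c ! i)"] by (simp add: comp_def)
      also have "\<dots> = (\<Sum>i\<in>{0..<n}. int (c ! i) + int (c ! (p i)))" by (simp add: sum.distrib)
      also have "\<dots> \<le> (\<Sum>i\<in>{0..<n}. 2 * hc (int (c ! i) + int (c ! (p i))))" by (intro sum_mono hc_bounds)
      also have "\<dots> = 2 * (\<Sum>i\<in>{0..<n}. hc (int (c ! i) + int (c ! (p i))))" by (simp add: sum_distrib_left)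
      finally show "(\<Sum>i\<in>{0..<n}. int (c ! i)) \<le> (\<Sum>i\<in>{0..<n}. hc (int (c ! i) + int (c ! p i)))" by simp
    qed
    moreover have "ex (det (2 \<cdot>\<^sub>m ?B)) (int n + v (det B))"
    proof -
      have dB: "det ?B = det U * det B * det U"
        using det_mult[of "transpose_mat U * B" n U] det_mult[of "transpose_mat U" n B] det_transpose[OF U'(1)] U'(1) Bc by simp
      have "ex (2 ^ n * (det U * det B * det U)) (int n + (0 + v (det B) + 0))"
        unfolding two_power_tw using U'(3) nd by (intro ex_mult ex_tw ex_self)
      then show ?thesis using U'(1) dB by simp
    qed
    ultimately have S: "(\<Sum>i\<in>{0..<n}. int (c ! i)) \<le> int n + v (det B)" by (auto simp: ex_def vge_def)
    have "c ! i \<le> N" if i: "i < n" for i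
    proof -
      have "int (c ! i) \<le> (\<Sum>i\<in>{0..<n}. int (c ! i))" using i by (intro member_le_sum) auto
      then show ?thesis using S by (simp add: N_def)
    qed
    then show ?thesis using len by (auto simp: in_set_conv_nth)
  qed
  then have "SS_set v B \<subseteq> {c. set c \<subseteq> {..N} \<and> length c = n}" by blast
  then show ?thesis using finite_lists_length_eq[of "{..N}" n] finite_subset by blast
qed

lemma GK_max: assumes nd: "det B \<noteq> 0" and ne: "SS_set v B \<noteq> {}"
  shows "GK v B \<in> SS_set v B" "\<And>a. a \<in> SS_set v B \<Longrightarrow> lexordp_eq a (GK v B)"
proof -
  obtain g where g: "g \<in> SS_set v B" "\<forall>a\<in>SS_set v B. lexordp_eq a g" using finite_lex_max[OF SS_finite[OF nd] ne] by blast
  have "GK v B = g" unfolding GK_def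
  proof (rule the_equality)
    show "g \<in> SS_set v B \<and> (\<forall>a\<in>SS_set v B. lexordp_eq a g)" using g by blast
    show "g' = g" if "g' \<in> SS_set v B \<and> (\<forall>a\<in>SS_set v B. lexordp_eq a g')" for g'
      using that g lexordp_eq_antisym by blast
  qed
  then show "GK v B \<in> SS_set v B" "\<And>a. a \<in> SS_set v B \<Longrightarrow> lexordp_eq a (GK v B)" using g by auto
qed

lemma GK_level_max:
  assumes nd: "det B \<noteq> 0" and U: "GL_o v n U" and c: "GK v B \<in> S_set v (transpose_mat U * B * U)"
  shows "level_max n (fU U) (\<lambda>k. int (GK v B ! k))"
proof (rule ccontr)
  assume "\<not> ?thesis"
  then obtain U' c' where c': "GL_o v n U'" "c' \<in> S_set v (transpose_mat U' * B * U')" "ord_class.lexordp (GK v B) c'"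
    using improve_levels[OF U c] by blast
  then have "c' \<in> SS_set v B" unfolding SS_iff by blast
  then have "lexordp_eq c' (GK v B)" using GK_max[OF nd] by blast
  then show False using c'(3) lexordp_conv_lexordp_eq by blast
qed

lemma lc_mat: assumes "U \<in> carrier_mat n n"
  shows "lc {..<n} x (fU U) = (\<lambda>i. if i < n then (\<Sum>k<n. U $$ (i, k) * x k) else 0)"
  unfolding lc_def by (rule ext) (auto simp: sum_fun_apply fU_def fsc_def mult.commute)

text \<open>Column j of P is the coordinate vector of the j-th vector of the second basis, which
  lies in filtration step \<open>c2 ! j\<close> of its own basis. By \<open>norm_unique\<close> it
  lies in the same step for the first basis.\<close>

lemma level_max_entries:
  assumes U: "GL_o v n U1" and P: "GL_o v n P" and c1: "c1 \<in> S_set v (transpose_mat U1 * B * U1)"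
    and c2: "c2 \<in> S_set v (transpose_mat (U1 * P) * B * (U1 * P))"
    and level_max: "level_max n (fU U1) (\<lambda>k. int (c1 ! k))" "level_max n (fU (U1 * P)) (\<lambda>k. int (c2 ! k))"
    and ij: "i < n" "j < n"
  shows "ge (P $$ (i, j)) (hc (int (c2 ! j) - int (c1 ! i)))"
proof -
  let ?a = "\<lambda>k. int (c1 ! k)" and ?c = "\<lambda>k. int (c2 ! k)"
  note U' = GL_oD[OF U] and P' = GL_oD[OF P]
  have U2: "U1 * P \<in> carrier_mat n n" using U' P' by simp
  obtain Q where Q: "GL_o v n Q" "P * Q = 1\<^sub>m n" "Q * P = 1\<^sub>m n" using GL_o_inverse[OF P] by blast
  note Q' = GL_oD[OF Q(1)]
  define M where "M x k = (\<Sum>l<n. Q $$ (k, l) * x l)" for x :: "nat \<Rightarrow> 'a" and k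
  define N where "N x k = (\<Sum>l<n. P $$ (k, l) * x l)" for x :: "nat \<Rightarrow> 'a" and k
  have comp: "(\<Sum>k<n. A $$ (i, k) * (\<Sum>l<n. C $$ (k, l) * x l)) = (\<Sum>l<n. (A * C) $$ (i, l) * x l)"
    if "A \<in> carrier_mat n n" "C \<in> carrier_mat n n" "i < n" for A C :: "'a mat" and i and x :: "nat \<Rightarrow> 'a"
  proof -
    have "(\<Sum>k<n. A $$ (i, k) * (\<Sum>l<n. C $$ (k, l) * x l)) = (\<Sum>k<n. \<Sum>l<n. A $$ (i, k) * C $$ (k, l) * x l)"
      by (simp add: sum_distrib_left mult.assoc)
    also have "\<dots> = (\<Sum>l<n. \<Sum>k<n. A $$ (i, k) * C $$ (k, l) * x l)" by (rule sum.swap)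
    also have "\<dots> = (\<Sum>l<n. (A * C) $$ (i, l) * x l)"
      using that by (intro sum.cong refl) (simp add: scalar_prod_def lessThan_atLeast0 sum_distrib_right)
    finally show ?thesis .
  qed
  have one: "(\<Sum>l<n. (1\<^sub>m n) $$ (i, l) * x l) = x i" if i: "i < n" for i and x :: "nat \<Rightarrow> 'a"
  proof -
    have "(\<Sum>l<n. (1\<^sub>m n) $$ (i, l) * x l) = (\<Sum>l<n. if l = i then x i else 0)" using i by (intro sum.cong refl) auto
    then show ?thesis using i by simp
  qed
  have "cA {..<n} ?a (?c j) (\<lambda>k. P $$ (k, j)) \<longleftrightarrow> cA {..<n} ?c (?c j) (M (\<lambda>k. P $$ (k, j)))"
  proof (rule norm_unique[where e = "fU U1" and f = "fU (U1 * P)" and N = N])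
    show "aint {..<n} (fU U1) ?a" "aint {..<n} (fU (U1 * P)) ?c" using c1 c2 S_set_iff U'(1) U2 by auto
    show "lc {..<n} x (fU U1) = lc {..<n} (M x) (fU (U1 * P))" for x
    proof -
      have "(U1 * P) * Q = U1" using U'(1) P'(1) Q'(1) Q(2) by (simp add: assoc_mult_mat[of _ n n _ n _ n])
      then show ?thesis unfolding lc_mat[OF U'(1)] lc_mat[OF U2] M_def using comp[OF U2 Q'(1)] by auto
    qed
    show "lc {..<n} x (fU (U1 * P)) = lc {..<n} (N x) (fU U1)" for x
      unfolding lc_mat[OF U'(1)] lc_mat[OF U2] N_def using comp[OF U'(1) P'(1)] by auto
    show "M (N x) k = x k" if "k < n" for x k unfolding M_def N_def using comp[OF Q'(1) P'(1) that] Q(3) one[OF that] by simp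
    show "N (M x) k = x k" if "k < n" for x k unfolding M_def N_def using comp[OF P'(1) Q'(1) that] Q(2) one[OF that] by simp
    show "\<forall>k<n. ge (M x k) 0" if "\<forall>k<n. ge (x k) 0" for x unfolding M_def using that Q'(2) by (auto intro!: ge_sum ge_prod0)
    show "\<forall>k<n. ge (N x k) 0" if "\<forall>k<n. ge (x k) 0" for x unfolding N_def using that P'(2) by (auto intro!: ge_sum ge_prod0)
    show "\<forall>k<n. ge (P $$ (k, j)) 0" using P'(2) ij by simp
  qed (use level_max in auto)
  moreover have "M (\<lambda>k. P $$ (k, j)) k = (if k = j then 1 else 0)" if "k < n" for k
  proof -
    have "M (\<lambda>k. P $$ (k, j)) k = (Q * P) $$ (k, j)"
      unfolding M_def using that ij P'(1) Q'(1) by (simp add: scalar_prod_def lessThan_atLeast0)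
    then show ?thesis using Q(3) that ij by simp
  qed
  then have "cA {..<n} ?c (?c j) (M (\<lambda>k. P $$ (k, j)))" by (auto simp: cA_def hc_def)
  ultimately have "cA {..<n} ?a (?c j) (\<lambda>k. P $$ (k, j))" by blast
  then show ?thesis using ij by (simp add: cA_def)
qed

text \<open>A larger level at position k would make the block of rows up to k and columns from k
  divisible by 2. Its k + 1 rows and n - k columns meet every permutation, so the determinant could
  not be a unit.\<close>

lemma level_max_levels_le:
  assumes P: "GL_o v n P" and ent: "\<And>i j. i < n \<Longrightarrow> j < n \<Longrightarrow> ge (P $$ (i, j)) (hc (int (c2 ! j) - int (c1 ! i)))"
    and s: "sorted c1" "sorted c2" "length c1 = n" "length c2 = n" and k: "k < n"
  shows "c2 ! k \<le> c1 ! k"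
proof (rule ccontr)
  assume lt: "\<not> c2 ! k \<le> c1 ! k"
  note P' = GL_oD[OF P]
  have "ge (det P) 1"
  proof (rule det_ge[OF P'(1), where g = "\<lambda>i j. if i \<le> k \<and> k \<le> j then 1 else 0"])
    fix i j assume ij: "i < n" "j < n"
    show "ge (P $$ (i, j)) (if i \<le> k \<and> k \<le> j then 1 else 0)"
    proof (cases "i \<le> k \<and> k \<le> j")
      case True
      then have "c1 ! i \<le> c1 ! k" "c2 ! k \<le> c2 ! j" using s ij k by (auto simp: sorted_iff_nth_mono)
      then have "1 \<le> hc (int (c2 ! j) - int (c1 ! i))" using lt hc_bounds[of "int (c2 ! j) - int (c1 ! i)"] by linarith
      then show ?thesis using ent[OF ij] True ge_mono by simp
    qed (use P' ij in auto)
  next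
    fix p assume p: "p permutes {0..<n}"
    have "\<exists>i\<le>k. k \<le> p i"
    proof (rule ccontr)
      assume "\<not> (\<exists>i\<le>k. k \<le> p i)"
      then have "p ` {..k} \<subseteq> {..<k}" by auto
      then have "card (p ` {..k}) \<le> k" using card_mono[of "{..<k}" "p ` {..k}"] by simp
      moreover have "inj_on p {..k}" using permutes_inj_on[OF p] .
      ultimately show False by (simp add: card_image)
    qed
    then obtain i where i: "i \<le> k" "k \<le> p i" by blast
    have "(1::int) \<le> (if i \<le> k \<and> k \<le> p i then 1 else 0)" using i by simp
    also have "\<dots> \<le> (\<Sum>i\<in>{0..<n}. if i \<le> k \<and> k \<le> p i then 1 else 0)"
      using i k by (intro member_le_sum) auto
    finally show "(1::int) \<le> (\<Sum>i = 0..<n. if i \<le> k \<and> k \<le> p i then 1 else 0)" .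
  qed
  then show False using P'(3) by (auto simp: ex_def vge_def)
qed

text \<open>The greatest sequence is realized by a basis that is also \<open>level_max\<close>.
  Comparing this basis with the given one in both directions makes the level sequences equal, so
  \<open>level_max\<close> certifies a Gross-Keating invariant.\<close>

lemma GK_eq:
  assumes nd: "det B \<noteq> 0" and U: "GL_o v n U" and c: "c \<in> S_set v (transpose_mat U * B * U)"
    and level_max: "level_max n (fU U) (\<lambda>k. int (c ! k))"
  shows "GK v B = c"
proof -
  have cS: "c \<in> SS_set v B" unfolding SS_iff using U c by blast
  then have ne: "SS_set v B \<noteq> {}" by blast
  let ?g = "GK v B"
  obtain U0 where U0: "GL_o v n U0" "?g \<in> S_set v (transpose_mat U0 * B * U0)" using GK_max(1)[OF nd ne] unfolding SS_iff by blast
  have LM0: "level_max n (fU U0) (\<lambda>k. int (?g ! k))" using GK_level_max[OF nd U0] .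
  note U' = GL_oD[OF U] and U0' = GL_oD[OF U0(1)]
  obtain W where W: "GL_o v n W" "U * W = 1\<^sub>m n" "W * U = 1\<^sub>m n" using GL_o_inverse[OF U] by blast
  obtain W0 where W0: "GL_o v n W0" "U0 * W0 = 1\<^sub>m n" "W0 * U0 = 1\<^sub>m n" using GL_o_inverse[OF U0(1)] by blast
  note W' = GL_oD[OF W(1)] and W0' = GL_oD[OF W0(1)]
  have e1: "U * (W * U0) = U0" using U'(1) W'(1) U0'(1) W(2) by (simp add: assoc_mult_mat[symmetric, of _ n n _ n _ n])
  have e2: "U0 * (W0 * U) = U" using U'(1) W0'(1) U0'(1) W0(2) by (simp add: assoc_mult_mat[symmetric, of _ n n _ n _ n])
  have G1: "GL_o v n (W * U0)" "GL_o v n (W0 * U)" using GL_o_mult W W0 U U0 by blast+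
  have ent1: "ge ((W * U0) $$ (i, j)) (hc (int (?g ! j) - int (c ! i)))" if "i < n" "j < n" for i j
    using level_max_entries[OF U G1(1) c _ level_max _ that, unfolded e1] U0(2) LM0 by blast
  have ent2: "ge ((W0 * U) $$ (i, j)) (hc (int (c ! j) - int (?g ! i)))" if "i < n" "j < n" for i j
    using level_max_entries[OF U0(1) G1(2) U0(2) _ LM0 _ that, unfolded e2] c level_max by blast
  have s: "sorted c" "sorted ?g" "length c = n" "length ?g = n" using c U0(2) S_set_iff U'(1) U0'(1) by auto
  show ?thesis
  proof (rule nth_equalityI)
    fix k assume "k < length ?g"
    then have k: "k < n" using s by simp
    show "?g ! k = c ! k"
      using level_max_levels_le[OF G1(1) ent1 s k] level_max_levels_le[OF G1(2) ent2 s(2,1,4,3) k] by simp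
  qed (use s in simp)
qed

lemma SS_equiv: assumes U: "GL_o v n U" shows "SS_set v (transpose_mat U * B * U) = SS_set v B"
proof -
  note U' = GL_oD[OF U]
  let ?B = "transpose_mat U * B * U"
  have dim: "dim_row ?B = n" using U'(1) by simp
  have as: "transpose_mat X * ?B * X = transpose_mat (U * X) * B * (U * X)" if "X \<in> carrier_mat n n" for X
    using that U'(1) Bc by (simp add: transpose_mult[of _ n n] assoc_mult_mat[of _ n n _ n _ n])
  have 1: "SS_set v ?B = (\<Union>X\<in>{X. GL_o v n X}. S_set v (transpose_mat (U * X) * B * (U * X)))"
    unfolding SS_set_def dim using as GL_oD(1) by (intro SUP_cong) auto
  have 2: "SS_set v B = (\<Union>X\<in>{X. GL_o v n X}. S_set v (transpose_mat X * B * X))"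
    using Bc by (simp add: SS_set_def)
  obtain W where W: "GL_o v n W" "U * W = 1\<^sub>m n" using GL_o_inverse[OF U] by blast
  note W' = GL_oD[OF W(1)]
  have 3: "\<exists>Y. GL_o v n Y \<and> U * Y = X" if X: "GL_o v n X" for X
  proof (intro exI[of _ "W * X"] conjI)
    show "GL_o v n (W * X)" using GL_o_mult W X by blast
    show "U * (W * X) = X" using U'(1) W'(1) GL_oD(1)[OF X] W(2) by (simp add: assoc_mult_mat[symmetric, of _ n n _ n _ n])
  qed
  show ?thesis unfolding 1 2 using 3 GL_o_mult[OF U] by blast
qed

lemma GK_equiv: "GL_o v n U \<Longrightarrow> GK v (transpose_mat U * B * U) = GK v B"
  unfolding GK_def using SS_equiv by simp

end

section \<open>Gram matrices\<close>

context dyadic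
begin

text \<open>For unramified D the norm form takes even orders only. Otherwise an odd order is
  attained: by -D if D has odd order, and by 1 - D / z^2 = -2 s with a unit s if D = z^2 (1 + 2
  s).\<close>

lemma quad_unramified_iff:
  assumes D: "D \<noteq> 0" shows "quad_unramified v D \<longleftrightarrow> \<not> is_square D \<and> unr D"
proof (cases "is_square D")
  case True then show ?thesis by (simp add: quad_unramified_def)
next
  case ns: False
  show ?thesis
  proof (cases "unr D")
    case True
    then obtain s t where st: "s \<noteq> 0" "ge t 0" "D = s * s * (1 + 4 * t)" by (auto simp: unr_def)
    have ns': "\<not> is_square (1 + 4 * t)" using ns st is_square_mult_sq[of s "1 + 4 * t"] by (simp add: mult.commute)
    have "even (v (a * a - D * b * b))" if "a \<noteq> 0 \<or> b \<noteq> 0" for a b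
    proof -
      have "a \<noteq> 0 \<or> s * b \<noteq> 0" using that st by auto
      then have "even (v (a * a - (1 + 4 * t) * ((s * b) * (s * b))))" using is_norm_unr_parity[OF st(2) ns'] by blast
      moreover have "a * a - (1 + 4 * t) * ((s * b) * (s * b)) = a * a - D * b * b" unfolding st(3) by (simp add: ac_simps)
      ultimately show ?thesis by simp
    qed
    then show ?thesis using ns True by (auto simp: quad_unramified_def)
  next
    case nu: False
    have "\<exists>a b. (a \<noteq> 0 \<or> b \<noteq> 0) \<and> odd (v (a * a - D * b * b))"
    proof (cases "odd (v D)")
      case True
      then show ?thesis by (intro exI[of _ 0] exI[of _ 1]) simp
    next
      case False
      then obtain z s where z: "z \<noteq> 0" "ge s 0" "D = z * z * (1 + 2 * s)" using even_normal[OF D] by blast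
      have "\<not> ge s 1"
      proof
        assume "ge s 1"
        then have "unr (1 + 2 * s)" by (rule unr_1_plus2)
        then show False using nu z unr_mult unr_sq by metis
      qed
      then have "ex (- 2 * s) 1" using z(2) ex_mult[of "-2" 1 s 0] exI'[of s 0] by simp
      moreover have "1 * 1 - D * (1 / z) * (1 / z) = - 2 * s" using z by (simp add: field_simps)
      ultimately show ?thesis by (intro exI[of _ 1] exI[of _ "1 / z"]) (auto simp: ex_def)
    qed
    then show ?thesis using nu by (auto simp: quad_unramified_def)
  qed
qed

definition xid :: "'a \<Rightarrow> int" where "xid D = (if is_square D then 1 else if unr D then -1 else 0)"

lemma xid_cong: assumes "x \<noteq> 0" "y \<noteq> 0" "is_square (x * y)" shows "xid x = xid y"
proof -
  have "is_square x \<longleftrightarrow> is_square y"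
    using is_square_cancel[of x y] is_square_cancel[of y x] assms by (auto simp: mult.commute)
  moreover have "unr x \<longleftrightarrow> unr y"
    using unr_cancel[of x y] unr_cancel[of y x] unr_square[OF assms(3)] assms by (auto simp: mult.commute)
  ultimately show ?thesis by (simp add: xid_def)
qed

lemma xi_xid: assumes "det G \<noteq> 0" shows "xi v G = xid (D_inv G)"
proof -
  have "(-4 :: 'a) \<noteq> 0" using four_nz by simp
  then have "D_inv G \<noteq> 0" using assms unfolding D_inv_def by simp
  then show ?thesis using quad_unramified_iff by (simp add: xi_def xid_def)
qed

lemma xid_zero: "xid D \<noteq> 0 \<longleftrightarrow> unr D" if "D \<noteq> 0"
  using that unr_square by (auto simp: xid_def)

definition zetad :: "'a list \<Rightarrow> int" where "zetad d = (if even (length d) then xid (Dd d) else etad d)"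

text \<open>The property under the choice operator in \<open>eta\<close>, so that the chosen
  diagonalization can be compared with a given one.\<close>

definition dgm :: "'a mat \<Rightarrow> 'a list \<Rightarrow> bool" where
  "dgm G d \<longleftrightarrow> length d = dim_row G \<and> (\<exists>P. P \<in> carrier_mat (dim_row G) (dim_row G) \<and> det P \<noteq> 0 \<and>
             transpose_mat P * G * P = diag_mat_of d)"

lemma det_diag: "det (diag_mat_of d) = prod_list (d :: 'a list)"
proof -
  have "det (diag_mat_of d) = prod_list (diag_mat (diag_mat_of d))"
    by (rule det_upper_triangular[of _ "length d"]) (auto simp: diag_mat_of_def)
  also have "diag_mat (diag_mat_of d) = d" by (rule nth_equalityI) (auto simp: diag_mat_def diag_mat_of_def)
  finally show ?thesis .
qed

lemma dgm_det:
  fixes G :: "'a mat"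
  assumes G: "G \<in> carrier_mat m m" and P: "P \<in> carrier_mat m m" "transpose_mat P * G * P = diag_mat_of d"
  shows "det G * (det P * det P) = prod_list d"
proof -
  have "det (transpose_mat P * G * P) = det P * det G * det P"
    using det_mult[of "transpose_mat P * G" m P] det_mult[of "transpose_mat P" m G] det_transpose[OF P(1)] P(1) G by simp
  then have "prod_list d = det P * det G * det P" using P(2) det_diag[of d] by metis
  then show ?thesis by (simp add: ac_simps)
qed

lemma dgm_disom:
  assumes G: "G \<in> carrier_mat m m" "det G \<noteq> 0" and d: "dgm G d" "dgm G d'"
  shows "disom d d'"
proof -
  obtain P where P: "length d = m" "P \<in> carrier_mat m m" "det P \<noteq> 0" "transpose_mat P * G * P = diag_mat_of d"
    using d(1) G by (auto simp: dgm_def)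
  obtain R where R: "length d' = m" "R \<in> carrier_mat m m" "det R \<noteq> 0" "transpose_mat R * G * R = diag_mat_of d'"
    using d(2) G by (auto simp: dgm_def)
  define W where "W = (1 / det P) \<cdot>\<^sub>m adj_mat P"
  note adj = adj_mat[OF P(2)]
  have W: "W \<in> carrier_mat m m" using adj by (simp add: W_def)
  have "P * W = (1 / det P) \<cdot>\<^sub>m (P * adj_mat P)" unfolding W_def using mult_smult_distrib[OF P(2) adj(1)] by simp
  also have "\<dots> = 1\<^sub>m m" unfolding adj(2) using P(3) by (intro eq_matI) auto
  finally have PW: "P * W = 1\<^sub>m m" .
  define Q where "Q = W * R"
  have Q: "Q \<in> carrier_mat m m" using W R by (simp add: Q_def)
  have PQ: "P * Q = R" unfolding Q_def using P(2) W R(2) PW by (simp add: assoc_mult_mat[symmetric, of _ m m _ m _ m])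
  have "transpose_mat Q * diag_mat_of d * Q = diag_mat_of d'"
  proof -
    have "transpose_mat Q * (transpose_mat P * G * P) * Q = transpose_mat (P * Q) * G * (P * Q)"
      using P(2) Q G(1) by (simp add: transpose_mult[of _ m m] assoc_mult_mat[of _ m m _ m _ m])
    then show ?thesis unfolding P(4) PQ R(4) .
  qed
  then have e: "(transpose_mat Q * diag_mat_of d * Q) $$ (j, k) = diag_mat_of d' $$ (j, k)" for j k by simp
  have "(\<Sum>i<m. d ! i * (Q $$ (i, j) * Q $$ (i, k))) = (if j = k then d' ! j else 0)" if jk: "j < m" "k < m" for j k
  proof -
    have dc: "diag_mat_of d \<in> carrier_mat m m" using P(1) by (simp add: diag_mat_of_def)
    have "(transpose_mat Q * diag_mat_of d * Q) $$ (j, k) = (transpose_mat Q * (diag_mat_of d * Q)) $$ (j, k)"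
      using Q dc by (simp add: assoc_mult_mat[of _ m m _ m _ m])
    also have "\<dots> = (\<Sum>i<m. Q $$ (i, j) * (diag_mat_of d * Q) $$ (i, k))"
      using Q dc jk by (simp add: scalar_prod_def lessThan_atLeast0 del: index_mult_mat(1)) 
        (simp add: times_mat_def[of "transpose_mat Q"] scalar_prod_def)
    also have "\<dots> = (\<Sum>i<m. d ! i * (Q $$ (i, j) * Q $$ (i, k)))"
    proof (rule sum.cong[OF refl])
      fix i assume i: "i \<in> {..<m}"
      have "(diag_mat_of d * Q) $$ (i, k) = (\<Sum>l<m. diag_mat_of d $$ (i, l) * Q $$ (l, k))"
        using i jk Q dc by (simp add: scalar_prod_def lessThan_atLeast0)
      also have "\<dots> = (\<Sum>l<m. if l = i then d ! i * Q $$ (i, k) else 0)"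
        using i P(1) by (intro sum.cong refl) (auto simp: diag_mat_of_def)
      also have "\<dots> = d ! i * Q $$ (i, k)" using i by simp
      finally show "Q $$ (i, j) * (diag_mat_of d * Q) $$ (i, k) = d ! i * (Q $$ (i, j) * Q $$ (i, k))" by (simp add: ac_simps)
    qed
    finally show ?thesis using e[of j k] jk R(1) by (simp add: diag_mat_of_def)
  qed
  then show ?thesis unfolding disom_def using P(1) R(1) by (intro conjI exI[of _ "\<lambda>i j. Q $$ (i, j)"]) auto
qed

text \<open>The even case depends only on a square class, where the factor 4^[n/2] disappears; the
  odd case is independent of the diagonalization by \<open>hasse_invariant\<close>.\<close>

lemma zeta_dgm:
  assumes G: "G \<in> carrier_mat m m" and nd: "\<forall>x\<in>set d. x \<noteq> 0" and d: "dgm G d"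
  shows "zeta_inv v G = zetad d" "det G \<noteq> 0" "is_square (det G * prod_list d)"
proof -
  obtain P where P: "length d = m" "P \<in> carrier_mat m m" "det P \<noteq> 0" "transpose_mat P * G * P = diag_mat_of d"
    using d G by (auto simp: dgm_def)
  have det: "det G * (det P * det P) = prod_list d" using dgm_det[OF G P(2,4)] .
  have pd: "prod_list d \<noteq> 0" using nd prod_list_nz by blast
  then show dG: "det G \<noteq> 0" using det by auto
  have "det G * prod_list d = (det G * det P) * (det G * det P)" unfolding det[symmetric] by (simp add: ac_simps)
  then show sq: "is_square (det G * prod_list d)" by (simp only: is_square_sq)
  have m4: "(-4 :: 'a) \<noteq> 0" using four_nz by simp
  have "is_square (D_inv G * Dd d)"
  proof -
    let ?k = "m div 2"
    have "(-4::'a) ^ ?k = ((-1) * (2 * 2)) ^ ?k" by simp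
    then have 1: "(-4::'a) ^ ?k = (-1) ^ ?k * (2 ^ ?k * 2 ^ ?k)" by (simp only: power_mult_distrib)
    have 2: "(-1::'a) ^ ?k * (-1) ^ ?k = 1" by (metis mult_minus_left mult_1 minus_minus power_mult_distrib power_one)
    have "D_inv G * Dd d = ((-1) ^ ?k * (2 ^ ?k * 2 ^ ?k)) * det G * ((-1) ^ ?k * prod_list d)"
      using G P(1) 1 by (simp add: D_inv_def Dd_def)
    also have "\<dots> = (2 ^ ?k * 2 ^ ?k) * (det G * prod_list d) * ((-1) ^ ?k * (-1) ^ ?k)" by (simp only: ac_simps)
    finally have "D_inv G * Dd d = (2 ^ ?k * 2 ^ ?k) * (det G * prod_list d)" unfolding 2 by simp
    then show ?thesis using is_square_mult[OF is_square_sq sq] by metis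
  qed
  moreover have "D_inv G \<noteq> 0" "Dd d \<noteq> 0" using dG pd m4 by (auto simp: D_inv_def Dd_def)
  ultimately have X: "xi v G = xid (Dd d)" using xi_xid[OF dG] xid_cong[of "D_inv G" "Dd d"] by simp
  \<comment> \<open>The list that \<open>eta\<close> happens to choose. Its entries are nonzero
    because the determinant is, and it is isometric to d.\<close>
  define d0 where "d0 = (SOME d. length d = dim_row G \<and>
        (\<exists>P. P \<in> carrier_mat (dim_row G) (dim_row G) \<and> det P \<noteq> 0 \<and> transpose_mat P * G * P = diag_mat_of d))"
  have "dgm G d0" unfolding dgm_def d0_def by (rule someI_ex) (use d in \<open>auto simp: dgm_def\<close>)
  then obtain P0 where P0: "length d0 = m" "P0 \<in> carrier_mat m m" "det P0 \<noteq> 0" "transpose_mat P0 * G * P0 = diag_mat_of d0"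
    using G by (auto simp: dgm_def)
  have "prod_list d0 \<noteq> 0" using dgm_det[OF G P0(2,4)] dG P0(3) by (metis mult_eq_0_iff)
  then have nd0: "\<forall>x\<in>set d0. x \<noteq> 0" using prod_list_nz by blast
  have "disom d d0" using dgm_disom[OF G dG d \<open>dgm G d0\<close>] .
  then have hs: "hs d = hs d0" using hasse_invariant nd nd0 by blast
  have "eta G = eta_of_diag d0 (det G)" by (simp add: eta_def d0_def)
  also have "\<dots> = etad d"
    unfolding etad_def eta_of_diag_hs[OF nd0] eta_of_diag_hs[OF nd] using hs P0(1) P(1) hilbert_cong[of "-1" "det G" "prod_list d"] dG pd sq by simp
  finally show "zeta_inv v G = zetad d" unfolding zeta_inv_def zetad_def using X G P(1) by simp
qed

text \<open>Invertibility of P follows from the determinant of G', which is nonzero because G' has a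
  diagonalization with nonzero entries.\<close>

lemma zeta_inv_cong:
  assumes G: "G \<in> carrier_mat m m" and P: "P \<in> carrier_mat m m" and G': "G' = transpose_mat P * G * P"
    and nd: "\<forall>x\<in>set d. x \<noteq> 0" and d: "dgm G' d"
  shows "zeta_inv v G' = zeta_inv v G" "det G \<noteq> 0"
proof -
  have G'c: "G' \<in> carrier_mat m m" using G P G' by simp
  have dim: "dim_row G' = m" using G'c by simp
  note z = zeta_dgm[OF G'c nd d]
  have "det G' = det P * det G * det P"
    unfolding G' using det_mult[of "transpose_mat P * G" m P] det_mult[of "transpose_mat P" m G] det_transpose[OF P] P G by simp
  then have dP: "det P \<noteq> 0" using z(2) by auto
  obtain R where R: "length d = m" "R \<in> carrier_mat m m" "det R \<noteq> 0" "transpose_mat R * G' * R = diag_mat_of d"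
    using d unfolding dgm_def dim by blast
  have "transpose_mat (P * R) * G * (P * R) = diag_mat_of d"
    unfolding R(4)[symmetric] G' using P R(2) G by (simp add: transpose_mult[of _ m m] assoc_mult_mat[of _ m m _ m _ m])
  moreover have "det (P * R) \<noteq> 0" using det_mult[OF P R(2)] dP R by simp
  ultimately have "dgm G d" unfolding dgm_def using R P G by (intro conjI exI[of _ "P * R"]) auto
  then show "zeta_inv v G' = zeta_inv v G" "det G \<noteq> 0" using zeta_dgm[OF G nd] z by auto
qed

end

context qspace
begin

definition gram :: "nat \<Rightarrow> (nat \<Rightarrow> 'b) \<Rightarrow> 'a mat" where "gram m e = mat m m (\<lambda>(i, j). b (e i) (e j))"

lemma gram_carrier [simp]: "gram m e \<in> carrier_mat m m" by (simp add: gram_def)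

lemma diagz_dgm: assumes "diagz {..<m} e d" shows "dgm (gram m e) d" "\<forall>x\<in>set d. x \<noteq> 0"
proof -
  obtain P where len: "length d = m" and nz: "\<forall>x\<in>set d. x \<noteq> 0"
    and P: "\<And>j k. j < m \<Longrightarrow> k < m \<Longrightarrow> b (lc {..<m} (P j) e) (lc {..<m} (P k) e) = (if j = k then d ! j else 0)"
    using assms unfolding diagz_def by auto
  define M where "M = mat m m (\<lambda>(i, j). P j i)"
  have M: "M \<in> carrier_mat m m" by (simp add: M_def)
  have eq: "transpose_mat M * gram m e * M = diag_mat_of d"
  proof (rule eq_matI)
    show "dim_row (transpose_mat M * gram m e * M) = dim_row (diag_mat_of d)" "dim_col (transpose_mat M * gram m e * M) = dim_col (diag_mat_of d)"
      using M len by (auto simp: diag_mat_of_def)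
    fix j k assume "j < dim_row (diag_mat_of d)" "k < dim_col (diag_mat_of d)"
    then have jk: "j < m" "k < m" using len by (auto simp: diag_mat_of_def)
    have "(transpose_mat M * gram m e * M) $$ (j, k) = (\<Sum>l<m. (\<Sum>i<m. P j i * b (e i) (e l)) * P k l)"
      using jk by (simp add: M_def gram_def scalar_prod_def lessThan_atLeast0)
    also have "\<dots> = (\<Sum>l<m. P k l * b (e l) (lc {..<m} (P j) e))"
      using b_lc[of "{..<m}" "P j" e] by (intro sum.cong refl) (simp add: b_sym[of "e _" "lc {..<m} (P j) e"] mult.commute)
    also have "\<dots> = b (lc {..<m} (P j) e) (lc {..<m} (P k) e)"
      using b_lc[of "{..<m}" "P k" e "lc {..<m} (P j) e"] b_sym[of "lc {..<m} (P j) e" "lc {..<m} (P k) e"] by simp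
    finally show "(transpose_mat M * gram m e * M) $$ (j, k) = diag_mat_of d $$ (j, k)"
      using P[OF jk] jk len by (simp add: diag_mat_of_def)
  qed
  have "det M \<noteq> 0"
  proof
    assume "det M = 0"
    then have "prod_list d = 0" using dgm_det[OF gram_carrier M eq] by simp
    then show False using nz prod_list_nz by blast
  qed
  then show "dgm (gram m e) d" unfolding dgm_def using eq M len by (intro conjI exI[of _ M]) (auto simp: gram_def)
  show "\<forall>x\<in>set d. x \<noteq> 0" by (rule nz)
qed

lemma close_invariants_zeta:
  assumes ai: "aint {..<m} e a" and sr: "\<And>t. semireg {..<m} e a t" and cl: "close {..<m} e f a"
  shows "zeta_inv v (gram m e) = zeta_inv v (gram m f)"
    "\<exists>d. dgm (gram m f) d \<and> (\<forall>x\<in>set d. x \<noteq> 0)"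
proof -
  obtain d d' where d: "diagz {..<m} e d" "diagz {..<m} f d'" "inv_agree m (nondeg {..<m} e a) d d'"
    using close_invariants[OF _ ai sr cl] by auto
  note z = zeta_dgm[OF gram_carrier diagz_dgm(2)[OF d(1)] diagz_dgm(1)[OF d(1)]]
    and z' = zeta_dgm[OF gram_carrier diagz_dgm(2)[OF d(2)] diagz_dgm(1)[OF d(2)]]
  show "\<exists>d. dgm (gram m f) d \<and> (\<forall>x\<in>set d. x \<noteq> 0)" using diagz_dgm[OF d(2)] by blast
  have len: "length d = m" "length d' = m" using d by (auto simp: diagz_def)
  have pn: "prod_list d \<noteq> 0" "prod_list d' \<noteq> 0" using diagz_dgm(2)[OF d(1)] diagz_dgm(2)[OF d(2)] prod_list_nz by blast+
  then have nz: "Dd d \<noteq> 0" "Dd d' \<noteq> 0" by (auto simp: Dd_def)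
  have "zetad d = zetad d'"
  proof (cases "even m")
    case True
    then have "unr (Dd d) \<and> unr (Dd d') \<and> is_square (Dd d * Dd d') \<or> \<not> unr (Dd d) \<and> \<not> unr (Dd d')"
      using d(3) by (auto simp: inv_agree_def)
    then have "xid (Dd d) = xid (Dd d')" using xid_cong[OF nz] xid_zero[OF nz(1)] xid_zero[OF nz(2)] by auto
    then show ?thesis using True len by (simp add: zetad_def)
  next
    case False then show ?thesis using d(3) len by (simp add: zetad_def inv_agree_def)
  qed
  then show "zeta_inv v (gram m e) = zeta_inv v (gram m f)" using z z' by simp
qed

text \<open>This is \<open>close_invariants\<close> for a family compared with itself. It expresses
  a property of the family by the determinant and the discriminant of its Gram matrix, in which the
  conditions on pre-optimal forms are phrased.\<close>

lemma nondeg_char: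
  assumes ai: "aint {..<m} e a" and sr: "\<And>t. semireg {..<m} e a t"
  shows "nondeg {..<m} e a t \<longleftrightarrow> (if even m then xi v (gram m e) \<noteq> 0 else odd (v (det (gram m e)) - t))" "det (gram m e) \<noteq> 0"
proof -
  obtain d d' where d: "diagz {..<m} e d" "diagz {..<m} e d'" "inv_agree m (nondeg {..<m} e a) d d'"
    using close_invariants[OF _ ai sr close_refl] by auto
  note z = zeta_dgm[OF gram_carrier diagz_dgm(2)[OF d(1)] diagz_dgm(1)[OF d(1)]]
  show "det (gram m e) \<noteq> 0" using z by auto
  have len: "length d = m" using d by (auto simp: diagz_def)
  have pn: "prod_list d \<noteq> 0" using diagz_dgm(2)[OF d(1)] prod_list_nz by blast
  then have nz: "Dd d \<noteq> 0" by (auto simp: Dd_def)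
  show "nondeg {..<m} e a t \<longleftrightarrow> (if even m then xi v (gram m e) \<noteq> 0 else odd (v (det (gram m e)) - t))"
  proof (cases "even m")
    case True
    then have "xi v (gram m e) = xid (Dd d)" using z(1) len by (simp add: zeta_inv_def zetad_def gram_def)
    then show ?thesis using True d(3) xid_zero[OF nz] by (auto simp: inv_agree_def)
  next
    case False
    then obtain p where p: "\<And>t. nondeg {..<m} e a t \<longleftrightarrow> odd (t - p)" "even (v (prod_list d) - p)" using d(3) by (auto simp: inv_agree_def)
    obtain s where s: "det (gram m e) * prod_list d = s * s" using z(3) by (auto simp: is_square_def)
    then have "s \<noteq> 0" using z(2) pn by auto
    then have "v (det (gram m e)) + v (prod_list d) = 2 * v s" using v_mult[OF z(2) pn] v_mult[of s s] s by simp
    moreover have "even (y - p) \<Longrightarrow> x + y = 2 * z \<Longrightarrow> odd (x - t) \<longleftrightarrow> odd (t - p)" for x y z :: int by presburger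
    ultimately have "odd (v (det (gram m e)) - t) \<longleftrightarrow> odd (t - p)" using p(2) by blast
    then show ?thesis using False p(1) by simp
  qed
qed



lemma fam_cong:
  assumes "\<And>k. k \<in> S \<Longrightarrow> e k = e' k" "\<And>k. k \<in> S \<Longrightarrow> a k = a' k"
  shows "aint S e a \<longleftrightarrow> aint S e' a'" "semireg S e a t \<longleftrightarrow> semireg S e' a' t" "nondeg S e a t \<longleftrightarrow> nondeg S e' a' t"
proof -
  have 1: "lc S x e = lc S x e'" for x using assms(1) by (intro lc_cong) auto
  have 2: "cA S a t x \<longleftrightarrow> cA S a' t x" for t x using assms(2) by (auto simp: cA_def)
  have 3: "lev S e a t u \<longleftrightarrow> lev S e' a' t u" for t u using assms by (auto simp: lev_def)
  show "aint S e a \<longleftrightarrow> aint S e' a'" using assms by (auto simp: aint_def)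
  show "semireg S e a t \<longleftrightarrow> semireg S e' a' t" "nondeg S e a t \<longleftrightarrow> nondeg S e' a' t" unfolding semireg_def nondeg_def by (simp_all add: 1 2 3)
qed

text \<open>Vectors with levels of the other parity do not enter the graded piece, so
  \<open>add_other\<close> can be applied to them one after another.\<close>

lemma semireg_extend:
  assumes "finite T" "finite S" "S \<inter> T = {}" "aint (S \<union> T) f a" "\<And>k. k \<in> T \<Longrightarrow> odd (a k - t)" "semireg S f a t"
  shows "semireg (S \<union> T) f a t"
  using assms
proof (induction T rule: finite_induct)
  case (insert m T)
  have ai: "aint (insert m (S \<union> T)) f a" using insert.prems(3) by simp
  have "semireg (S \<union> T) f a t"
    using insert.prems ai by (intro insert.IH) (auto intro: aint_subset[OF ai])
  then have "semireg (insert m (S \<union> T)) (f(m := f m)) (a(m := a m)) t"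
    using insert.prems insert.hyps ai by (intro add_other(1)) auto
  then show ?case by simp
qed simp

end

context mspace
begin

lemma gram_supp:
  assumes m: "m \<le> n" and s: "\<And>j p. j < m \<Longrightarrow> p \<ge> m \<Longrightarrow> h j p = 0"
  shows "gram m h = transpose_mat (mat m m (\<lambda>(p, j). h j p)) * upleft B m * mat m m (\<lambda>(p, j). h j p)"
proof (rule eq_matI)
  let ?R = "mat m m (\<lambda>(p, j). h j p)"
  fix i j assume "i < dim_row (transpose_mat ?R * upleft B m * ?R)" "j < dim_col (transpose_mat ?R * upleft B m * ?R)"
  then have ij: "i < m" "j < m" by auto
  have "bf (h i) (h j) = (\<Sum>p<m. \<Sum>r<n. h i p * B $$ (p, r) * h j r)"
    unfolding bf_def by (rule sum.mono_neutral_right) (use m s ij in auto)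
  also have "\<dots> = (\<Sum>p<m. \<Sum>r<m. h i p * B $$ (p, r) * h j r)"
    by (intro sum.cong[OF refl] sum.mono_neutral_right) (use m s ij in auto)
  also have "\<dots> = (\<Sum>r<m. (\<Sum>p<m. h i p * B $$ (p, r)) * h j r)"
    by (subst sum.swap) (simp add: sum_distrib_right)
  also have "\<dots> = (transpose_mat ?R * upleft B m * ?R) $$ (i, j)"
    using ij by (simp add: upleft_def scalar_prod_def lessThan_atLeast0)
  finally show "gram m h $$ (i, j) = (transpose_mat ?R * upleft B m * ?R) $$ (i, j)" using ij by (simp add: gram_def)
qed (auto simp: gram_def)

lemma upleft_carrier [simp]: "upleft A m \<in> carrier_mat m m" by (simp add: upleft_def)

text \<open>The first m vectors of the optimal basis U differ from their truncations to the first m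
  vectors of V by terms of higher level, because the levels jump at m. The truncations are close to
  them and, V being triangular, involve only the first m coordinates, so their Gram matrix is
  congruent over F to the upper-left block of B.\<close>

lemma zeta_upleft:
  assumes nd: "det B \<noteq> 0" and V: "GL_o v n V" and tri: "\<And>p j. p < n \<Longrightarrow> j < p \<Longrightarrow> V $$ (p, j) = 0"
    and cV: "c \<in> S_set v (transpose_mat V * B * V)" and LMV: "level_max n (fU V) (\<lambda>k. int (c ! k))"
    and U: "GL_o v n U" and cU: "c \<in> S_set v (transpose_mat U * B * U)"
    and m: "0 < m" "m \<le> n" "m < n \<Longrightarrow> c ! (m - 1) < c ! m"
  shows "zeta_inv v (upleft (transpose_mat U * B * U) m) = zeta_inv v (upleft B m)"
proof -
  note V' = GL_oD[OF V] and U' = GL_oD[OF U]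
  have GK: "GK v B = c" using GK_eq[OF nd V cV LMV] .
  define a where "a = (\<lambda>k. int (c ! k))"
  define f where "f = fU U"
  define e where "e = fU V"
  have len: "length c = n" and srt: "sorted c" and ai: "aint {..<n} f a" and aiV: "aint {..<n} e a"
    using cU[unfolded S_set_iff[OF U'(1)]] cV[unfolded S_set_iff[OF V'(1)]] by (auto simp: f_def a_def e_def)
  have LMU: "level_max n f a" unfolding f_def a_def using GK_level_max[OF nd U] GK cU by simp
  obtain W where W: "GL_o v n W" "V * W = 1\<^sub>m n" using GL_o_inverse[OF V] by blast
  note W' = GL_oD[OF W(1)]
  define P where "P = W * U"
  have P: "GL_o v n P" using GL_o_mult[OF W(1) U] by (simp add: P_def)
  note P' = GL_oD[OF P]
  have VP: "V * P = U" unfolding P_def using V'(1) W'(1) U'(1) W(2) by (simp add: assoc_mult_mat[symmetric, of _ n n _ n _ n])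
  have ent: "ge (P $$ (i, j)) (hc (a j - a i))" if "i < n" "j < n" for i j
    using level_max_entries[OF V P cV _ LMV _ that, unfolded VP] cU LMU by (simp add: a_def f_def)
  have mono: "a j \<le> a k" if "j \<le> k" "k < n" for j k using that srt len by (auto simp: a_def sorted_iff_nth_mono)
  have gap: "a j + 1 \<le> a k" if "j < m" "m \<le> k" "k < n" for j k
  proof -
    have "a j \<le> a (m - 1)" "a m \<le> a k" using mono that m by auto
    moreover have "a (m - 1) < a m" using m that by (simp add: a_def)
    ultimately show ?thesis by simp
  qed
  \<comment> \<open>The truncation; the dropped part has coefficients \<open>z\<close>, and these
    are integral on vectors of level at least a j + 1, hence of a higher filtration step.\<close>
  define g where "g j = lc {..<m} (\<lambda>i. P $$ (i, j)) e" for j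
  define z where "z j i = (if i < m then 0 else P $$ (i, j))" for i j
  define rr where "rr j = lc {..<n} (z j) e" for j
  have fg: "f j = g j + rr j" if j: "j < m" for j
  proof -
    have jn: "j < n" using j m by simp
    have "f j = lc {..<n} (\<lambda>i. P $$ (i, j)) e" unfolding f_def e_def using lc_fU[OF V'(1) P'(1) jn] VP by simp
    also have "\<dots> = lc {..<n} (\<lambda>i. (if i < m then P $$ (i, j) else 0) + z j i) e" by (rule lc_cong) (auto simp: z_def)
    also have "\<dots> = lc {..<n} (\<lambda>i. if i < m then P $$ (i, j) else 0) e + rr j" unfolding lc_add rr_def ..
    also have "lc {..<n} (\<lambda>i. if i < m then P $$ (i, j) else 0) e = g j"
      unfolding g_def lc_def by (rule sum.mono_neutral_cong_right) (use m in auto)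
    finally show ?thesis .
  qed
  have Pf: "f j = lc {..<n} (\<lambda>i. P $$ (i, j)) e" "cA {..<n} a (a j) (\<lambda>i. P $$ (i, j))" if j: "j < m" for j
    using lc_fU[OF V'(1) P'(1), of j] VP j m ent by (auto simp: f_def e_def cA_def)
  have zA: "cA {..<n} a (a j + 1) (z j)" if j: "j < m" for j
    unfolding cA_def
  proof
    fix i assume i: "i \<in> {..<n}"
    show "ge (z j i) (hc (a j + 1 - a i))"
    proof (cases "i < m")
      case False
      then have "hc (a j + 1 - a i) \<le> 0" using gap[OF j, of i] i by (simp add: hc_le_iff)
      moreover have "ge (P $$ (i, j)) 0" using P'(2) i j m by simp
      ultimately show ?thesis using False ge_mono by (auto simp: z_def)
    qed (simp add: z_def)
  qed
  have cl: "close {..<m} f g a" unfolding close_def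
  proof (intro conjI ballI)
    fix j assume "j \<in> {..<m}" then have j: "j < m" by simp
    have gj: "g j = f j - rr j" using fg[OF j] by simp
    have "ge (bb (f j) (rr j)) (a j + 1)"
      using aint_lc2[OF aiV Pf(2)[OF j] zA[OF j]] unfolding Pf(1)[OF j] rr_def by (simp add: hc_2t1)
    moreover have "ge (q (rr j)) (a j + 1)" unfolding rr_def using aint_q[OF _ aiV zA[OF j]] by simp
    ultimately have "ge (q (rr j) - bb (f j) (rr j)) (a j + 1)" using ge_diff by blast
    then show "ge (q (g j) - q (f j)) (a j + 1)" unfolding gj q_diff by (rule ge_eq) simp
  next
    fix j k assume "j \<in> {..<m}" "k \<in> {..<m}" then have j: "j < m" and k: "k < m" by auto
    have gj: "g j = f j - rr j" "g k = f k - rr k" using fg[OF j] fg[OF k] by auto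
    have 1: "ge (bb (f j) (rr k)) (hc (a j + a k + 1))"
      using aint_lc2[OF aiV Pf(2)[OF j] zA[OF k]] unfolding Pf(1)[OF j] rr_def by (simp add: add.assoc)
    have 2: "ge (bb (rr j) (f k)) (hc (a j + a k + 1))"
      using aint_lc2[OF aiV zA[OF j] Pf(2)[OF k]] unfolding Pf(1)[OF k] rr_def by (simp add: ac_simps)
    have 3: "ge (bb (rr j) (rr k)) (hc (a j + a k + 1))"
      using aint_lc2[OF aiV zA[OF j] cA_mono[OF zA[OF k], of "a k"]] unfolding rr_def by (simp add: ac_simps)
    have "ge (bb (rr j) (rr k) - bb (f j) (rr k) - bb (rr j) (f k)) (hc (a j + a k + 1))"
      by (rule ge_diff[OF ge_diff[OF 3 1] 2])
    then show "ge (bb (g j) (g k) - bb (f j) (f k)) (hc (a j + a k + 1))"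
      unfolding gj bb_diff bb_diff2 by (rule ge_eq) simp
  qed
  have aim: "aint {..<m} f a" using aint_subset[OF ai] m by auto
  define s where "s = a (m - 1)"
  have Sm: "{k. k < n \<and> a k \<le> s} = {..<m}"
  proof (intro equalityI subsetI)
    fix k assume "k \<in> {k. k < n \<and> a k \<le> s}"
    then show "k \<in> {..<m}" using gap[of "m - 1" k] m by (force simp: s_def)
  next
    fix k assume "k \<in> {..<m}"
    then show "k \<in> {k. k < n \<and> a k \<le> s}" using mono[of k "m - 1"] m by (auto simp: s_def)
  qed
  have sr1: "semireg {..<m} f a s" using LMU Sm unfolding level_max_def by metis
  \<comment> \<open>The first m vectors are those of level at most s. Maximality gives
    semiregularity at s for all of them and at s - 1 for those of smaller level; vectors of level
    exactly s do not affect the latter.\<close>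
  define T0 where "T0 = {k. k < n \<and> a k \<le> s - 1}"
  define T1 where "T1 = {k. k < n \<and> a k = s}"
  have T01: "{..<m} = T0 \<union> T1" unfolding Sm[symmetric] T0_def T1_def by auto
  have "semireg (T0 \<union> T1) f a (s - 1)"
  proof (rule semireg_extend)
    show "semireg T0 f a (s - 1)" using LMU unfolding level_max_def T0_def by blast
    show "aint (T0 \<union> T1) f a" using aim T01 by simp
  qed (auto simp: T0_def T1_def)
  then have sr2: "semireg {..<m} f a (s - 1)" using T01 by simp
  have sr: "semireg {..<m} f a t" for t using semireg_all[OF sr2, of t] sr1 by simp
  have z1: "zeta_inv v (gram m f) = zeta_inv v (gram m g)" and z2: "\<exists>d. dgm (gram m g) d \<and> (\<forall>x\<in>set d. x \<noteq> 0)"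
    using close_invariants_zeta[OF aim sr cl] by auto
  have gs: "g j p = 0" if "j < m" "p \<ge> m" for j p
  proof -
    have "g j p = (\<Sum>i<m. P $$ (i, j) * e i p)" unfolding g_def lc_def by (simp add: sum_fun_apply fsc_def)
    also have "\<dots> = 0" by (intro sum.neutral) (use that tri m in \<open>auto simp: e_def fU_def\<close>)
    finally show ?thesis .
  qed
  have "zeta_inv v (gram m g) = zeta_inv v (upleft B m)"
    using z2 zeta_inv_cong(1)[OF upleft_carrier _ gram_supp[OF m(2) gs]] by auto
  moreover have "gram m f = upleft (transpose_mat U * B * U) m"
  proof (rule eq_matI)
    fix i j assume "i < dim_row (upleft (transpose_mat U * B * U) m)" "j < dim_col (upleft (transpose_mat U * B * U) m)"
    then have ij: "i < m" "j < m" by (auto simp: upleft_def)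
    then show "gram m f $$ (i, j) = upleft (transpose_mat U * B * U) m $$ (i, j)"
      using bf_fU[OF U'(1) U'(1), of i j] m by (simp add: gram_def upleft_def f_def del: index_mult_mat)
  qed (auto simp: gram_def upleft_def)
  ultimately show ?thesis using z1 by simp
qed

end

section \<open>Block decompositions\<close>

definition sqb :: "nat \<times> 'a mat \<Rightarrow> bool" where
  "sqb b \<longleftrightarrow> snd b \<in> carrier_mat (dim_row (snd b)) (dim_row (snd b)) \<and> transpose_mat (snd b) = snd b"

definition bdim :: "(nat \<times> 'a mat) list \<Rightarrow> nat" where "bdim xs = (\<Sum>b\<leftarrow>xs. dim_row (snd b))"

lemma bdim_append: "bdim (xs @ ys) = bdim xs + bdim ys" by (simp add: bdim_def)

lemma perp_carrier: "A \<in> carrier_mat m m \<Longrightarrow> C \<in> carrier_mat k k \<Longrightarrow> perp A C \<in> carrier_mat (m + k) (m + k)"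
  by (auto simp: perp_def)

lemma perp_index:
  assumes "A \<in> carrier_mat m m" "C \<in> carrier_mat k k" "p < m + k" "r < m + k"
  shows "perp A C $$ (p, r) = (if p < m then if r < m then A $$ (p, r) else 0 else if r < m then 0 else C $$ (p - m, r - m))"
  using assms by (auto simp: perp_def)

lemma perp_assoc:
  assumes A: "A \<in> carrier_mat m m" and C: "C \<in> carrier_mat k k" and D: "D \<in> carrier_mat l l"
  shows "perp A (perp C D) = perp (perp A C) D"
proof (rule eq_matI)
  note c1 = perp_carrier[OF A perp_carrier[OF C D]] and c2 = perp_carrier[OF perp_carrier[OF A C] D]
  show "dim_row (perp A (perp C D)) = dim_row (perp (perp A C) D)" "dim_col (perp A (perp C D)) = dim_col (perp (perp A C) D)"
    using c1 c2 by auto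
  fix i j assume "i < dim_row (perp (perp A C) D)" "j < dim_col (perp (perp A C) D)"
  then have ij: "i < m + k + l" "j < m + k + l" using c2 by auto
  show "perp A (perp C D) $$ (i, j) = perp (perp A C) D $$ (i, j)"
    using ij by (simp add: perp_index[OF A perp_carrier[OF C D]] perp_index[OF perp_carrier[OF A C] D] perp_index[OF A C] perp_index[OF C D])
       (auto simp: perp_index[OF C D] not_less)
qed

lemma perp_empty: assumes A: "A \<in> carrier_mat m m"
  shows "perp (0\<^sub>m 0 0) A = A" "perp A (0\<^sub>m 0 0) = A"
proof -
  have Z: "0\<^sub>m 0 0 \<in> carrier_mat 0 0" by simp
  show "perp (0\<^sub>m 0 0) A = A"
  proof (rule eq_matI)
    fix i j assume ij: "i < dim_row A" "j < dim_col A"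
    then show "perp (0\<^sub>m 0 0) A $$ (i, j) = A $$ (i, j)" using perp_index[OF Z A, of i j] A by auto
  qed (use perp_carrier[OF Z A] A in auto)
  show "perp A (0\<^sub>m 0 0) = A"
  proof (rule eq_matI)
    fix i j assume ij: "i < dim_row A" "j < dim_col A"
    then show "perp A (0\<^sub>m 0 0) $$ (i, j) = A $$ (i, j)" using perp_index[OF A Z, of i j] A by auto
  qed (use perp_carrier[OF A Z] A in auto)
qed

lemma perp_sym:
  assumes A: "A \<in> carrier_mat m m" "transpose_mat A = A" and C: "C \<in> carrier_mat k k" "transpose_mat C = C"
  shows "transpose_mat (perp A C) = perp A C"
proof (rule eq_matI)
  note c = perp_carrier[OF A(1) C(1)]
  have sA: "A $$ (i, j) = A $$ (j, i)" if "i < m" "j < m" for i j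
    using that A by (metis carrier_matD index_transpose_mat(1))
  have sC: "C $$ (i, j) = C $$ (j, i)" if "i < k" "j < k" for i j
    using that C by (metis carrier_matD index_transpose_mat(1))
  show "dim_row (transpose_mat (perp A C)) = dim_row (perp A C)" "dim_col (transpose_mat (perp A C)) = dim_col (perp A C)" using c by auto
  fix i j assume "i < dim_row (perp A C)" "j < dim_col (perp A C)"
  then have ij: "i < m + k" "j < m + k" using c by auto
  then have "transpose_mat (perp A C) $$ (i, j) = perp A C $$ (j, i)" using c by auto
  then show "transpose_mat (perp A C) $$ (i, j) = perp A C $$ (i, j)"
    using ij sA sC by (simp add: perp_index[OF A(1) C(1)])
qed

lemma perp_det:
  fixes A :: "'a::field mat"
  assumes A: "A \<in> carrier_mat m m" and C: "C \<in> carrier_mat k k"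
  shows "det (perp A C) = det A * det C"
proof -
  have "perp A C = four_block_mat A (0\<^sub>m m k) (0\<^sub>m k m) C" using A C by (auto simp: perp_def)
  then show ?thesis using det_four_block_mat_lower_left_zero[OF A _ _ C, of "0\<^sub>m m k" "0\<^sub>m k m"] by simp
qed

lemma blocks_carrier: "\<forall>b\<in>set xs. sqb b \<Longrightarrow> blocks_mat xs \<in> carrier_mat (bdim xs) (bdim xs)"
proof (induction xs)
  case Nil then show ?case by (simp add: blocks_mat_def bdim_def)
next
  case (Cons b xs)
  obtain k C where b: "b = (k, C)" by force
  have C: "2 ^ k \<cdot>\<^sub>m C \<in> carrier_mat (dim_row C) (dim_row C)" using Cons.prems b by (simp add: sqb_def)
  have "blocks_mat (b # xs) = perp (2 ^ k \<cdot>\<^sub>m C) (blocks_mat xs)" by (simp add: blocks_mat_def b)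
  then show ?case using perp_carrier[OF C Cons.IH] Cons.prems b by (simp add: bdim_def)
qed

lemma blocks_sym: "\<forall>b\<in>set xs. sqb b \<Longrightarrow> transpose_mat (blocks_mat xs) = blocks_mat xs"
proof (induction xs)
  case Nil then show ?case by (auto simp: blocks_mat_def)
next
  case (Cons b xs)
  obtain k C where b: "b = (k, C)" by force
  have C: "2 ^ k \<cdot>\<^sub>m C \<in> carrier_mat (dim_row C) (dim_row C)" "transpose_mat C = C" using Cons.prems b by (auto simp: sqb_def)
  have "transpose_mat (2 ^ k \<cdot>\<^sub>m C) = 2 ^ k \<cdot>\<^sub>m transpose_mat C" by (intro eq_matI) auto
  then have Cs: "transpose_mat (2 ^ k \<cdot>\<^sub>m C) = 2 ^ k \<cdot>\<^sub>m C" using C by simp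
  have "blocks_mat (b # xs) = perp (2 ^ k \<cdot>\<^sub>m C) (blocks_mat xs)" by (simp add: blocks_mat_def b)
  then show ?case using perp_sym[OF C(1) Cs blocks_carrier] Cons by simp
qed

lemma blocks_append:
  assumes "\<forall>b\<in>set (xs @ ys). sqb b"
  shows "blocks_mat (xs @ ys) = perp (blocks_mat xs) (blocks_mat ys)"
  using assms
proof (induction xs)
  case Nil
  then show ?case using perp_empty(1)[OF blocks_carrier[of ys]] by (simp add: blocks_mat_def)
next
  case (Cons b xs)
  obtain k C where b: "b = (k, C)" by force
  have C: "2 ^ k \<cdot>\<^sub>m C \<in> carrier_mat (dim_row C) (dim_row C)" using Cons.prems b by (simp add: sqb_def)
  have step: "blocks_mat (b # zs) = perp (2 ^ k \<cdot>\<^sub>m C) (blocks_mat zs)" for zs by (simp add: blocks_mat_def b)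
  have "blocks_mat ((b # xs) @ ys) = perp (2 ^ k \<cdot>\<^sub>m C) (perp (blocks_mat xs) (blocks_mat ys))"
    using Cons step[of "xs @ ys"] by simp
  also have "\<dots> = perp (blocks_mat (b # xs)) (blocks_mat ys)"
    unfolding step using Cons.prems by (intro perp_assoc[OF C blocks_carrier blocks_carrier]) auto
  finally show ?case .
qed

locale preform = dyadic v for v :: "'a::field \<Rightarrow> int" +
  fixes bs :: "(nat \<times> 'a mat) list"
  assumes valid: "\<forall>b\<in>set bs. valid_block v b"
begin

lemma valid_sqb: assumes "valid_block v b" shows "sqb b"
proof -
  let ?C = "snd b"
  consider "unimod_diag v ?C" | "half_even_unimod v ?C" using assms unfolding valid_block_def by blast
  then show ?thesis
  proof cases
    case 1
    then have c: "?C \<in> carrier_mat (dim_row ?C) (dim_row ?C)" and o: "\<forall>i<dim_row ?C. \<forall>j<dim_row ?C. i \<noteq> j \<longrightarrow> ?C $$ (i, j) = 0"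
      unfolding unimod_diag_def by blast+
    have dc: "dim_col ?C = dim_row ?C" by (rule carrier_matD(2)[OF c])
    have "transpose_mat ?C = ?C"
    proof (rule eq_matI)
      fix i j assume ij: "i < dim_row ?C" "j < dim_col ?C"
      have j: "j < dim_row ?C" and i: "i < dim_col ?C" using ij dc by simp_all
      have "transpose_mat ?C $$ (i, j) = ?C $$ (j, i)" using ij(1) i j dc by simp
      also have "\<dots> = ?C $$ (i, j)"
      proof (cases "i = j")
        case False then show ?thesis using o[rule_format, OF ij(1) j] o[rule_format, OF j ij(1)] by simp
      qed simp
      finally show "transpose_mat ?C $$ (i, j) = ?C $$ (i, j)" .
    qed (simp_all add: dc)
    then show ?thesis unfolding sqb_def using c by blast
  next
    case 2
    then obtain M where M: "M \<in> carrier_mat 2 2" "transpose_mat M = M" "?C = (1 / 2) \<cdot>\<^sub>m M" unfolding half_even_unimod_def by blast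
    have "transpose_mat ((1 / 2) \<cdot>\<^sub>m M) = (1 / 2) \<cdot>\<^sub>m transpose_mat M" by (intro eq_matI) auto
    then show ?thesis using M by (simp add: sqb_def)
  qed
qed

lemma sq: "\<forall>b\<in>set bs. sqb b" using valid valid_sqb by blast

lemma sqb_subset: "set xs \<subseteq> set bs \<Longrightarrow> \<forall>b\<in>set xs. sqb b" using sq by blast

definition N where "N = bdim bs"
definition dg where "dg i = bdim (take i bs)"
abbreviation "BB \<equiv> blocks_mat bs"

sublocale mspace v N BB
  by unfold_locales (use blocks_carrier[OF sq] blocks_sym[OF sq] in \<open>auto simp: N_def\<close>)

lemma Bpre_carrier: "Bpre bs i \<in> carrier_mat (dg i) (dg i)"
  unfolding Bpre_def dg_def by (rule blocks_carrier) (rule sqb_subset, auto dest: in_set_takeD)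

lemma dg_0 [simp]: "dg 0 = 0" by (simp add: dg_def bdim_def)
lemma dg_len: "dg (length bs) = N" by (simp add: dg_def N_def)

lemma dg_Suc: "i < length bs \<Longrightarrow> dg (Suc i) = dg i + dim_row (CC bs (Suc i))"
  by (simp add: dg_def take_Suc_conv_app_nth bdim_append CC_def) (simp add: bdim_def)

lemma dg_mono: "i \<le> j \<Longrightarrow> dg i \<le> dg j"
proof -
  assume "i \<le> j"
  then have "take j bs = take i bs @ drop i (take j bs)" by (metis append_take_drop_id min.absorb1 take_take)
  then show ?thesis unfolding dg_def by (metis bdim_append le_add1)
qed

lemma dg_le_N: "dg i \<le> N"
  using dg_mono[of i "max i (length bs)"] by (simp add: dg_def N_def max_def split: if_splits)

lemma dg_sum: "i \<le> length bs \<Longrightarrow> dg i = (\<Sum>j = 1..i. dim_row (CC bs j))"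
  by (induction i) (auto simp: dg_Suc)

lemma BB_split: "BB = perp (Bpre bs i) (blocks_mat (drop i bs))"
proof -
  have "BB = blocks_mat (take i bs @ drop i bs)" by simp
  also have "\<dots> = perp (Bpre bs i) (blocks_mat (drop i bs))" unfolding Bpre_def by (rule blocks_append) (use sq in simp)
  finally show ?thesis .
qed

lemma drop_carrier: "blocks_mat (drop i bs) \<in> carrier_mat (N - dg i) (N - dg i)"
proof -
  have "bdim (drop i bs) = N - dg i" unfolding N_def dg_def using bdim_append[of "take i bs" "drop i bs"] by simp
  then show ?thesis using blocks_carrier[OF sqb_subset[of "drop i bs"]] set_drop_subset by metis
qed

lemma BB_index:
  assumes "p < N" "r < N"
  shows "p < dg i \<Longrightarrow> r < dg i \<Longrightarrow> BB $$ (p, r) = Bpre bs i $$ (p, r)"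
    and "p < dg i \<Longrightarrow> r \<ge> dg i \<Longrightarrow> BB $$ (p, r) = 0" "p \<ge> dg i \<Longrightarrow> r < dg i \<Longrightarrow> BB $$ (p, r) = 0"
proof -
  have pr: "p < dg i + (N - dg i)" "r < dg i + (N - dg i)" using assms dg_le_N[of i] by auto
  note P = perp_index[OF Bpre_carrier drop_carrier pr, folded BB_split]
  show "p < dg i \<Longrightarrow> r < dg i \<Longrightarrow> BB $$ (p, r) = Bpre bs i $$ (p, r)" using P by simp
  show "p < dg i \<Longrightarrow> r \<ge> dg i \<Longrightarrow> BB $$ (p, r) = 0" "p \<ge> dg i \<Longrightarrow> r < dg i \<Longrightarrow> BB $$ (p, r) = 0" using P by auto
qed

lemma upleft_BB: "upleft BB (dg i) = Bpre bs i"
proof (rule eq_matI)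
  fix p r assume "p < dim_row (Bpre bs i)" "r < dim_col (Bpre bs i)"
  then have pr: "p < dg i" "r < dg i" using carrier_matD[OF Bpre_carrier[of i]] by simp_all
  then show "upleft BB (dg i) $$ (p, r) = Bpre bs i $$ (p, r)"
    using BB_index(1)[of p r i] dg_le_N[of i] by (simp add: upleft_def)
qed (use Bpre_carrier[of i] in \<open>auto simp: upleft_def\<close>)

lemma block_carrier: "i < length bs \<Longrightarrow> CC bs (Suc i) \<in> carrier_mat (dim_row (CC bs (Suc i))) (dim_row (CC bs (Suc i)))"
  using sq[unfolded sqb_def] nth_mem[of i bs] unfolding CC_def diff_Suc_1 by blast

lemma Bpre_Suc:
  assumes i: "i < length bs" shows "Bpre bs (Suc i) = perp (Bpre bs i) (2 ^ kk bs (Suc i) \<cdot>\<^sub>m CC bs (Suc i))"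
proof -
  have "Bpre bs (Suc i) = blocks_mat (take i bs @ [bs ! i])" using i by (simp add: Bpre_def take_Suc_conv_app_nth)
  also have "\<dots> = perp (Bpre bs i) (blocks_mat [bs ! i])"
    unfolding Bpre_def using sq i by (intro blocks_append) (auto dest: in_set_takeD)
  also have "blocks_mat [bs ! i] = perp (2 ^ kk bs (Suc i) \<cdot>\<^sub>m CC bs (Suc i)) (0\<^sub>m 0 0)"
    by (simp add: blocks_mat_def kk_def CC_def split: prod.split)
  also have "\<dots> = 2 ^ kk bs (Suc i) \<cdot>\<^sub>m CC bs (Suc i)" by (rule perp_empty(2)[OF smult_carrier_mat[OF block_carrier[OF i]]])
  finally show ?thesis .
qed

lemma BB_block:
  assumes i: "i < length bs" and p: "p < dim_row (CC bs (Suc i))" "r < dim_row (CC bs (Suc i))"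
  shows "BB $$ (dg i + p, dg i + r) = 2 ^ kk bs (Suc i) * CC bs (Suc i) $$ (p, r)"
proof -
  have d: "dg i + p < dg (Suc i)" "dg i + r < dg (Suc i)" using dg_Suc[OF i] p by auto
  then have "BB $$ (dg i + p, dg i + r) = Bpre bs (Suc i) $$ (dg i + p, dg i + r)"
    using dg_le_N[of "Suc i"] by (intro BB_index(1)[of _ _ "Suc i"]) auto
  also have "\<dots> = (2 ^ kk bs (Suc i) \<cdot>\<^sub>m CC bs (Suc i)) $$ (p, r)"
    unfolding Bpre_Suc[OF i] using perp_index[OF Bpre_carrier smult_carrier_mat[OF block_carrier[OF i]], of "dg i + p" i "dg i + r" "2 ^ kk bs (Suc i)"] p by simp
  finally show ?thesis using p carrier_matD(2)[OF block_carrier[OF i]] by simp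
qed

lemma Bpre_det_Suc:
  assumes i: "i < length bs"
  shows "det (Bpre bs (Suc i)) = det (Bpre bs i) * (2 ^ kk bs (Suc i)) ^ dim_row (CC bs (Suc i)) * det (CC bs (Suc i))"
  unfolding Bpre_Suc[OF i]
  using perp_det[OF Bpre_carrier smult_carrier_mat[OF block_carrier[OF i]], of i "2 ^ kk bs (Suc i)"] carrier_matD[OF block_carrier[OF i]]
  by (simp add: mult.assoc)



section \<open>Adapted bases, built block by block\<close>

definition std_vec :: "nat \<Rightarrow> nat \<Rightarrow> 'a" where "std_vec p = (\<lambda>r. if r = p then 1 else 0)"

lemma bf_std_vec_left: assumes p: "p < N" shows "bf (std_vec p) y = (\<Sum>r<N. BB $$ (p, r) * y r)"
proof -
  have "bf (std_vec p) y = (\<Sum>p'<N. if p' = p then (\<Sum>r<N. BB $$ (p, r) * y r) else 0)"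
    unfolding bf_def by (intro sum.cong refl) (auto simp: std_vec_def)
  then show ?thesis using p by simp
qed

lemma bf_std_vec: assumes p: "p < N" "r < N" shows "bf (std_vec p) (std_vec r) = BB $$ (p, r)"
proof -
  have "bf (std_vec p) (std_vec r) = (\<Sum>r'<N. if r' = r then BB $$ (p, r) else 0)"
    unfolding bf_std_vec_left[OF p(1)] by (intro sum.cong refl) (auto simp: std_vec_def)
  then show ?thesis using p by simp
qed

lemma orth_std_vec: assumes p: "p < N" "dg i \<le> p" and y: "\<And>r. r \<ge> dg i \<Longrightarrow> y r = 0" shows "bb (std_vec p) y = 0"
proof -
  have "BB $$ (p, r) * y r = 0" if "r < N" for r
    using BB_index(3)[of p r i] that p y[of r] by (cases "r < dg i") auto
  then have "(\<Sum>r<N. BB $$ (p, r) * y r) = 0" by (intro sum.neutral) simp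
  then show ?thesis unfolding bb_def bf_std_vec_left[OF p(1)] by simp
qed

text \<open>Columns of an integral upper unitriangular base change. It preserves the span of the
  first p coordinate vectors for every p, hence the determinants and discriminants of all upper-left
  blocks.\<close>

definition tri :: "nat \<Rightarrow> (nat \<Rightarrow> nat \<Rightarrow> 'a) \<Rightarrow> bool" where
  "tri m e \<longleftrightarrow> (\<forall>j<m. e j j = 1 \<and> (\<forall>p>j. e j p = 0) \<and> (\<forall>p. ge (e j p) 0))"

lemma triD: assumes "tri m e" "j < m" shows "e j j = 1" "p > j \<Longrightarrow> e j p = 0" "ge (e j p) 0"
  using assms by (auto simp: tri_def)

lemma tri_new:
  assumes t: "tri d e" and x: "\<And>k. k < d \<Longrightarrow> ge (x k) 0"
  shows "tri (Suc d) (e(d := std_vec d + lc {..<d} x e))"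
proof -
  let ?f = "std_vec d + lc {..<d} x e"
  have lcp: "lc {..<d} x e p = (\<Sum>k<d. x k * e k p)" for p by (simp add: lc_def sum_fun_apply fsc_def)
  have 0: "lc {..<d} x e p = 0" if "p \<ge> d" for p unfolding lcp using triD(2)[OF t] that by (intro sum.neutral) auto
  have "ge (lc {..<d} x e p) 0" for p unfolding lcp using x triD(3)[OF t] by (intro ge_sum ge_prod0) auto
  then have "ge (?f p) 0" for p by (cases "p = d") (auto simp: std_vec_def intro!: ge_add)
  moreover have "?f d = 1" "\<And>p. p > d \<Longrightarrow> ?f p = 0" using 0 by (auto simp: std_vec_def)
  ultimately show ?thesis using t by (auto simp: tri_def less_Suc_eq)
qed

lemma tri_det:
  assumes t: "tri m e" shows "det (mat m m (\<lambda>(p, j). e j p)) = 1"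
proof -
  let ?R = "mat m m (\<lambda>(p, j). e j p)"
  have R: "?R \<in> carrier_mat m m" by simp
  have ut: "upper_triangular ?R" using triD(2)[OF t] by (auto simp: upper_triangular_def)
  have "det ?R = prod_list (diag_mat ?R)" by (rule det_upper_triangular[OF ut R])
  also have "diag_mat ?R = map (\<lambda>_. 1) [0..<m]" using triD(1)[OF t] by (auto simp: diag_mat_def)
  also have "prod_list \<dots> = (1::'a)" by (induction m) auto
  finally show ?thesis .
qed

lemma gram_tri_det:
  assumes m: "m \<le> N" and t: "tri m e" shows "det (gram m e) = det (upleft BB m)"
proof -
  let ?R = "mat m m (\<lambda>(p, j). e j p)"
  have R: "?R \<in> carrier_mat m m" by simp
  have 1: "det ?R = 1" by (rule tri_det[OF t])
  have "gram m e = transpose_mat ?R * upleft BB m * ?R" using triD(2)[OF t] by (intro gram_supp[OF m]) auto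
  then have "det (gram m e) = det (transpose_mat ?R * upleft BB m) * det ?R" using det_mult[of "transpose_mat ?R * upleft BB m" m ?R] by simp
  also have "det (transpose_mat ?R * upleft BB m) = det (transpose_mat ?R) * det (upleft BB m)"
    using det_mult[of "transpose_mat ?R" m "upleft BB m"] by simp
  finally show ?thesis using 1 det_transpose[OF R] by simp
qed

text \<open>The criterion of \<open>nondeg_char\<close> for the first i blocks. It mentions the form
  only, so it can be evaluated before any adapted basis is known.\<close>

definition prefix_nondeg :: "nat \<Rightarrow> int \<Rightarrow> bool" where
  "prefix_nondeg i t \<longleftrightarrow> (if even (dg i) then xi v (Bpre bs i) \<noteq> 0 else odd (v (det (Bpre bs i)) - t))"

lemma nondeg_prefix_nondeg:
  assumes t: "tri (dg i) e" and ai: "aint {..<dg i} e a" and sr: "\<And>t. semireg {..<dg i} e a t"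
  shows "nondeg {..<dg i} e a l \<longleftrightarrow> prefix_nondeg i l" "det (Bpre bs i) \<noteq> 0"
proof -
  have d: "det (gram (dg i) e) = det (Bpre bs i)" using gram_tri_det[OF dg_le_N t] unfolding upleft_BB .
  have "D_inv (gram (dg i) e) = D_inv (Bpre bs i)"
    unfolding D_inv_def d carrier_matD(1)[OF Bpre_carrier] carrier_matD(1)[OF gram_carrier] ..
  then have x: "xi v (gram (dg i) e) = xi v (Bpre bs i)" by (simp add: xi_def)
  show "nondeg {..<dg i} e a l \<longleftrightarrow> prefix_nondeg i l" unfolding nondeg_char(1)[OF ai sr] prefix_nondeg_def d x ..
  show "det (Bpre bs i) \<noteq> 0" using nondeg_char(2)[OF ai sr] d by simp
qed

text \<open>The last clause says that the levels jump only at ends of blocks, where the truncated family is again semiregular.\<close>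
definition adapted :: "nat \<Rightarrow> (nat \<Rightarrow> nat \<Rightarrow> 'a) \<Rightarrow> (nat \<Rightarrow> int) \<Rightarrow> bool" where
  "adapted i e a \<longleftrightarrow> tri (dg i) e \<and> aint {..<dg i} e a \<and> (\<forall>t. semireg {..<dg i} e a t) \<and>
     (\<forall>j k. j \<le> k \<longrightarrow> k < dg i \<longrightarrow> a j \<le> a k) \<and> (\<forall>k<dg i. 0 \<le> a k) \<and>
     (\<forall>p. 0 < p \<longrightarrow> p < dg i \<longrightarrow> a (p - 1) < a p \<longrightarrow> (\<exists>l\<ge>1. l \<le> i \<and> p = dg l \<and> (\<forall>t. semireg {..<p} e a t)))"

lemma adapted_D:
  assumes "adapted i e a"
  shows "tri (dg i) e" "aint {..<dg i} e a" "semireg {..<dg i} e a t" "j \<le> k \<Longrightarrow> k < dg i \<Longrightarrow> a j \<le> a k"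
    "k < dg i \<Longrightarrow> 0 \<le> a k"
    "0 < p \<Longrightarrow> p < dg i \<Longrightarrow> a (p - 1) < a p \<Longrightarrow> \<exists>l\<ge>1. l \<le> i \<and> p = dg l \<and> (\<forall>t. semireg {..<p} e a t)"
proof -
  note c = assms[unfolded adapted_def]
  note c1 = c[THEN conjunct2] note c2 = c1[THEN conjunct2] note c3 = c2[THEN conjunct2] note c4 = c3[THEN conjunct2]
  show "tri (dg i) e" by (rule c[THEN conjunct1])
  show "aint {..<dg i} e a" by (rule c1[THEN conjunct1])
  show "semireg {..<dg i} e a t" by (rule c2[THEN conjunct1, rule_format])
  show "j \<le> k \<Longrightarrow> k < dg i \<Longrightarrow> a j \<le> a k" by (rule c3[THEN conjunct1, rule_format])
  show "k < dg i \<Longrightarrow> 0 \<le> a k" by (rule c4[THEN conjunct1, rule_format])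
  show "0 < p \<Longrightarrow> p < dg i \<Longrightarrow> a (p - 1) < a p \<Longrightarrow> \<exists>l\<ge>1. l \<le> i \<and> p = dg l \<and> (\<forall>t. semireg {..<p} e a t)"
    using c4[THEN conjunct2] by (elim allE impE)
qed

text \<open>All new vectors have one common level, at least as large as the earlier ones, so the
  only possible new jump is at the old end \<open>dg i\<close>, which is an end of a block.\<close>

lemma adapted_extend:
  assumes G: "adapted i e a" and i: "i \<le> i'"
    and eq: "\<And>k. k < dg i \<Longrightarrow> e' k = e k" "\<And>k. k < dg i \<Longrightarrow> a' k = a k"
    and t: "tri (dg i') e'" and ai: "aint {..<dg i'} e' a'" and sr: "\<And>t. semireg {..<dg i'} e' a' t"
    and r: "\<And>k. dg i \<le> k \<Longrightarrow> k < dg i' \<Longrightarrow> a' k = r" "0 \<le> r" "\<And>k. k < dg i \<Longrightarrow> a k \<le> r"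
  shows "adapted i' e' a'" "\<And>k. k < dg i' \<Longrightarrow> a' k \<le> r"
proof -
  note G' = adapted_D[OF G]
  show le: "a' k \<le> r" if "k < dg i'" for k using that r eq by (cases "k < dg i") auto
  have mono: "a' j \<le> a' k" if jk: "j \<le> k" "k < dg i'" for j k
  proof (cases "k < dg i")
    case True then show ?thesis using G'(4)[OF jk(1) True] eq(2)[of j] eq(2)[of k] jk by simp
  next
    case False then show ?thesis using r(1)[of k] le[of j] jk by simp
  qed
  have pos: "0 \<le> a' k" if "k < dg i'" for k using that r(1,2) eq(2) G'(5) by (cases "k < dg i") auto
  have cut: "\<exists>l\<ge>1. l \<le> i' \<and> p = dg l \<and> (\<forall>t. semireg {..<p} e' a' t)" if p: "0 < p" "p < dg i'" "a' (p - 1) < a' p" for p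
  proof -
    consider "p < dg i" | "p = dg i" | "p > dg i" by linarith
    then show ?thesis
    proof cases
      case 1
      then have "a (p - 1) < a p" using p eq(2)[of p] eq(2)[of "p - 1"] by simp
      then obtain l where l: "l \<ge> 1" "l \<le> i" "p = dg l" "\<forall>t. semireg {..<p} e a t" using G'(6)[OF p(1) 1] by blast
      have "semireg {..<p} e' a' t" for t using fam_cong(2)[of "{..<p}" e e' a a' t] l(4) eq 1 by simp
      then show ?thesis using l i by (intro exI[of _ l]) auto
    next
      case 2
      have "i \<ge> 1" using 2 p dg_0 by (cases i) auto
      moreover have "semireg {..<p} e' a' t" for t using fam_cong(2)[of "{..<p}" e e' a a' t] G'(3) eq 2 by simp
      ultimately show ?thesis using 2 i by (intro exI[of _ i]) auto
    next
      case 3 then show ?thesis using r(1)[of p] r(1)[of "p - 1"] p by simp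
    qed
  qed
  show "adapted i' e' a'" unfolding adapted_def by (intro conjI allI impI) (fact t ai sr mono pos cut)+
qed

text \<open>A level at most l + 1 leaves a nonnegative coefficient bound, as
  \<open>hc (- 1) = 0\<close>. This makes the corrections of diagonal vectors integral.\<close>

lemma cA_int:
  assumes c: "cA S a l x" and a: "\<And>k. k \<in> S \<Longrightarrow> a k \<le> l + 1" and k: "k \<in> S" shows "ge (x k) 0"
proof -
  have "ge (x k) (hc (l - a k))" using c k by (simp add: cA_def)
  moreover have "0 \<le> hc (l - a k)" using a[OF k] by (simp add: hc_def)
  ultimately show ?thesis using ge_mono by blast
qed

lemma orth_e:
  assumes t: "tri (dg i) e" and p: "dg i \<le> p" "p < N" and k: "k \<in> {..<dg i}" shows "bb (std_vec p) (e k) = 0"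
  by (rule orth_std_vec[OF p(2,1)]) (use triD(2)[OF t, of k] k in auto)

lemma lessThan_Suc2: "{..<Suc (Suc d)} = insert (Suc d) (insert d {..<d})" by auto

text \<open>The two basis vectors of the block need no correction: they are orthogonal to everything
  before and span a plane whose polar value has exact order equal to the scale.\<close>

lemma step_even:
  assumes i: "i < length bs" and nD: "\<not> unimod_diag v (CC bs (Suc i))" and G: "adapted i e a"
    and T: "\<And>k. k < dg i \<Longrightarrow> a k \<le> int (kk bs (Suc i))"
  shows "\<exists>e' a'. adapted (Suc i) e' a' \<and> (\<forall>k<dg (Suc i). a' k \<le> int (kk bs (Suc i)))"
proof -
  note G' = adapted_D[OF G]
  define l where "l = int (kk bs (Suc i))"
  define d where "d = dg i"
  define C where "C = CC bs (Suc i)"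
  have "valid_block v (bs ! i)" using valid i by simp
  then have "half_even_unimod v C" using nD unfolding valid_block_def C_def CC_def by simp
  then obtain M where M: "M \<in> carrier_mat 2 2" "transpose_mat M = M" "\<forall>i<2. \<forall>j<2. intg v (M $$ (i, j))"
    "ge (M $$ (0, 0)) 1" "ge (M $$ (1, 1)) 1" "GL_o v 2 M" "C = (1 / 2) \<cdot>\<^sub>m M"
    unfolding half_even_unimod_def by blast
  have C2: "dim_row C = 2" using M by simp
  have dS: "dg (Suc i) = Suc (Suc d)" using dg_Suc[OF i] C2 by (simp add: C_def d_def)
  have dN: "Suc d < N" "d < N" using dg_le_N[of "Suc i"] dS by auto
  have sym: "M $$ (1, 0) = M $$ (0, 1)" using arg_cong[OF M(2), of "\<lambda>X. X $$ (1, 0)"] M(1) by simp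
  have Cij: "C $$ (p, r) = M $$ (p, r) / 2" if "p < 2" "r < 2" for p r using that M(1,7) by simp
  have g01: "ge (M $$ (0, 1)) 0" using M(3) by (simp add: intg_def)
  \<comment> \<open>The diagonal of M is even and its determinant a unit, so the off-diagonal entry
    is a unit.\<close>
  have "\<not> ge (M $$ (0, 1)) 1"
  proof
    assume g: "ge (M $$ (0, 1)) 1"
    have "ge (M $$ (p, r)) 1" if "p < 2" "r < 2" for p r
      using that g sym M(4,5) by (auto simp: less_2_cases_iff)
    then have "ge (det M) 2" by (intro det_ge[OF M(1), of "\<lambda>_ _. 1"]) auto
    then show False using ex_not_ge[OF GL_oD(3)[OF M(6)]] ge_mono[of "det M" 2 1] by simp
  qed
  then have u: "ex (M $$ (0, 1)) 0" using g01 by (simp add: ex_iff)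
  have E: "BB $$ (d + p, d + r) = tw l * (M $$ (p, r) / 2)" if "p < 2" "r < 2" for p r
    using BB_block[OF i, of p r] that C2 Cij[OF that] by (simp add: C_def[symmetric] d_def l_def two_power_tw)
  have q1: "ge (q (std_vec d)) l"
  proof -
    have "ge (M $$ (0, 0) / 2) 0" using ge_divide[OF M(4), of 2 1] by simp
    then have "ge (tw l * (M $$ (0, 0) / 2)) l" using ge_mult[OF ex_ge[OF ex_tw[of l]]] by fastforce
    then show ?thesis unfolding q_def bf_std_vec[OF dN(2) dN(2)] by (rule ge_eq) (use E[of 0 0] in simp)
  qed
  have q2: "ge (q (std_vec (Suc d))) l"
  proof -
    have "ge (M $$ (1, 1) / 2) 0" using ge_divide[OF M(5), of 2 1] by simp
    then have "ge (tw l * (M $$ (1, 1) / 2)) l" using ge_mult[OF ex_ge[OF ex_tw[of l]]] by fastforce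
    then show ?thesis unfolding q_def bf_std_vec[OF dN(1) dN(1)] by (rule ge_eq) (use E[of 1 1] in simp)
  qed
  have "bb (std_vec d) (std_vec (Suc d)) = tw l * M $$ (0, 1)"
    unfolding bb_def bf_std_vec[OF dN(2) dN(1)] using E[of 0 1] by (simp add: mult.commute)
  then have b12: "ex (bb (std_vec d) (std_vec (Suc d))) l" using ex_mult[OF ex_tw[of l] u] by simp
  then have b21: "ex (bb (std_vec (Suc d)) (std_vec d)) l" using bb_sym[of "std_vec d" "std_vec (Suc d)"] by simp
  have o1: "bb (std_vec d) (e k) = 0" if "k \<in> {..<d}" for k using orth_e[OF G'(1) _ dN(2), of k] that by (simp add: d_def)
  have o2: "bb (std_vec (Suc d)) (e k) = 0" if "k \<in> {..<d}" for k using orth_e[OF G'(1) _ dN(1), of k] that by (simp add: d_def)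
  let ?e1 = "e(d := std_vec d)" and ?a1 = "a(d := l)"
  let ?e = "?e1(Suc d := std_vec (Suc d))" and ?a = "?a1(Suc d := l)"
  have a1: "aint (insert d {..<d}) ?e1 ?a1"
    by (rule add_aint) (use G'(2) q1 o1 in \<open>auto simp: d_def lev_def\<close>)
  have l2: "lev (insert d {..<d}) ?e1 ?a1 l (std_vec (Suc d))"
    unfolding lev_def
  proof
    fix k assume k: "k \<in> insert d {..<d}"
    show "ge (bb (std_vec (Suc d)) (?e1 k)) (hc (l + ?a1 k))"
      using k o2[of k] ex_ge[OF b21] by (cases "k = d") auto
  qed
  have a2: "aint {..<Suc (Suc d)} ?e ?a" unfolding lessThan_Suc2 by (rule add_aint[OF a1 _ l2 q2]) auto
  have sr: "semireg {..<Suc (Suc d)} ?e ?a t" for t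
  proof -
    have "semireg {..<d} ?e ?a t" using fam_cong(2)[of "{..<d}" e ?e a ?a t] G'(3) by (simp add: d_def)
    moreover have "semireg {..<Suc (Suc d)} ?e ?a t \<longleftrightarrow> semireg {..<d} ?e ?a t"
      unfolding lessThan_Suc2
    proof (rule plane_split(2)[where lam = "\<lambda>_. 0" and mu = "\<lambda>_. 0" and h = l])
      show "aint (insert (Suc d) (insert d {..<d})) ?e ?a" using a2 unfolding lessThan_Suc2 .
      show "ex (bb (?e (Suc d)) (?e d)) l" using b21 by simp
      show "bb (?e k) (?e (Suc d)) = 0" "bb (?e k) (?e d) = 0" if "k \<in> {..<d}" for k
        using o1[OF that] o2[OF that] that bb_sym[of "e k"] by auto
    qed auto
    ultimately show ?thesis by simp
  qed
  have t1: "tri (Suc d) ?e1" using tri_new[OF G'(1), of "\<lambda>_. 0"] by (simp add: lc_zero d_def)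
  have t2: "tri (Suc (Suc d)) ?e" using tri_new[OF t1, of "\<lambda>_. 0"] by (simp add: lc_zero)
  have "adapted (Suc i) ?e ?a" "\<And>k. k < dg (Suc i) \<Longrightarrow> ?a k \<le> l"
    by (rule adapted_extend[OF G, of "Suc i" ?e ?a l]; use t2 a2 sr T in \<open>auto simp: dS d_def[symmetric] l_def\<close>)+
  then show ?thesis unfolding l_def by blast
qed

lemma D_block:
  assumes i: "i < length bs" and D: "unimod_diag v (CC bs (Suc i))" and p: "p < dim_row (CC bs (Suc i))"
  shows "ex (q (std_vec (dg i + p))) (int (kk bs (Suc i)))"
    and "r < dim_row (CC bs (Suc i)) \<Longrightarrow> p \<noteq> r \<Longrightarrow> bb (std_vec (dg i + p)) (std_vec (dg i + r)) = 0"
proof -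
  have dN: "dg i + r < N" if "r < dim_row (CC bs (Suc i))" for r using that dg_Suc[OF i] dg_le_N[of "Suc i"] by simp
  have "ex (CC bs (Suc i) $$ (p, p)) 0" using D p by (auto simp: unimod_diag_def unit_o_def ex_def)
  then have "ex (BB $$ (dg i + p, dg i + p)) (int (kk bs (Suc i)))"
    unfolding BB_block[OF i p p] two_power_tw using ex_mult[OF ex_tw] by fastforce
  then show "ex (q (std_vec (dg i + p))) (int (kk bs (Suc i)))" unfolding q_def bf_std_vec[OF dN[OF p] dN[OF p]] .
  show "bb (std_vec (dg i + p)) (std_vec (dg i + r)) = 0" if r: "r < dim_row (CC bs (Suc i))" and ne: "p \<noteq> r"
    unfolding bb_def bf_std_vec[OF dN[OF p] dN[OF r]] BB_block[OF i p r] using D p r ne by (auto simp: unimod_diag_def)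
qed

text \<open>The outcome of \<open>add_unary\<close> in terms of the form. The two bounds in T are
  what monotonicity needs: level l occurs only next to a nondegenerate prefix, and otherwise the
  level is at least l + 1.\<close>

lemma step_unary:
  assumes i: "i < length bs" and D: "unimod_diag v (CC bs (Suc i))" and dm: "dim_row (CC bs (Suc i)) = 1" and G: "adapted i e a"
    and l: "l = int (kk bs (Suc i))" and T: "\<And>k. k < dg i \<Longrightarrow> a k \<le> l + 1" "\<And>k. prefix_nondeg i l \<Longrightarrow> k < dg i \<Longrightarrow> a k \<le> l"
  shows "\<exists>e' a' r. adapted (Suc i) e' a' \<and> (\<forall>k<dg (Suc i). a' k \<le> r) \<and>
    (r = l \<and> prefix_nondeg i l \<or> r = l + 1 \<and> \<not> prefix_nondeg i l \<and> \<not> prefix_nondeg (Suc i) l \<or> r = l + 2 \<and> \<not> prefix_nondeg i l \<and> prefix_nondeg (Suc i) l)"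
proof -
  note G' = adapted_D[OF G]
  define d where "d = dg i"
  have dS: "dg (Suc i) = Suc d" using dg_Suc[OF i] dm by (simp add: d_def)
  have dN: "d < N" using dg_le_N[of "Suc i"] dS by auto
  have qn: "ex (q (std_vec d)) l" using D_block(1)[OF i D, of 0] dm by (simp add: d_def l)
  have o1: "bb (std_vec d) (e k) = 0" if "k \<in> {..<d}" for k using orth_e[OF G'(1) _ dN, of k] that by (simp add: d_def)
  obtain x r where x: "cA {..<d} a l x" and ai: "aint (insert d {..<d}) (e(d := std_vec d + lc {..<d} x e)) (a(d := r))"
    and sr: "\<forall>t. semireg (insert d {..<d}) (e(d := std_vec d + lc {..<d} x e)) (a(d := r)) t"
    and r: "r = l \<and> nondeg {..<d} e a l \<or>
      r = l + 1 \<and> \<not> nondeg {..<d} e a l \<and> \<not> nondeg (insert d {..<d}) (e(d := std_vec d + lc {..<d} x e)) (a(d := r)) l \<or>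
      r = l + 2 \<and> \<not> nondeg {..<d} e a l \<and> nondeg (insert d {..<d}) (e(d := std_vec d + lc {..<d} x e)) (a(d := r)) l"
    using add_unary[OF finite_lessThan _ G'(2) G'(3) _ qn, of d, folded d_def, OF _ o1] by auto
  define e' where "e' = e(d := std_vec d + lc {..<d} x e)"
  have st: "insert d {..<d} = {..<Suc d}" by auto
  have t: "tri (Suc d) e'" unfolding e'_def
    using G'(1) T(1) cA_int[OF x] by (intro tri_new) (auto simp: d_def)
  note R0 = nondeg_prefix_nondeg(1)[OF G'(1) G'(2) G'(3), of l, folded d_def]
  have R1: "nondeg {..<Suc d} e' (a(d := r)) l \<longleftrightarrow> prefix_nondeg (Suc i) l"
    using nondeg_prefix_nondeg(1)[of "Suc i" e' "a(d := r)" l] t ai sr unfolding dS st e'_def by blast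
  have r': "r = l \<and> prefix_nondeg i l \<or> r = l + 1 \<and> \<not> prefix_nondeg i l \<and> \<not> prefix_nondeg (Suc i) l \<or> r = l + 2 \<and> \<not> prefix_nondeg i l \<and> prefix_nondeg (Suc i) l"
    using r unfolding st e'_def[symmetric] R0 R1 .
  have le: "a k \<le> r" if "k < dg i" for k using r' T(1)[OF that] T(2)[OF _ that] by auto
  have "0 \<le> r" using r' l by auto
  then have "adapted (Suc i) e' (a(d := r))" "\<And>k. k < dg (Suc i) \<Longrightarrow> (a(d := r)) k \<le> r"
    using le t ai sr by (intro adapted_extend[OF G, of "Suc i" e' "a(d := r)" r]; auto simp: dS d_def[symmetric] st e'_def)+
  then show ?thesis using r' by blast
qed

text \<open>Serves a diagonal block of degree 2 as well as two merged blocks of degree 1. The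
  condition \<open>alt\<close> excludes unequal levels: if the first vector got l + 1, the second
  could only differ from it by making the end nondegenerate.\<close>

lemma step_unary_pair:
  assumes i: "i \<le> i'" and dS: "dg i' = dg i + 2" and G: "adapted i e a"
    and l0: "0 \<le> l" and T: "\<And>k. k < dg i \<Longrightarrow> a k \<le> l + 1"
    and qn: "ex (q (std_vec (dg i))) l" "ex (q (std_vec (Suc (dg i)))) l" "bb (std_vec (Suc (dg i))) (std_vec (dg i)) = 0"
    and nR: "\<not> prefix_nondeg i l" and alt: "\<not> prefix_nondeg i' l \<or> dg (Suc i) = Suc (dg i) \<and> prefix_nondeg (Suc i) l"
  shows "\<exists>e' a'. adapted i' e' a' \<and> (\<forall>k<dg i'. a' k \<le> l + 1)"
proof -
  note G' = adapted_D[OF G]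
  define d where "d = dg i"
  have dS': "dg i' = Suc (Suc d)" using dS by (simp add: d_def)
  have dN: "d < N" "Suc d < N" using dg_le_N[of i'] dS' by auto
  note qn' = qn[folded d_def]
  have b12: "bb (std_vec d) (std_vec (Suc d)) = 0" using qn'(3) bb_sym by simp
  have o1: "bb (std_vec d) (e k) = 0" if "k \<in> {..<d}" for k using orth_e[OF G'(1) _ dN(1), of k] that by (simp add: d_def)
  have o2: "bb (std_vec (Suc d)) (e k) = 0" if "k \<in> {..<d}" for k using orth_e[OF G'(1) _ dN(2), of k] that by (simp add: d_def)
  have st: "insert d {..<d} = {..<Suc d}" by auto
  have st2: "insert (Suc d) {..<Suc d} = {..<Suc (Suc d)}" by auto
  note R0 = nondeg_prefix_nondeg(1)[OF G'(1) G'(2) G'(3), of l, folded d_def]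
  have fin: "\<exists>e' a'. adapted i' e' a' \<and> (\<forall>k<dg i'. a' k \<le> l + 1)"
    if H: "e' = e(d := f, Suc d := g)" "a' = a(d := l + 1, Suc d := l + 1)" "tri (Suc (Suc d)) e'" "aint {..<Suc (Suc d)} e' a'" "\<And>t. semireg {..<Suc (Suc d)} e' a' t"
    for e' a' f g
  proof -
    have "adapted i' e' a'" "\<And>k. k < dg i' \<Longrightarrow> a' k \<le> l + 1"
      using H i T l0 by (intro adapted_extend[OF G, of i' e' a' "l + 1"]; auto simp: dS' d_def[symmetric])+
    then show ?thesis by blast
  qed
  \<comment> \<open>The first vector is adjoined tentatively. If its level would be l + 2, this
    attempt is discarded and both vectors are corrected simultaneously through
    \<open>free_rad\<close>.\<close>
  obtain x r where x: "cA {..<d} a l x" and ai: "aint (insert d {..<d}) (e(d := std_vec d + lc {..<d} x e)) (a(d := r))"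
    and sr: "\<forall>t. semireg (insert d {..<d}) (e(d := std_vec d + lc {..<d} x e)) (a(d := r)) t"
    and r: "r = l + 1 \<and> \<not> nondeg (insert d {..<d}) (e(d := std_vec d + lc {..<d} x e)) (a(d := r)) l \<or> r = l + 2 \<and> free_rad {..<d} e a l"
    using add_unary[OF finite_lessThan _ G'(2) G'(3) _ qn(1), of d, folded d_def, OF _ o1] nR R0 by auto
  define e1 where "e1 = e(d := std_vec d + lc {..<d} x e)"
  have xi: "ge (x k) 0" if "k < d" for k using cA_int[OF x, of k] T that by (simp add: d_def)
  have t1: "tri (Suc d) e1" unfolding e1_def using G'(1) xi by (intro tri_new) (auto simp: d_def)
  show ?thesis
  proof (cases "r = l + 2")
    case True
    then have free_rad: "free_rad {..<d} e a l" using r by simp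
    obtain x1 x2 where xx: "cA {..<d} a l x1" "cA {..<d} a l x2"
      and ai2: "aint (insert (Suc d) (insert d {..<d})) (e(d := std_vec d + lc {..<d} x1 e, Suc d := std_vec (Suc d) + lc {..<d} x2 e)) (a(d := l + 1, Suc d := l + 1))"
      and sr2: "\<forall>t. semireg (insert (Suc d) (insert d {..<d})) (e(d := std_vec d + lc {..<d} x1 e, Suc d := std_vec (Suc d) + lc {..<d} x2 e)) (a(d := l + 1, Suc d := l + 1)) t"
      using add_unary_pair[OF finite_lessThan _ _ _ G'(2)[folded d_def] G'(3)[folded d_def] free_rad o1 o2 b12 qn'(1,2), of d "Suc d"] by auto
    have xi1: "ge (x1 k) 0" "ge (x2 k) 0" if "k < d" for k
      using cA_int[OF xx(1), of k] cA_int[OF xx(2), of k] T that by (auto simp: d_def)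
    let ?f = "std_vec d + lc {..<d} x1 e" and ?g = "std_vec (Suc d) + lc {..<d} x2 e"
    have u1: "tri (Suc d) (e(d := ?f))" using G'(1) xi1 by (intro tri_new) (auto simp: d_def)
    have "lc {..<Suc d} (x2(d := 0)) (e(d := ?f)) = lc {..<d} x2 e"
      unfolding st[symmetric] by (simp add: lc_insert lc_upd)
    then have u2: "tri (Suc (Suc d)) (e(d := ?f, Suc d := ?g))"
      using tri_new[OF u1, of "x2(d := 0)"] xi1(2) by (fastforce simp: less_Suc_eq)
    show ?thesis using fin[OF refl refl u2] ai2 sr2 unfolding lessThan_Suc2 by blast
  next
    case False
    then have rl: "r = l + 1" and nR1: "\<not> nondeg {..<Suc d} e1 (a(d := r)) l" using r unfolding st e1_def by auto
    have ai1: "aint {..<Suc d} e1 (a(d := r))" and sr1: "\<And>t. semireg {..<Suc d} e1 (a(d := r)) t" using ai sr unfolding st e1_def by auto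
    have "\<not> (dg (Suc i) = Suc (dg i) \<and> prefix_nondeg (Suc i) l)"
    proof
      assume A: "dg (Suc i) = Suc (dg i) \<and> prefix_nondeg (Suc i) l"
      then have s: "dg (Suc i) = Suc d" by (simp add: d_def)
      have "nondeg {..<Suc d} e1 (a(d := r)) l \<longleftrightarrow> prefix_nondeg (Suc i) l"
        using nondeg_prefix_nondeg(1)[of "Suc i" e1 "a(d := r)" l] t1 ai1 sr1 unfolding s by blast
      then show False using A nR1 by simp
    qed
    \<comment> \<open>With level l + 1 for the first vector the intermediate prefix is degenerate at
      l, so the first alternative in \<open>alt\<close> must hold. It rules out level l + 2 for the
      second vector.\<close>
    then have nR2: "\<not> prefix_nondeg i' l" using alt by blast
    have o3: "bb (std_vec (Suc d)) (e1 k) = 0" if k: "k \<in> {..<Suc d}" for k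
    proof (cases "k = d")
      case True
      have "bb (std_vec (Suc d)) (lc {..<d} x e) = 0" by (rule orth_lc) (rule o2)
      then show ?thesis using True qn'(3) by (simp add: e1_def bb_add2)
    next
      case False then show ?thesis using o2[of k] k by (simp add: e1_def)
    qed
    obtain x2 r2 where x2: "cA {..<Suc d} (a(d := r)) l x2"
      and ai2: "aint (insert (Suc d) {..<Suc d}) (e1(Suc d := std_vec (Suc d) + lc {..<Suc d} x2 e1)) ((a(d := r))(Suc d := r2))"
      and sr2: "\<forall>t. semireg (insert (Suc d) {..<Suc d}) (e1(Suc d := std_vec (Suc d) + lc {..<Suc d} x2 e1)) ((a(d := r))(Suc d := r2)) t"
      and r2: "r2 = l + 1 \<or> nondeg (insert (Suc d) {..<Suc d}) (e1(Suc d := std_vec (Suc d) + lc {..<Suc d} x2 e1)) ((a(d := r))(Suc d := r2)) l"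
      using add_unary[OF finite_lessThan _ ai1 sr1 o3 qn'(2), of "Suc d"] nR1 by auto
    let ?e2 = "e1(Suc d := std_vec (Suc d) + lc {..<Suc d} x2 e1)"
    have "ge (x2 k) 0" if "k < Suc d" for k
    proof (rule cA_int[OF x2])
      show "(a(d := r)) k \<le> l + 1" if "k \<in> {..<Suc d}" for k
        using T[of k] that rl by (cases "k = d") (auto simp: d_def)
    qed (use that in simp)
    then have t2: "tri (Suc (Suc d)) ?e2" by (rule tri_new[OF t1])
    have "nondeg {..<Suc (Suc d)} ?e2 ((a(d := r))(Suc d := r2)) l \<longleftrightarrow> prefix_nondeg i' l"
      using nondeg_prefix_nondeg(1)[of i' ?e2 "(a(d := r))(Suc d := r2)" l] t2 ai2 sr2 unfolding dS' st2 by blast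
    then have "r2 = l + 1" using r2 nR2 unfolding st2 by blast
    then have A2: "a(d := l + 1, Suc d := l + 1) = (a(d := r))(Suc d := r2)" using rl by simp
    show ?thesis by (rule fin[OF _ A2[symmetric] t2]) (use ai2 sr2 in \<open>auto simp: st2 e1_def\<close>)
  qed
qed

lemma adapted_0: "adapted 0 e a"
  by (simp add: adapted_def tri_def aint_def semireg_def cA_def)


section \<open>Pre-optimal forms\<close>


lemma ex_prod_list: "(\<And>x. x \<in> set xs \<Longrightarrow> ex x 0) \<Longrightarrow> ex (prod_list xs) 0"
proof (induction xs)
  case (Cons x xs)
  have "ex x 0" "ex (prod_list xs) 0" using Cons by auto
  then show ?case using ex_mult[of x 0 "prod_list xs" 0] by simp
qed simp

lemma det_unimod_diag: assumes D: "unimod_diag v C" shows "ex (det C) 0"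
proof -
  define n where "n = dim_row C"
  have c: "C \<in> carrier_mat n n" and o: "\<And>i j. i < n \<Longrightarrow> j < n \<Longrightarrow> i \<noteq> j \<Longrightarrow> C $$ (i, j) = 0" and u: "\<And>i. i < n \<Longrightarrow> ex (C $$ (i, i)) 0"
    using D unfolding unimod_diag_def n_def[symmetric] unit_o_def ex_def by blast+
  have "upper_triangular C" using o n_def by (auto simp: upper_triangular_def)
  then have "det C = prod_list (diag_mat C)" using det_upper_triangular c by blast
  moreover have "ex (prod_list (diag_mat C)) 0" by (rule ex_prod_list) (use u in \<open>auto simp: diag_mat_def n_def\<close>)
  ultimately show ?thesis by simp
qed

lemma det_block_nz: assumes i: "i < length bs" shows "det (CC bs (Suc i)) \<noteq> 0"
proof (cases "unimod_diag v (CC bs (Suc i))")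
  case True then show ?thesis using ex_nz[OF det_unimod_diag] by blast
next
  case False
  have "valid_block v (bs ! i)" using valid i by simp
  then have "half_even_unimod v (CC bs (Suc i))" using False unfolding valid_block_def CC_def by simp
  then obtain M where M: "M \<in> carrier_mat 2 2" "GL_o v 2 M" "CC bs (Suc i) = (1 / 2) \<cdot>\<^sub>m M"
    unfolding half_even_unimod_def by blast
  then show ?thesis using GL_oD(4)[OF M(2)] by simp
qed

lemma det_Bpre_nz: "i \<le> length bs \<Longrightarrow> det (Bpre bs i) \<noteq> 0"
proof (induction i)
  case 0
  have "Bpre bs 0 \<in> carrier_mat 0 0" using Bpre_carrier[of 0] by simp
  then show ?case by simp
next
  case (Suc i)
  then show ?case using Bpre_det_Suc[of i] det_block_nz[of i] by simp
qed

lemma v_det_Suc: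
  assumes i: "i < length bs" and D: "unimod_diag v (CC bs (Suc i))"
  shows "v (det (Bpre bs (Suc i))) = v (det (Bpre bs i)) + int (kk bs (Suc i)) * int (dim_row (CC bs (Suc i)))"
proof -
  have "ex (det (Bpre bs i)) (v (det (Bpre bs i)))" using ex_self det_Bpre_nz i by simp
  moreover have "ex ((2 ^ kk bs (Suc i)) ^ m) (int (kk bs (Suc i)) * int m)" for m
    using ex_tw[of "int (kk bs (Suc i)) * int m"] two_power_tw[of "kk bs (Suc i) * m"] by (simp add: power_mult)
  ultimately have "ex (det (Bpre bs (Suc i))) (v (det (Bpre bs i)) + int (kk bs (Suc i)) * int (dim_row (CC bs (Suc i))) + 0)"
    unfolding Bpre_det_Suc[OF i] by (intro ex_mult det_unimod_diag[OF D])
  then show ?thesis by (simp add: ex_def)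
qed

lemma prefix_nondeg_0: "prefix_nondeg 0 t"
proof -
  have "D_inv (Bpre bs 0) = 1" using Bpre_carrier[of 0] by (simp add: D_inv_def)
  then have "xi v (Bpre bs 0) = 1" by (auto simp: xi_def is_square_def intro: exI[of _ 1])
  then show ?thesis by (simp add: prefix_nondeg_def)
qed

end

locale preopt = preform v bs for v :: "'a::field \<Rightarrow> int" and bs +
  assumes po1: "PO1 v bs" and po2: "PO2 v bs" and po3: "PO3 v bs" and po4: "PO4 v bs" and po5: "PO5 v bs" and po6: "PO6 v bs"
begin

abbreviation "D i \<equiv> unimod_diag v (CC bs i)"
abbreviation "dm i \<equiv> dim_row (CC bs i)"
abbreviation "kint i \<equiv> int (kk bs i)"

lemma dim_Bpre: "dim_row (Bpre bs i) = dg i" by (rule carrier_matD(1)[OF Bpre_carrier])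

lemma dm_pos: "D i \<Longrightarrow> dm i \<ge> 1" unfolding unimod_diag_def by blast

lemma D_sum:
  assumes J: "finite J" "\<And>j. j \<in> J \<Longrightarrow> 1 \<le> j \<and> j \<le> length bs \<and> D j \<and> kk bs j = m"
  shows "(\<Sum>j\<in>J. dm j) \<le> 2"
proof -
  have "{j. isD v bs m j} \<subseteq> {..length bs}" by (auto simp: isD_def)
  then have "finite {j. isD v bs m j}" using finite_subset by blast
  then have "(\<Sum>j\<in>J. dm j) \<le> (\<Sum>j\<in>{j. isD v bs m j}. dm j)"
    by (rule sum_mono2) (use J(2) in \<open>auto simp: isD_def\<close>)
  then show ?thesis using po1 unfolding PO1_def by (meson le_trans)
qed

lemma D_dim: assumes "1 \<le> i" "i \<le> length bs" "D i" shows "dm i = 1 \<or> dm i = 2"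
  using D_sum[of "{i}" "kk bs i"] dm_pos[of i] assms by auto

lemma D_pair: assumes "1 \<le> i" "Suc i \<le> length bs" "D i" "D (Suc i)" "kk bs (Suc i) = kk bs i"
  shows "dm i = 1" "dm (Suc i) = 1"
proof -
  have "(\<Sum>j\<in>{i, Suc i}. dm j) \<le> 2" by (rule D_sum[of _ "kk bs i"]) (use assms in auto)
  then show "dm i = 1" "dm (Suc i) = 1" using dm_pos[of i] dm_pos[of "Suc i"] assms by auto
qed

lemma D_triple: assumes "1 \<le> i" "Suc (Suc i) \<le> length bs" "D i" "D (Suc i)" "D (Suc (Suc i))"
    "kk bs (Suc i) = kk bs i" "kk bs (Suc (Suc i)) = kk bs i"
  shows False
proof -
  have "(\<Sum>j\<in>{i, Suc i, Suc (Suc i)}. dm j) \<le> 2" by (rule D_sum[of _ "kk bs i"]) (use assms in auto)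
  then show False using dm_pos[of i] dm_pos[of "Suc i"] dm_pos[of "Suc (Suc i)"] assms by auto
qed

lemma order:
  assumes "1 \<le> i" "Suc i \<le> length bs"
  shows "D i \<Longrightarrow> D (Suc i) \<Longrightarrow> kint i \<le> kint (Suc i)" "\<not> D i \<Longrightarrow> \<not> D (Suc i) \<Longrightarrow> kint i \<le> kint (Suc i)"
    "D i \<Longrightarrow> \<not> D (Suc i) \<Longrightarrow> kint i + 1 \<le> kint (Suc i)" "\<not> D i \<Longrightarrow> D (Suc i) \<Longrightarrow> kint i \<le> kint (Suc i) + 1"
proof -
  note p = po2[unfolded PO2_def, rule_format, of i "Suc i", OF lessI, of "kk bs i" "kk bs (Suc i)"]
  show "D i \<Longrightarrow> D (Suc i) \<Longrightarrow> kint i \<le> kint (Suc i)" "\<not> D i \<Longrightarrow> \<not> D (Suc i) \<Longrightarrow> kint i \<le> kint (Suc i)"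
    "D i \<Longrightarrow> \<not> D (Suc i) \<Longrightarrow> kint i + 1 \<le> kint (Suc i)" "\<not> D i \<Longrightarrow> D (Suc i) \<Longrightarrow> kint i \<le> kint (Suc i) + 1"
    using p assms by (simp_all add: isD_def isE_def)
qed

text \<open>The level contributed by a diagonal block of degree one. If it exceeds the scale by \<open>2\<close> and the next block is diagonal of the
  same scale, the two vectors can be replaced by vectors of common level \<open>kint i + 1\<close>; this is the case \<open>merged\<close>.\<close>
definition lam :: "nat \<Rightarrow> int" where
  "lam i = (if prefix_nondeg (i - 1) (kint i) then kint i else if prefix_nondeg i (kint i) then kint i + 2 else kint i + 1)"

definition merged :: "nat \<Rightarrow> bool" where
  "merged i \<longleftrightarrow> 2 \<le> i \<and> D i \<and> D (i - 1) \<and> kk bs (i - 1) = kk bs i \<and> lam (i - 1) = kint i + 2"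

text \<open>An upper bound for the levels of an adapted basis of the first i blocks. After a merged
  pair the bound refers to the common level of the pair, so a preceding block may have a larger
  \<open>top_level\<close> than its successor.\<close>

definition top_level :: "nat \<Rightarrow> int" where
  "top_level i = (if i = 0 then 0 else if \<not> D i then kint i else if dm i = 2 \<or> merged i then kint i + 1 else lam i)"

lemma lam_le: "lam i \<le> kint i + 2" by (simp add: lam_def)

text \<open>The critical case is a diagonal block of degree 1, outside a merged pair, followed by an
  even block of the next scale: (PO5) then makes the prefix before it nondegenerate at its scale, so
  its level is the scale itself.\<close>

lemma top_E:
  assumes i: "Suc i \<le> length bs" and E: "\<not> D (Suc i)"
  shows "top_level i \<le> kint (Suc i)"
proof (cases "i = 0")
  case True then show ?thesis by (simp add: top_level_def)
next
  case False
  then have i1: "1 \<le> i" by simp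
  show ?thesis
  proof (cases "D i")
    case nD: False then show ?thesis using order(2)[OF i1 i nD E] False by (simp add: top_level_def)
  next
    case D: True
    have ord: "kint i + 1 \<le> kint (Suc i)" by (rule order(3)[OF i1 i D E])
    show ?thesis
    proof (cases "(dm i = 2 \<or> merged i) \<or> kint i + 2 \<le> kint (Suc i)")
      case True then show ?thesis using ord D False lam_le[of i] by (auto simp: top_level_def)
    next
      case c: False
      then have k: "kk bs i + 1 = kk bs (i + 1)" using ord by simp
      obtain j where j: "i = Suc j" using i1 by (cases i) auto
      have j': "j < length bs" using j i by simp
      have "1 \<le> i \<and> i < length bs \<and> D i \<and> \<not> D (i + 1) \<and> kk bs i + 1 = kk bs (i + 1)" using i1 i D E k by simp
      then have p: "dm i = 1" "even (dg i) \<and> odd (v (det (Bpre bs i))) \<or> odd (dg i) \<and> (2 \<le> i \<longrightarrow> xi v (Bpre bs (i - 1)) \<noteq> 0)"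
        using po5[unfolded PO5_def, rule_format, of i] by (simp_all add: dim_Bpre)
      have dS: "dg i = Suc (dg j)" using dg_Suc[OF j'] p(1) j by simp
      have vd: "v (det (Bpre bs i)) = v (det (Bpre bs j)) + kint i" using v_det_Suc[OF j'] D p(1) j by simp
      have "prefix_nondeg j (kint i)"
      proof (cases "even (dg i)")
        case True
        then have o: "odd (v (det (Bpre bs j)) + kint i)" "odd (dg j)" using p(2) vd dS by auto
        have "odd (x + y) \<Longrightarrow> odd (x - y)" for x y :: int by presburger
        then have "odd (v (det (Bpre bs j)) - kint i)" using o(1) by blast
        then show ?thesis using o(2) by (simp add: prefix_nondeg_def)
      next
        case odd: False
        show ?thesis
        proof (cases "j = 0")
          case True then show ?thesis using prefix_nondeg_0 by simp
        next
          case False then show ?thesis using odd p(2) dS j by (simp add: prefix_nondeg_def)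
        qed
      qed
      then have "lam i = kint i" using j by (simp add: lam_def)
      then show ?thesis using ord c D False by (simp add: top_level_def)
    qed
  qed
qed

text \<open>Supplies the bounds for \<open>step_unary\<close> and \<open>step_unary_pair\<close>.
  For a preceding even block one scale higher this is (PO4). For a preceding diagonal block of equal
  scale it is the absence of merging, and for one a scale lower it is (PO6) in even degree and
  parity in odd degree.\<close>

lemma top_D:
  assumes i: "Suc i \<le> length bs" and DS: "D (Suc i)" and nm: "\<not> merged (Suc i)"
  shows "top_level i \<le> kint (Suc i) + 1" "dm (Suc i) = 1 \<Longrightarrow> prefix_nondeg i (kint (Suc i)) \<Longrightarrow> top_level i \<le> kint (Suc i)"
proof -
  have "top_level i \<le> kint (Suc i) + 1 \<and> (dm (Suc i) = 1 \<and> prefix_nondeg i (kint (Suc i)) \<longrightarrow> top_level i \<le> kint (Suc i))"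
  proof (cases "i = 0")
    case True then show ?thesis by (simp add: top_level_def)
  next
    case i0: False
    then have i1: "1 \<le> i" by simp
    have il: "i < length bs" using i by simp
    show ?thesis
    proof (cases "D i")
      case nD: False
      have ord: "kint i \<le> kint (Suc i) + 1" by (rule order(4)[OF i1 i nD DS])
      have t: "top_level i = kint i" using nD i0 by (simp add: top_level_def)
      have "\<not> prefix_nondeg i (kint (Suc i))" if k: "kint i = kint (Suc i) + 1" and d1: "dm (Suc i) = 1"
      proof -
        have "2 \<le> Suc i \<and> Suc i \<le> length bs \<and> int (kk bs (Suc i)) = int (kk bs (Suc i - 1)) - 1 \<and> D (Suc i) \<and> \<not> D (Suc i - 1)"
          using i1 i k DS nD by simp
        then have p: "even (dg (Suc i)) \<and> even (v (det (Bpre bs (Suc i)))) \<or> odd (dg (Suc i)) \<and> xi v (Bpre bs i) = 0"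
          using po4[unfolded PO4_def, rule_format, of "Suc i"] d1 by (simp add: dim_Bpre)
        have dS: "dg (Suc i) = Suc (dg i)" using dg_Suc[OF il] d1 by simp
        have vd: "v (det (Bpre bs (Suc i))) = v (det (Bpre bs i)) + kint (Suc i)" using v_det_Suc[OF il DS] d1 by simp
        have "even (x + y) \<Longrightarrow> even (x - y)" for x y :: int by presburger
        then have "even (v (det (Bpre bs (Suc i)))) \<Longrightarrow> even (v (det (Bpre bs i)) - kint (Suc i))" unfolding vd by blast
        then show ?thesis using p dS by (auto simp: prefix_nondeg_def)
      qed
      then show ?thesis using ord t by fastforce
    next
      case D: True
      have ord: "kint i \<le> kint (Suc i)" by (rule order(1)[OF i1 i D DS])
      have t: "top_level i = (if dm i = 2 \<or> merged i then kint i + 1 else lam i)" using D i0 by (simp add: top_level_def)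
      have tle: "top_level i \<le> kint i + 2" using t lam_le[of i] by auto
      consider "kk bs (Suc i) = kk bs i" | "kint (Suc i) = kint i + 1" | "kint i + 2 \<le> kint (Suc i)" using ord by linarith
      then show ?thesis
      proof cases
        case 1
        note dp = D_pair[OF i1 i D DS 1]
        have nmi: "\<not> merged i"
        proof
          assume m: "merged i"
          then obtain j where j: "i = Suc j" "1 \<le> j" by (cases i) (auto simp: merged_def)
          then show False using m D_triple[of j] i D DS 1 by (auto simp: merged_def)
        qed
        have tl: "top_level i = lam i" using t dp nmi by simp
        have "lam i \<noteq> kint i + 2" using nm 1 D DS i1 by (auto simp: merged_def)
        then show ?thesis using tl 1 by (auto simp: lam_def split: if_splits)
      next
        case 2
        have "\<not> prefix_nondeg i (kint (Suc i))" if c: "\<not> (dm i = 2 \<or> merged i)" "lam i = kint i + 2"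
        proof
          assume R: "prefix_nondeg i (kint (Suc i))"
          \<comment> \<open>Level \<open>kint i + 2\<close> arises only with a prefix nondegenerate
            at \<open>kint i\<close>. In odd degree it cannot be nondegenerate at the next integer
            as well, since nondegenerate levels have one parity.\<close>
          have R': "prefix_nondeg i (kint i)" using c(2) by (auto simp: lam_def split: if_splits)
          show False
          proof (cases "even (dg i)")
            case True
            have "1 \<le> i \<and> i < length bs \<and> even (dim_row (Bpre bs i)) \<and> D i \<and> D (i + 1) \<and> kk bs (i + 1) = kk bs i + 1"
              using i1 i True D DS 2 by (simp add: dim_Bpre)
            then have "xi v (Bpre bs i) = 0" using po6[unfolded PO6_def, rule_format, of i] by blast
            then show False using R True by (simp add: prefix_nondeg_def)
          next
            case False
            have "odd (x - y) \<Longrightarrow> odd (x - (y + 1)) \<Longrightarrow> False" for x y :: int by presburger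
            then show False using R R' False unfolding prefix_nondeg_def 2 by auto
          qed
        qed
        then show ?thesis using 2 t by (auto simp: lam_def split: if_splits)
      next
        case 3 then show ?thesis using tle by simp
      qed
    qed
  qed
  then show "top_level i \<le> kint (Suc i) + 1" "dm (Suc i) = 1 \<Longrightarrow> prefix_nondeg i (kint (Suc i)) \<Longrightarrow> top_level i \<le> kint (Suc i)" by auto
qed

text \<open>A translation of (PO3): the order of the determinant grows by twice the scale, so in odd
  degree both prefixes are degenerate at levels of the same parity.\<close>

lemma D2_not_prefix_nondeg:
  assumes i: "Suc i \<le> length bs" and D: "D (Suc i)" and d2: "dm (Suc i) = 2"
  shows "\<not> prefix_nondeg i (kint (Suc i))" "\<not> prefix_nondeg (Suc i) (kint (Suc i))"
proof -
  have il: "i < length bs" using i by simp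
  have dS: "dg (Suc i) = dg i + 2" using dg_Suc[OF il] d2 by simp
  have vd: "v (det (Bpre bs (Suc i))) = v (det (Bpre bs i)) + kint (Suc i) * 2" using v_det_Suc[OF il D] d2 by simp
  have "1 \<le> Suc i \<and> Suc i \<le> length bs \<and> D (Suc i) \<and> dm (Suc i) = 2" using i D d2 by simp
  then have p: "even (dg i) \<and> xi v (Bpre bs i) = 0 \<and> xi v (Bpre bs (Suc i)) = 0 \<or> odd (dg i) \<and> even (v (det (Bpre bs i)) + kint (Suc i))"
    using po3[unfolded PO3_def, rule_format, of "Suc i"] dS by (simp add: dim_Bpre)
  have pr: "even (x + y) \<Longrightarrow> even (x - y)" "even (x + y) \<Longrightarrow> even (x + y * 2 - y)" for x y :: int by presburger+
  show "\<not> prefix_nondeg i (kint (Suc i))" using p pr(1)[of "v (det (Bpre bs i))" "kint (Suc i)"] by (auto simp: prefix_nondeg_def)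
  show "\<not> prefix_nondeg (Suc i) (kint (Suc i))"
    using p pr(2)[of "v (det (Bpre bs i))" "kint (Suc i)"] dS unfolding prefix_nondeg_def vd by auto
qed

text \<open>The induction is over all smaller indices, because a merged pair is built from the basis
  before both of its blocks.\<close>

lemma adapted_exists:
  assumes "i \<le> length bs"
  shows "\<exists>e a. adapted i e a \<and> (\<forall>k<dg i. a k \<le> top_level i)"
  using assms
proof (induction i rule: less_induct)
  case (less i)
  show ?case
  proof (cases i)
    case 0 then show ?thesis using adapted_0 by (auto simp: top_level_def)
  next
    case (Suc j)
    have jl: "Suc j \<le> length bs" "j < length bs" using Suc less.prems by auto
    obtain e a where G: "adapted j e a" and T: "\<And>k. k < dg j \<Longrightarrow> a k \<le> top_level j"
      using less.IH[of j] Suc jl by auto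
    show ?thesis
    proof (cases "D (Suc j)")
      case False
      have "a k \<le> kint (Suc j)" if "k < dg j" for k using T[OF that] top_E[OF jl(1) False] by simp
      from step_even[OF jl(2) False G this] show ?thesis using False Suc by (auto simp: top_level_def)
    next
      case D: True
      show ?thesis
      proof (cases "merged (Suc j)")
        case True
        \<comment> \<open>The basis for j blocks ends at a level one too high for the next vector.
          It is abandoned, and the pair of blocks is adjoined to the basis for h blocks.\<close>
        then obtain h where h: "j = Suc h" by (cases j) (auto simp: merged_def)
        have m: "D j" "kk bs j = kk bs (Suc j)" "lam j = kint (Suc j) + 2" using True by (auto simp: merged_def)
        have hl: "Suc h \<le> length bs" "h < length bs" using h jl by auto
        note dp = D_pair[of j, OF _ jl(1) m(1) D m(2)[symmetric]]
        have d1: "dm j = 1" "dm (Suc j) = 1" using dp h by auto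
        have nm: "\<not> merged (Suc h)"
        proof
          assume mm: "merged (Suc h)"
          then show False using D_triple[of h] m D jl h by (auto simp: merged_def)
        qed
        obtain e a where G: "adapted h e a" and T: "\<And>k. k < dg h \<Longrightarrow> a k \<le> top_level h"
          using less.IH[of h] Suc h jl by auto
        have Dh: "D (Suc h)" using m(1) h by simp
        have R: "\<not> prefix_nondeg h (kint (Suc j))" "prefix_nondeg (Suc h) (kint (Suc j))" using m(2,3) h by (auto simp: lam_def split: if_splits)
        have dh: "dg (Suc h) = Suc (dg h)" using dg_Suc[OF hl(2)] d1 h by simp
        have dS: "dg (Suc j) = dg h + 2" using dg_Suc[OF jl(2)] d1 h dh by simp
        have q1: "ex (q (std_vec (dg h))) (kint (Suc j))" using D_block(1)[OF hl(2) Dh, of 0] d1 h m(2) by simp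
        have q2: "ex (q (std_vec (Suc (dg h)))) (kint (Suc j))" using D_block(1)[OF jl(2) D, of 0] d1 h dh by simp
        have NN: "Suc (dg h) < N" "dg h < N" using dg_le_N[of "Suc j"] dS by auto
        have o: "bb (std_vec (Suc (dg h))) (std_vec (dg h)) = 0"
          by (rule orth_std_vec[of _ "Suc h"]) (use NN dh in \<open>auto simp: std_vec_def\<close>)
        have Tk: "a k \<le> kint (Suc j) + 1" if "k < dg h" for k using T[OF that] top_D(1)[OF hl(1) Dh nm] m(2) h by simp
        have "\<exists>e' a'. adapted (Suc j) e' a' \<and> (\<forall>k<dg (Suc j). a' k \<le> kint (Suc j) + 1)"
          by (rule step_unary_pair[OF _ dS G _ Tk q1 q2 o R(1)]) (use h dh R(2) in auto)
        moreover have "top_level (Suc j) = kint (Suc j) + 1" using D True by (simp add: top_level_def)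
        ultimately show ?thesis using Suc by simp
      next
        case nm: False
        note td = top_D[OF jl(1) D nm]
        show ?thesis
        proof (cases "dm (Suc j) = 2")
          case d2: True
          note nR = D2_not_prefix_nondeg[OF jl(1) D d2]
          have dS: "dg (Suc j) = dg j + 2" using dg_Suc[OF jl(2)] d2 by simp
          have q1: "ex (q (std_vec (dg j))) (kint (Suc j))" using D_block(1)[OF jl(2) D, of 0] d2 by simp
          have q2: "ex (q (std_vec (Suc (dg j)))) (kint (Suc j))" using D_block(1)[OF jl(2) D, of 1] d2 by simp
          have o: "bb (std_vec (Suc (dg j))) (std_vec (dg j)) = 0" using D_block(2)[OF jl(2) D, of 1 0] d2 by simp
          have Tk: "a k \<le> kint (Suc j) + 1" if "k < dg j" for k using T[OF that] td(1) by simp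
          have "\<exists>e' a'. adapted (Suc j) e' a' \<and> (\<forall>k<dg (Suc j). a' k \<le> kint (Suc j) + 1)"
            by (rule step_unary_pair[OF _ dS G _ Tk q1 q2 o nR(1)]) (use nR(2) in auto)
          moreover have "top_level (Suc j) = kint (Suc j) + 1" using D d2 by (simp add: top_level_def)
          ultimately show ?thesis using Suc by simp
        next
          case False
          then have d1: "dm (Suc j) = 1" using D_dim[of "Suc j"] jl D by auto
          have Tk: "a k \<le> kint (Suc j) + 1" if "k < dg j" for k using T[OF that] td(1) by simp
          have Tk': "a k \<le> kint (Suc j)" if "prefix_nondeg j (kint (Suc j))" "k < dg j" for k using T[OF that(2)] td(2)[OF d1 that(1)] by simp
          obtain e' a' r where g: "adapted (Suc j) e' a'" "\<forall>k<dg (Suc j). a' k \<le> r"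
            and r: "r = kint (Suc j) \<and> prefix_nondeg j (kint (Suc j)) \<or> r = kint (Suc j) + 1 \<and> \<not> prefix_nondeg j (kint (Suc j)) \<and> \<not> prefix_nondeg (Suc j) (kint (Suc j)) \<or>
              r = kint (Suc j) + 2 \<and> \<not> prefix_nondeg j (kint (Suc j)) \<and> prefix_nondeg (Suc j) (kint (Suc j))"
            using step_unary[OF jl(2) D d1 G refl Tk Tk'] by blast
          have "top_level (Suc j) = r" using r D nm d1 by (auto simp: top_level_def lam_def)
          then show ?thesis using g Suc by blast
        qed
      qed
    qed
  qed
qed

end

section \<open>Jumps of the level sequence and the extended datum\<close>

lemma sum_list_counts:
  "distinct xs \<Longrightarrow> sum_list (map (\<lambda>m. length (filter ((=) m) g)) xs) = length (filter (\<lambda>x. x \<in> set xs) g)"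
proof (induction xs)
  case (Cons y ys)
  have "length (filter (\<lambda>x. x \<in> set (y # ys)) g) = length (filter ((=) y) g) + length (filter (\<lambda>x. x \<in> set ys) g)"
    using Cons.prems by (induction g) auto
  then show ?case using Cons by simp
qed simp

lemma filter_takeWhile_sorted: "sorted g \<Longrightarrow> filter (\<lambda>x. x \<le> c) g = takeWhile (\<lambda>x. x \<le> (c::nat)) g"
proof (induction g)
  case (Cons x g)
  show ?case
  proof (cases "x \<le> c")
    case False
    have "filter (\<lambda>x. x \<le> c) g = []" using Cons.prems False by (auto simp: filter_empty_conv)
    then show ?thesis using False by simp
  qed (use Cons in simp)
qed simp

text \<open>In a sorted list the first u distinct values are those up to the u-th one, so the
  partial sum of multiplicities is the length of an initial segment that ends at a jump or at the
  end of the list.\<close>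

lemma gk_partial_cut:
  assumes s: "sorted g" and u: "1 \<le> u" "u \<le> length (remdups g)"
  shows "0 < gk_partial g u" "gk_partial g u \<le> length g"
    "gk_partial g u < length g \<Longrightarrow> g ! (gk_partial g u - 1) < g ! gk_partial g u"
proof -
  define R where "R = remdups g"
  define c where "c = R ! (u - 1)"
  have R: "sorted R" "distinct R" "set R = set g" using s by (auto simp: R_def)
  have uR: "u - 1 < length R" using u by (simp add: R_def)
  have mem: "x \<in> set (take u R) \<longleftrightarrow> x \<le> c" if "x \<in> set g" for x
  proof -
    have "x \<in> set R" using that R(3) by simp
    then obtain j where j: "j < length R" "x = R ! j" unfolding in_set_conv_nth by blast
    show ?thesis
    proof
      assume "x \<in> set (take u R)"
      then obtain i where i: "i < u" "i < length R" "x = R ! i" by (auto simp: in_set_conv_nth)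
      then show "x \<le> c" unfolding c_def i(3) using sorted_nth_mono[OF R(1), of i "u - 1"] uR by simp
    next
      assume le: "x \<le> c"
      have "j < u"
      proof (rule ccontr)
        assume "\<not> j < u"
        then have "c \<le> x" unfolding c_def j(2) using sorted_nth_mono[OF R(1), of "u - 1" j] j(1) by simp
        then have "R ! j = R ! (u - 1)" using le j(2) c_def by simp
        then have "j = u - 1" using nth_eq_iff_index_eq[OF R(2) j(1) uR] by simp
        then show False using \<open>\<not> j < u\<close> u by simp
      qed
      then show "x \<in> set (take u R)" using j by (auto simp: in_set_conv_nth)
    qed
  qed
  have "gk_partial g u = sum_list (map (\<lambda>m. length (filter ((=) m) g)) (take u R))"
    by (simp add: gk_partial_def gk_mults_def R_def take_map)
  also have "\<dots> = length (filter (\<lambda>x. x \<in> set (take u R)) g)" using R(2) by (intro sum_list_counts) simp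
  also have "filter (\<lambda>x. x \<in> set (take u R)) g = filter (\<lambda>x. x \<le> c) g" using mem by (intro filter_cong) auto
  finally have m: "gk_partial g u = length (filter (\<lambda>x. x \<le> c) g)" .
  then have m': "gk_partial g u = length (takeWhile (\<lambda>x. x \<le> c) g)" using filter_takeWhile_sorted[OF s] by simp
  have "c \<in> set g" using nth_mem[OF uR] R(3) by (simp add: c_def)
  then have "filter (\<lambda>x. x \<le> c) g \<noteq> []" by (auto simp: filter_empty_conv)
  then show 0: "0 < gk_partial g u" using m by simp
  show "gk_partial g u \<le> length g" using m by simp
  assume lt: "gk_partial g u < length g"
  have "\<not> g ! gk_partial g u \<le> c" using nth_length_takeWhile[of "\<lambda>x. x \<le> c" g] lt unfolding m' by simp
  moreover have "g ! (gk_partial g u - 1) \<le> c"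
  proof -
    have l: "gk_partial g u - 1 < length (takeWhile (\<lambda>x. x \<le> c) g)" using 0 m' by simp
    then have "takeWhile (\<lambda>x. x \<le> c) g ! (gk_partial g u - 1) \<in> set (takeWhile (\<lambda>x. x \<le> c) g)" by simp
    then have "takeWhile (\<lambda>x. x \<le> c) g ! (gk_partial g u - 1) \<le> c" using set_takeWhileD by fast
    then show ?thesis using takeWhile_nth[OF l] by simp
  qed
  ultimately show "g ! (gk_partial g u - 1) < g ! gk_partial g u" by simp
qed

context preopt
begin

text \<open>An adapted basis of all blocks satisfies the criterion of \<open>GK_eq\<close>. For any
  t the vectors of level at most t form an initial segment that is empty, complete or cut at a jump,
  and in the last case \<open>adapted\<close> gives semiregularity.\<close>

lemma adapted_GK:
  assumes G: "adapted (length bs) e a"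
  defines "V \<equiv> mat N N (\<lambda>(p, j). e j p)" and "c \<equiv> map (\<lambda>k. nat (a k)) [0..<N]"
  shows "GL_o v N V" "\<And>p j. p < N \<Longrightarrow> j < p \<Longrightarrow> V $$ (p, j) = 0" "c \<in> S_set v (transpose_mat V * BB * V)"
    "level_max N (fU V) (\<lambda>k. int (c ! k))"
proof -
  note G' = adapted_D[OF G, unfolded dg_len]
  have Vc: "V \<in> carrier_mat N N" by (simp add: V_def)
  show "GL_o v N V" by (rule GL_oI) (use triD(3)[OF G'(1)] tri_det[OF G'(1)] in \<open>auto simp: V_def\<close>)
  show "V $$ (p, j) = 0" if "p < N" "j < p" for p j using triD(2)[OF G'(1), of j p] that by (simp add: V_def)
  have e: "fU V j = e j" if "j < N" for j
  proof
    fix p show "fU V j p = e j p" using triD(2)[OF G'(1) that, of p] that by (auto simp: fU_def V_def)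
  qed
  have ca: "int (c ! k) = a k" if "k < N" for k using that G'(5) by (simp add: c_def)
  have "sorted c" using G'(4,5) by (auto simp: sorted_iff_nth_mono c_def intro: nat_mono)
  moreover have "aint {..<N} (fU V) (\<lambda>k. int (c ! k))"
    using fam_cong(1)[of "{..<N}" e "fU V" a "\<lambda>k. int (c ! k)"] e ca G'(2) by simp
  ultimately show "c \<in> S_set v (transpose_mat V * BB * V)" unfolding S_set_iff[OF Vc] by (simp add: c_def)
  show "level_max N (fU V) (\<lambda>k. int (c ! k))" unfolding level_max_def
  proof
    fix t
    \<comment> \<open>The first position whose level exceeds t; the alternative
      \<open>N \<le> k\<close> gives the value N when no such position exists.\<close>
    define p where "p = (LEAST k. N \<le> k \<or> t < a k)"
    have pN: "p \<le> N" unfolding p_def by (rule Least_le) simp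
    have p1: "N \<le> p \<or> t < a p" unfolding p_def by (rule LeastI[of _ N]) simp
    have p2: "a k \<le> t" "k < N" if "k < p" for k using not_less_Least[of k "\<lambda>k. N \<le> k \<or> t < a k"] that by (auto simp: p_def)
    have S: "{k. k < N \<and> int (c ! k) \<le> t} = {..<p}"
    proof (intro equalityI subsetI)
      fix k assume "k \<in> {k. k < N \<and> int (c ! k) \<le> t}"
      then have k: "k < N" "a k \<le> t" using ca by auto
      show "k \<in> {..<p}"
      proof (rule ccontr)
        assume "k \<notin> {..<p}"
        then have "a p \<le> a k" "t < a p" using G'(4)[of p k] k p1 by auto
        then show False using k by simp
      qed
    next
      fix k assume "k \<in> {..<p}"
      then show "k \<in> {k. k < N \<and> int (c ! k) \<le> t}" using p2[of k] ca[of k] by simp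
    qed
    have "semireg {..<p} e a t"
    proof -
      consider "p = 0" | "p = N" | "0 < p" "p < N" using pN by linarith
      then show ?thesis
      proof cases
        case 1 then show ?thesis by (simp add: semireg_def cA_def)
      next
        case 2 then show ?thesis using G'(3) by simp
      next
        case 3
        then have "a (p - 1) < a p" using p1 p2(1)[of "p - 1"] by simp
        then show ?thesis using G'(6)[OF 3] by blast
      qed
    qed
    then show "semireg {k. k < N \<and> int (c ! k) \<le> t} (fU V) (\<lambda>k. int (c ! k)) t"
      unfolding S using fam_cong(2)[of "{..<p}" e "fU V" a "\<lambda>k. int (c ! k)" t] e ca pN by simp
  qed
qed

text \<open>The datum is a choice among the data of all optimal forms equivalent to B. It is
  determined because one such form exists, from the adapted basis, and all of them give the same
  values by \<open>zeta_upleft\<close>.\<close>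

lemma EGK_blocks:
  assumes ne: "bs \<noteq> []"
  shows "\<exists>ls :: nat list.
     length ls = length (gk_mults (GK v BB)) \<and>
     (\<forall>j. 1 \<le> j \<and> j \<le> length ls \<longrightarrow>
        1 \<le> ls ! (j - 1) \<and> ls ! (j - 1) \<le> length bs \<and>
        gk_partial (GK v BB) j = (\<Sum>i = 1..ls ! (j - 1). dim_row (CC bs i)) \<and>
        upleft BB (gk_partial (GK v BB) j) = Bpre bs (ls ! (j - 1))) \<and>
     EGK v BB = (gk_mults (GK v BB), gk_values (GK v BB), map (\<lambda>l. zeta_inv v (Bpre bs l)) ls)"
proof -
  obtain e a where G: "adapted (length bs) e a" using adapted_exists by blast
  note G' = adapted_D[OF G, unfolded dg_len]
  define V where "V = mat N N (\<lambda>(p, j). e j p)"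
  define c where "c = map (\<lambda>k. nat (a k)) [0..<N]"
  note V = adapted_GK[OF G, folded V_def c_def]
  have nd: "det BB \<noteq> 0" using det_Bpre_nz[of "length bs"] by (simp add: Bpre_def)
  have GK: "GK v BB = c" by (rule GK_eq[OF nd V(1,3,4)])
  have len: "length c = N" by (simp add: c_def)
  have srt: "sorted c" using V(3) by (simp add: S_set_def)
  define s where "s = length (remdups c)"
  note cut = gk_partial_cut[OF srt, folded s_def, unfolded len]
  have "\<exists>l. 1 \<le> l \<and> l \<le> length bs \<and> gk_partial c u = dg l" if u: "1 \<le> u" "u \<le> s" for u
  \<comment> \<open>The last value exhausts the list and corresponds to all blocks; any earlier one
    is a strict jump of a.\<close>
  proof (cases "gk_partial c u = N")
    case True
    then show ?thesis using ne dg_len by (intro exI[of _ "length bs"]) (cases bs, auto)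
  next
    case False
    define m where "m = gk_partial c u"
    have m: "0 < m" "m < N" "c ! (m - 1) < c ! m" using cut[OF u] False by (auto simp: m_def)
    have "c ! k = nat (a k)" if "k < N" for k using that by (simp add: c_def)
    then have "nat (a (m - 1)) < nat (a m)" using m by simp
    then have am: "a (m - 1) < a m" by simp
    obtain l where "l \<ge> 1" "l \<le> length bs" "m = dg l" using G'(6)[OF m(1,2) am] by blast
    then show ?thesis using m_def by (intro exI[of _ l]) simp
  qed
  then obtain pl where pl: "\<And>u. 1 \<le> u \<Longrightarrow> u \<le> s \<Longrightarrow> 1 \<le> pl u \<and> pl u \<le> length bs \<and> gk_partial c u = dg (pl u)" by metis
  define ls where "ls = map pl [1..<Suc s]"
  have lsj: "ls ! (j - 1) = pl j" if "1 \<le> j" "j \<le> s" for j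
  proof -
    have "ls ! (j - 1) = pl ([1..<Suc s] ! (j - 1))" unfolding ls_def using that by (intro nth_map) simp
    also have "[1..<Suc s] ! (j - 1) = j" using that by (subst nth_upt) auto
    finally show ?thesis .
  qed
  have lls: "length ls = s" by (simp add: ls_def)
  \<comment> \<open>Every admissible choice yields this datum: its sequence is c by invariance under
    equivalence, and its truncated invariants are those of the prefixes.\<close>
  have data: "egk_data v B' = (gk_mults c, gk_values c, map (\<lambda>l. zeta_inv v (Bpre bs l)) ls)"
    if B': "o_equiv v BB B'" "optimal v B'" for B'
  proof -
    obtain U where U: "GL_o v N U" "B' = transpose_mat U * BB * U"
      using B'(1) unfolding o_equiv_def carrier_matD(1)[OF Bc] by blast
    have GK': "GK v B' = c" unfolding U(2) GK_equiv[OF U(1)] by (rule GK)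
    have cU: "c \<in> S_set v (transpose_mat U * BB * U)" using B'(2)[unfolded optimal_def GK'] unfolding U(2) .
    have z: "zeta_inv v (upleft B' (gk_partial c u)) = zeta_inv v (Bpre bs (pl u))" if u: "1 \<le> u" "u \<le> s" for u
    proof -
      have "zeta_inv v (upleft B' (gk_partial c u)) = zeta_inv v (upleft BB (gk_partial c u))"
        unfolding U(2) by (rule zeta_upleft[OF nd V(1,2,3,4) U(1) cU cut[OF u]])
      also have "upleft BB (gk_partial c u) = Bpre bs (pl u)" using pl[OF u] upleft_BB by simp
      finally show ?thesis .
    qed
    have "map (\<lambda>u. zeta_inv v (upleft B' (gk_partial c u))) [1..<Suc s] = map (\<lambda>l. zeta_inv v (Bpre bs l)) ls"
      unfolding ls_def map_map by (rule map_cong[OF refl]) (use z in auto)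
    then show ?thesis unfolding egk_data_def GK' Let_def by (simp add: gk_values_def s_def)
  qed
  have oV: "o_equiv v BB (transpose_mat V * BB * V)" unfolding o_equiv_def carrier_matD(1)[OF Bc] using V(1) by blast
  have opV: "optimal v (transpose_mat V * BB * V)" unfolding optimal_def GK_equiv[OF V(1)] GK by (rule V(3))
  have "EGK v BB = (gk_mults c, gk_values c, map (\<lambda>l. zeta_inv v (Bpre bs l)) ls)"
    unfolding EGK_def
  proof (rule some_equality)
    show "\<exists>B'. o_equiv v BB B' \<and> optimal v B' \<and> (gk_mults c, gk_values c, map (\<lambda>l. zeta_inv v (Bpre bs l)) ls) = egk_data v B'"
      using oV opV data[OF oV opV] by (intro exI[of _ "transpose_mat V * BB * V"]) simp
    show "x = (gk_mults c, gk_values c, map (\<lambda>l. zeta_inv v (Bpre bs l)) ls)"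
      if "\<exists>B'. o_equiv v BB B' \<and> optimal v B' \<and> x = egk_data v B'" for x
      using that data by (elim exE conjE) simp
  qed
  moreover have "1 \<le> ls ! (j - 1) \<and> ls ! (j - 1) \<le> length bs \<and> gk_partial c j = (\<Sum>i = 1..ls ! (j - 1). dim_row (CC bs i)) \<and>
        upleft BB (gk_partial c j) = Bpre bs (ls ! (j - 1))" if j: "1 \<le> j \<and> j \<le> length ls" for j
  proof -
    have j': "1 \<le> j" "j \<le> s" using j lls by auto
    show ?thesis unfolding lsj[OF j'] using pl[OF j'] dg_sum[of "pl j"] upleft_BB[of "pl j"] by simp
  qed
  moreover have "length ls = length (gk_mults c)" using lls by (simp add: s_def gk_mults_def)
  ultimately show ?thesis unfolding GK by blast
qed

end

theorem theorem4p2: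
  fixes v :: "'a::field \<Rightarrow> int"
    and bs :: "(nat \<times> 'a mat) list"
  assumes F: "unram_ext_Q2 v"
    and ne: "bs \<noteq> []"
    and po: "pre_optimal v bs"
  shows "\<exists>ls :: nat list.
     length ls = length (gk_mults (GK v (blocks_mat bs))) \<and>
     (\<forall>j. 1 \<le> j \<and> j \<le> length ls \<longrightarrow>
        1 \<le> ls ! (j - 1) \<and> ls ! (j - 1) \<le> length bs \<and>
        gk_partial (GK v (blocks_mat bs)) j = (\<Sum>i = 1..ls ! (j - 1). dim_row (CC bs i)) \<and>
        upleft (blocks_mat bs) (gk_partial (GK v (blocks_mat bs)) j) = Bpre bs (ls ! (j - 1))) \<and>
     EGK v (blocks_mat bs) =
       (gk_mults (GK v (blocks_mat bs)), gk_values (GK v (blocks_mat bs)),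
        map (\<lambda>l. zeta_inv v (Bpre bs l)) ls)"
proof -
  interpret preopt v bs
    by unfold_locales (use F po in \<open>auto simp: pre_optimal_def\<close>)
  show ?thesis by (rule EGK_blocks[OF ne])
qed

end
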